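(* Let $X\subseteq\mathbb{P}^m$ be either a hyperquadric or the whole projective space, equipped with an additive action of $\mathbb{G}_a^n$ ($n=\dim X$) with open orbit $O$, and suppose $K(X)\nsubseteq Fix(X)$. Choose $x_0\in O$. Let $G^{(1)}=\bigcap_{x\in K(X)}G_x$, where $G_x\subseteq \mathbb{G}_a^n$ is the stabilizer of $x$, and let $\mathbf{L}^{(1)}\subseteq\mathbb{P}^m$ be the linear span of $G^{(1)}\cdot x_0$. Then: (i) $\mathbf{L}^{(1)}\subsetneq\mathbb{P}^m$. (ii) $\mathbf{L}^{(1)}$ is $G^{(1)}$-invariant, and the action of $G^{(1)}$ on $\mathbf{L}^{(1)}$ induces an additive action on $Q^{(1)}=\overline{G^{(1)}\cdot x_0}\subseteq\mathbf{L}^{(1)}$ with open orbit $O^{(1)}=G^{(1)}\cdot x_0$, where $Q^{(1)}$ is either a non-degenerate hyperquadric in $\mathbf{L}^{(1)}$ or the whole projective space $\mathbf{L}^{(1)}$.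
   Context: We work over an algebraically closed field $\mathbb{K}$ of characteristic zero; $\mathbb{G}_a=(\mathbb{K},+)$ and $\mathbb{G}_a^n$ is the $n$-dimensional vector group. For a closed subvariety $X\subseteq\mathbb{P}^m$ of dimension $n$, an additive action on $X$ is an effective algebraic action $\mathbb{G}_a^n\times\mathbb{P}^m\to\mathbb{P}^m$ such that $X$ is $\mathbb{G}_a^n$-invariant and the induced action on $X$ has an open orbit $O$. A hyperquadric is a quadric hypersurface that is a variety (irreducible and reduced, possibly singular). $Fix(X)$ is the set of points of $X$ fixed by the group. $K(X)=Sing(X)$ (the singular locus) if $X$ is a hyperquadric, and $K(X)=X\setminus O$ if $X$ is a projective space. A subset of a projective space is called non-degenerate if it is not contained in any hyperplane (so "non-degenerate hyperquadric" does not mean smooth). *)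

theory Defs
  imports "HOL-Analysis.Analysis" "HOL-Computational_Algebra.Polynomial"
begin

text \<open>Polynomials enter through the functions they induce. All ground fields below are infinite,
  so a polynomial is determined by its function, and it is homogeneous of degree \<open>d\<close> iff the
  function scales with weight \<open>d\<close>. The set \<open>poly_funs C\<close> is the algebra of functions generated by
  the coordinate functions in \<open>C\<close>.\<close>

inductive_set poly_funs :: "('x \<Rightarrow> 'a::comm_ring_1) set \<Rightarrow> ('x \<Rightarrow> 'a) set"
  for C :: "('x \<Rightarrow> 'a) set" where
  coord: "c \<in> C \<Longrightarrow> c \<in> poly_funs C"
| const: "(\<lambda>_. a) \<in> poly_funs C"
| add: "f \<in> poly_funs C \<Longrightarrow> g \<in> poly_funs C \<Longrightarrow> (\<lambda>x. f x + g x) \<in> poly_funs C"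
| mult: "f \<in> poly_funs C \<Longrightarrow> g \<in> poly_funs C \<Longrightarrow> (\<lambda>x. f x * g x) \<in> poly_funs C"

definition polys :: "('a::comm_ring_1 ^ 'k \<Rightarrow> 'a) set" where
  "polys = poly_funs (range (\<lambda>i v. v $ i))"

definition polys2 :: "(('a::comm_ring_1 ^ 'n) \<times> ('a ^ 'k) \<Rightarrow> 'a) set" where
  "polys2 = poly_funs (range (\<lambda>i (g, v). g $ i) \<union> range (\<lambda>i (g, v). v $ i))"

definition homog :: "nat \<Rightarrow> ('a::comm_ring_1 ^ 'k \<Rightarrow> 'a) set" where
  "homog d = {f \<in> polys. \<forall>c v. f (c *s v) = c ^ d * f v}"


text \<open>A point of projective space is a one-dimensional linear subspace, and \<open>proj W\<close> is the
  projective space \<open>\<bbbP>(W)\<close> of a linear subspace \<open>W\<close>. Thus \<open>\<bbbP>\<^sup>m\<close> is \<open>proj UNIV\<close> for the vector space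
  \<open>'a ^ 'k\<close> with \<open>CARD('k) = m + 1\<close>, and its linear subspaces are the sets \<open>proj W\<close>.\<close>

definition proj :: "('a::field ^ 'k) set \<Rightarrow> ('a ^ 'k) set set" where
  "proj W = {vec.span {v} | v. v \<in> W \<and> v \<noteq> 0}"

definition zero_locus :: "('a::field ^ 'k \<Rightarrow> 'a) set \<Rightarrow> ('a ^ 'k) set set" where
  "zero_locus S = {x \<in> proj UNIV. \<forall>f\<in>S. \<forall>v\<in>x. f v = 0}"

definition zariski :: "('a::field ^ 'k) set topology" where
  "zariski = topology (\<lambda>U. \<exists>S \<subseteq> (\<Union>d. homog d). U = proj UNIV - zero_locus S)"

definition irreducible_in :: "'p topology \<Rightarrow> 'p set \<Rightarrow> bool" where
  "irreducible_in T S \<longleftrightarrow> S \<subseteq> topspace T \<and> S \<noteq> {} \<and>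
     (\<forall>A B. closedin T A \<and> closedin T B \<and> S \<subseteq> A \<union> B \<longrightarrow> S \<subseteq> A \<or> S \<subseteq> B)"

text \<open>The supremum of the lengths \<open>l\<close> of chains \<open>Z\<^sub>0 \<subset> \<dots> \<subset> Z\<^sub>l\<close> of irreducible closed sets
  (with value \<open>0\<close> on the empty space).\<close>

definition krull_dim :: "'p topology \<Rightarrow> enat" where
  "krull_dim T = Sup {enat l | l. \<exists>Z :: nat \<Rightarrow> 'p set.
     (\<forall>i\<le>l. closedin T (Z i) \<and> irreducible_in T (Z i)) \<and> (\<forall>i<l. Z i \<subset> Z (Suc i))}"

definition dim_of :: "('a::field ^ 'k) set set \<Rightarrow> enat" where
  "dim_of X = krull_dim (subtopology zariski X)"

definition closed_subvariety :: "('a::field ^ 'k) set \<Rightarrow> ('a ^ 'k) set set \<Rightarrow> bool" where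
  "closed_subvariety W X \<longleftrightarrow> X \<subseteq> proj W \<and> closedin zariski X \<and> irreducible_in zariski X"


text \<open>\<open>dderiv f v w\<close> is the formal derivative of the polynomial \<open>f\<close> at \<open>v\<close> in direction \<open>w\<close>: the
  coefficient of \<open>t\<close> in \<open>f (v + t w)\<close>.\<close>

definition dderiv :: "('a::field ^ 'k \<Rightarrow> 'a) \<Rightarrow> 'a ^ 'k \<Rightarrow> 'a ^ 'k \<Rightarrow> 'a" where
  "dderiv f v w = coeff (THE p. \<forall>t. poly p t = f (v + t *s w)) 1"

text \<open>The tangent space at \<open>x\<close> of the affine cone over \<open>X\<close>; its dimension is one more than the
  dimension of the Zariski tangent space of \<open>X\<close> at \<open>x\<close>.\<close>

definition cone_tangent :: "('a::field ^ 'k) set set \<Rightarrow> ('a ^ 'k) set \<Rightarrow> ('a ^ 'k) set" where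
  "cone_tangent X x =
     {w. \<forall>f \<in> (\<Union>d. homog d). X \<subseteq> zero_locus {f} \<longrightarrow> (\<forall>v \<in> x - {0}. dderiv f v w = 0)}"

definition Sing :: "('a::field ^ 'k) set set \<Rightarrow> ('a ^ 'k) set set" where
  "Sing X = {x \<in> X. enat (vec.dim (cone_tangent X x)) > dim_of X + 1}"

text \<open>Hyperquadrics of \<open>proj W\<close>: quadrics \<open>{q = 0}\<close>, with \<open>q\<close> a non-zero quadratic form on \<open>W\<close>, that
  are irreducible and reduced, i.e. the ideal generated by \<open>q\<close> in the polynomial ring of \<open>W\<close> is
  radical.\<close>

definition reduced_on :: "('a::field ^ 'k) set \<Rightarrow> ('a ^ 'k \<Rightarrow> 'a) \<Rightarrow> bool" where
  "reduced_on W q \<longleftrightarrow> (\<forall>f\<in>polys. \<forall>r.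
     (\<exists>g\<in>polys. \<forall>v\<in>W. f v ^ r = q v * g v) \<longrightarrow> (\<exists>g\<in>polys. \<forall>v\<in>W. f v = q v * g v))"

definition hyperquadric :: "('a::field ^ 'k) set \<Rightarrow> ('a ^ 'k) set set \<Rightarrow> bool" where
  "hyperquadric W X \<longleftrightarrow> (\<exists>q \<in> homog 2. (\<exists>v\<in>W. q v \<noteq> 0) \<and>
     X = proj W \<inter> zero_locus {q} \<and> irreducible_in zariski X \<and> reduced_on W q)"

definition nondegenerate :: "('a::field ^ 'k) set \<Rightarrow> ('a ^ 'k) set set \<Rightarrow> bool" where
  "nondegenerate W X \<longleftrightarrow>
     \<not> (\<exists>H. vec.subspace H \<and> H \<subseteq> W \<and> vec.dim H + 1 = vec.dim W \<and> X \<subseteq> proj H)"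

text \<open>The linear subspace whose projectivization is the linear span of \<open>S\<close>.\<close>

definition span_space :: "('a::field ^ 'k) set set \<Rightarrow> ('a ^ 'k) set" where
  "span_space S = vec.span (\<Union>S)"


text \<open>Actions of a vector group \<open>V\<close> (a linear subspace of \<open>'a ^ 'n\<close> under addition) on \<open>proj W\<close>.
  Only the values of \<open>act\<close> on \<open>V\<close> and \<open>proj W\<close> matter.\<close>

definition is_action ::
  "('a::field ^ 'n) set \<Rightarrow> ('a ^ 'k) set \<Rightarrow> ('a ^ 'n \<Rightarrow> ('a ^ 'k) set \<Rightarrow> ('a ^ 'k) set) \<Rightarrow> bool" where
  "is_action V W act \<longleftrightarrow>
     (\<forall>g\<in>V. \<forall>x\<in>proj W. act g x \<in> proj W) \<and>
     (\<forall>x\<in>proj W. act 0 x = x) \<and>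
     (\<forall>g\<in>V. \<forall>h\<in>V. \<forall>x\<in>proj W. act (g + h) x = act g (act h x))"

text \<open>The map \<open>V \<times> proj W \<rightarrow> proj W\<close> is a morphism of varieties: near every point, i.e. on a principal
  open set \<open>{h \<noteq> 0}\<close>, it is given by polynomials without common zeros that are homogeneous of one
  degree in the coordinates of \<open>proj W\<close>.\<close>

definition is_morphism ::
  "('a::field ^ 'n) set \<Rightarrow> ('a ^ 'k) set \<Rightarrow> ('a ^ 'n \<Rightarrow> ('a ^ 'k) set \<Rightarrow> ('a ^ 'k) set) \<Rightarrow> bool" where
  "is_morphism V W act \<longleftrightarrow> (\<forall>g\<^sub>0\<in>V. \<forall>v\<^sub>0\<in>W - {0}. \<exists>h \<in> polys2. \<exists>F d e.
     (\<forall>i. (\<lambda>p. F p $ i) \<in> polys2) \<and>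
     (\<forall>g v c. h (g, c *s v) = c ^ d * h (g, v)) \<and>
     (\<forall>g v c. F (g, c *s v) = c ^ e *s F (g, v)) \<and>
     h (g\<^sub>0, v\<^sub>0) \<noteq> 0 \<and>
     (\<forall>g\<in>V. \<forall>v\<in>W - {0}. h (g, v) \<noteq> 0 \<longrightarrow>
        F (g, v) \<noteq> 0 \<and> act g (vec.span {v}) = vec.span {F (g, v)}))"

definition effective ::
  "('a::field ^ 'n) set \<Rightarrow> ('a ^ 'k) set \<Rightarrow> ('a ^ 'n \<Rightarrow> ('a ^ 'k) set \<Rightarrow> ('a ^ 'k) set) \<Rightarrow> bool" where
  "effective V W act \<longleftrightarrow> (\<forall>g\<in>V. (\<forall>x\<in>proj W. act g x = x) \<longrightarrow> g = 0)"

text \<open>\<open>act\<close> is an additive action of the vector group \<open>V\<close> on the closed subvariety \<open>X\<close> of \<open>proj W\<close>,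
  with open orbit \<open>Om\<close>. In characteristic zero every closed subgroup of a vector group is a linear
  subspace, so subgroups of \<open>'a ^ 'n\<close> that are vector groups are exactly its linear subspaces.\<close>

definition additive_action ::
  "('a::field ^ 'n) set \<Rightarrow> ('a ^ 'k) set \<Rightarrow> ('a ^ 'k) set set \<Rightarrow>
   ('a ^ 'n \<Rightarrow> ('a ^ 'k) set \<Rightarrow> ('a ^ 'k) set) \<Rightarrow> ('a ^ 'k) set set \<Rightarrow> bool" where
  "additive_action V W X act Om \<longleftrightarrow>
     vec.subspace V \<and> vec.subspace W \<and>
     closed_subvariety W X \<and> dim_of X = enat (vec.dim V) \<and>
     is_action V W act \<and> is_morphism V W act \<and> effective V W act \<and>
     (\<forall>g\<in>V. act g ` X = X) \<and>
     (\<exists>x\<in>X. Om = (\<lambda>g. act g x) ` V) \<and> openin (subtopology zariski X) Om"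

definition stabilizer ::
  "('a::field ^ 'n \<Rightarrow> ('a ^ 'k) set \<Rightarrow> ('a ^ 'k) set) \<Rightarrow> ('a ^ 'k) set \<Rightarrow> ('a ^ 'n) set" where
  "stabilizer act x = {g. act g x = x}"

definition Fix ::
  "('a::field ^ 'n \<Rightarrow> ('a ^ 'k) set \<Rightarrow> ('a ^ 'k) set) \<Rightarrow> ('a ^ 'k) set set \<Rightarrow> ('a ^ 'k) set set" where
  "Fix act X = {x \<in> X. \<forall>g. act g x = x}"

definition K_locus :: "('a::field ^ 'k) set set \<Rightarrow> ('a ^ 'k) set set \<Rightarrow> ('a ^ 'k) set set" where
  "K_locus X Om = (if hyperquadric UNIV X then Sing X else X - Om)"


lemma homog_mult: "f \<in> homog d \<Longrightarrow> g \<in> homog e \<Longrightarrow> (\<lambda>v. f v * g v) \<in> homog (d + e)"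
  by (auto simp: homog_def polys_def power_add intro: poly_funs.mult)

lemma istopology_zariski:
  "istopology (\<lambda>U :: ('a::field ^ 'k) set set.
     \<exists>S \<subseteq> (\<Union>d. homog d). U = proj UNIV - zero_locus S)"
  unfolding istopology_def
proof (intro conjI allI impI)
  fix U U' :: "('a ^ 'k) set set"
  assume "\<exists>S \<subseteq> (\<Union>d. homog d). U = proj UNIV - zero_locus S"
    and "\<exists>S \<subseteq> (\<Union>d. homog d). U' = proj UNIV - zero_locus S"
  then obtain S S' where S: "S \<subseteq> (\<Union>d. homog d)" "U = proj UNIV - zero_locus S"
    "S' \<subseteq> (\<Union>d. homog d)" "U' = proj UNIV - zero_locus S'" by auto
  define P where "P = {(\<lambda>v. f v * g v) | f g. f \<in> S \<and> g \<in> S'}"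
  have P: "P \<subseteq> (\<Union>d. homog d)"
  proof
    fix h assume "h \<in> P"
    then obtain f g where fg: "f \<in> S" "g \<in> S'" "h = (\<lambda>v. f v * g v)" by (auto simp: P_def)
    obtain d e where "f \<in> homog d" "g \<in> homog e" using fg(1,2) S(1,3) by blast
    then have "h \<in> homog (d + e)" unfolding fg(3) by (rule homog_mult)
    then show "h \<in> (\<Union>d. homog d)" by blast
  qed
  have "x \<in> U \<inter> U' \<longleftrightarrow> x \<in> proj UNIV - zero_locus P" for x
  proof (cases "x \<in> proj UNIV")
    case True
    then obtain u where u: "u \<noteq> 0" "x = vec.span {u}" by (auto simp: proj_def)
    have ux: "u \<in> x" using u by (simp add: vec.span_base)
    have key: "(\<exists>v\<in>x. f v \<noteq> 0) \<longleftrightarrow> f u \<noteq> 0" if "f \<in> (\<Union>d. homog d)" for f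
    proof
      assume "\<exists>v\<in>x. f v \<noteq> 0"
      then obtain v where v: "v \<in> x" "f v \<noteq> 0" by blast
      from v(1) obtain c where c: "v = c *s u" unfolding u(2) vec.span_singleton by blast
      from that obtain d where "f \<in> homog d" by blast
      then have "f v = c ^ d * f u" unfolding c homog_def by blast
      with v(2) show "f u \<noteq> 0" by auto
    qed (use ux in blast)
    have loc: "x \<in> proj UNIV - zero_locus R \<longleftrightarrow> (\<exists>f\<in>R. f u \<noteq> 0)"
      if "R \<subseteq> (\<Union>d. homog d)" for R
    proof -
      have "x \<in> proj UNIV - zero_locus R \<longleftrightarrow> (\<exists>f\<in>R. \<exists>v\<in>x. f v \<noteq> 0)"
        using True by (auto simp: zero_locus_def)
      also have "\<dots> \<longleftrightarrow> (\<exists>f\<in>R. f u \<noteq> 0)"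
        by (intro bex_cong refl key) (use that in blast)
      finally show ?thesis .
    qed
    have "(\<exists>h\<in>P. h u \<noteq> 0) \<longleftrightarrow> (\<exists>f\<in>S. f u \<noteq> 0) \<and> (\<exists>g\<in>S'. g u \<noteq> 0)"
    proof
      assume "\<exists>h\<in>P. h u \<noteq> 0"
      then show "(\<exists>f\<in>S. f u \<noteq> 0) \<and> (\<exists>g\<in>S'. g u \<noteq> 0)"
        by (auto simp: P_def)
    next
      assume "(\<exists>f\<in>S. f u \<noteq> 0) \<and> (\<exists>g\<in>S'. g u \<noteq> 0)"
      then obtain f g where fg: "f \<in> S" "g \<in> S'" "f u * g u \<noteq> 0" by auto
      then have "(\<lambda>v. f v * g v) \<in> P" by (auto simp: P_def)
      then show "\<exists>h\<in>P. h u \<noteq> 0" using fg(3) by (intro bexI[of _ "\<lambda>v. f v * g v"])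
    qed
    then show ?thesis
      using loc[OF S(1)] loc[OF S(3)] loc[OF P] S(2,4) by simp
  qed (use S in auto)
  then show "\<exists>S \<subseteq> (\<Union>d. homog d). U \<inter> U' = proj UNIV - zero_locus S"
    using P by blast
next
  fix \<U> :: "('a ^ 'k) set set set"
  assume *: "\<forall>U\<in>\<U>. \<exists>S \<subseteq> (\<Union>d. homog d). U = proj UNIV - zero_locus S"
  define R where "R = {S. S \<subseteq> (\<Union>d. homog d) \<and> proj UNIV - zero_locus S \<in> \<U>}"
  have "\<Union>\<U> = (\<Union>S\<in>R. proj UNIV - zero_locus S)"
  proof
    show "\<Union>\<U> \<subseteq> (\<Union>S\<in>R. proj UNIV - zero_locus S)"
    proof
      fix x assume "x \<in> \<Union>\<U>"
      then obtain U where U: "U \<in> \<U>" "x \<in> U" by blast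
      with * obtain S where "S \<subseteq> (\<Union>d. homog d)" "U = proj UNIV - zero_locus S" by blast
      with U show "x \<in> (\<Union>S\<in>R. proj UNIV - zero_locus S)" by (auto simp: R_def)
    qed
  qed (auto simp: R_def)
  also have "\<dots> = proj UNIV - zero_locus (\<Union>R)"
    by (auto simp: zero_locus_def)
  finally show "\<exists>S \<subseteq> (\<Union>d. homog d). \<Union>\<U> = proj UNIV - zero_locus S"
    by (intro exI[of _ "\<Union>R"]) (auto simp: R_def)
qed

lemma openin_zariski:
  "openin zariski U \<longleftrightarrow> (\<exists>S \<subseteq> (\<Union>d. homog d). U = proj UNIV - zero_locus S)"
  unfolding zariski_def by (subst topology_inverse'[OF istopology_zariski]) simp

lemma topspace_zariski: "topspace (zariski :: ('a::field ^ 'k) set topology) = proj UNIV"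
proof -
  have "(\<lambda>_. 1 :: 'a) \<in> homog 0"
    by (auto simp: homog_def polys_def intro: poly_funs.const)
  moreover have "vec.span {v} \<noteq> {}" for v :: "'a ^ 'k"
    using vec.span_base by blast
  then have "zero_locus {\<lambda>_ :: 'a ^ 'k. 1 :: 'a} = {}"
    by (auto simp: zero_locus_def proj_def)
  ultimately have "openin zariski (proj UNIV :: ('a ^ 'k) set set)"
    unfolding openin_zariski by (intro exI[of _ "{\<lambda>_. 1}"]) auto
  moreover have "U \<subseteq> proj UNIV" if "openin zariski U" for U :: "('a ^ 'k) set set"
    using that unfolding openin_zariski by blast
  ultimately show ?thesis
    by (metis openin_subset openin_topspace subset_antisym)
qed

lemma closedin_zariski:
  "closedin zariski A \<longleftrightarrow> (\<exists>S \<subseteq> (\<Union>d. homog d). A = zero_locus S)"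
proof -
  have sub: "zero_locus S \<subseteq> proj UNIV" for S :: "('a ^ 'k \<Rightarrow> 'a) set"
    by (auto simp: zero_locus_def)
  show ?thesis
    unfolding closedin_def topspace_zariski openin_zariski
  proof
    assume "A \<subseteq> proj UNIV \<and> (\<exists>S \<subseteq> (\<Union>d. homog d). proj UNIV - A = proj UNIV - zero_locus S)"
    then obtain S where S: "A \<subseteq> proj UNIV" "S \<subseteq> (\<Union>d. homog d)"
      "proj UNIV - A = proj UNIV - zero_locus S" by blast
    have "A = zero_locus S" using S(1,3) sub[of S] by blast
    with S(2) show "\<exists>S \<subseteq> (\<Union>d. homog d). A = zero_locus S" by blast
  next
    assume "\<exists>S \<subseteq> (\<Union>d. homog d). A = zero_locus S"
    with sub show "A \<subseteq> proj UNIV \<and>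
      (\<exists>S \<subseteq> (\<Union>d. homog d). proj UNIV - A = proj UNIV - zero_locus S)" by blast
  qed
qed

lemma dderiv_eqI:
  fixes f :: "'a::field_char_0 ^ 'k \<Rightarrow> 'a"
  assumes "\<And>t. poly p t = f (v + t *s w)"
  shows "dderiv f v w = coeff p 1"
proof -
  have "(THE p. \<forall>t. poly p t = f (v + t *s w)) = p"
  proof (rule the_equality)
    fix p' assume "\<forall>t. poly p' t = f (v + t *s w)"
    then have "poly p' = poly p" using assms by auto
    then show "p' = p" using poly_eq_poly_eq_iff by blast
  qed (use assms in auto)
  then show ?thesis by (simp add: dderiv_def)
qed

lemma polys_line_poly:
  fixes f :: "'a::field ^ 'k \<Rightarrow> 'a"
  assumes "f \<in> polys"
  shows "\<exists>p. \<forall>t. poly p t = f (v + t *s w)"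
  using assms unfolding polys_def
proof induction
  case (coord c)
  then obtain i where c: "c = (\<lambda>v. v $ i)" by auto
  show ?case by (rule exI[of _ "[:v $ i, w $ i:]"]) (simp add: c)
next
  case (const a)
  show ?case by (rule exI[of _ "[:a:]"]) simp
next
  case (add f g)
  then show ?case by (metis poly_add)
next
  case (mult f g)
  then show ?case by (metis poly_mult)
qed

end

theory Submission
  imports Defs "HOL-Computational_Algebra.Polynomial_Factorial"
    "HOL-Computational_Algebra.Field_as_Ring" "HOL-Library.Function_Algebras"
begin

text \<open>The action lifts to a linear unipotent representation, and the vector over \<open>x\<^sub>0\<close> is cyclic for it,
  so the vector space becomes a commutative local algebra \<open>A = K e + N\<close> with \<open>e\<close> over \<open>x\<^sub>0\<close> in which
  \<open>g\<close> acts as multiplication by \<open>exp (\<nu> g)\<close>, where \<open>\<nu>\<close> embeds the group into the nilradical \<open>N\<close> as a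
  subspace \<open>U\<close>. A dimension count gives \<open>U = N\<close> for the projective space and \<open>U\<close> of codimension one in
  \<open>N\<close> for a quadric, and \<open>K(X)\<close> is the projectivization of a subspace \<open>R\<close>. Then \<open>G1\<close> corresponds to
  \<open>S = J \<inter> U\<close>, where \<open>J\<close> is the ideal of nilpotent annihilators of \<open>R\<close>. If \<open>S\<close> is closed under
  multiplication, then \<open>exp S = e + S\<close> and the orbit closure is a projective space. Otherwise
  \<open>J = S + K p\<close> for a product \<open>p\<close> of two elements of \<open>S\<close>, the quadric restricted to \<open>K e + J\<close> takes the
  form \<open>q (a e + s + c p) = q s + a c \<theta>\<close> with \<open>\<theta> \<noteq> 0\<close> and \<open>q\<close> not identically \<open>0\<close> on \<open>S\<close>, and \<open>exp S\<close>
  is its affine part \<open>{e + s - (q s / \<theta>) p}\<close>. The inclusion \<open>K e + J \<subset> A\<close> is proper because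
  \<open>K(X)\<close> is not fixed pointwise.\<close>

section \<open>Bivariate polynomials over a field form a factorial ring\<close>

text \<open>The action is given only by local charts on the product of group and space, so no matrix
  is at hand. Along a projective line it is a vector of bivariate polynomials, and factoriality
  allows a common factor to be removed so that nothing vanishes any more; hence the preliminaries on
  polynomial rings. Maps that are linear on all lines come from matrices, and determinant one
  together with the value \<open>mat 1\<close> at time zero makes these unique, so that they
  multiply correctly. Dimension is defined by chains of closed sets and is controlled by counting:
  at most \<open>r + 1\<close> polynomials in \<open>r\<close> parameters can be free of homogeneous
  relations. For a quadric, invariance of \<open>q\<close> makes multiplication by elements of
  \<open>U\<close> skew for the polar form \<open>B\<close>. So \<open>B e\<close> kills
  \<open>U\<close> and all threefold products from \<open>U\<close>, while a product of two elements
  acts self-adjointly. Since \<open>U\<close> has codimension one among the nilpotents, it is the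
  kernel of \<open>B e\<close> there; thus \<open>S\<close> fails to be closed exactly through a
  product on which \<open>B e\<close> is non-zero, and this value is \<theta>.\<close>

text \<open>The factoriality of polynomial rings is available for coefficient types of class
  \<open>field_gcd\<close> only; the copy \<open>'a fw\<close> of an arbitrary field \<open>'a\<close> belongs to that class.\<close>

typedef 'a fw = "UNIV :: 'a set" morphisms of_fw to_fw by auto

lemmas to_fw_inverse' [simp] = to_fw_inverse[OF UNIV_I] and of_fw_inverse' [simp] = of_fw_inverse

instantiation fw :: (field) field
begin

definition "0 = to_fw 0"
definition "1 = to_fw 1"
definition "x + y = to_fw (of_fw x + of_fw y)"
definition "x * y = to_fw (of_fw x * of_fw y)"
definition "x - y = to_fw (of_fw x - of_fw y)"
definition "- x = to_fw (- of_fw x)"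
definition "divide x y = to_fw (of_fw x / of_fw y)"
definition "inverse x = to_fw (inverse (of_fw x))"
instance
  by standard
    (auto simp: zero_fw_def one_fw_def plus_fw_def times_fw_def minus_fw_def uminus_fw_def
      divide_fw_def inverse_fw_def of_fw_inject[symmetric] algebra_simps divide_inverse)
end

lemma of_fw_simps [simp]:
  "of_fw 0 = 0" "of_fw 1 = 1" "of_fw (x + y) = of_fw x + of_fw y"
  "of_fw (x * y) = of_fw x * of_fw y" "of_fw (x - y) = of_fw x - of_fw y"
  by (simp_all add: zero_fw_def one_fw_def plus_fw_def times_fw_def minus_fw_def)

lemma of_fw_of_nat [simp]: "of_fw (of_nat n) = of_nat n"
  by (induction n) simp_all

lemma of_fw_eq_0_iff [simp]: "of_fw x = 0 \<longleftrightarrow> x = 0"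
  by (metis of_fw_inject of_fw_simps(1))

instance fw :: (field_char_0) field_char_0
proof
  show "inj (of_nat :: nat \<Rightarrow> 'a fw)"
    by (rule injI) (metis of_fw_of_nat of_nat_eq_iff)
qed

instantiation fw ::
  (field) "{unique_euclidean_ring, normalization_euclidean_semiring, normalization_semidom_multiplicative}"
begin

definition [simp]: "normalize_fw = (normalize_field :: 'a fw \<Rightarrow> _)"
definition [simp]: "unit_factor_fw = (unit_factor_field :: 'a fw \<Rightarrow> _)"
definition [simp]: "modulo_fw = (mod_field :: 'a fw \<Rightarrow> _)"
definition [simp]: "euclidean_size_fw = (euclidean_size_field :: 'a fw \<Rightarrow> _)"
definition [simp]: "division_segment (x :: 'a fw) = 1"
instance
  by standard (simp_all add: dvd_field_iff field_split_simps split: if_splits)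
end

instantiation fw :: (field) euclidean_ring_gcd
begin

definition gcd_fw :: "'a fw \<Rightarrow> 'a fw \<Rightarrow> 'a fw" where
  "gcd_fw = Euclidean_Algorithm.gcd"
definition lcm_fw :: "'a fw \<Rightarrow> 'a fw \<Rightarrow> 'a fw" where
  "lcm_fw = Euclidean_Algorithm.lcm"
definition Gcd_fw :: "'a fw set \<Rightarrow> 'a fw" where
  "Gcd_fw = Euclidean_Algorithm.Gcd"
definition Lcm_fw :: "'a fw set \<Rightarrow> 'a fw" where
  "Lcm_fw = Euclidean_Algorithm.Lcm"
instance by standard (simp_all add: gcd_fw_def lcm_fw_def Gcd_fw_def Lcm_fw_def)
end

instance fw :: (field) field_gcd ..

text \<open>The outer variable \<open>s\<close> runs along a line of projective space and the
  coefficients are polynomials in the time \<open>t\<close>, so \<open>degree\<close> measures the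
  degree along the line.\<close>

definition ev2 :: "'a::field fw poly poly \<Rightarrow> 'a \<Rightarrow> 'a \<Rightarrow> 'a" where
  "ev2 P t s = of_fw (poly (poly P [:to_fw s:]) (to_fw t))"

lemma ev2_simps [simp]:
  "ev2 0 t s = 0" "ev2 1 t s = 1"
  "ev2 (P + Q) t s = ev2 P t s + ev2 Q t s"
  "ev2 (P * Q) t s = ev2 P t s * ev2 Q t s"
  "ev2 (P - Q) t s = ev2 P t s - ev2 Q t s"
  "ev2 [:[:to_fw a:]:] t s = a"
  by (simp_all add: ev2_def)

lemma ev2_vars [simp]: "ev2 [:[:0, 1:]:] t s = t" "ev2 [:0, 1:] t s = s"
  by (simp_all add: ev2_def)

text \<open>Already the constants \<open>[:to_fw s:]\<close> are infinitely many roots of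
  \<open>P\<close> in its coefficient ring.\<close>

lemma ev2_eq_0D:
  fixes P :: "'a::field_char_0 fw poly poly"
  assumes "\<And>t s. ev2 P t s = 0"
  shows "P = 0"
proof (rule ccontr)
  assume "P \<noteq> 0"
  have "poly P [:to_fw s:] = 0" for s
  proof -
    have "poly (poly P [:to_fw s:]) x = 0" for x
      using assms[of "of_fw x" s] by (simp add: ev2_def)
    then show ?thesis using poly_all_0_iff_0 by blast
  qed
  then have "range (\<lambda>s. [:to_fw s:]) \<subseteq> {x. poly P x = 0}" by auto
  then have "finite (range (\<lambda>s::'a. [:to_fw s:]))"
    using poly_roots_finite[OF \<open>P \<noteq> 0\<close>] finite_subset by blast
  moreover have "inj (\<lambda>s::'a. [:to_fw s:])"
    by (rule injI) (simp add: to_fw_inject)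
  ultimately show False using infinite_UNIV_char_0 finite_imageD by blast
qed

text \<open>Freezing the time returns to polynomials over \<open>'a\<close> itself, where algebraic
  closedness is available.\<close>

definition slice :: "'a::field fw poly poly \<Rightarrow> 'a \<Rightarrow> 'a poly" where
  "slice P t = map_poly (\<lambda>c. of_fw (poly c (to_fw t))) P"

lemma poly_slice [simp]: "poly (slice P t) s = ev2 P t s"
  by (induction P) (simp_all add: slice_def ev2_def map_poly_pCons algebra_simps)

lemma coeff_slice: "coeff (slice P t) j = of_fw (poly (coeff P j) (to_fw t))"
  by (simp add: slice_def coeff_map_poly)

lemma poly_map_of_fw: "poly (map_poly of_fw c) t = of_fw (poly c (to_fw t))"
  by (induction c) (simp_all add: map_poly_pCons)

text \<open>After division by the gcd, a prime common to all quotients could be multiplied back into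
  the gcd.\<close>

lemma coprime_part:
  fixes P :: "'k::finite \<Rightarrow> 'b::field_gcd poly poly"
  assumes "P i0 \<noteq> 0"
  obtains D R where "\<And>i. P i = D * R i" "\<And>p. prime_elem p \<Longrightarrow> \<exists>i. \<not> p dvd R i"
proof
  define D where "D = Gcd (range P)"
  define R where "R = (\<lambda>i. P i div D)"
  have D0: "D \<noteq> 0" using assms by (auto simp: D_def Gcd_0_iff)
  show R: "P i = D * R i" for i
    by (simp add: R_def D_def Gcd_dvd)
  show "\<exists>i. \<not> p dvd R i" if "prime_elem p" for p
  proof (rule ccontr)
    assume "\<not> ?thesis"
    then have "D * p dvd P i" for i using R[of i] by (metis dvd_refl mult_dvd_mono)
    then have "D * p dvd D" unfolding D_def by (intro Gcd_greatest) auto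
    then have "p dvd 1" using D0 dvd_times_left_cancel_iff[of D p 1] by simp
    with that show False by (simp add: prime_elem_def)
  qed
qed

text \<open>If all \<open>R i\<close> vanished at the point, some prime factor \<open>p\<close> of
  \<open>R i0\<close> would vanish there. It cannot divide \<open>Q i0\<close>, so the cross
  relations push it into every \<open>R j\<close>. Vanishing at a point is thus converted into a
  common divisor; this is where factoriality enters.\<close>

lemma coprime_nonvanishing:
  fixes R Q :: "'k::finite \<Rightarrow> 'a::field fw poly poly"
  assumes R: "\<And>p. prime_elem p \<Longrightarrow> \<exists>i. \<not> p dvd R i"
    and eq: "\<And>i j. R i * Q j = R j * Q i"
    and nz: "ev2 (Q i0) t s \<noteq> 0"
  shows "\<exists>i. ev2 (R i) t s \<noteq> 0"
proof (rule ccontr)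
  assume "\<not> ?thesis"
  then have z: "ev2 (R i) t s = 0" for i by auto
  have "Q i0 \<noteq> 0" using nz by auto
  have "R i0 \<noteq> 0"
  proof
    assume "R i0 = 0"
    then have "R j = 0" for j using eq[of i0 j] \<open>Q i0 \<noteq> 0\<close> by simp
    \<comment> \<open>Any prime would do here, since it would divide all the \<open>R j\<close>,
      which are zero.\<close>
    moreover have "prime_elem [:0, 1 :: 'a fw poly:]"
      using prime_elem_linear_poly[of 1 0] by simp
    ultimately show False using R by fastforce
  qed
  have "\<exists>p. prime_elem p \<and> p dvd R i0 \<and> ev2 p t s = 0"
  proof -
    have "\<exists>p\<in>#A. ev2 p t s = 0" if "ev2 (prod_mset A) t s = 0" for A :: "'a fw poly poly multiset"
      using that by (induction A) auto
    moreover obtain A where A: "\<And>x. x \<in># A \<Longrightarrow> prime_elem x" "normalize (prod_mset A) = normalize (R i0)"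
      using prime_factorization_exists[OF \<open>R i0 \<noteq> 0\<close>] by blast
    moreover have "ev2 (prod_mset A) t s = 0"
    proof -
      have "R i0 dvd prod_mset A" using A(2) by (metis associated_iff_dvd)
      then obtain c where "prod_mset A = R i0 * c" by blast
      then show ?thesis using z by simp
    qed
    moreover have "p dvd R i0" if "p \<in># A" for p
    proof -
      have "p dvd prod_mset A" using that by (rule dvd_prod_mset)
      also have "prod_mset A dvd R i0" using A(2) by (metis associated_iff_dvd)
      finally show ?thesis .
    qed
    ultimately show ?thesis by blast
  qed
  then obtain p where p: "prime_elem p" "p dvd R i0" "ev2 p t s = 0" by blast
  have "\<not> p dvd Q i0"
    using nz p(3) by (auto elim!: dvdE)
  then have "p dvd R j" for j
    using p(1,2) eq[of i0 j] prime_elem_dvd_multD[OF p(1), of "R j" "Q i0"] by (metis dvd_mult2)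
  then show False using R[OF p(1)] by blast
qed

text \<open>\<open>p'\<close> is \<open>p\<close> seen from the point at infinity of a line. Its
  regularity there bounds the degree of \<open>p\<close>, and its value there is the coefficient of
  index \<open>e\<close>.\<close>

lemma poly_reversal:
  fixes p p' :: "'a::field_char_0 poly"
  assumes "\<And>r. r \<noteq> 0 \<Longrightarrow> poly p' r = r ^ e * poly p (1 / r)"
  shows "degree p \<le> e" "coeff p e = poly p' 0"
proof -
  define d where "d = degree p"
  \<comment> \<open>The extra factor \<open>[:0, 1:]\<close> makes the identity hold at
    \<open>r = 0\<close> as well.\<close>
  have "poly ([:0, 1:] * (monom 1 d * p')) r = poly ([:0, 1:] * (monom 1 e * reflect_poly p)) r" for r
    by (cases "r = 0") (simp_all add: assms poly_monom poly_reflect_poly_nz d_def inverse_eq_divide)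
  then have "[:0, 1:] * (monom 1 d * p') = [:0, 1:] * (monom 1 e * reflect_poly p)"
    using poly_eq_poly_eq_iff by blast
  then have eq: "monom 1 d * p' = monom 1 e * reflect_poly p" by simp
  show d: "degree p \<le> e"
  proof (rule ccontr)
    assume "\<not> ?thesis"
    then have "e < d" by (simp add: d_def)
    then have "coeff (monom 1 d * p') e = 0" by (simp add: coeff_monom_mult)
    then have "coeff (reflect_poly p) 0 = 0" unfolding eq by (simp add: coeff_monom_mult)
    then have "p = 0" by simp
    with \<open>e < d\<close> show False by (simp add: d_def)
  qed
  have "coeff p' 0 = coeff (monom 1 e * reflect_poly p) d"
    unfolding eq[symmetric] by (simp add: coeff_monom_mult)
  also have "\<dots> = coeff p e"
    using d by (auto simp: coeff_monom_mult d_def coeff_eq_0)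
  finally show "coeff p e = poly p' 0" by (simp add: poly_0_coeff_0)
qed

section \<open>Linearization of the action\<close>

lemma poly_funs_path:
  assumes "f \<in> poly_funs C" "\<And>c. c \<in> C \<Longrightarrow> \<exists>p. \<forall>t. poly p t = c (\<gamma> t)"
  shows "\<exists>p. \<forall>t. poly p t = f (\<gamma> t)"
  using assms(1)
proof induction
  case (const a)
  show ?case by (rule exI[of _ "[:a:]"]) simp
next
  case (add f g)
  then show ?case by (metis poly_add)
next
  case (mult f g)
  then show ?case by (metis poly_mult)
qed (use assms(2) in blast)

lemma poly_funs_ev2:
  assumes "f \<in> poly_funs C" "\<And>c. c \<in> C \<Longrightarrow> \<exists>P. \<forall>t s. ev2 P t s = c (\<gamma> t s)"
  shows "\<exists>P. \<forall>t s. ev2 P t s = f (\<gamma> t s)"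
  using assms(1)
proof induction
  case (const a)
  show ?case by (rule exI[of _ "[:[:to_fw a:]:]"]) simp
next
  case (add f g)
  then show ?case by (metis ev2_simps(3))
next
  case (mult f g)
  then show ?case by (metis ev2_simps(4))
qed (use assms(2) in blast)

lemma polys2_ev2:
  fixes v w :: "'a::field ^ 'k"
  assumes "f \<in> polys2"
  shows "\<exists>P. \<forall>t s. ev2 P t s = f (t *s g, s *s v + w)"
  using assms unfolding polys2_def
proof (rule poly_funs_ev2[where \<gamma> = "\<lambda>t s. (t *s g, s *s v + w)"], goal_cases)
  case (1 c)
  then consider i where "c = (\<lambda>(g, v). g $ i)" | i where "c = (\<lambda>(g, v). v $ i)" by auto
  then show ?case
  proof cases
    case 1
    show ?thesis
      by (rule exI[of _ "[:[:0, 1:]:] * [:[:to_fw (g $ i):]:]"]) (simp add: 1 del: mult_pCons_left mult_pCons_right)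
  next
    case 2
    show ?thesis
      by (rule exI[of _ "[:0, 1:] * [:[:to_fw (v $ i):]:] + [:[:to_fw (w $ i):]:]"])
        (simp add: 2 del: mult_pCons_left mult_pCons_right)
  qed
qed

lemma polys2_ev2_vec:
  fixes v w :: "'a::field ^ 'k"
  assumes "\<And>i. (\<lambda>p. F p $ i) \<in> polys2"
  shows "\<exists>P. \<forall>i t s. ev2 (P i) t s = F (t *s g, s *s v + w) $ i"
proof -
  have "\<forall>i. \<exists>P. \<forall>t s. ev2 P t s = F (t *s g, s *s v + w) $ i"
    using polys2_ev2[OF assms] by blast
  from choice[OF this] show ?thesis .
qed

lemma polys2_path:
  fixes v w :: "'a::field ^ 'k"
  assumes "f \<in> polys2"
  shows "\<exists>p. \<forall>r. poly p r = f (g, v + r *s w)"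
  using assms unfolding polys2_def
proof (rule poly_funs_path[where \<gamma> = "\<lambda>r. (g, v + r *s w)"], goal_cases)
  case (1 c)
  then consider i where "c = (\<lambda>(g, v). g $ i)" | i where "c = (\<lambda>(g, v). v $ i)" by auto
  then show ?case
  proof cases
    case 1
    show ?thesis by (rule exI[of _ "[:g $ i:]"]) (simp add: 1)
  next
    case 2
    show ?thesis by (rule exI[of _ "[:v $ i, w $ i:]"]) (simp add: 2)
  qed
qed

lemma span_singleton_eq_iff:
  fixes v w :: "'a::field ^ 'k"
  assumes "v \<noteq> 0" "w \<noteq> 0"
  shows "vec.span {v} = vec.span {w} \<longleftrightarrow> (\<exists>c. c \<noteq> 0 \<and> w = c *s v)"
proof
  assume "vec.span {v} = vec.span {w}"
  then have "w \<in> vec.span {v}" by (simp add: vec.span_base)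
  then obtain c where "w = c *s v" by (auto simp: vec.span_singleton)
  with assms show "\<exists>c. c \<noteq> 0 \<and> w = c *s v" by (intro exI[of _ c]) auto
next
  assume "\<exists>c. c \<noteq> 0 \<and> w = c *s v"
  then obtain c where c: "c \<noteq> 0" "w = c *s v" by blast
  have "range (\<lambda>k. k *s v) = range (\<lambda>k. k *s w)"
  proof (intro equalityI subsetI)
    fix x assume "x \<in> range (\<lambda>k. k *s v)"
    then obtain k where "x = k *s v" by blast
    then have "x = (k / c) *s w" using c by simp
    then show "x \<in> range (\<lambda>k. k *s w)" by blast
  next
    fix x assume "x \<in> range (\<lambda>k. k *s w)"
    then show "x \<in> range (\<lambda>k. k *s v)" using c by (auto simp: )
  qed
  then show "vec.span {v} = vec.span {w}" by (simp add: vec.span_singleton)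
qed

text \<open>Proportionality becomes a family of polynomial identities, which can be extended from
  almost all parameters to all of them.\<close>

lemma span_singleton_eq_minors:
  fixes v w :: "'a::field ^ 'k"
  assumes "v \<noteq> 0" "w \<noteq> 0"
  shows "vec.span {v} = vec.span {w} \<longleftrightarrow> (\<forall>i j. v $ i * w $ j = v $ j * w $ i)"
proof
  assume "vec.span {v} = vec.span {w}"
  then obtain c where "w = c *s v" using span_singleton_eq_iff[OF assms] by blast
  then show "\<forall>i j. v $ i * w $ j = v $ j * w $ i" by simp
next
  assume *: "\<forall>i j. v $ i * w $ j = v $ j * w $ i"
  obtain i where i: "v $ i \<noteq> 0" using assms(1) by (auto simp: vec_eq_iff)
  have w: "w = (w $ i / v $ i) *s v"
    using * i by (simp add: vec_eq_iff field_simps)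
  then have "w $ i / v $ i \<noteq> 0" using assms(2) by force
  with w show "vec.span {v} = vec.span {w}" using span_singleton_eq_iff[OF assms] by blast
qed

lemma span_singleton_minors:
  fixes v w :: "'a::field ^ 'k"
  assumes "vec.span {v} = vec.span {w}" "v \<noteq> 0" "w \<noteq> 0"
  shows "v $ i * w $ j = v $ j * w $ i"
  using span_singleton_eq_minors[OF assms(2,3)] assms(1) by blast

lemma span_singleton_scale:
  fixes v :: "'a::field ^ 'k"
  assumes "c \<noteq> 0"
  shows "vec.span {c *s v} = vec.span {v}"
proof (cases "v = 0")
  case False
  then show ?thesis using span_singleton_eq_iff[of v "c *s v"] assms by auto
qed simp

lemma span_singleton_in_proj: "v \<noteq> 0 \<Longrightarrow> vec.span {v} \<in> proj UNIV"
  by (auto simp: proj_def)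

lemma is_action_inj:
  fixes act :: "'a::field ^ 'n \<Rightarrow> ('a ^ 'k) set \<Rightarrow> ('a ^ 'k) set"
  assumes "is_action UNIV UNIV act" "x \<in> proj UNIV" "y \<in> proj UNIV" "act g x = act g y"
  shows "x = y"
proof -
  have "act (- g) (act g z) = z" if "z \<in> proj UNIV" for z
    using assms(1) that unfolding is_action_def by (metis UNIV_I add.left_inverse)
  then show ?thesis using assms(2-4) by metis
qed

lemma no_root_imp_const:
  fixes p :: "'a::alg_closed_field poly"
  assumes "\<And>x. poly p x \<noteq> 0"
  shows "\<exists>c. c \<noteq> 0 \<and> p = [:c:]"
proof -
  have "degree p = 0" using assms alg_closed_imp_poly_has_root by blast
  then obtain c where "p = [:c:]" by (meson degree_eq_zeroE)
  with assms show ?thesis by auto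
qed

lemma poly_nonzero_point:
  fixes p :: "'a::field_char_0 poly"
  assumes "p \<noteq> 0"
  obtains r where "r \<noteq> 0" "poly p r \<noteq> 0"
proof -
  have "[:0, 1:] * p \<noteq> 0" using assms by simp
  then obtain r where "poly ([:0, 1:] * p) r \<noteq> 0" using poly_all_0_iff_0 by blast
  then show ?thesis using that by auto
qed

section \<open>Charts of the action and its restriction to lines\<close>

definition is_chart where
  "is_chart act g v h F d e \<longleftrightarrow> (\<forall>i. (\<lambda>p. F p $ i) \<in> polys2) \<and> h \<in> polys2 \<and>
     (\<forall>g v c. h (g, c *s v) = c ^ d * h (g, v)) \<and>
     (\<forall>g v c. F (g, c *s v) = c ^ e *s F (g, v)) \<and> h (g, v) \<noteq> 0 \<and>
     (\<forall>g v. v \<noteq> 0 \<longrightarrow> h (g, v) \<noteq> 0 \<longrightarrow>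
        F (g, v) \<noteq> 0 \<and> act g (vec.span {v}) = vec.span {F (g, v)})"

lemma is_chartD:
  assumes "is_chart act g v h F d e"
  shows "(\<lambda>p. F p $ i) \<in> polys2" "h \<in> polys2"
    "h (g', c *s v') = c ^ d * h (g', v')" "F (g', c *s v') = c ^ e *s F (g', v')" "h (g, v) \<noteq> 0"
    "v' \<noteq> 0 \<Longrightarrow> h (g', v') \<noteq> 0 \<Longrightarrow>
       F (g', v') \<noteq> 0 \<and> act g' (vec.span {v'}) = vec.span {F (g', v')}"
  using assms unfolding is_chart_def by blast+

lemma morphism_chart:
  fixes act :: "'a::field ^ 'n \<Rightarrow> ('a ^ 'k) set \<Rightarrow> ('a ^ 'k) set"
  assumes "is_morphism UNIV UNIV act" "v \<noteq> 0"
  shows "\<exists>h F d e. is_chart act g v h F d e"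
proof -
  have "v \<in> UNIV - {0}" using assms(2) by simp
  from assms(1)[unfolded is_morphism_def, rule_format, OF UNIV_I this, of g]
  show ?thesis
    apply (elim bexE exE conjE)
    subgoal for h F d e
      unfolding is_chart_def by (intro exI[of _ h] exI[of _ F] exI[of _ d] exI[of _ e]) simp
    done
qed

text \<open>In a chart \<open>F\<close> of the action around the point \<open>(0, [v])\<close>, cancel the common factor of the
  bivariate polynomials \<open>F (t g, s v + w)\<close>. The quotient \<open>R\<close> vanishes nowhere, since near every
  point it is proportional to a chart. At \<open>t = 0\<close> it is a multiple of \<open>s v + w\<close>, and its leading
  coefficient in \<open>s\<close> does not vanish there because \<open>F (0, v) \<noteq> 0\<close>. Hence \<open>R\<close> has degree one in \<open>s\<close>.\<close>

lemma action_on_line: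
  fixes act :: "'a::{alg_closed_field, field_char_0} ^ 'n \<Rightarrow> ('a ^ 'k) set \<Rightarrow> ('a ^ 'k) set"
  assumes act: "is_action UNIV UNIV act" and mor: "is_morphism UNIV UNIV act"
    and indep: "\<And>a b. a *s v + b *s w = 0 \<Longrightarrow> a = 0 \<and> b = 0"
  obtains p1 p0 :: "'k \<Rightarrow> 'a poly" where
    "\<And>t a b. a \<noteq> 0 \<or> b \<noteq> 0 \<Longrightarrow>
       (\<chi> i. a * poly (p1 i) t + b * poly (p0 i) t) \<noteq> 0 \<and>
       act (t *s g) (vec.span {a *s v + b *s w}) = vec.span {\<chi> i. a * poly (p1 i) t + b * poly (p0 i) t}"
proof -
  have v0: "v \<noteq> 0" using indep[of 1 0] by auto
  have w0: "w \<noteq> 0" using indep[of 0 1] by auto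
  have l0: "s *s v + w \<noteq> 0" for s using indep[of s 1] by auto
  obtain j l where jl: "v $ j * w $ l \<noteq> v $ l * w $ j"
  proof -
    have "vec.span {v} \<noteq> vec.span {w}"
    proof
      assume "vec.span {v} = vec.span {w}"
      then obtain c where "w = c *s v" using span_singleton_eq_iff[OF v0 w0] by blast
      then show False using indep[of "- c" 1] by simp
    qed
    then show ?thesis using span_singleton_eq_minors[OF v0 w0] that by blast
  qed
  obtain h F d e where ch: "is_chart act 0 v h F d e" using morphism_chart[OF mor v0] by blast
  note F2 = is_chartD(1)[OF ch] and h2 = is_chartD(2)[OF ch] and hh = is_chartD(3)[OF ch]
    and Fh = is_chartD(4)[OF ch] and h0 = is_chartD(5)[OF ch] and hF = is_chartD(6)[OF ch]
  obtain P where P: "\<And>i t s. ev2 (P i) t s = F (t *s g, s *s v + w) $ i"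
    using polys2_ev2_vec[of F, OF F2] by blast
  obtain H where H: "\<And>t s. ev2 H t s = h (t *s g, s *s v + w)" using polys2_ev2[OF h2] by blast
  have shift: "s *s v + w = s *s (v + (1 / s) *s w)" if "s \<noteq> 0" for s
    using that by (simp add: vector_add_ldistrib)
  \<comment> \<open>\<open>v\<close> is the point at infinity of the line \<open>s *s v + w\<close>;
    homogeneity carries non-vanishing of \<open>h\<close> at \<open>v\<close> to some finite point
    of the line.\<close>
  have H0: "H \<noteq> 0"
  proof
    assume "H = 0"
    then have z: "h (0, s *s v + w) = 0" for s using H[of 0 s] by simp
    obtain p where p: "\<And>r. poly p r = h (0, v + r *s w)" using polys2_path[OF h2] by blast
    have "p \<noteq> 0" using p[of 0] h0 by auto
    then obtain r where r: "r \<noteq> 0" "poly p r \<noteq> 0" using poly_nonzero_point by blast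
    then have "h (0, (1 / r) *s (v + r *s w)) \<noteq> 0" unfolding hh using p by simp
    then show False using z[of "1 / r"] r(1) by (simp add: vector_add_ldistrib)
  qed
  \<comment> \<open>By homogeneity of degree \<open>e\<close> and reversal in \<open>s\<close>, the
    value of \<open>F\<close> at \<open>v\<close> is the coefficient of index
    \<open>e\<close>.\<close>
  have top: "degree (slice (P i) 0) \<le> e" "coeff (slice (P i) 0) e = F (0, v) $ i"
    and degP: "degree (P i) \<le> e" for i
  proof -
    have *: "degree (slice (P i) t) \<le> e" "coeff (slice (P i) t) e = F (t *s g, v) $ i" for t
    proof -
      obtain p where p: "\<And>r. poly p r = F (t *s g, v + r *s w) $ i" using polys2_path[OF F2] by blast
      have "poly p r = r ^ e * poly (slice (P i) t) (1 / r)" if "r \<noteq> 0" for r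
        unfolding p poly_slice P using that Fh[of "t *s g" r "(1 / r) *s v + w"]
        by (simp add: vector_add_ldistrib)
      note poly_reversal[OF this]
      then show "degree (slice (P i) t) \<le> e" "coeff (slice (P i) t) e = F (t *s g, v) $ i"
        using p[of 0] by auto
    qed
    show "degree (slice (P i) 0) \<le> e" "coeff (slice (P i) 0) e = F (0, v) $ i" using *[of 0] by auto
    show "degree (P i) \<le> e"
    proof (rule degree_le, intro allI impI)
      fix n assume "e < n"
      then have "poly (coeff (P i) n) (to_fw t) = 0" for t
        using *(1)[of t] coeff_slice[of "P i" t n] by (simp add: coeff_eq_0)
      then have "poly (coeff (P i) n) x = 0" for x by (metis of_fw_inverse')
      then show "coeff (P i) n = 0" using poly_all_0_iff_0 by blast
    qed
  qed
  obtain i1 where i1: "F (0, v) $ i1 \<noteq> 0" using hF[OF v0 h0] by (auto simp: vec_eq_iff)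
  then have P1: "P i1 \<noteq> 0" using top(2)[of i1] by (auto simp: slice_def)
  obtain D R where PR: "\<And>i. P i = D * R i" and R: "\<And>p. prime_elem p \<Longrightarrow> \<exists>i. \<not> p dvd R i"
    using coprime_part[where P = P, OF P1] by blast
  have D0: "D \<noteq> 0" using PR[of i1] P1 by auto
  have Rnz: "(\<chi> i. ev2 (R i) t s) \<noteq> 0 \<and> act (t *s g) (vec.span {s *s v + w}) = vec.span {\<chi> i. ev2 (R i) t s}"
    for t s
  proof -
    obtain h' F' d' e' where ch': "is_chart act (t *s g) (s *s v + w) h' F' d' e'"
      using morphism_chart[OF mor l0] by blast
    note F2' = is_chartD(1)[OF ch'] and h2' = is_chartD(2)[OF ch'] and h0' = is_chartD(5)[OF ch']
      and hF' = is_chartD(6)[OF ch']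
    obtain Q where Q: "\<And>i t s. ev2 (Q i) t s = F' (t *s g, s *s v + w) $ i"
      using polys2_ev2_vec[of F', OF F2'] by blast
    obtain H' where H': "\<And>t s. ev2 H' t s = h' (t *s g, s *s v + w)" using polys2_ev2[OF h2'] by blast
    have H0': "H' \<noteq> 0" using H'[of t s] h0' by auto
    have "R i * Q l = R l * Q i" for i l
    proof -
      \<comment> \<open>The factors \<open>H\<close> and \<open>H'\<close> take care of the points
        outside one of the two charts.\<close>
      have "ev2 (H * H' * (P i * Q l)) t s = ev2 (H * H' * (P l * Q i)) t s" for t s
      proof (cases "h (t *s g, s *s v + w) = 0 \<or> h' (t *s g, s *s v + w) = 0")
        case False
        then have "vec.span {F (t *s g, s *s v + w)} = vec.span {F' (t *s g, s *s v + w)}"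
          "F (t *s g, s *s v + w) \<noteq> 0" "F' (t *s g, s *s v + w) \<noteq> 0"
          using hF[OF l0, of "t *s g" s] hF'[OF l0, of "t *s g" s] by auto
          from span_singleton_minors[OF this, of i l] show ?thesis by (simp add: P Q)
      qed (auto simp: H H')
      then have "H * H' * (P i * Q l) - H * H' * (P l * Q i) = 0"
        by (intro ev2_eq_0D) (simp only: ev2_simps(5) diff_self)
      then have "H * H' * D * (R i * Q l) = H * H' * D * (R l * Q i)" by (simp add: PR algebra_simps)
      then show ?thesis using H0 H0' D0 by simp
    qed
    note RQ = this
    have F's: "F' (t *s g, s *s v + w) \<noteq> 0" "act (t *s g) (vec.span {s *s v + w}) = vec.span {F' (t *s g, s *s v + w)}"
      using hF'[OF l0 h0'] by auto
    then obtain i0 where "ev2 (Q i0) t s \<noteq> 0" by (auto simp: Q vec_eq_iff)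
    from coprime_nonvanishing[OF R RQ this] have nz: "(\<chi> i. ev2 (R i) t s) \<noteq> 0"
      by (auto simp: vec_eq_iff)
    moreover have "vec.span {F' (t *s g, s *s v + w)} = vec.span {\<chi> i. ev2 (R i) t s}"
    proof -
      have "ev2 (R i) t s * ev2 (Q l) t s = ev2 (R l) t s * ev2 (Q i) t s" for i l
        using arg_cong[OF RQ[of i l], of "\<lambda>P. ev2 P t s"] by simp
      then show ?thesis
        by (subst span_singleton_eq_minors[OF F's(1) nz]) (simp add: Q[symmetric] mult.commute)
    qed
    ultimately show ?thesis using F's by simp
  qed
  \<comment> \<open>At time zero \<open>R\<close> is a multiple of \<open>s *s v + w\<close> by a
    scalar depending on \<open>s\<close>. \<open>lam\<close> is this scalar times a fixed minor of
    \<open>v\<close> and \<open>w\<close>; having no zero it is constant, so the scalar is constant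
    too.\<close>
  define lam where "lam = [:v $ j:] * slice (R l) 0 - [:v $ l:] * slice (R j) 0"
  have act0: "vec.span {s *s v + w} = vec.span {\<chi> i. ev2 (R i) 0 s}" for s
    using Rnz[of 0 s] act span_singleton_in_proj[OF l0] by (simp add: is_action_def)
  have lam: "\<exists>c. c \<noteq> 0 \<and> poly lam s = c * (v $ j * w $ l - v $ l * w $ j) \<and> (\<forall>i. ev2 (R i) 0 s = c * (s * v $ i + w $ i))" for s
  proof -
    obtain c where c: "c \<noteq> 0" "(\<chi> i. ev2 (R i) 0 s) = c *s (s *s v + w)"
      using span_singleton_eq_iff[of "s *s v + w" "\<chi> i. ev2 (R i) 0 s"] l0 Rnz[of 0 s] act0[of s] by auto
    then have "ev2 (R i) 0 s = c * (s * v $ i + w $ i)" for i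
      by (metis vec_lambda_beta vector_add_component vector_smult_component)
    with c(1) show ?thesis by (intro exI[of _ c]) (auto simp: lam_def algebra_simps)
  qed
  then have "poly lam s \<noteq> 0" for s using jl by (metis mult_eq_0_iff right_minus_eq)
  then obtain c where c: "lam = [:c:]" using no_root_imp_const by blast
  define k where "k = c / (v $ j * w $ l - v $ l * w $ j)"
  have "ev2 (R i) 0 s = k * (s * v $ i + w $ i)" for i s
    using lam[of s] jl by (auto simp: c k_def)
  then have "poly (slice (R i) 0) s = poly [:k * w $ i, k * v $ i:] s" for i s
    by (simp add: algebra_simps)
  then have slR: "slice (R i) 0 = [:k * w $ i, k * v $ i:]" for i
    using poly_eq_poly_eq_iff by blast
  have R0: "R i1 \<noteq> 0" using P1 PR by auto
  have "degree (P i1) = e"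
  proof -
    have "coeff (P i1) e \<noteq> 0" using top(2)[of i1] i1 by (auto simp: coeff_slice)
    then have "e \<le> degree (P i1)" by (rule le_degree)
    with degP[of i1] show ?thesis by simp
  qed
  then have e: "e = degree D + degree (R i1)" using PR[of i1] D0 R0 by (simp add: degree_mult_eq)
  have "degree (R i1) \<le> 1"
  proof -
    have "coeff (P i1) e = coeff D (degree D) * coeff (R i1) (degree (R i1))"
      unfolding PR e by (simp add: coeff_mult_degree_sum)
    then have "coeff (slice (R i1) 0) (degree (R i1)) \<noteq> 0"
      using top(2)[of i1] i1 by (auto simp: coeff_slice)
    then have "degree (R i1) \<le> degree (slice (R i1) 0)" by (rule le_degree)
    also have "\<dots> \<le> 1" unfolding slR by (simp add: degree_pCons_le)
    finally show ?thesis .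
  qed
  have degR: "degree (R i) \<le> 1" for i
  proof (cases "R i = 0")
    case False
    then have "degree D + degree (R i) \<le> e" using degP[of i] PR[of i] D0 by (simp add: degree_mult_eq)
    with e \<open>degree (R i1) \<le> 1\<close> show ?thesis by simp
  qed simp
  define p0 where "p0 = (\<lambda>i. map_poly of_fw (coeff (R i) 0))"
  define p1 where "p1 = (\<lambda>i. map_poly of_fw (coeff (R i) 1))"
  have ev: "ev2 (R i) t s = s * poly (p1 i) t + poly (p0 i) t" for i t s
  proof -
    obtain a b where "R i = [:a, b:]"
    proof
      show "R i = [:coeff (R i) 0, coeff (R i) 1:]"
      proof (rule poly_eqI)
        fix n show "coeff (R i) n = coeff [:coeff (R i) 0, coeff (R i) 1:] n"
          using degR[of i] coeff_eq_0[of "R i" n]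
          by (cases "n \<le> 1") (auto simp: coeff_pCons le_Suc_eq split: nat.splits)
      qed
    qed
    then show ?thesis by (simp add: ev2_def p0_def p1_def poly_map_of_fw algebra_simps)
  qed
  show thesis
  proof (rule that)
    fix t a b :: 'a assume ab: "a \<noteq> 0 \<or> b \<noteq> 0"
    let ?u = "\<chi> i. a * poly (p1 i) t + b * poly (p0 i) t"
    show "?u \<noteq> 0 \<and> act (t *s g) (vec.span {a *s v + b *s w}) = vec.span {?u}"
    proof (cases "b = 0")
      case False
      have u: "?u = b *s (\<chi> i. ev2 (R i) t (a / b))" and l: "a *s v + b *s w = b *s ((a / b) *s v + w)"
        using False by (simp_all add: ev vec_eq_iff algebra_simps)
      show ?thesis unfolding u l span_singleton_scale[OF False]
        using Rnz[of t "a / b"] False vec.scale_eq_0_iff by blast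
    next
      case True
      with ab have a: "a \<noteq> 0" by simp
      have u: "?u = a *s (\<chi> i. poly (p1 i) t)" using True by (simp add: vec_eq_iff)
      \<comment> \<open>If the leading coefficient vanished, the points \<open>s = 0\<close> and
        \<open>s = 1\<close> of the line would have the same image.\<close>
      have nz: "(\<chi> i. poly (p1 i) t) \<noteq> 0"
      proof
        assume "(\<chi> i. poly (p1 i) t) = 0"
        then have "ev2 (R i) t 0 = ev2 (R i) t 1" for i by (simp add: ev vec_eq_iff)
        then have "act (t *s g) (vec.span {0 *s v + w}) = act (t *s g) (vec.span {1 *s v + w})"
          using Rnz[of t 0] Rnz[of t 1] by simp
        then have "vec.span {0 *s v + w} = vec.span {1 *s v + w}"
          using is_action_inj[OF act] span_singleton_in_proj l0 by blast
        then obtain c where "1 *s v + w = c *s (0 *s v + w)"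
          using span_singleton_eq_iff l0 by blast
        then have "1 *s v + (1 - c) *s w = 0" by (simp add: vec_eq_iff algebra_simps)
        then show False using indep[of 1 "1 - c"] by simp
      qed
      obtain h' F' d' e' where ch': "is_chart act (t *s g) v h' F' d' e'"
        using morphism_chart[OF mor v0] by blast
      note F2' = is_chartD(1)[OF ch'] and h2' = is_chartD(2)[OF ch'] and h0' = is_chartD(5)[OF ch']
        and hF' = is_chartD(6)[OF ch']
      have "\<forall>i. \<exists>p. \<forall>r. poly p r = F' (t *s g, v + r *s w) $ i"
        using polys2_path[OF F2'] by blast
      from choice[OF this] obtain Q where Q: "\<And>i r. poly (Q i) r = F' (t *s g, v + r *s w) $ i" by blast
      obtain H' where H': "\<And>r. poly H' r = h' (t *s g, v + r *s w)" using polys2_path[OF h2'] by blast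
      have H0': "H' \<noteq> 0" using H'[of 0] h0' by auto
      have vr: "v + r *s w \<noteq> 0" for r using indep[of 1 r] by auto
      \<comment> \<open>The same lift in the coordinate \<open>r = 1 / s\<close>, in which the
        missing point \<open>b = 0\<close> becomes \<open>r = 0\<close>.\<close>
      define S where "S = (\<lambda>i. [:poly (p1 i) t, poly (p0 i) t:])"
      have eq: "S i * Q l = S l * Q i" for i l
      proof -
        have "poly ([:0, 1:] * H' * (S i * Q l)) r = poly ([:0, 1:] * H' * (S l * Q i)) r" for r
        proof (cases "r = 0 \<or> h' (t *s g, v + r *s w) = 0")
          case False
          then have r: "r \<noteq> 0" by simp
          have vw: "v + r *s w = r *s ((1 / r) *s v + w)" using r by (simp add: vector_add_ldistrib)
          have S: "(\<chi> i. poly (S i) r) = r *s (\<chi> i. ev2 (R i) t (1 / r))"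
            using r by (simp add: S_def ev vec_eq_iff field_simps)
          have "act (t *s g) (vec.span {v + r *s w}) = vec.span {\<chi> i. poly (S i) r}"
            "(\<chi> i. poly (S i) r) \<noteq> 0"
            unfolding vw S span_singleton_scale[OF r]
            using Rnz[of t "1 / r"] r vec.scale_eq_0_iff by blast+
          then have "vec.span {\<chi> i. poly (S i) r} = vec.span {F' (t *s g, v + r *s w)}"
            "(\<chi> i. poly (S i) r) \<noteq> 0" "F' (t *s g, v + r *s w) \<noteq> 0"
            using hF'[OF vr, of "t *s g" r] False by auto
          from span_singleton_minors[OF this, of i l] show ?thesis by (simp add: Q)
        qed (auto simp: H')
        then have "[:0, 1:] * H' * (S i * Q l) = [:0, 1:] * H' * (S l * Q i)"
          using poly_eq_poly_eq_iff by blast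
        then show ?thesis using H0' by simp
      qed
      have "vec.span {\<chi> i. poly (p1 i) t} = vec.span {F' (t *s g, v)}"
      proof -
        have "poly (p1 i) t * F' (t *s g, v) $ l = poly (p1 l) t * F' (t *s g, v) $ i" for i l
          using arg_cong[OF eq[of i l], of "\<lambda>p. poly p 0"] by (simp add: Q S_def)
        then show ?thesis
          using span_singleton_eq_minors[OF nz, of "F' (t *s g, v)"] hF'[OF v0 h0'] by simp
      qed
      then have "act (t *s g) (vec.span {v}) = vec.span {\<chi> i. poly (p1 i) t}"
        using hF'[OF v0 h0'] by simp
      then show ?thesis using u nz a True by (simp add: span_singleton_scale)
    qed
  qed
qed

section \<open>Polynomial functions of one variable\<close>

definition polyf :: "('a::comm_ring_1 \<Rightarrow> 'a) \<Rightarrow> bool" where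
  "polyf f \<longleftrightarrow> (\<exists>p. \<forall>t. poly p t = f t)"

lemma polyf_const: "polyf (\<lambda>t. c)"
  unfolding polyf_def by (rule exI[of _ "[:c:]"]) simp

lemma polyf_id: "polyf (\<lambda>t. t)"
  unfolding polyf_def by (rule exI[of _ "[:0, 1:]"]) simp

lemma polyf_poly: "polyf (\<lambda>t. poly p t)"
  unfolding polyf_def by blast

lemma polyf_add: "polyf f \<Longrightarrow> polyf g \<Longrightarrow> polyf (\<lambda>t. f t + g t)"
  unfolding polyf_def by (metis poly_add)

lemma polyf_mult: "polyf f \<Longrightarrow> polyf g \<Longrightarrow> polyf (\<lambda>t. f t * g t)"
  unfolding polyf_def by (metis poly_mult)

lemma polyf_diff: "polyf f \<Longrightarrow> polyf g \<Longrightarrow> polyf (\<lambda>t. f t - g t)"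
  unfolding polyf_def by (metis poly_diff)

lemma polyf_sum: "(\<And>i. i \<in> I \<Longrightarrow> polyf (f i)) \<Longrightarrow> polyf (\<lambda>t. \<Sum>i\<in>I. f i t)"
  by (induction I rule: infinite_finite_induct) (simp_all add: polyf_const polyf_add)

lemma polyf_prod: "(\<And>i. i \<in> I \<Longrightarrow> polyf (f i)) \<Longrightarrow> polyf (\<lambda>t. \<Prod>i\<in>I. f i t)"
  by (induction I rule: infinite_finite_induct) (simp_all add: polyf_const polyf_mult)

lemma polyf_power: "polyf f \<Longrightarrow> polyf (\<lambda>t. f t ^ n)"
  by (induction n) (simp_all add: polyf_const polyf_mult)

lemmas polyf_intros = polyf_add polyf_diff polyf_mult polyf_sum polyf_prod polyf_power polyf_poly
  polyf_id polyf_const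

lemma polyf_compose: "polyf f \<Longrightarrow> polyf g \<Longrightarrow> polyf (\<lambda>t. f (g t))"
  unfolding polyf_def by (metis poly_pcompose)

lemma polyf_affine: "polyf f \<Longrightarrow> polyf (\<lambda>t. f (a + b * t))"
  by (rule polyf_compose[of f "\<lambda>t. a + b * t"]) (assumption, intro polyf_intros)

lemma polyf_det:
  fixes P :: "'a::field \<Rightarrow> 'a ^ 'k ^ 'k"
  shows "(\<And>i j. polyf (\<lambda>t. P t $ i $ j)) \<Longrightarrow> polyf (\<lambda>t. det (P t))"
  unfolding det_def by (intro polyf_intros)

lemma polyf_matrix_mult:
  fixes P Q :: "'a::field \<Rightarrow> 'a ^ 'k ^ 'k"
  shows "(\<And>i j. polyf (\<lambda>t. P t $ i $ j)) \<Longrightarrow> (\<And>i j. polyf (\<lambda>t. Q t $ i $ j)) \<Longrightarrow>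
    polyf (\<lambda>t. (P t ** Q t) $ i $ j)"
  by (simp add: matrix_matrix_mult_def) (intro polyf_intros)

lemma polyf_eqI:
  fixes f g :: "'a::field_char_0 \<Rightarrow> 'a"
  assumes "polyf f" "polyf g" "infinite {t. f t = g t}"
  shows "f = g"
proof -
  obtain p where p: "\<And>t. poly p t = f t - g t" using polyf_diff[OF assms(1,2)] unfolding polyf_def by blast
  have "p = 0"
  proof (rule ccontr)
    assume "p \<noteq> 0"
    from poly_roots_finite[OF this] show False using assms(3) by (simp add: p)
  qed
  then show ?thesis using p by (metis ext poly_0 right_minus_eq)
qed

lemma polyf_eq_cofinite:
  fixes f g :: "'a::field_char_0 \<Rightarrow> 'a"
  assumes "polyf f" "polyf g" "finite S" "\<And>t. t \<notin> S \<Longrightarrow> f t = g t"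
  shows "f t = g t"
proof -
  have "- S \<subseteq> {t. f t = g t}" using assms(4) by auto
  moreover have "infinite (- S)"
    using assms(3) infinite_UNIV_char_0 by (metis Compl_UNIV_eq finite_compl)
  ultimately have "infinite {t. f t = g t}" using finite_subset by blast
  from polyf_eqI[OF assms(1,2) this] show ?thesis by simp
qed

section \<open>Maps of projective space that are linear on lines\<close>

definition indep2 :: "'a::field ^ 'k \<Rightarrow> 'a ^ 'k \<Rightarrow> bool" where
  "indep2 v w \<longleftrightarrow> (\<forall>a b. a *s v + b *s w = 0 \<longrightarrow> a = 0 \<and> b = 0)"

lemma indep2_nonzero:
  assumes "indep2 v w"
  shows "v \<noteq> 0 \<and> w \<noteq> 0"
  using assms[unfolded indep2_def, rule_format, of 1 0] assms[unfolded indep2_def, rule_format, of 0 1]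
  by auto

lemma indep2_iff_span:
  assumes "v \<noteq> 0" "w \<noteq> 0"
  shows "indep2 v w \<longleftrightarrow> vec.span {v} \<noteq> vec.span {w}"
proof
  assume i: "indep2 v w"
  show "vec.span {v} \<noteq> vec.span {w}"
  proof
    assume "vec.span {v} = vec.span {w}"
    then obtain c where "w = c *s v" using span_singleton_eq_iff[OF assms] by blast
    then have "c *s v + (-1) *s w = 0" by simp
    with i show False unfolding indep2_def by fastforce
  qed
next
  assume s: "vec.span {v} \<noteq> vec.span {w}"
  show "indep2 v w"
    unfolding indep2_def
  proof (intro allI impI)
    fix a b assume eq: "a *s v + b *s w = 0"
    show "a = 0 \<and> b = 0"
    proof (cases "b = 0")
      case True then show ?thesis using eq assms by auto
    next
      case False
      have "w = (- a / b) *s v"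
        using eq False by (auto simp: vec_eq_iff field_simps add_eq_0_iff2)
      moreover from this have "- a / b \<noteq> 0" using assms by auto
      ultimately have False using s span_singleton_eq_iff[OF assms] by blast
      then show ?thesis ..
    qed
  qed
qed

lemma indep2D: "indep2 v w \<Longrightarrow> a *s v + b *s w = c *s v + d *s w \<Longrightarrow> a = c \<and> b = d"
  unfolding indep2_def
  by (drule spec[of _ "a - c"], drule spec[of _ "b - d"]) (simp add: vector_sub_rdistrib algebra_simps)

lemma in_span_singleton_iff: "x \<in> vec.span {v} \<longleftrightarrow> (\<exists>c. x = c *s v)"
  by (auto simp: vec.span_singleton)

lemma span_singleton_eqD: "vec.span {v} = vec.span {w} \<Longrightarrow> \<exists>c. w = c *s v"
  by (metis in_span_singleton_iff singletonI vec.span_base)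

lemma solve3:
  fixes e v w :: "'a::field ^ 'k"
  assumes "x *s e + y *s v + z *s w = 0" "z \<noteq> 0"
  shows "w = (- x / z) *s e + (- y / z) *s v"
proof -
  have "w = (1 / z) *s (x *s e + y *s v + z *s w) + (- x / z) *s e + (- y / z) *s v"
    using assms(2) by (simp add: vec_eq_iff field_simps)
  then show ?thesis using assms(1) by simp
qed

text \<open>An injective self-map of projective space whose restriction to every line is projective-linear
  is projective-linear: fix \<open>e\<close> and \<open>f\<close> with \<open>T [e] = [f]\<close>, and send \<open>v\<close> to its image under the lift
  of the restriction of \<open>T\<close> to the line through \<open>[e]\<close> and \<open>[v]\<close> that maps \<open>e\<close> to \<open>f\<close>.\<close>

lemma collineation_linear:
  fixes T :: "('a::field ^ 'k) set \<Rightarrow> ('a ^ 'k) set"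
  assumes inj: "\<And>x y. x \<in> proj UNIV \<Longrightarrow> y \<in> proj UNIV \<Longrightarrow> T x = T y \<Longrightarrow> x = y"
    and proj: "\<And>x. x \<in> proj UNIV \<Longrightarrow> T x \<in> proj UNIV"
    and lin: "\<And>v w. indep2 v w \<Longrightarrow> \<exists>p q. \<forall>a b. a \<noteq> 0 \<or> b \<noteq> 0 \<longrightarrow>
        a *s p + b *s q \<noteq> 0 \<and> T (vec.span {a *s v + b *s w}) = vec.span {a *s p + b *s q}"
  obtains A where "\<And>v. v \<noteq> 0 \<Longrightarrow> A *v v \<noteq> 0 \<and> T (vec.span {v}) = vec.span {A *v v}"
proof -
  define e :: "'a ^ 'k" where "e = axis undefined 1"
  have e0: "e \<noteq> 0" by (auto simp: e_def axis_eq_0_iff)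
  obtain f where f: "f \<noteq> 0" "T (vec.span {e}) = vec.span {f}"
    using proj[OF span_singleton_in_proj[OF e0]] by (auto simp: proj_def)
  \<comment> \<open>Testing \<open>u\<close> on the whole span of \<open>e\<close> and
    \<open>v\<close>, and not only at \<open>v\<close>, removes the scalar ambiguity of a
    lift.\<close>
  define rel where "rel v u \<longleftrightarrow> (\<forall>a b. a *s e + b *s v \<noteq> 0 \<longrightarrow>
    a *s f + b *s u \<noteq> 0 \<and> T (vec.span {a *s e + b *s v}) = vec.span {a *s f + b *s u})" for v u
  have relD: "a *s f + b *s u \<noteq> 0" "T (vec.span {a *s e + b *s v}) = vec.span {a *s f + b *s u}"
    if "rel v u" "a *s e + b *s v \<noteq> 0" for v u a b using that unfolding rel_def by blast+
  have inj': "vec.span {v} = vec.span {w}" if "v \<noteq> 0" "w \<noteq> 0" "T (vec.span {v}) = T (vec.span {w})" for v w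
    by (rule inj) (use that span_singleton_in_proj in auto)
  have ind: "indep2 v' w'" if "indep2 v w" "v' \<noteq> 0" "w' \<noteq> 0" "T (vec.span {v}) = vec.span {v'}"
    "T (vec.span {w}) = vec.span {w'}" for v w v' w'
  proof -
    have nz: "v \<noteq> 0" "w \<noteq> 0" using indep2_nonzero[OF that(1)] by auto
    have "vec.span {v'} \<noteq> vec.span {w'}"
    proof
      assume "vec.span {v'} = vec.span {w'}"
      then have "T (vec.span {v}) = T (vec.span {w})" using that(4,5) by simp
      from inj'[OF nz this] show False using that(1) indep2_iff_span[OF nz] by simp
    qed
    then show ?thesis using indep2_iff_span[OF that(2,3)] by simp
  qed
  have spane: "v = 0 \<or> indep2 e v \<or> (\<exists>c. c \<noteq> 0 \<and> v = c *s e)" for v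
    using indep2_iff_span[OF e0, of v] span_singleton_eq_iff[OF e0, of v] by auto
  have ex: "\<exists>u. rel v u" for v
  proof -
    have "rel (c *s e) (c *s f)" for c
      unfolding rel_def
    proof (intro allI impI)
      fix a b assume nz: "a *s e + b *s (c *s e) \<noteq> 0"
      have eqs: "a *s e + b *s (c *s e) = (a + b * c) *s e" "a *s f + b *s (c *s f) = (a + b * c) *s f"
        by (simp_all add: vec_eq_iff algebra_simps)
      have "a + b * c \<noteq> 0" using nz unfolding eqs vec.scale_eq_0_iff by simp
      then show "a *s f + b *s (c *s f) \<noteq> 0 \<and> T (vec.span {a *s e + b *s (c *s e)}) = vec.span {a *s f + b *s (c *s f)}"
        unfolding eqs span_singleton_scale[OF \<open>a + b * c \<noteq> 0\<close>] vec.scale_eq_0_iff using f by simp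
    qed
    moreover have "\<exists>c. v = c *s e" if "\<not> indep2 e v"
      using spane[of v] that by (metis vec.scale_zero_left)
    ultimately have "\<exists>u. rel v u" if "\<not> indep2 e v" using that by blast
    moreover have "\<exists>u. rel v u" if "indep2 e v"
    proof -
      from lin[OF that] obtain p q where pq0: "\<forall>a b. a \<noteq> 0 \<or> b \<noteq> 0 \<longrightarrow>
        a *s p + b *s q \<noteq> 0 \<and> T (vec.span {a *s e + b *s v}) = vec.span {a *s p + b *s q}"
        by (elim exE)
      note pq = pq0[rule_format]
      have "p \<noteq> 0" "vec.span {f} = vec.span {p}" using pq[of 1 0] f by auto
      then obtain m where m: "m \<noteq> 0" "p = m *s f" using span_singleton_eq_iff[OF f(1)] by blast
      have "rel v ((1 / m) *s q)"
        unfolding rel_def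
      proof (intro allI impI)
        fix a b assume "a *s e + b *s v \<noteq> 0"
        then have ab: "a \<noteq> 0 \<or> b \<noteq> 0" by auto
        have eq: "a *s p + b *s q = m *s (a *s f + b *s ((1 / m) *s q))"
          using m by (simp add: vec_eq_iff algebra_simps)
        show "a *s f + b *s ((1 / m) *s q) \<noteq> 0 \<and>
            T (vec.span {a *s e + b *s v}) = vec.span {a *s f + b *s ((1 / m) *s q)}"
          using pq[OF ab] unfolding eq span_singleton_scale[OF m(1)] vec.scale_eq_0_iff by simp
      qed
      then show ?thesis ..
    qed
    ultimately show ?thesis by blast
  qed
  \<comment> \<open>For \<open>v\<close> off the line of \<open>e\<close>, two lifts differ by a
    factor, and the point \<open>e + v\<close> forces this factor to be one.\<close>
  have uniq: "u = u'" if r: "rel v u" and r': "rel v u'" for v u u'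
  proof (cases "indep2 e v")
    case True
    have nz: "v \<noteq> 0" "e + v \<noteq> 0" using indep2_nonzero[OF True] True[unfolded indep2_def, rule_format, of 1 1] by auto
    have u: "u \<noteq> 0" "u' \<noteq> 0" "vec.span {u} = vec.span {u'}"
      and fu: "f + u \<noteq> 0" "f + u' \<noteq> 0" "vec.span {f + u} = vec.span {f + u'}"
      using relD[OF r, of 0 1] relD[OF r', of 0 1] relD[OF r, of 1 1] relD[OF r', of 1 1] nz by auto
    have i: "indep2 f u" using ind[OF True f(1) u(1) f(2)] relD[OF r, of 0 1] nz by simp
    obtain k where k: "u' = k *s u" using span_singleton_eq_iff[OF u(1,2)] u(3) by blast
    obtain m where m: "f + u' = m *s (f + u)" using span_singleton_eq_iff[OF fu(1,2)] fu(3) by blast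
    have "1 *s f + k *s u = m *s f + m *s u" using m unfolding k by (simp add: vector_add_ldistrib)
    from indep2D[OF i this] have "k = 1" by simp
    then show ?thesis using k by simp
  next
    case False
    then obtain c where c: "v = c *s e" using spane[of v] by (metis vec.scale_zero_left)
    have "u = c *s f" if r: "rel v u" for u
    proof -
      have *: "a *s f + b *s u \<noteq> 0 \<and> vec.span {f} = vec.span {a *s f + b *s u}" if "a + b * c \<noteq> 0" for a b
      proof -
        have eq: "a *s e + b *s v = (a + b * c) *s e" by (simp add: c vec_eq_iff algebra_simps)
        have "a *s e + b *s v \<noteq> 0" unfolding eq using that e0 vec.scale_eq_0_iff by blast
        from relD[OF r this] show ?thesis unfolding eq span_singleton_scale[OF that] f(2) by blast
      qed
      have "(1 - c) + 1 * c \<noteq> 0" by simp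
      from *[OF this] obtain k where "(1 - c) *s f + 1 *s u = k *s f"
        using span_singleton_eq_iff[OF f(1), of "(1 - c) *s f + 1 *s u"] by blast
      then have "u = k *s f - (1 - c) *s f" by (metis add_diff_cancel_left' vector_smult_lid)
      also have "\<dots> = (k - 1 + c) *s f" by (simp add: vec_eq_iff algebra_simps)
      finally have u: "u = (k - 1 + c) *s f" .
      have "k - 1 + c = c"
      proof (rule ccontr)
        assume "k - 1 + c \<noteq> c"
        then have "- (k - 1 + c) + 1 * c \<noteq> 0" by (simp add: algebra_simps)
        from *[OF this] show False unfolding u by (simp add: vec_eq_iff algebra_simps)
      qed
      then show ?thesis using u by simp
    qed
    then show ?thesis using r r' by blast
  qed
  have scale: "rel (c *s v) (c *s u)" if r: "rel v u" for v u c
    unfolding rel_def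
  proof (intro allI impI)
    fix a b assume "a *s e + b *s (c *s v) \<noteq> 0"
    then show "a *s f + b *s (c *s u) \<noteq> 0 \<and> T (vec.span {a *s e + b *s (c *s v)}) = vec.span {a *s f + b *s (c *s u)}"
      using relD[OF r, of a "b * c"] by simp
  qed
  \<comment> \<open>Inside the span of \<open>e\<close> and \<open>v\<close>, additivity is just
    linearity of the lift on a single line.\<close>
  have dep_add: "rel (v + w) (u + u')" if r: "rel v u" "rel w u'" and w: "w = x *s e + y *s v" for v u w u' x y
  proof -
    have "rel w (x *s f + y *s u)"
      unfolding rel_def
    proof (intro allI impI)
      fix a b assume nz: "a *s e + b *s w \<noteq> 0"
      have eq: "a *s e + b *s w = (a + b * x) *s e + (b * y) *s v"
        "a *s f + b *s (x *s f + y *s u) = (a + b * x) *s f + (b * y) *s u"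
        by (simp_all add: w vec_eq_iff algebra_simps)
      show "a *s f + b *s (x *s f + y *s u) \<noteq> 0 \<and>
          T (vec.span {a *s e + b *s w}) = vec.span {a *s f + b *s (x *s f + y *s u)}"
        using relD[OF r(1) nz[unfolded eq]] unfolding eq by blast
    qed
    then have u': "u' = x *s f + y *s u" using uniq r(2) by blast
    show ?thesis
      unfolding rel_def
    proof (intro allI impI)
      fix a b assume nz: "a *s e + b *s (v + w) \<noteq> 0"
      have eq: "a *s e + b *s (v + w) = (a + b * x) *s e + (b * (1 + y)) *s v"
        "a *s f + b *s (u + u') = (a + b * x) *s f + (b * (1 + y)) *s u"
        by (simp_all add: w u' vec_eq_iff algebra_simps)
      show "a *s f + b *s (u + u') \<noteq> 0 \<and>
          T (vec.span {a *s e + b *s (v + w)}) = vec.span {a *s f + b *s (u + u')}"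
        using relD[OF r(1) nz[unfolded eq]] unfolding eq by blast
    qed
  qed
  have add: "rel (v + w) (u + u')" if r: "rel v u" and r': "rel w u'" for v w u u'
  proof (cases "\<exists>x y z. (x \<noteq> 0 \<or> y \<noteq> 0 \<or> z \<noteq> 0) \<and> x *s e + y *s v + z *s w = 0")
    case True
    then obtain x y z where xyz: "x \<noteq> 0 \<or> y \<noteq> 0 \<or> z \<noteq> 0" "x *s e + y *s v + z *s w = 0" by blast
    consider "z \<noteq> 0" | "y \<noteq> 0" | "y = 0" "z = 0" by blast
    then show ?thesis
    proof cases
      case 1
      have "w = (- x / z) *s e + (- y / z) *s v"
        using solve3[OF xyz(2) 1] .
      from dep_add[OF r r' this] show ?thesis .
    next
      case 2
      have "v = (- x / y) *s e + (- z / y) *s w"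
        using solve3[of x e z w y v] xyz(2) 2 by (simp add: algebra_simps)
      from dep_add[OF r' r this] show ?thesis by (simp add: add.commute)
    next
      case 3
      then show ?thesis using xyz e0 by auto
    qed
  next
    case False
    then have ind3: "x = 0 \<and> y = 0 \<and> z = 0" if "x *s e + y *s v + z *s w = 0" for x y z
      using that by blast
    have ev: "indep2 e v" and vw: "indep2 v w" and evw: "indep2 (e + v) w" and ewv: "indep2 (e + w) v"
      unfolding indep2_def
    proof safe
      fix a b
      show "a = 0" "b = 0" if "a *s e + b *s v = 0" using ind3[of a b 0] that by auto
      show "a = 0" "b = 0" if "a *s v + b *s w = 0" using ind3[of 0 a b] that by auto
      show "a = 0" "b = 0" if "a *s (e + v) + b *s w = 0"
        using ind3[of a a b] that by (auto simp: vector_add_ldistrib)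
      show "a = 0" "b = 0" if "a *s (e + w) + b *s v = 0"
        using ind3[of a b a] that by (auto simp: vector_add_ldistrib algebra_simps)
    qed
    obtain u'' where r'': "rel (v + w) u''" using ex by blast
    have nz: "v \<noteq> 0" "w \<noteq> 0" "v + w \<noteq> 0" "e + v \<noteq> 0" "e + w \<noteq> 0" "e + (v + w) \<noteq> 0"
      using indep2_nonzero[OF vw] indep2_nonzero[OF evw] indep2_nonzero[OF ewv]
        ind3[of 0 1 1] ind3[of 1 1 1] by (auto simp: add.assoc)
    have on_line: "\<exists>\<alpha> \<beta>. u'' = \<alpha> *s p + \<beta> *s q"
      if "indep2 v w" "T (vec.span {v + w}) = vec.span {u''}" "u'' \<noteq> 0" "p \<noteq> 0" "q \<noteq> 0"
        "T (vec.span {v}) = vec.span {p}" "T (vec.span {w}) = vec.span {q}" for v w p q u''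
    proof -
      from lin[OF that(1)] obtain p' q' where pq0: "\<forall>a b. a \<noteq> 0 \<or> b \<noteq> 0 \<longrightarrow>
        a *s p' + b *s q' \<noteq> 0 \<and> T (vec.span {a *s v + b *s w}) = vec.span {a *s p' + b *s q'}"
        by (elim exE)
      note pq = pq0[rule_format]
      have "p' \<noteq> 0" "vec.span {p} = vec.span {p'}" "q' \<noteq> 0" "vec.span {q} = vec.span {q'}"
        "p' + q' \<noteq> 0" "vec.span {p' + q'} = vec.span {u''}"
        using pq[of 1 0] pq[of 0 1] pq[of 1 1] that by auto
      note * = this
      obtain a where a: "p' = a *s p" using span_singleton_eqD[OF *(2)] by blast
      obtain b where b: "q' = b *s q" using span_singleton_eqD[OF *(4)] by blast
      obtain c where c: "u'' = c *s (p' + q')" using span_singleton_eqD[OF *(6)] by blast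
      from a b c have "u'' = (c * a) *s p + (c * b) *s q" by (simp add: vector_add_ldistrib)
      then show ?thesis by blast
    qed
    have Tv: "u \<noteq> 0" "T (vec.span {v}) = vec.span {u}" and Tev: "f + u \<noteq> 0" "T (vec.span {e + v}) = vec.span {f + u}"
      using relD[OF r, of 0 1] relD[OF r, of 1 1] nz by auto
    have Tw: "u' \<noteq> 0" "T (vec.span {w}) = vec.span {u'}" and Tew: "f + u' \<noteq> 0" "T (vec.span {e + w}) = vec.span {f + u'}"
      using relD[OF r', of 0 1] relD[OF r', of 1 1] nz by auto
    have T2: "u'' \<noteq> 0" "T (vec.span {v + w}) = vec.span {u''}"
      and T3: "f + u'' \<noteq> 0" "T (vec.span {e + (v + w)}) = vec.span {f + u''}"
      using relD[OF r'', of 0 1] relD[OF r'', of 1 1] nz by auto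
    have fu: "indep2 f u" using ind[OF ev f(1) Tv(1) f(2) Tv(2)] .
    \<comment> \<open>A relation between the images would put \<open>w\<close> into the span of
      \<open>e\<close> and \<open>v\<close>, by injectivity of \<open>T\<close>.\<close>
    have f_ind3: "x = 0 \<and> y = 0 \<and> z = 0" if eq: "x *s f + y *s u + z *s u' = 0" for x y z
    proof -
      have z: "z = 0"
      proof (rule ccontr)
        assume z: "z \<noteq> 0"
        have u': "u' = (- x / z) *s f + (- y / z) *s u"
          using solve3[OF eq z] .
        define s where "s = (- x / z) *s e + (- y / z) *s v"
        have s0: "s \<noteq> 0"
        proof
          assume "s = 0"
          then have 0: "- x / z = 0 \<and> - y / z = 0"
            using ev[unfolded indep2_def, rule_format, of "- x / z" "- y / z"] unfolding s_def by blast
          show False using Tw(1) u' unfolding 0[THEN conjunct1] 0[THEN conjunct2] by simp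
        qed
        have "T (vec.span {s}) = vec.span {u'}"
          using relD(2)[OF r s0[unfolded s_def]] unfolding s_def u' .
        from inj'[OF s0 nz(2) trans[OF this Tw(2)[symmetric]]]
        obtain c where c: "w = c *s s" using span_singleton_eqD by blast
        have "(c * (- x / z)) *s e + (c * (- y / z)) *s v + (-1) *s w = c *s s - w"
          by (simp add: s_def vec_eq_iff algebra_simps)
        also have "\<dots> = 0" unfolding c by simp
        finally have "(c * (- x / z)) *s e + (c * (- y / z)) *s v + (-1) *s w = 0" .
        from ind3[OF this] show False by simp
      qed
      then have "x *s f + y *s u = 0" using eq by simp
      then have "x = 0 \<and> y = 0" using fu unfolding indep2_def by blast
      with z show ?thesis by simp
    qed
    \<comment> \<open>\<open>e + (v + w)\<close> lies on the line through \<open>e + v\<close> and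
      \<open>w\<close> and also on the line through \<open>e + w\<close> and \<open>v\<close>.
      Comparing the two resulting expressions for its lift with that for \<open>v + w\<close> forces
      \<open>a = 1\<close> and \<open>b = 1\<close>.\<close>
    obtain a b where ab: "u'' = a *s u + b *s u'"
      using on_line[OF vw T2(2,1) Tv(1) Tw(1) Tv(2) Tw(2)] by blast
    obtain c d where cd: "f + u'' = c *s (f + u) + d *s u'"
      using on_line[OF evw _ T3(1) Tev(1) Tw(1) Tev(2) Tw(2)] T3(2) unfolding add.assoc by blast
    obtain c' d' where cd': "f + u'' = c' *s (f + u') + d' *s u"
    proof -
      have "T (vec.span {(e + w) + v}) = vec.span {f + u''}" using T3(2) by (simp only: ac_simps)
      from on_line[OF ewv this T3(1) Tew(1) Tv(1) Tew(2) Tv(2)] show ?thesis using that by blast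
    qed
    have "(1 - c) *s f + (a - c) *s u + (b - d) *s u' = f + u'' - (c *s (f + u) + d *s u')"
      unfolding ab by (simp add: vec_eq_iff algebra_simps)
    also have "\<dots> = 0" unfolding cd by simp
    finally have "(1 - c) *s f + (a - c) *s u + (b - d) *s u' = 0" .
    from f_ind3[OF this] have "a = 1" by auto
    have "(1 - c') *s f + (a - d') *s u + (b - c') *s u' = f + u'' - (c' *s (f + u') + d' *s u)"
      unfolding ab by (simp add: vec_eq_iff algebra_simps)
    also have "\<dots> = 0" unfolding cd' by simp
    finally have "(1 - c') *s f + (a - d') *s u + (b - c') *s u' = 0" .
    from f_ind3[OF this] have "b = 1" by auto
    have "u'' = u + u'" unfolding ab \<open>a = 1\<close> \<open>b = 1\<close> by simp
    then show ?thesis using r'' by (rule subst)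
  qed
  have "\<forall>i. \<exists>u. rel (axis i 1) u" using ex by blast
  from choice[OF this] obtain B where B: "\<And>i. rel (axis i 1) (B i)" by blast
  define A where "A = (\<chi> j i. B i $ j)"
  have Ab: "A *v v = (\<Sum>i\<in>UNIV. v $ i *s B i)" for v
    by (simp add: A_def matrix_vector_mult_def vec_eq_iff mult.commute)
  have rel0: "rel 0 0"
    using scale[OF B[of undefined], of 0] unfolding vec.scale_zero_left .
  have "rel (\<Sum>i\<in>S. v $ i *s axis i 1) (\<Sum>i\<in>S. v $ i *s B i)" for v and S :: "'k set"
  proof (induction S rule: infinite_finite_induct)
    case (insert i S)
    show ?case
      unfolding sum.insert[OF insert(1,2)] by (rule add[OF scale[OF B] insert(3)])
  qed (simp_all add: rel0)
  from this[where S = UNIV] have relA: "rel v (A *v v)" for v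
    by (simp only: Ab basis_expansion)
  show thesis
  proof (rule that)
    fix v :: "'a ^ 'k" assume "v \<noteq> 0"
    then show "A *v v \<noteq> 0 \<and> T (vec.span {v}) = vec.span {A *v v}"
      using relD[OF relA, of 0 1 v] by simp
  qed
qed

section \<open>Matrices up to scalars and lifts of one-parameter groups\<close>

definition smat :: "'a::field \<Rightarrow> 'a ^ 'k ^ 'k \<Rightarrow> 'a ^ 'k ^ 'k" where
  "smat c A = (\<chi> i. c *s (A $ i))"

lemma smat_nth [simp]: "smat c A $ i $ j = c * A $ i $ j"
  by (simp add: smat_def)

lemma smat_mult_vec: "smat c A *v v = c *s (A *v v)"
  by (simp add: vec_eq_iff matrix_vector_mult_def sum_distrib_left algebra_simps)

lemma smat_one [simp]: "smat 1 A = A" and smat_0 [simp]: "smat 0 A = 0"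
  by (simp_all add: vec_eq_iff)

lemma smat_smat: "smat c (smat d A) = smat (c * d) A"
  by (simp add: vec_eq_iff algebra_simps)

lemma smat_mult: "smat c A ** smat d B = smat (c * d) (A ** B)"
  by (simp add: vec_eq_iff matrix_matrix_mult_def sum_distrib_left algebra_simps)

lemma det_smat: "det (smat c A) = c ^ CARD('k) * det (A :: 'a::field ^ 'k ^ 'k)"
proof -
  have "det (smat c A) = det (\<chi> i. (\<lambda>_. c) i *s (($) A) i)" by (simp add: smat_def)
  also have "\<dots> = c ^ CARD('k) * det A" unfolding det_rows_mul by simp
  finally show ?thesis .
qed

lemma matrix_columns: "A *v axis j 1 = (\<chi> i. A $ i $ j)"
  by (simp add: vec_eq_iff matrix_vector_mult_def axis_def if_distrib cong: if_cong)

lemma matrix_minors_smat: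
  fixes A B :: "'a::field ^ 'k ^ 'k"
  assumes "\<And>i j k l. A $ i $ j * B $ k $ l = A $ k $ l * B $ i $ j" "B \<noteq> 0"
  shows "\<exists>c. A = smat c B"
proof -
  obtain k l where kl: "B $ k $ l \<noteq> 0" using assms(2) by (auto simp: vec_eq_iff)
  have "A = smat (A $ k $ l / B $ k $ l) B"
    using assms(1)[of _ _ k l] kl by (simp add: vec_eq_iff field_simps)
  then show ?thesis ..
qed

text \<open>Such a matrix is unique only up to a non-zero factor; the lemmas below remove this
  ambiguity along one-parameter groups.\<close>

definition rep :: "('a::field ^ 'n \<Rightarrow> ('a ^ 'k) set \<Rightarrow> ('a ^ 'k) set) \<Rightarrow> 'a ^ 'k ^ 'k \<Rightarrow> 'a ^ 'n \<Rightarrow> bool" where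
  "rep act A g \<longleftrightarrow> (\<forall>v. v \<noteq> 0 \<longrightarrow> A *v v \<noteq> 0 \<and> act g (vec.span {v}) = vec.span {A *v v})"

lemma repD:
  assumes "rep act A g" "v \<noteq> 0"
  shows "A *v v \<noteq> 0" "act g (vec.span {v}) = vec.span {A *v v}"
  using assms by (auto simp: rep_def)

lemma rep_det:
  assumes "rep act A g"
  shows "det A \<noteq> 0"
proof -
  have "inj ((*v) A)"
    using repD(1)[OF assms] by (auto simp: vec.inj_iff_eq_0)
  then show ?thesis using det_nz_iff_inj_gen[OF matrix_vector_mul_linear_gen[of A]] by simp
qed

lemma rep_mult:
  fixes A B :: "'a::field ^ 'k ^ 'k"
  assumes "is_action UNIV UNIV act" "rep act A g" "rep act B h"
  shows "rep act (A ** B) (g + h)"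
  unfolding rep_def
proof (intro allI impI)
  fix v :: "'a ^ 'k" assume v: "v \<noteq> 0"
  note B = repD[OF assms(3) v] and AB = repD[OF assms(2) repD(1)[OF assms(3) v]]
  have "act (g + h) (vec.span {v}) = act g (act h (vec.span {v}))"
    using assms(1) span_singleton_in_proj[OF v] by (auto simp: is_action_def)
  then show "A ** B *v v \<noteq> 0 \<and> act (g + h) (vec.span {v}) = vec.span {A ** B *v v}"
    using B AB by (simp add: matrix_vector_mul_assoc)
qed

lemma rep_smat: "rep act A g \<Longrightarrow> c \<noteq> 0 \<Longrightarrow> rep act (smat c A) g"
  unfolding rep_def smat_mult_vec vec.scale_eq_0_iff by (simp add: span_singleton_scale)

lemma rep_one: "is_action UNIV UNIV act \<Longrightarrow> rep act (mat 1) 0"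
  by (auto simp: rep_def is_action_def span_singleton_in_proj)

text \<open>Each basis vector comes with its own factor; comparing on
  \<open>axis i 1 + axis j 1\<close> makes the factors equal.\<close>

lemma rep_unique:
  fixes A A' :: "'a::field ^ 'k ^ 'k"
  assumes A: "rep act A g" and A': "rep act A' g"
  shows "\<exists>c. c \<noteq> 0 \<and> A' = smat c A"
proof -
  have ax: "axis i 1 \<noteq> (0 :: 'a ^ 'k)" for i by (simp add: axis_eq_0_iff)
  have ex: "\<exists>c. c \<noteq> 0 \<and> A' *v v = c *s (A *v v)" if "v \<noteq> 0" for v
    using span_singleton_eq_iff[OF repD(1)[OF A that] repD(1)[OF A' that]]
      repD(2)[OF A that] repD(2)[OF A' that] by simp
  have "\<forall>i. \<exists>c. c \<noteq> 0 \<and> A' *v axis i 1 = c *s (A *v axis i 1)" using ex[OF ax] by blast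
  from choice[OF this] obtain c where c: "\<And>i. c i \<noteq> 0" "\<And>i. A' *v axis i 1 = c i *s (A *v axis i 1)"
    by blast
  have const: "c i = c j" for i j
  proof (cases "i = j")
    case False
    have ij: "a = 0 \<and> b = 0" if "a *s axis i 1 + b *s axis j 1 = (0 :: 'a ^ 'k)" for a b
      using that False by (auto simp: vec_eq_iff axis_def split: if_splits dest: spec[of _ i] spec[of _ j])
    have "axis i 1 + axis j 1 \<noteq> (0 :: 'a ^ 'k)" using ij[of 1 1] by auto
    from ex[OF this] obtain d where "A' *v (axis i 1 + axis j 1) = d *s (A *v (axis i 1 + axis j 1))" by blast
    then have "A *v ((c i - d) *s axis i 1 + (c j - d) *s axis j 1) = 0"
      by (simp add: vec.add vec.scale c(2) vector_add_ldistrib vector_sub_rdistrib algebra_simps)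
    then have "(c i - d) *s axis i 1 + (c j - d) *s axis j 1 = 0" using repD(1)[OF A] by blast
    from ij[OF this] show ?thesis by simp
  qed simp
  have "A' = smat (c undefined) A"
    using c(2) const[of _ undefined] by (auto simp: vec_eq_iff matrix_columns)
  then show ?thesis using c(1) by blast
qed

lemma action_on_line':
  fixes act :: "'a::{alg_closed_field, field_char_0} ^ 'n \<Rightarrow> ('a ^ 'k) set \<Rightarrow> ('a ^ 'k) set"
  assumes act: "is_action UNIV UNIV act" and mor: "is_morphism UNIV UNIV act" and i: "indep2 v w"
  shows "\<exists>P Q. (\<forall>j. polyf (\<lambda>t. P t $ j) \<and> polyf (\<lambda>t. Q t $ j)) \<and>
    (\<forall>t a b. a \<noteq> 0 \<or> b \<noteq> 0 \<longrightarrow> a *s P t + b *s Q t \<noteq> 0 \<and>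
      act (t *s g) (vec.span {a *s v + b *s w}) = vec.span {a *s P t + b *s Q t})"
proof (rule action_on_line[OF act mor i[unfolded indep2_def, rule_format], where g = g])
  fix p1 p0 :: "'k \<Rightarrow> 'a poly"
  assume p: "\<And>t a b. a \<noteq> 0 \<or> b \<noteq> 0 \<Longrightarrow>
       (\<chi> i. a * poly (p1 i) t + b * poly (p0 i) t) \<noteq> 0 \<and>
       act (t *s g) (vec.span {a *s v + b *s w}) = vec.span {\<chi> i. a * poly (p1 i) t + b * poly (p0 i) t}"
  have eq: "a *s (\<chi> i. poly (p1 i) t) + b *s (\<chi> i. poly (p0 i) t) =
      (\<chi> i. a * poly (p1 i) t + b * poly (p0 i) t)" for a b t
    by (simp add: vec_eq_iff)
  show ?thesis
    by (rule exI[of _ "\<lambda>t. \<chi> i. poly (p1 i) t"], rule exI[of _ "\<lambda>t. \<chi> i. poly (p0 i) t"])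
      (unfold eq, use p in \<open>simp add: polyf_poly\<close>)
qed

lemma rep_exists:
  fixes act :: "'a::{alg_closed_field, field_char_0} ^ 'n \<Rightarrow> ('a ^ 'k) set \<Rightarrow> ('a ^ 'k) set"
  assumes act: "is_action UNIV UNIV act" and mor: "is_morphism UNIV UNIV act"
  shows "\<exists>A. rep act A g"
proof -
  obtain A where "\<And>v. v \<noteq> 0 \<Longrightarrow> A *v v \<noteq> 0 \<and> act g (vec.span {v}) = vec.span {A *v v}"
  proof (rule collineation_linear[of "act g"])
    show "x = y" if "x \<in> proj UNIV" "y \<in> proj UNIV" "act g x = act g y" for x y
      using is_action_inj[OF act that] .
    show "act g x \<in> proj UNIV" if "x \<in> proj UNIV" for x
      using act that by (simp add: is_action_def)
    show "\<exists>p q. \<forall>a b. a \<noteq> 0 \<or> b \<noteq> 0 \<longrightarrow>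
        a *s p + b *s q \<noteq> 0 \<and> act g (vec.span {a *s v + b *s w}) = vec.span {a *s p + b *s q}"
      if i: "indep2 v w" for v w
    proof -
      from action_on_line'[OF act mor i, of g]
      obtain P Q where "\<forall>t a b. a \<noteq> 0 \<or> b \<noteq> 0 \<longrightarrow> a *s P t + b *s Q t \<noteq> 0 \<and>
        act (t *s g) (vec.span {a *s v + b *s w}) = vec.span {a *s P t + b *s Q t}"
        by (elim exE conjE)
      from this[THEN spec, of 1] show ?thesis unfolding vector_smult_lid
        by (intro exI[of _ "P 1"] exI[of _ "Q 1"])
    qed
  qed blast
  then show ?thesis unfolding rep_def by blast
qed

definition polyf_mat :: "('a::comm_ring_1 \<Rightarrow> 'a ^ 'k ^ 'k) \<Rightarrow> bool" where
  "polyf_mat B \<longleftrightarrow> (\<forall>i j. polyf (\<lambda>t. B t $ i $ j))"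

text \<open>The determinants leave only finitely many possible factors, namely roots of unity. One
  of them therefore occurs for infinitely many \<open>t\<close>, hence for all \<open>t\<close>, and
  it is one because of the value at \<open>0\<close>.\<close>

lemma polyf_mat_uniq:
  fixes P Q :: "'a::field_char_0 \<Rightarrow> 'a ^ 'k ^ 'k"
  assumes P: "polyf_mat P" and Q: "polyf_mat Q"
    and det: "\<And>t. det (P t) = 1" "\<And>t. det (Q t) = 1"
    and scal: "\<And>t. \<exists>c. P t = smat c (Q t)" and init: "P 0 = Q 0"
  shows "P = Q"
proof -
  define R where "R = {c :: 'a. c ^ CARD('k) = 1}"
  have "R \<subseteq> {c. poly (monom 1 CARD('k) - 1) c = 0}" by (auto simp: R_def poly_monom)
  moreover have "monom 1 CARD('k) - 1 \<noteq> (0 :: 'a poly)"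
  proof
    assume "monom 1 CARD('k) - 1 = (0 :: 'a poly)"
    then have "poly (monom 1 CARD('k) - 1) (0 :: 'a) = 0" by simp
    then show False by (simp add: poly_monom power_0_left)
  qed
  ultimately have "finite R" using poly_roots_finite finite_subset by blast
  have "(\<Union>c\<in>R. {t. P t = smat c (Q t)}) = UNIV"
  proof (intro equalityI subsetI)
    fix t
    obtain c where c: "P t = smat c (Q t)" using scal by blast
    then have "c ^ CARD('k) = 1" using det[of t] by (simp add: det_smat)
    with c show "t \<in> (\<Union>c\<in>R. {t. P t = smat c (Q t)})" by (auto simp: R_def)
  qed simp
  then have "infinite (\<Union>c\<in>R. {t. P t = smat c (Q t)})" using infinite_UNIV_char_0 by simp
  then obtain c where c: "infinite {t. P t = smat c (Q t)}" using \<open>finite R\<close> by blast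
  have eq: "P t = smat c (Q t)" for t
  proof -
    have "(\<lambda>t. P t $ i $ j) = (\<lambda>t. c * Q t $ i $ j)" for i j
    proof (rule polyf_eqI)
      show "polyf (\<lambda>t. P t $ i $ j)" using P by (simp add: polyf_mat_def)
      show "polyf (\<lambda>t. c * Q t $ i $ j)"
        using Q unfolding polyf_mat_def by (intro polyf_intros) blast
      show "infinite {t. P t $ i $ j = c * Q t $ i $ j}"
        by (rule infinite_super[OF _ c]) auto
    qed
    then show ?thesis by (simp add: vec_eq_iff fun_eq_iff)
  qed
  have "P 0 \<noteq> 0" using det(1)[of 0] det_0[where 'n = 'k and 'a = 'a] by (auto simp: mat_0)
  then obtain i j where "P 0 $ i $ j \<noteq> 0" by (auto simp: vec_eq_iff)
  moreover have "P 0 $ i $ j = c * P 0 $ i $ j" using eq[of 0] init smat_nth by metis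
  ultimately have "c = 1" by simp
  with eq show ?thesis by (auto simp: fun_eq_iff)
qed

text \<open>On the line through two coordinate points a polynomial lift exists. It yields two
  columns of \<open>A t\<close> with one common factor \<open>m\<close>, which is what allows
  columns to be glued.\<close>

lemma axis_polynomial_lift:
  fixes act :: "'a::{alg_closed_field, field_char_0} ^ 'n \<Rightarrow> ('a ^ 'k) set \<Rightarrow> ('a ^ 'k) set"
  assumes act: "is_action UNIV UNIV act" and mor: "is_morphism UNIV UNIV act"
    and A: "\<And>t. rep act (A t) (t *s g)" and "i \<noteq> i0"
  shows "\<exists>P Q. (\<forall>j. polyf (\<lambda>t. P t $ j) \<and> polyf (\<lambda>t. Q t $ j)) \<and>
    (\<forall>t. \<exists>m. m \<noteq> 0 \<and> P t = m *s (A t *v axis i0 1) \<and> Q t = m *s (A t *v axis i 1))"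
proof -
  let ?v = "axis i0 1 :: 'a ^ 'k" and ?w = "axis i 1 :: 'a ^ 'k"
  have ind: "a = 0 \<and> b = 0" if "a *s ?v + b *s ?w = 0" for a b
    using that \<open>i \<noteq> i0\<close> by (auto simp: vec_eq_iff axis_def split: if_splits dest: spec[of _ i] spec[of _ i0])
  from ind have "indep2 ?v ?w" unfolding indep2_def by blast
  from action_on_line'[OF act mor this, of g]
  obtain P Q where polyf: "\<forall>j. polyf (\<lambda>t. P t $ j) \<and> polyf (\<lambda>t. Q t $ j)"
    and PQ0: "\<forall>t a b. a \<noteq> 0 \<or> b \<noteq> 0 \<longrightarrow> a *s P t + b *s Q t \<noteq> 0 \<and>
      act (t *s g) (vec.span {a *s ?v + b *s ?w}) = vec.span {a *s P t + b *s Q t}"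
    by (elim exE conjE)
  have PQ: "a *s P t + b *s Q t \<noteq> 0" "act (t *s g) (vec.span {a *s ?v + b *s ?w}) = vec.span {a *s P t + b *s Q t}"
    if "a \<noteq> 0 \<or> b \<noteq> 0" for a b t
    using PQ0 that by blast+
  have "\<exists>m. m \<noteq> 0 \<and> P t = m *s (A t *v ?v) \<and> Q t = m *s (A t *v ?w)" for t
  proof -
    have ex: "\<exists>m. m \<noteq> 0 \<and> a *s P t + b *s Q t = m *s (A t *v (a *s ?v + b *s ?w))" if ab: "a \<noteq> 0 \<or> b \<noteq> 0" for a b
    proof -
      have nz: "a *s ?v + b *s ?w \<noteq> 0" using ind ab by blast
      show ?thesis
        using span_singleton_eq_iff[OF repD(1)[OF A[of t] nz] PQ(1)[OF ab, of t]]
          repD(2)[OF A[of t] nz] PQ(2)[OF ab, of t] by simp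
    qed
    obtain m where m: "m \<noteq> 0" "P t = m *s (A t *v ?v)" using ex[of 1 0] by auto
    obtain m' where m': "Q t = m' *s (A t *v ?w)" using ex[of 0 1] by auto
    obtain k where k: "P t + Q t = k *s (A t *v (?v + ?w))" using ex[of 1 1] by auto
    have "A t *v ((m - k) *s ?v + (m' - k) *s ?w) = (P t + Q t) - k *s (A t *v (?v + ?w))"
      unfolding m(2) m' by (simp add: vec.add vec.scale vector_add_ldistrib vector_sub_rdistrib algebra_simps)
    also have "\<dots> = 0" unfolding k by simp
    finally have "(m - k) *s ?v + (m' - k) *s ?w = 0" using repD(1)[OF A] by blast
    from ind[OF this] have "m = m'" by simp
    with m m' show ?thesis by blast
  qed
  with polyf show ?thesis by blast
qed

lemma polynomial_lift:
  fixes act :: "'a::{alg_closed_field, field_char_0} ^ 'n \<Rightarrow> ('a ^ 'k) set \<Rightarrow> ('a ^ 'k) set"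
  assumes act: "is_action UNIV UNIV act" and mor: "is_morphism UNIV UNIV act"
    and A: "\<And>t. rep act (A t) (t *s g)" and "i1 \<noteq> (i0 :: 'k)"
  shows "\<exists>B. polyf_mat B \<and> B 0 \<noteq> 0 \<and> (\<forall>t. \<exists>c. B t = smat c (A t))"
proof -
  have "\<exists>P Q. (\<forall>j. polyf (\<lambda>t. P t $ j) \<and> polyf (\<lambda>t. Q t $ j)) \<and>
    (\<forall>t. \<exists>m. m \<noteq> 0 \<and> P t = m *s (A t *v axis i0 1) \<and> Q t = m *s (A t *v axis i 1))" for i
  proof (cases "i = i0")
    case False
    from axis_polynomial_lift[OF act mor A this] show ?thesis .
  next
    case True
    \<comment> \<open>For the column \<open>i0\<close> itself the pair of \<open>i0\<close> and
      \<open>i1\<close> is used, with \<open>P\<close> serving also as \<open>Q\<close>.\<close>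
    from axis_polynomial_lift[OF act mor A \<open>i1 \<noteq> i0\<close>] show ?thesis unfolding True by metis
  qed
  then have "\<forall>i. \<exists>P Q. (\<forall>j. polyf (\<lambda>t. P t $ j) \<and> polyf (\<lambda>t. Q t $ j)) \<and>
    (\<forall>t. \<exists>m. m \<noteq> 0 \<and> P t = m *s (A t *v axis i0 1) \<and> Q t = m *s (A t *v axis i 1))" by blast
  from choice[OF this] obtain P where "\<forall>i. \<exists>Q. (\<forall>j. polyf (\<lambda>t. P i t $ j) \<and> polyf (\<lambda>t. Q t $ j)) \<and>
    (\<forall>t. \<exists>m. m \<noteq> 0 \<and> P i t = m *s (A t *v axis i0 1) \<and> Q t = m *s (A t *v axis i 1))" by blast
  from choice[OF this] obtain Q where PQ: "\<And>i j. polyf (\<lambda>t. P i t $ j)" "\<And>i j. polyf (\<lambda>t. Q i t $ j)"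
    "\<And>i t. \<exists>m. m \<noteq> 0 \<and> P i t = m *s (A t *v axis i0 1) \<and> Q i t = m *s (A t *v axis i 1)" by blast
  \<comment> \<open>Each column \<open>Q i\<close> carries its own factor \<open>m i\<close>.
    Multiplying by the \<open>i0\<close> entries of all other \<open>P l\<close> equalizes them:
    every column gets the product of all \<open>m l\<close> times a power of
    \<open>A t $ i0 $ i0\<close>.\<close>
  define B where "B = (\<lambda>t. \<chi> j i. Q i t $ j * (\<Prod>l\<in>UNIV - {i}. P l t $ i0))"
  have "polyf_mat B"
    unfolding polyf_mat_def B_def using PQ(1,2) by (auto intro!: polyf_intros)
  moreover have *: "\<exists>c. B t = smat c (A t) \<and> (A t $ i0 $ i0 \<noteq> 0 \<longrightarrow> c \<noteq> 0)" for t
  proof -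
    have "\<forall>i. \<exists>m. m \<noteq> 0 \<and> P i t = m *s (A t *v axis i0 1) \<and> Q i t = m *s (A t *v axis i 1)"
      using PQ(3) by blast
    from choice[OF this] obtain m where m: "\<And>i. m i \<noteq> 0" "\<And>i. P i t = m i *s (A t *v axis i0 1)"
      "\<And>i. Q i t = m i *s (A t *v axis i 1)" by blast
    define c where "c = (\<Prod>l\<in>UNIV. m l) * A t $ i0 $ i0 ^ (CARD('k) - 1)"
    have "B t $ j $ i = c * A t $ j $ i" for i j
    proof -
      have "B t $ j $ i = m i * A t $ j $ i * ((\<Prod>l\<in>UNIV - {i}. m l) * A t $ i0 $ i0 ^ (CARD('k) - 1))"
        by (simp add: B_def m matrix_columns prod.distrib card_Diff_singleton)
      also have "\<dots> = c * A t $ j $ i"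
        using prod.remove[of UNIV i m] by (simp add: c_def algebra_simps)
      finally show ?thesis .
    qed
    then have "B t = smat c (A t)" by (simp add: vec_eq_iff)
    moreover have "c \<noteq> 0" if "A t $ i0 $ i0 \<noteq> 0" using that m(1) by (simp add: c_def)
    ultimately show ?thesis by blast
  qed
  moreover have "B 0 \<noteq> 0"
  proof -
    obtain c where "c \<noteq> 0" "A 0 = smat c (mat 1)"
      using rep_unique[OF rep_one[OF act], of "A 0"] A[of 0] by auto
    then have a: "A 0 $ i0 $ i0 \<noteq> 0" by (simp add: mat_def)
    from *[of 0] a obtain c' where "c' \<noteq> 0" "B 0 = smat c' (A 0)" by blast
    then have "B 0 $ i0 $ i0 \<noteq> 0" using a by simp
    then show ?thesis by auto
  qed
  ultimately show ?thesis by blast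
qed

lemma nonvanishing_lift:
  fixes A :: "'a::field_char_0 \<Rightarrow> 'a ^ 'k ^ 'k"
  assumes "polyf_mat B" "B 0 \<noteq> 0" "\<And>t. \<exists>c. B t = smat c (A t)"
  shows "\<exists>B F. polyf_mat B \<and> (\<forall>t. B t \<noteq> 0) \<and> finite F \<and> (\<forall>t. t \<notin> F \<longrightarrow> (\<exists>c. B t = smat c (A t)))"
proof -
  define E where "E = (\<lambda>(p :: 'k \<Rightarrow> 'k \<Rightarrow> 'a poly) t. (\<chi> i j. poly (p i j) t))"
  define valid where "valid = (\<lambda>p :: 'k \<Rightarrow> 'k \<Rightarrow> 'a poly. (\<exists>i j. p i j \<noteq> 0) \<and>
    (\<exists>F. finite F \<and> (\<forall>t. t \<notin> F \<longrightarrow> (\<exists>c. E p t = smat c (A t)))))"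
  define deg where "deg = (\<lambda>p :: 'k \<Rightarrow> 'k \<Rightarrow> 'a poly. \<Sum>i\<in>UNIV. \<Sum>j\<in>UNIV. degree (p i j))"
  have "\<exists>p. valid p"
  proof -
    have "\<forall>i. \<exists>q. \<forall>j. \<forall>t. poly (q j) t = B t $ i $ j"
    proof
      fix i
      have "\<forall>j. \<exists>q. \<forall>t. poly q t = B t $ i $ j" using assms(1) by (simp add: polyf_mat_def polyf_def)
      from choice[OF this] show "\<exists>q. \<forall>j. \<forall>t. poly (q j) t = B t $ i $ j" .
    qed
    from choice[OF this] obtain p where p: "\<And>i j t. poly (p i j) t = B t $ i $ j" by blast
    then have EB: "E p t = B t" for t by (simp add: E_def vec_eq_iff)
    obtain i j where "B 0 $ i $ j \<noteq> 0" using assms(2) by (auto simp: vec_eq_iff)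
    then have "p i j \<noteq> 0" using p[of i j 0] by auto
    then have "valid p" unfolding valid_def EB using assms(3) by blast
    then show ?thesis by blast
  qed
  then obtain p where p: "valid p" "\<And>q. valid q \<Longrightarrow> deg p \<le> deg q"
    using ex_has_least_nat[of valid _ deg] by blast
  obtain F where F: "finite F" "\<And>t. t \<notin> F \<Longrightarrow> \<exists>c. E p t = smat c (A t)" using p(1) by (auto simp: valid_def)
  have "E p t0 \<noteq> 0" for t0
  proof
    assume "E p t0 = 0"
    then have "poly (p i j) t0 = 0" for i j by (simp add: E_def vec_eq_iff)
    then have "[:- t0, 1:] dvd p i j" for i j by (simp add: poly_eq_0_iff_dvd)
    note dvd = this
    define q where "q i j = p i j div [:- t0, 1:]" for i j
    have q: "p i j = [:- t0, 1:] * q i j" for i j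
      unfolding q_def by (rule dvd_mult_div_cancel[OF dvd, symmetric])
    have Ep: "E p t = smat (t - t0) (E q t)" for t
      by (simp add: E_def vec_eq_iff q algebra_simps)
    have "\<exists>c. E q t = smat c (A t)" if t: "t \<notin> insert t0 F" for t
    proof -
      obtain c where "smat (t - t0) (E q t) = smat c (A t)" using F(2)[of t] t unfolding Ep by blast
      then have "smat (1 / (t - t0)) (smat (t - t0) (E q t)) = smat (1 / (t - t0)) (smat c (A t))" by simp
      then show ?thesis using t by (auto simp: smat_smat)
    qed
    moreover have "finite (insert t0 F)" using F(1) by simp
    moreover obtain i j where ij: "p i j \<noteq> 0" using p(1) unfolding valid_def by blast
    then have nz: "q i j \<noteq> 0" unfolding q[of i j] by auto
    ultimately have "valid q" unfolding valid_def by blast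
    have deg_q: "degree (p i j) = Suc (degree (q i j))" if "q i j \<noteq> 0" for i j
    proof -
      have "degree (p i j) = degree [:- t0, 1:] + degree (q i j)"
        unfolding q[of i j] by (rule degree_mult_eq) (use that in auto)
      then show ?thesis by simp
    qed
    have le: "degree (q i j) \<le> degree (p i j)" for i j
      by (cases "q i j = 0") (simp_all add: deg_q)
    have lt: "degree (q i j) < degree (p i j)" using deg_q[OF nz] by simp
    have "(\<Sum>j\<in>UNIV. degree (q i j)) < (\<Sum>j\<in>UNIV. degree (p i j))"
      by (rule sum_strict_mono_ex1) (simp_all add: le, rule exI[of _ j], rule lt)
    moreover have "(\<Sum>j\<in>UNIV. degree (q i j)) \<le> (\<Sum>j\<in>UNIV. degree (p i j))" for i
      by (rule sum_mono) (rule le)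
    ultimately have "deg q < deg p"
      unfolding deg_def by (intro sum_strict_mono_ex1) auto
    with p(2)[OF \<open>valid q\<close>] show False by simp
  qed
  moreover have "polyf_mat (E p)" by (simp add: polyf_mat_def E_def polyf_poly)
  ultimately show ?thesis using F by blast
qed

lemma polyf_mat_mult:
  fixes P Q :: "'a::field \<Rightarrow> 'a ^ 'k ^ 'k"
  shows "polyf_mat P \<Longrightarrow> polyf_mat Q \<Longrightarrow> polyf_mat (\<lambda>t. P t ** Q t)"
  unfolding polyf_mat_def by (intro allI polyf_matrix_mult[of P Q]) blast+

lemma polyf_mat_const: "polyf_mat (\<lambda>t. A)"
  by (simp add: polyf_mat_def polyf_const)

lemma polyf_mat_affine: "polyf_mat P \<Longrightarrow> polyf_mat (\<lambda>t. P (a + b * t))"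
  unfolding polyf_mat_def by (intro allI polyf_affine[of "\<lambda>t. P t $ _ $ _"]) blast

lemma polyf_mat_minors:
  fixes P Q :: "'a::field_char_0 \<Rightarrow> 'a ^ 'k ^ 'k"
  assumes "polyf_mat P" "polyf_mat Q" "finite F" "\<And>t. t \<notin> F \<Longrightarrow> \<exists>c. P t = smat c (Q t)"
  shows "P t $ i $ j * Q t $ k $ l = P t $ k $ l * Q t $ i $ j"
proof (rule polyf_eq_cofinite[where f = "\<lambda>t. P t $ i $ j * Q t $ k $ l" and
      g = "\<lambda>t. P t $ k $ l * Q t $ i $ j" and S = F])
  show "polyf (\<lambda>t. P t $ i $ j * Q t $ k $ l)" "polyf (\<lambda>t. P t $ k $ l * Q t $ i $ j)"
    using assms(1,2) unfolding polyf_mat_def by (auto intro: polyf_mult)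
  show "finite F" by (rule assms(3))
  fix t assume "t \<notin> F"
  from assms(4)[OF this] obtain c where "P t = smat c (Q t)" by blast
  then show "P t $ i $ j * Q t $ k $ l = P t $ k $ l * Q t $ i $ j" by simp
qed

text \<open>A nowhere vanishing polynomial family of matrices representing a one-parameter group is, up to
  a constant factor, a one-parameter group of matrices of determinant \<open>1\<close>: its determinant has no zero,
  hence is constant, and the scalar relating \<open>B s ** B t\<close> to \<open>B (s + t)\<close> is a root of unity.\<close>

lemma one_parameter_lift:
  fixes act :: "'a::{alg_closed_field, field_char_0} ^ 'n \<Rightarrow> ('a ^ 'k) set \<Rightarrow> ('a ^ 'k) set"
  assumes act: "is_action UNIV UNIV act"
    and A: "\<And>t. rep act (A t) (t *s g)"
    and B: "polyf_mat B" "\<And>t. B t \<noteq> 0" and F: "finite F" "\<And>t. t \<notin> F \<Longrightarrow> \<exists>c. B t = smat c (A t)"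
  shows "\<exists>B. polyf_mat B \<and> (\<forall>t. det (B t) = 1) \<and> B 0 = mat 1 \<and> (\<forall>t. rep act (B t) (t *s g)) \<and>
    (\<forall>s t. B (s + t) = B s ** B t)"
proof -
  have repB: "rep act (B t) (t *s g)" if t: "t \<notin> F" for t
  proof -
    obtain c where c: "B t = smat c (A t)" using F(2)[OF t] by blast
    then have "c \<noteq> 0" using B(2)[of t] by auto
    then show ?thesis unfolding c by (rule rep_smat[OF A])
  qed
  have shift_fin: "finite {t. s + t \<in> F}" for s
  proof -
    have "{t. s + t \<in> F} = (\<lambda>x. x - s) ` F" by force
    then show ?thesis using F(1) by simp
  qed
  have avoid: "\<exists>t. t \<notin> F \<and> s + t \<notin> F \<and> s - t \<notin> F" for s
  proof -
    have "{t. s - t \<in> F} \<subseteq> (\<lambda>x. s - x) ` F"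
      by (intro subsetI image_eqI[where x = "s - _"]) simp_all
    then have "finite {t. s - t \<in> F}" using F(1) finite_subset by blast
    then have "finite (F \<union> {t. s + t \<in> F} \<union> {t. s - t \<in> F})" using F(1) shift_fin by simp
    from ex_new_if_finite[OF infinite_UNIV_char_0 this]
    obtain t where "t \<notin> F \<union> {t. s + t \<in> F} \<union> {t. s - t \<in> F}" by blast
    then show ?thesis by blast
  qed
  have generic: "\<exists>c. B s ** B t = smat c (B (s + t))" if "s \<notin> F" "t \<notin> F" "s + t \<notin> F" for s t
  proof -
    have "rep act (B s ** B t) ((s + t) *s g)"
      using rep_mult[OF act repB[OF that(1)] repB[OF that(2)]] by (simp add: vector_sadd_rdistrib)
    from rep_unique[OF repB[OF that(3)] this] show ?thesis by blast
  qed
  \<comment> \<open>Multiplicativity up to scalars is extended one variable at a time, first in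
    \<open>t\<close> for admissible \<open>s\<close>, then in \<open>s\<close>.\<close>
  have half: "(B s ** B t) $ i $ j * B (s + t) $ k $ l = (B s ** B t) $ k $ l * B (s + t) $ i $ j"
    if "s \<notin> F" for s t i j k l
  proof (rule polyf_mat_minors[where P = "\<lambda>t. B s ** B t" and Q = "\<lambda>t. B (s + t)" and F = "F \<union> {t. s + t \<in> F}"])
    show "polyf_mat (\<lambda>t. B s ** B t)" by (intro polyf_mat_mult polyf_mat_const B)
    show "polyf_mat (\<lambda>t. B (s + t))" using polyf_mat_affine[OF B(1), of s 1] by simp
    show "finite (F \<union> {t. s + t \<in> F})" using F(1) shift_fin by simp
    show "\<exists>c. B s ** B t = smat c (B (s + t))" if "t \<notin> F \<union> {t. s + t \<in> F}" for t
      using generic[OF \<open>s \<notin> F\<close>] that by simp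
  qed
  have minors: "(B s ** B t) $ i $ j * B (s + t) $ k $ l = (B s ** B t) $ k $ l * B (s + t) $ i $ j"
    for s t i j k l
  proof (rule polyf_eq_cofinite[where f = "\<lambda>s. (B s ** B t) $ i $ j * B (s + t) $ k $ l" and
      g = "\<lambda>s. (B s ** B t) $ k $ l * B (s + t) $ i $ j" and S = F])
    have "polyf_mat (\<lambda>s. B s ** B t)" by (intro polyf_mat_mult polyf_mat_const B)
    moreover have "polyf_mat (\<lambda>s. B (s + t))"
      using polyf_mat_affine[OF B(1), of t 1] by (simp add: add.commute)
    ultimately show "polyf (\<lambda>s. (B s ** B t) $ i $ j * B (s + t) $ k $ l)"
      "polyf (\<lambda>s. (B s ** B t) $ k $ l * B (s + t) $ i $ j)"
      unfolding polyf_mat_def by (auto intro: polyf_mult)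
  qed (use F(1) half in auto)
  have mult: "\<exists>c. B s ** B t = smat c (B (s + t))" for s t
    by (rule matrix_minors_smat[OF minors B(2)])
  \<comment> \<open>A singular \<open>B t\<close> would force \<open>c = 0\<close>, hence
    \<open>B t ** B s = 0\<close> with \<open>B s\<close> invertible, and \<open>B t\<close> would
    vanish.\<close>
  have det: "det (B t) \<noteq> 0" for t
  proof
    assume 0: "det (B t) = 0"
    obtain s where s: "s \<notin> F" "t + s \<notin> F" using avoid by blast
    obtain c where c: "B t ** B s = smat c (B (t + s))" using mult by blast
    have "c ^ CARD('k) * det (B (t + s)) = 0"
      using arg_cong[OF c, of det] 0 by (simp add: det_mul det_smat)
    then have "c = 0" using rep_det[OF repB[OF s(2)]] by simp
    then have "B t ** B s = 0" using c by simp
    moreover obtain C where "B s ** C = mat 1"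
      using rep_det[OF repB[OF s(1)]] invertible_det_nz invertible_def by metis
    ultimately have "B t = 0 ** C"
      by (metis matrix_mul_assoc matrix_mul_rid)
    then have "B t = 0" by (simp add: vec_eq_iff matrix_matrix_mult_def)
    then show False using B(2) by blast
  qed
  obtain p where p: "\<And>t. poly p t = det (B t)"
    using polyf_det[of B] B(1) unfolding polyf_mat_def polyf_def by blast
  then obtain d where d: "p = [:d:]" using no_root_imp_const[of p] det by metis
  have detd: "det (B t) = det (B 0)" for t using p[of t] p[of 0] d by simp
  obtain b where b: "B 0 = smat b (mat 1)"
  proof -
    obtain b where b: "B 0 ** B 0 = smat b (B 0)" using mult[of 0 0] by auto
    obtain C where C: "B 0 ** C = mat 1" using det[of 0] invertible_det_nz invertible_def by metis
    have "B 0 = (B 0 ** B 0) ** C" by (simp add: matrix_mul_assoc[symmetric] C)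
    also have "\<dots> = smat b (mat 1)" unfolding b using smat_mult[of b "B 0" 1 C] C by simp
    finally show ?thesis using that by blast
  qed
  have b0: "b \<noteq> 0" using b B(2)[of 0] by auto
  define B' where "B' t = smat (1 / b) (B t)" for t
  have B'0: "B' 0 = mat 1" using b b0 by (simp add: B'_def smat_smat)
  have det': "det (B' t) = 1" for t
  proof -
    have "det (B' t) = det (B' 0)" using detd[of t] by (simp add: B'_def det_smat)
    then show ?thesis using B'0 by simp
  qed
  have pB': "polyf_mat B'"
    using B(1) unfolding polyf_mat_def B'_def smat_nth by (intro allI polyf_mult polyf_const) blast
  have mult': "B' (s + t) = B' s ** B' t" for s t
  proof -
    have "(\<lambda>t. B' s ** B' t) = (\<lambda>t. B' (s + t))"
    proof (rule polyf_mat_uniq)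
      show "polyf_mat (\<lambda>t. B' s ** B' t)" by (intro polyf_mat_mult polyf_mat_const pB')
      show "polyf_mat (\<lambda>t. B' (s + t))" using polyf_mat_affine[OF pB', of s 1] by simp
      show "\<exists>c. B' s ** B' t = smat c (B' (s + t))" for t
      proof -
        obtain c where c: "B s ** B t = smat c (B (s + t))" using mult by blast
        have "B' s ** B' t = smat (c / b) (B' (s + t))"
          unfolding B'_def smat_mult smat_smat c using b0 by (simp add: smat_smat field_simps)
        then show ?thesis by blast
      qed
    qed (simp_all add: det_mul det' B'0)
    then show ?thesis by (auto simp: fun_eq_iff)
  qed
  have "rep act (B' t) (t *s g)" for t
  proof -
    \<comment> \<open>Splitting \<open>t\<close> into two admissible times recovers the
      representation property at exceptional \<open>t\<close>.\<close>
    obtain s where s: "s \<notin> F" "t - s \<notin> F" using avoid by blast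
    have "rep act (B (t - s) ** B s) ((t - s) *s g + s *s g)"
      by (rule rep_mult[OF act repB[OF s(2)] repB[OF s(1)]])
    moreover have "(t - s) *s g + s *s g = t *s g" by (simp add: vector_sub_rdistrib)
    moreover obtain c where c: "B (t - s) ** B s = smat c (B t)" using mult[of "t - s" s] by auto
    ultimately have r: "rep act (smat c (B t)) (t *s g)" by simp
    have "c \<noteq> 0" using rep_det[OF r] by (auto simp: det_smat)
    from rep_smat[OF r, of "1 / (c * b)"] this b0 show ?thesis
      by (simp add: B'_def smat_smat)
  qed
  with pB' det' B'0 mult' show ?thesis by blast
qed

text \<open>Lifts of determinant one with value \<open>mat 1\<close> at zero are unique by
  \<open>polyf_mat_uniq\<close>. Products and rescalings of such lifts are again of this kind, so
  the lifts for different \<open>g\<close> fit together to a homomorphism.\<close>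

theorem linearization:
  fixes act :: "'a::{alg_closed_field, field_char_0} ^ 'n \<Rightarrow> ('a ^ 'k) set \<Rightarrow> ('a ^ 'k) set"
  assumes act: "is_action UNIV UNIV act" and mor: "is_morphism UNIV UNIV act"
  shows "\<exists>\<rho>. (\<forall>g. rep act (\<rho> g) g) \<and> (\<forall>g h. \<rho> (g + h) = \<rho> g ** \<rho> h) \<and>
    (\<forall>g. polyf_mat (\<lambda>t. \<rho> (t *s g)))"
proof -
  define fam where "fam g B \<longleftrightarrow> polyf_mat B \<and> (\<forall>t. det (B t) = 1) \<and> B 0 = mat 1 \<and>
    (\<forall>t. rep act (B t) (t *s g))" for g B
  have famD: "polyf_mat B" "det (B t) = 1" "B 0 = mat 1" "rep act (B t) (t *s g)" if "fam g B" for g B t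
    using that by (auto simp: fam_def)
  have "\<exists>B. fam g B" for g
  proof (cases "\<exists>i0 i1 :: 'k. i1 \<noteq> i0")
    case True
    then obtain i0 i1 :: 'k where i: "i1 \<noteq> i0" by blast
    have "\<forall>t. \<exists>A. rep act A (t *s g)" using rep_exists[OF act mor] by blast
    from choice[OF this] obtain A where A: "\<And>t. rep act (A t) (t *s g)" by blast
    from polynomial_lift[OF act mor A i] obtain B where
      "polyf_mat B" "B 0 \<noteq> 0" "\<forall>t. \<exists>c. B t = smat c (A t)" by (elim exE conjE)
    from nonvanishing_lift[OF this(1,2) spec[OF this(3)]] obtain B F where
      B: "polyf_mat B" "\<forall>t. B t \<noteq> 0" "finite F" "\<forall>t. t \<notin> F \<longrightarrow> (\<exists>c. B t = smat c (A t))"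
      by (elim exE conjE)
    from one_parameter_lift[OF act A B(1) spec[OF B(2)] B(3) B(4)[rule_format]]
    show ?thesis unfolding fam_def by blast
  next
    case False
    \<comment> \<open>Here \<open>CARD('k) = 1\<close>, and projective space is a single
      point.\<close>
    have "rep act (mat 1) h" for h
      unfolding rep_def
    proof (intro allI impI)
      fix v :: "'a ^ 'k" assume v: "v \<noteq> 0"
      have "act h (vec.span {v}) \<in> proj UNIV"
        using act span_singleton_in_proj[OF v] by (simp add: is_action_def)
      then obtain w where w: "w \<noteq> 0" "act h (vec.span {v}) = vec.span {w}" by (auto simp: proj_def)
      have "vec.span {w} = vec.span {v}"
      proof (rule span_singleton_eq_minors[OF w(1) v, THEN iffD2], intro allI)
        fix i j :: 'k
        have "i = j" using False by blast
        then show "w $ i * v $ j = w $ j * v $ i" by simp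
      qed
      then show "mat 1 *v v \<noteq> 0 \<and> act h (vec.span {v}) = vec.span {mat 1 *v v}" using v w by simp
    qed
    then have "fam g (\<lambda>_. mat 1)" by (simp add: fam_def polyf_mat_const)
    then show ?thesis by blast
  qed
  then have "\<forall>g. \<exists>B. fam g B" by blast
  from choice[OF this] obtain B where B: "\<And>g. fam g (B g)" by blast
  have uniq: "P = Q" if "fam g P" "fam g Q" for g P Q
  proof (rule polyf_mat_uniq)
    show "\<exists>c. P t = smat c (Q t)" for t
      using rep_unique[OF famD(4)[OF that(2), of t] famD(4)[OF that(1), of t]] by blast
  qed (simp_all add: famD[OF that(1)] famD[OF that(2)])
  have scale: "B (c *s g) 1 = B g c" for c g
  proof -
    have "fam (c *s g) (\<lambda>t. B g (c * t))"
      unfolding fam_def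
      using polyf_mat_affine[OF famD(1)[OF B[of g]], of 0 c] famD(2,3)[OF B[of g]] famD(4)[OF B[of g], of "c * _"]
      by (simp add: mult.commute)
    from uniq[OF B this] show ?thesis by (simp add: fun_eq_iff)
  qed
  have add: "B (g + h) 1 = B g 1 ** B h 1" for g h
  proof -
    have "fam (g + h) (\<lambda>t. B g t ** B h t)"
      unfolding fam_def
      using polyf_mat_mult[OF famD(1)[OF B[of g]] famD(1)[OF B[of h]]]
        famD(2,3)[OF B[of g]] famD(2,3)[OF B[of h]] rep_mult[OF act famD(4)[OF B[of g]] famD(4)[OF B[of h]]]
      by (simp add: det_mul vector_add_ldistrib)
    from uniq[OF B this] show ?thesis by (simp add: fun_eq_iff)
  qed
  have "polyf_mat (\<lambda>t. B (t *s g) 1)" for g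
    unfolding scale by (rule famD(1)[OF B])
  moreover have "rep act (B g 1) g" for g using famD(4)[OF B[of g], of 1] by simp
  ultimately show ?thesis using add by (intro exI[of _ "\<lambda>g. B g 1"]) blast
qed

section \<open>Counting monomials\<close>

interpretation fs: vector_space "\<lambda>(c :: 'a::field) (f :: 'x \<Rightarrow> 'a) x. c * f x"
  by unfold_locales (auto simp: algebra_simps fun_eq_iff)

text \<open>Parameters are functions on \<open>nat\<close> of which the first \<open>r\<close>
  count, so that the number of parameters is a term and not a type.\<close>

definition tpoly :: "nat \<Rightarrow> ((nat \<Rightarrow> 'a::field) \<Rightarrow> 'a) set" where
  "tpoly r = poly_funs {\<lambda>t. t i | i. i < r}"

text \<open>Bounding each exponent separately instead of the total degree makes the count a plain
  power, and the bounds add under multiplication.\<close>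

definition box_monomials :: "nat \<Rightarrow> nat \<Rightarrow> ((nat \<Rightarrow> 'a::field) \<Rightarrow> 'a) set" where
  "box_monomials r D = (\<lambda>\<beta> t. \<Prod>i<r. t i ^ \<beta> i) ` {\<beta>. \<forall>i<r. \<beta> i \<le> D}"

lemma box_monomials_eq: "box_monomials r D = (\<lambda>\<beta> t. \<Prod>i<r. t i ^ \<beta> i) ` ({..<r} \<rightarrow>\<^sub>E {..D})"
proof (intro equalityI subsetI)
  fix f assume "f \<in> box_monomials r D"
  then obtain \<beta> where b: "\<forall>i<r. \<beta> i \<le> D" "f = (\<lambda>t. \<Prod>i<r. t i ^ \<beta> i)"
    by (auto simp: box_monomials_def)
  have "f = (\<lambda>t. \<Prod>i<r. t i ^ (restrict \<beta> {..<r}) i)" unfolding b(2) by (intro ext prod.cong) auto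
  moreover have "restrict \<beta> {..<r} \<in> {..<r} \<rightarrow>\<^sub>E {..D}" using b(1) by auto
  ultimately show "f \<in> (\<lambda>\<beta> t. \<Prod>i<r. t i ^ \<beta> i) ` ({..<r} \<rightarrow>\<^sub>E {..D})" by blast
qed (auto simp: box_monomials_def intro!: imageI)

lemma finite_box_monomials: "finite (box_monomials r D)"
  and card_box_monomials: "card (box_monomials r D) \<le> (D + 1) ^ r"
proof -
  have fin: "finite ({..<r} \<rightarrow>\<^sub>E {..D})" by (intro finite_PiE) auto
  then show "finite (box_monomials r D)" unfolding box_monomials_eq by simp
  have "card (box_monomials r D) \<le> card ({..<r} \<rightarrow>\<^sub>E {..D})"
    unfolding box_monomials_eq by (rule card_image_le[OF fin])
  also have "\<dots> = (D + 1) ^ r" by (simp add: card_PiE)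
  finally show "card (box_monomials r D) \<le> (D + 1) ^ r" .
qed

lemma box_monomials_mono: "D \<le> E \<Longrightarrow> box_monomials r D \<subseteq> box_monomials r E"
  by (auto simp: box_monomials_def intro!: imageI elim: le_trans)

lemma span_box_monomials_mult:
  assumes "f \<in> fs.span (box_monomials r D)" "g \<in> fs.span (box_monomials r E)"
  shows "(\<lambda>x. f x * g x) \<in> fs.span (box_monomials r (D + E))"
  using assms(1)
proof (induction rule: fs.span_induct)
  case base
  show "fs.subspace {f. (\<lambda>x. f x * g x) \<in> fs.span (box_monomials r (D + E))}"
    unfolding fs.subspace_def
  proof (intro conjI ballI allI)
    show "0 \<in> {f. (\<lambda>x. f x * g x) \<in> fs.span (box_monomials r (D + E))}"
      using fs.span_zero by (simp add: zero_fun_def)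
  next
    fix a b assume "a \<in> {f. (\<lambda>x. f x * g x) \<in> fs.span (box_monomials r (D + E))}"
      "b \<in> {f. (\<lambda>x. f x * g x) \<in> fs.span (box_monomials r (D + E))}"
    then show "a + b \<in> {f. (\<lambda>x. f x * g x) \<in> fs.span (box_monomials r (D + E))}"
      using fs.span_add[of "\<lambda>x. a x * g x" _ "\<lambda>x. b x * g x"] by (simp add: plus_fun_def algebra_simps)
  next
    fix c a assume "a \<in> {f. (\<lambda>x. f x * g x) \<in> fs.span (box_monomials r (D + E))}"
    then show "(\<lambda>x. c * a x) \<in> {f. (\<lambda>x. f x * g x) \<in> fs.span (box_monomials r (D + E))}"
      using fs.span_scale[of "\<lambda>x. a x * g x" _ c] by (simp add: algebra_simps)
  qed
next
  case (step f)
  then obtain \<beta> where b: "\<forall>i<r. \<beta> i \<le> D" "f = (\<lambda>t. \<Prod>i<r. t i ^ \<beta> i)"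
    by (auto simp: box_monomials_def)
  show "(\<lambda>x. f x * g x) \<in> fs.span (box_monomials r (D + E))"
    using assms(2)
  proof (induction rule: fs.span_induct)
    case base
    show "fs.subspace {g. (\<lambda>x. f x * g x) \<in> fs.span (box_monomials r (D + E))}"
      unfolding fs.subspace_def
    proof (intro conjI ballI allI)
      show "0 \<in> {g. (\<lambda>x. f x * g x) \<in> fs.span (box_monomials r (D + E))}"
        using fs.span_zero by (simp add: zero_fun_def)
    next
      fix a b assume "a \<in> {g. (\<lambda>x. f x * g x) \<in> fs.span (box_monomials r (D + E))}"
        "b \<in> {g. (\<lambda>x. f x * g x) \<in> fs.span (box_monomials r (D + E))}"
      then show "a + b \<in> {g. (\<lambda>x. f x * g x) \<in> fs.span (box_monomials r (D + E))}"
        using fs.span_add[of "\<lambda>x. f x * a x" _ "\<lambda>x. f x * b x"] by (simp add: plus_fun_def algebra_simps)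
    next
      fix c a assume "a \<in> {g. (\<lambda>x. f x * g x) \<in> fs.span (box_monomials r (D + E))}"
      then show "(\<lambda>x. c * a x) \<in> {g. (\<lambda>x. f x * g x) \<in> fs.span (box_monomials r (D + E))}"
        using fs.span_scale[of "\<lambda>x. f x * a x" _ c] by (simp add: algebra_simps)
    qed
  next
    case (step g)
    then obtain \<gamma> where c: "\<forall>i<r. \<gamma> i \<le> E" "g = (\<lambda>t. \<Prod>i<r. t i ^ \<gamma> i)"
      by (auto simp: box_monomials_def)
    have eq: "(\<lambda>x. f x * g x) = (\<lambda>t. \<Prod>i<r. t i ^ (\<beta> i + \<gamma> i))"
      unfolding b(2) c(2) by (simp add: power_add prod.distrib)
    have mem: "(\<lambda>t. \<Prod>i<r. t i ^ (\<beta> i + \<gamma> i)) \<in> box_monomials r (D + E)"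
      unfolding box_monomials_def using b(1) c(1) by (intro image_eqI[where x = "\<lambda>i. \<beta> i + \<gamma> i"]) (auto intro: add_mono)
    show "(\<lambda>x. f x * g x) \<in> fs.span (box_monomials r (D + E))"
      unfolding eq by (rule fs.span_base[OF mem])
  qed
qed

lemma const_in_span_box: "(\<lambda>_. a) \<in> fs.span (box_monomials r D)"
proof -
  have "(\<lambda>_. 1) \<in> box_monomials r D"
    unfolding box_monomials_def by (rule image_eqI[where x = "\<lambda>_. 0"]) auto
  then show ?thesis using fs.span_scale[OF fs.span_base, of "\<lambda>_. 1" _ a] by simp
qed

lemma tpoly_in_span_box:
  assumes "f \<in> tpoly r"
  shows "\<exists>D. f \<in> fs.span (box_monomials r D)"
  using assms unfolding tpoly_def
proof induction
  case (coord c)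
  then obtain i where i: "i < r" "c = (\<lambda>t. t i)" by auto
  have "c \<in> box_monomials r 1"
    unfolding box_monomials_def
  proof (rule image_eqI[where x = "\<lambda>j. if j = i then 1 else 0"])
    have "(\<Prod>j<r. t j ^ (if j = i then 1 else 0)) = (\<Prod>j<r. if j = i then t j else 1)" for t :: "nat \<Rightarrow> 'a"
      by (intro prod.cong) auto
    also have "\<dots> t = t i" for t using i(1) by (simp add: prod.delta)
    finally show "c = (\<lambda>t. \<Prod>j<r. t j ^ (if j = i then 1 else 0))" using i(2) by simp
  qed auto
  then show ?case using fs.span_base by blast
next
  case (const a)
  show ?case using const_in_span_box by blast
next
  case (add f g)
  then obtain D E where "f \<in> fs.span (box_monomials r D)" "g \<in> fs.span (box_monomials r E)" by blast
  then have "f \<in> fs.span (box_monomials r (D + E))" "g \<in> fs.span (box_monomials r (D + E))"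
    using fs.span_mono[OF box_monomials_mono[of D "D + E" r]] fs.span_mono[OF box_monomials_mono[of E "D + E" r]]
    by auto
  then have "f + g \<in> fs.span (box_monomials r (D + E))" by (rule fs.span_add)
  then show ?case by (auto simp: plus_fun_def)
next
  case (mult f g)
  then show ?case using span_box_monomials_mult by blast
qed

lemma span_box_power:
  assumes "f \<in> fs.span (box_monomials r D)"
  shows "(\<lambda>t. f t ^ n) \<in> fs.span (box_monomials r (D * n))"
proof (induction n)
  case 0
  show ?case using const_in_span_box[of 1] by simp
next
  case (Suc n)
  from span_box_monomials_mult[OF assms Suc] show ?case by simp
qed

lemma span_box_prod:
  fixes l :: nat
  shows "\<forall>j<l. f j \<in> fs.span (box_monomials r D) \<Longrightarrow> (\<lambda>t. \<Prod>j<l. f j t ^ \<alpha> j) \<in> fs.span (box_monomials r (D * (\<Sum>j<l. \<alpha> j)))"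
proof (induction l)
  case 0
  show ?case using const_in_span_box[of 1] by simp
next
  case (Suc l)
  then have 1: "(\<lambda>t. \<Prod>j<l. f j t ^ \<alpha> j) \<in> fs.span (box_monomials r (D * (\<Sum>j<l. \<alpha> j)))"
    and 2: "f l \<in> fs.span (box_monomials r D)" by auto
  from span_box_monomials_mult[OF 1 span_box_power[OF 2]] show ?case by (simp add: distrib_left)
qed

text \<open>Independence is required of the indexed family; equal members at different indices are
  excluded by a relation with coefficients \<open>1\<close> and \<open>-1\<close>.\<close>

lemma family_card_le:
  fixes \<psi> :: "'i \<Rightarrow> 'x \<Rightarrow> 'a::field"
  assumes "finite I" "finite B" "\<And>i. i \<in> I \<Longrightarrow> \<psi> i \<in> fs.span B"
    and ind: "\<And>u. (\<And>x. (\<Sum>i\<in>I. u i * \<psi> i x) = 0) \<Longrightarrow> \<forall>i\<in>I. u i = 0"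
  shows "card I \<le> card B"
proof -
  have inj: "inj_on \<psi> I"
  proof (rule inj_onI, rule ccontr)
    fix i j assume ij: "i \<in> I" "j \<in> I" "\<psi> i = \<psi> j" "i \<noteq> j"
    define u :: "'i \<Rightarrow> 'a" where "u k = (if k = i then 1 else 0) - (if k = j then 1 else 0)" for k
    have "(\<Sum>k\<in>I. u k * \<psi> k x) = 0" for x
    proof -
      have "(\<Sum>k\<in>I. u k * \<psi> k x) = (\<Sum>k\<in>I. (if k = i then \<psi> k x else 0)) - (\<Sum>k\<in>I. (if k = j then \<psi> k x else 0))"
        unfolding sum_subtractf[symmetric] by (intro sum.cong) (auto simp: u_def)
      also have "\<dots> = 0" using ij assms(1) by (simp add: sum.delta)
      finally show ?thesis .
    qed
    from ind[OF this] ij have "u i = 0" by blast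
    with ij(4) show False by (simp add: u_def)
  qed
  have "fs.independent (\<psi> ` I)"
  proof (rule fs.independent_if_scalars_zero)
    show "finite (\<psi> ` I)" using assms(1) by simp
    fix u f assume eq: "(\<Sum>f\<in>\<psi> ` I. (\<lambda>x. u f * f x)) = 0" and f: "f \<in> \<psi> ` I"
    have "(\<Sum>i\<in>I. u (\<psi> i) * \<psi> i x) = 0" for x
    proof -
      have "(\<Sum>f\<in>\<psi> ` I. (\<lambda>x. u f * f x)) x = (\<Sum>f\<in>\<psi> ` I. u f * f x)"
        by (induction rule: infinite_finite_induct) auto
      also have "\<dots> = (\<Sum>i\<in>I. u (\<psi> i) * \<psi> i x)" using inj by (simp add: sum.reindex)
      finally show ?thesis using eq by simp
    qed
    from ind[OF this] f show "u f = 0" by blast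
  qed
  moreover have "\<psi> ` I \<subseteq> fs.span B" using assms(3) by blast
  ultimately have "card (\<psi> ` I) \<le> card B" using fs.independent_span_bound assms(2) by blast
  then show ?thesis using inj by (simp add: card_image)
qed

text \<open>The entries from \<open>l\<close> on are fixed to zero so that each monomial has exactly
  one exponent function.\<close>

definition exponents :: "nat \<Rightarrow> nat \<Rightarrow> (nat \<Rightarrow> nat) set" where
  "exponents l d = {\<alpha>. (\<forall>j\<ge>l. \<alpha> j = 0) \<and> (\<Sum>j<l. \<alpha> j) = d}"

lemma exponents_0: "exponents 0 0 = {\<lambda>_. 0}" "exponents 0 (Suc d) = {}"
  by (auto simp: exponents_def)

lemma exponents_Suc_0: "exponents l 0 = {\<lambda>_. 0}"
  by (auto simp: exponents_def) (metis lessThan_iff linorder_not_less)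

text \<open>Splitting by whether the last exponent is zero separates the monomials free of the last
  variable from those divisible by it.\<close>

lemma exponents_Suc_Suc:
  "exponents (Suc l) (Suc d) = exponents l (Suc d) \<union> (\<lambda>\<alpha>. \<alpha>(l := Suc (\<alpha> l))) ` exponents (Suc l) d"
proof (intro equalityI subsetI)
  fix \<alpha> assume a: "\<alpha> \<in> exponents (Suc l) (Suc d)"
  show "\<alpha> \<in> exponents l (Suc d) \<union> (\<lambda>\<alpha>. \<alpha>(l := Suc (\<alpha> l))) ` exponents (Suc l) d"
  proof (cases "\<alpha> l")
    case 0
    then have "\<alpha> j = 0" if "j \<ge> l" for j using a that by (cases "j = l") (auto simp: exponents_def)
    then have "\<alpha> \<in> exponents l (Suc d)" using a 0 by (auto simp: exponents_def)
    then show ?thesis ..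
  next
    case (Suc n)
    have "(\<Sum>j<l. (\<alpha>(l := n)) j) = (\<Sum>j<l. \<alpha> j)" by (intro sum.cong) auto
    then have "\<alpha>(l := n) \<in> exponents (Suc l) d" using a Suc by (auto simp: exponents_def)
    moreover have "\<alpha> = (\<alpha>(l := n))(l := Suc ((\<alpha>(l := n)) l))" using Suc by auto
    ultimately show ?thesis by blast
  qed
next
  fix \<alpha> assume "\<alpha> \<in> exponents l (Suc d) \<union> (\<lambda>\<alpha>. \<alpha>(l := Suc (\<alpha> l))) ` exponents (Suc l) d"
  then show "\<alpha> \<in> exponents (Suc l) (Suc d)"
  proof
    assume "\<alpha> \<in> (\<lambda>\<alpha>. \<alpha>(l := Suc (\<alpha> l))) ` exponents (Suc l) d"
    then obtain \<beta> where b: "\<beta> \<in> exponents (Suc l) d" "\<alpha> = \<beta>(l := Suc (\<beta> l))" by blast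
    have "(\<Sum>j<l. (\<beta>(l := Suc (\<beta> l))) j) = (\<Sum>j<l. \<beta> j)" by (intro sum.cong) auto
    then show ?thesis using b by (auto simp: exponents_def)
  qed (auto simp: exponents_def)
qed

lemma finite_exponents: "finite (exponents l d)"
proof (induction l arbitrary: d)
  case 0
  show ?case by (cases d) (simp_all add: exponents_0)
next
  case (Suc l)
  show ?case by (induction d) (simp_all add: exponents_Suc_0 exponents_Suc_Suc Suc)
qed

text \<open>The first \<open>l\<close> exponents can be chosen freely up to \<open>d\<close>; the
  last one fills up the degree \<open>l * d\<close>.\<close>

lemma card_exponents: "(d + 1) ^ l \<le> card (exponents (Suc l) (l * d))"
proof -
  define f where "f \<gamma> j = (if j < l then \<gamma> j else if j = l then l * d - (\<Sum>i<l. \<gamma> i) else 0)"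
    for \<gamma> :: "nat \<Rightarrow> nat" and j
  have "inj_on f ({..<l} \<rightarrow>\<^sub>E {..d})"
  proof (rule inj_onI)
    fix \<gamma> \<gamma>' assume g: "\<gamma> \<in> {..<l} \<rightarrow>\<^sub>E {..d}" "\<gamma>' \<in> {..<l} \<rightarrow>\<^sub>E {..d}" "f \<gamma> = f \<gamma>'"
    show "\<gamma> = \<gamma>'"
    proof (rule PiE_ext[OF g(1,2)])
      fix i assume "i \<in> {..<l}"
      then show "\<gamma> i = \<gamma>' i" using fun_cong[OF g(3), of i] by (simp add: f_def)
    qed
  qed
  moreover have "f ` ({..<l} \<rightarrow>\<^sub>E {..d}) \<subseteq> exponents (Suc l) (l * d)"
  proof (rule image_subsetI)
    fix \<gamma> assume g: "\<gamma> \<in> {..<l} \<rightarrow>\<^sub>E {..d}"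
    have "(\<Sum>i<l. \<gamma> i) \<le> (\<Sum>i<l. d)" using g by (intro sum_mono) auto
    moreover have "(\<Sum>j<l. f \<gamma> j) = (\<Sum>j<l. \<gamma> j)" by (intro sum.cong) (auto simp: f_def)
    moreover have "f \<gamma> l = l * d - (\<Sum>i<l. \<gamma> i)" by (simp add: f_def)
    ultimately show "f \<gamma> \<in> exponents (Suc l) (l * d)" by (auto simp: exponents_def f_def)
  qed
  ultimately have "card ({..<l} \<rightarrow>\<^sub>E {..d}) \<le> card (exponents (Suc l) (l * d))"
    using finite_exponents by (intro card_inj_on_le)
  then show ?thesis by (simp add: card_PiE)
qed

text \<open>Algebraic independence in homogeneous form: relations are tested one degree at a time,
  as is appropriate for forms on a cone.\<close>

definition homog_indep :: "nat \<Rightarrow> (nat \<Rightarrow> 'x \<Rightarrow> 'a::field) \<Rightarrow> 'x set \<Rightarrow> bool" where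
  "homog_indep l \<phi> C \<longleftrightarrow> (\<forall>d c. (\<forall>x\<in>C. (\<Sum>\<alpha>\<in>exponents l d. c \<alpha> * (\<Prod>j<l. \<phi> j x ^ \<alpha> j)) = 0) \<longrightarrow>
     (\<forall>\<alpha>\<in>exponents l d. c \<alpha> = 0))"

text \<open>In degree \<open>l d\<close> there are at least \<open>(d + 1)^l\<close> monomials in \<open>\<phi>\<^sub>0, \<dots>, \<phi>\<^sub>l\<close>, but they lie in a space
  of dimension \<open>O(d^r)\<close>.\<close>

lemma homog_indep_le:
  fixes \<phi> :: "nat \<Rightarrow> (nat \<Rightarrow> 'a::field) \<Rightarrow> 'a"
  assumes ind: "homog_indep (Suc l) \<phi> UNIV" and tp: "\<And>j. j \<le> l \<Longrightarrow> \<phi> j \<in> tpoly r"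
  shows "l \<le> r"
proof (rule ccontr)
  assume "\<not> l \<le> r"
  have "\<forall>j\<in>{..l}. \<exists>D. \<phi> j \<in> fs.span (box_monomials r D)" using tpoly_in_span_box tp by blast
  from bchoice[OF this] obtain Df where Df: "\<And>j. j \<le> l \<Longrightarrow> \<phi> j \<in> fs.span (box_monomials r (Df j))" by auto
  define D where "D = Max (Df ` {..l})"
  have D: "\<phi> j \<in> fs.span (box_monomials r D)" if "j < Suc l" for j
  proof -
    have "Df j \<le> D" unfolding D_def using that by (intro Max_ge) auto
    from subsetD[OF fs.span_mono[OF box_monomials_mono[OF this]] Df] that show ?thesis by simp
  qed
  have bound: "(d + 1) ^ l \<le> (D * (l * d) + 1) ^ r" for d
  proof -
    have "card (exponents (Suc l) (l * d)) \<le> card (box_monomials r (D * (l * d)) :: ((nat \<Rightarrow> 'a) \<Rightarrow> 'a) set)"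
    proof (rule family_card_le[where \<psi> = "\<lambda>\<alpha> t. \<Prod>j<Suc l. \<phi> j t ^ \<alpha> j"])
      fix \<alpha> assume "\<alpha> \<in> exponents (Suc l) (l * d)"
      then have "(\<Sum>j<Suc l. \<alpha> j) = l * d" by (simp add: exponents_def)
      moreover have "\<forall>j<Suc l. \<phi> j \<in> fs.span (box_monomials r D)" using D by blast
      note span_box_prod[OF this, of \<alpha>]
      ultimately show "(\<lambda>t. \<Prod>j<Suc l. \<phi> j t ^ \<alpha> j) \<in> fs.span (box_monomials r (D * (l * d)))" by simp
    next
      fix u assume "\<And>x. (\<Sum>i\<in>exponents (Suc l) (l * d). u i * (\<Prod>j<Suc l. \<phi> j x ^ i j)) = 0"
      then show "\<forall>i\<in>exponents (Suc l) (l * d). u i = 0"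
        using ind unfolding homog_indep_def by blast
    qed (rule finite_exponents finite_box_monomials)+
    also have "\<dots> \<le> (D * (l * d) + 1) ^ r" by (rule card_box_monomials)
    finally show ?thesis using card_exponents[of d l] by simp
  qed
  \<comment> \<open>Chosen so that the upper bound at \<open>d = c\<close> is at most
    \<open>c * (c + 1) ^ r\<close>, which is less than \<open>(c + 1) ^ Suc r\<close>.\<close>
  define c where "c = (D * l + 1) ^ r"
  have "(c + 1) ^ Suc r \<le> (c + 1) ^ l" using \<open>\<not> l \<le> r\<close> by (intro power_increasing) auto
  also have "\<dots> \<le> (D * (l * c) + 1) ^ r" by (rule bound)
  also have "\<dots> \<le> ((D * l + 1) * (c + 1)) ^ r" by (intro power_mono) (auto simp: algebra_simps)
  also have "\<dots> = c * (c + 1) ^ r" by (simp only: power_mult_distrib c_def)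
  finally show False by simp
qed

text \<open>Restricting a relation of minimal degree to \<open>C l\<close>, where \<open>\<phi> l\<close> vanishes, shows that it is
  divisible by \<open>\<phi> l\<close>.\<close>

lemma homog_indep_chain:
  fixes \<phi> :: "nat \<Rightarrow> 'x \<Rightarrow> 'a::field"
  assumes C: "\<And>i. i < L \<Longrightarrow> C i \<subseteq> C (Suc i)" "C 0 \<noteq> {}"
    and van: "\<And>i x. i < L \<Longrightarrow> x \<in> C i \<Longrightarrow> \<phi> i x = 0"
    and cancel: "\<And>i d c. i < L \<Longrightarrow>
      (\<And>x. x \<in> C (Suc i) \<Longrightarrow> \<phi> i x * (\<Sum>\<alpha>\<in>exponents (Suc i) d. c \<alpha> * (\<Prod>j<Suc i. \<phi> j x ^ \<alpha> j)) = 0) \<Longrightarrow>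
      (\<And>x. x \<in> C (Suc i) \<Longrightarrow> (\<Sum>\<alpha>\<in>exponents (Suc i) d. c \<alpha> * (\<Prod>j<Suc i. \<phi> j x ^ \<alpha> j)) = 0)"
    and "l \<le> L"
  shows "homog_indep l \<phi> (C l)"
  using \<open>l \<le> L\<close>
proof (induction l)
  case 0
  show ?case
    unfolding homog_indep_def
  proof (intro allI impI)
    fix d :: nat and c :: "(nat \<Rightarrow> nat) \<Rightarrow> 'a"
    assume "\<forall>x\<in>C 0. (\<Sum>\<alpha>\<in>exponents 0 d. c \<alpha> * (\<Prod>j<0. \<phi> j x ^ \<alpha> j)) = 0"
    then show "\<forall>\<alpha>\<in>exponents 0 d. c \<alpha> = 0" using C(2) by (cases d) (auto simp: exponents_0)
  qed
next
  case (Suc l)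
  then have l: "l < L" and IH: "homog_indep l \<phi> (C l)" by auto
  have "\<exists>x. x \<in> C (Suc l)"
  proof -
    have "n \<le> L \<Longrightarrow> C n \<noteq> {}" for n
    proof (induction n)
      case (Suc n)
      then show ?case using C(1)[of n] by auto
    qed (use C(2) in simp)
    from this[of "Suc l"] l show ?thesis by auto
  qed
  then obtain x0 where x0: "x0 \<in> C (Suc l)" by blast
  have "\<forall>\<alpha>\<in>exponents (Suc l) d. c \<alpha> = 0"
    if "\<And>x. x \<in> C (Suc l) \<Longrightarrow> (\<Sum>\<alpha>\<in>exponents (Suc l) d. c \<alpha> * (\<Prod>j<Suc l. \<phi> j x ^ \<alpha> j)) = 0" for d c
    using that
  proof (induction d arbitrary: c)
    case 0
    from 0[OF x0] show ?case by (simp add: exponents_Suc_0)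
  next
    case (Suc d)
    define up where "up = (\<lambda>\<alpha> :: nat \<Rightarrow> nat. \<alpha>(l := Suc (\<alpha> l)))"
    have inj: "inj_on up A" for A
    proof (rule inj_onI)
      fix \<alpha> \<beta> assume e: "up \<alpha> = up \<beta>"
      show "\<alpha> = \<beta>"
      proof
        fix j show "\<alpha> j = \<beta> j" using fun_cong[OF e, of j] by (cases "j = l") (auto simp: up_def)
      qed
    qed
    have disj: "exponents l (Suc d) \<inter> up ` exponents (Suc l) d = {}"
      by (auto simp: exponents_def up_def)
    have low: "(\<Prod>j<Suc l. \<phi> j x ^ \<alpha> j) = (\<Prod>j<l. \<phi> j x ^ \<alpha> j)" if "\<alpha> \<in> exponents l (Suc d)" for \<alpha> x
      using that by (simp add: exponents_def)
    have high: "(\<Prod>j<Suc l. \<phi> j x ^ up \<alpha> j) = \<phi> l x * (\<Prod>j<Suc l. \<phi> j x ^ \<alpha> j)" for \<alpha> x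
    proof -
      have "(\<Prod>j<l. \<phi> j x ^ up \<alpha> j) = (\<Prod>j<l. \<phi> j x ^ \<alpha> j)" by (intro prod.cong) (auto simp: up_def)
      then show ?thesis by (simp add: up_def algebra_simps)
    qed
    have split: "(\<Sum>\<alpha>\<in>exponents (Suc l) (Suc d). c \<alpha> * (\<Prod>j<Suc l. \<phi> j x ^ \<alpha> j)) =
        (\<Sum>\<alpha>\<in>exponents l (Suc d). c \<alpha> * (\<Prod>j<l. \<phi> j x ^ \<alpha> j)) +
        \<phi> l x * (\<Sum>\<alpha>\<in>exponents (Suc l) d. c (up \<alpha>) * (\<Prod>j<Suc l. \<phi> j x ^ \<alpha> j))" for x
    proof -
      have "(\<Sum>\<alpha>\<in>exponents (Suc l) (Suc d). c \<alpha> * (\<Prod>j<Suc l. \<phi> j x ^ \<alpha> j)) =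
        (\<Sum>\<alpha>\<in>exponents l (Suc d). c \<alpha> * (\<Prod>j<Suc l. \<phi> j x ^ \<alpha> j)) +
        (\<Sum>\<alpha>\<in>up ` exponents (Suc l) d. c \<alpha> * (\<Prod>j<Suc l. \<phi> j x ^ \<alpha> j))"
        unfolding exponents_Suc_Suc up_def[symmetric]
        by (rule sum.union_disjoint) (use disj finite_exponents in auto)
      also have "(\<Sum>\<alpha>\<in>exponents l (Suc d). c \<alpha> * (\<Prod>j<Suc l. \<phi> j x ^ \<alpha> j)) =
        (\<Sum>\<alpha>\<in>exponents l (Suc d). c \<alpha> * (\<Prod>j<l. \<phi> j x ^ \<alpha> j))"
        by (intro sum.cong refl) (simp only: low)
      also have "(\<Sum>\<alpha>\<in>up ` exponents (Suc l) d. c \<alpha> * (\<Prod>j<Suc l. \<phi> j x ^ \<alpha> j)) =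
        \<phi> l x * (\<Sum>\<alpha>\<in>exponents (Suc l) d. c (up \<alpha>) * (\<Prod>j<Suc l. \<phi> j x ^ \<alpha> j))"
        unfolding sum.reindex[OF inj] o_def high by (simp add: sum_distrib_left algebra_simps)
      finally show ?thesis .
    qed
    have "(\<Sum>\<alpha>\<in>exponents l (Suc d). c \<alpha> * (\<Prod>j<l. \<phi> j x ^ \<alpha> j)) = 0" if x: "x \<in> C l" for x
      using split[of x] Suc.prems[of x] van[OF l x] C(1)[OF l] x by auto
    then have low0: "c \<alpha> = 0" if "\<alpha> \<in> exponents l (Suc d)" for \<alpha>
      using IH that unfolding homog_indep_def by blast
    have "\<phi> l x * (\<Sum>\<alpha>\<in>exponents (Suc l) d. c (up \<alpha>) * (\<Prod>j<Suc l. \<phi> j x ^ \<alpha> j)) = 0" if "x \<in> C (Suc l)" for x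
      using split[of x] Suc.prems[OF that] low0 by simp
    note cancel[OF l this]
    from Suc.IH[OF this] have "c (up \<alpha>) = 0" if "\<alpha> \<in> exponents (Suc l) d" for \<alpha>
      using that by blast
    with low0 show ?case unfolding exponents_Suc_Suc up_def[symmetric] by blast
  qed
  then show ?case unfolding homog_indep_def by blast
qed

section \<open>Zariski closures and dimension of parametrized sets\<close>

lemma homogD: "f \<in> homog d \<Longrightarrow> f \<in> polys" "f \<in> homog d \<Longrightarrow> f (c *s v) = c ^ d * f v"
  by (auto simp: homog_def)

lemma homog_const: "(\<lambda>_. a) \<in> homog 0"
  by (auto simp: homog_def polys_def intro: poly_funs.const)

lemma homog_scale: "f \<in> homog d \<Longrightarrow> (\<lambda>v. a * f v) \<in> homog d"
  using homog_mult[OF homog_const, of f d a] by simp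

lemma homog_add: "f \<in> homog d \<Longrightarrow> g \<in> homog d \<Longrightarrow> (\<lambda>v. f v + g v) \<in> homog d"
  by (auto simp: homog_def polys_def algebra_simps intro: poly_funs.add)

lemma homog_zero: "(\<lambda>_. 0) \<in> homog d"
  by (auto simp: homog_def polys_def intro: poly_funs.const)

lemma homog_sum: "(\<And>i. i \<in> I \<Longrightarrow> f i \<in> homog d) \<Longrightarrow> (\<lambda>v. \<Sum>i\<in>I. f i v) \<in> homog d"
  by (induction I rule: infinite_finite_induct) (simp_all add: homog_zero homog_add)

lemma homog_power: "f \<in> homog d \<Longrightarrow> (\<lambda>v. f v ^ n) \<in> homog (n * d)"
proof (induction n)
  case 0
  show ?case using homog_const[of 1] by simp
next
  case (Suc n)
  from homog_mult[OF Suc.prems Suc.IH[OF Suc.prems]] show ?case by simp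
qed

lemma homog_prod: "(\<And>i. i \<in> I \<Longrightarrow> f i \<in> homog (d i)) \<Longrightarrow> (\<lambda>v. \<Prod>i\<in>I. f i v) \<in> homog (\<Sum>i\<in>I. d i)"
proof (induction I rule: infinite_finite_induct)
  case (insert i I)
  then have "(\<lambda>v. f i v * (\<Prod>i\<in>I. f i v)) \<in> homog (d i + (\<Sum>i\<in>I. d i))" by (intro homog_mult) auto
  then show ?case using insert(1,2) by simp
qed (simp_all add: homog_const)

definition lf :: "'a::field ^ 'k \<Rightarrow> 'a ^ 'k \<Rightarrow> 'a" where
  "lf a v = (\<Sum>i\<in>UNIV. a $ i * v $ i)"

lemma lf_add: "lf a (v + w) = lf a v + lf a w"
  and lf_scale: "lf a (c *s v) = c * lf a v"
  and lf_zero: "lf a 0 = 0"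
  by (simp_all add: lf_def algebra_simps sum.distrib sum_distrib_left)

lemma lf_diff: "lf a (v - w) = lf a v - lf a w"
  by (simp add: lf_def algebra_simps sum_subtractf)

lemma lf_axis: "lf (axis i 1) v = v $ i"
  by (simp add: lf_def axis_def if_distrib[of "\<lambda>x. x * _"] cong: if_cong)

lemma lf_sum: "lf a (\<Sum>i\<in>I. f i) = (\<Sum>i\<in>I. lf a (f i))"
  by (induction I rule: infinite_finite_induct) (simp_all add: lf_zero lf_add)

lemma coord_homog: "(\<lambda>v. v $ i) \<in> homog 1"
  by (auto simp: homog_def polys_def intro: poly_funs.coord)

lemma lf_homog: "lf a \<in> homog 1"
proof -
  have "lf a = (\<lambda>v. \<Sum>i\<in>UNIV. a $ i * v $ i)" by (simp add: lf_def fun_eq_iff)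
  then show ?thesis by (simp only:) (intro homog_sum homog_scale coord_homog)
qed

lemma linear_functional_lf:
  fixes f :: "'a::field ^ 'k \<Rightarrow> 'a"
  assumes "\<And>v w. f (v + w) = f v + f w" "\<And>c v. f (c *s v) = c * f v"
  shows "f v = lf (\<chi> i. f (axis i 1)) v"
proof -
  have f0: "f 0 = 0" using assms(2)[of 0 0] by simp
  have "f (\<Sum>i\<in>S. v $ i *s axis i 1) = (\<Sum>i\<in>S. v $ i * f (axis i 1))" for S :: "'k set"
    by (induction S rule: infinite_finite_induct) (simp_all add: f0 assms)
  from this[of UNIV] show ?thesis by (simp add: lf_def basis_expansion mult.commute)
qed

lemma zero_at_point_iff:
  assumes "f \<in> homog d"
  shows "(\<forall>u\<in>vec.span {v}. f u = 0) \<longleftrightarrow> f v = 0"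
proof
  assume "\<forall>u\<in>vec.span {v}. f u = 0"
  then show "f v = 0" using vec.span_base[of v "{v}"] by simp
qed (auto simp: in_span_singleton_iff homogD(2)[OF assms])

lemma span_in_zero_locus_iff:
  assumes "f \<in> homog d" "v \<noteq> 0"
  shows "vec.span {v} \<in> zero_locus {f} \<longleftrightarrow> f v = 0"
  using zero_at_point_iff[OF assms(1)] span_singleton_in_proj[OF assms(2)] by (auto simp: zero_locus_def)

lemma closedin_zero_locus: "f \<in> homog d \<Longrightarrow> closedin zariski (zero_locus {f})"
  unfolding closedin_zariski by (intro exI[of _ "{f}"]) auto

lemma projE:
  assumes "x \<in> proj UNIV"
  obtains v where "v \<noteq> 0" "x = vec.span {v}"
  using assms by (auto simp: proj_def)

lemma closedin_zariski_point:
  assumes "closedin zariski Z" "v \<noteq> 0"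
    and "\<And>d f. f \<in> homog d \<Longrightarrow> Z \<subseteq> zero_locus {f} \<Longrightarrow> f v = 0"
  shows "vec.span {v} \<in> Z"
proof -
  obtain S where S: "S \<subseteq> (\<Union>d. homog d)" "Z = zero_locus S" using assms(1) closedin_zariski by blast
  have "f u = 0" if f: "f \<in> S" and u: "u \<in> vec.span {v}" for f u
  proof -
    obtain d where d: "f \<in> homog d" using S(1) f by blast
    have "Z \<subseteq> zero_locus {f}" using S(2) f by (auto simp: zero_locus_def)
    from assms(3)[OF d this] u zero_at_point_iff[OF d] show ?thesis by blast
  qed
  then show ?thesis unfolding S(2) using span_singleton_in_proj[OF assms(2)] by (simp add: zero_locus_def)
qed

lemma closure_point_iff:
  assumes "S \<subseteq> proj UNIV" "v \<noteq> 0"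
  shows "vec.span {v} \<in> zariski closure_of S \<longleftrightarrow>
    (\<forall>d. \<forall>f\<in>homog d. S \<subseteq> zero_locus {f} \<longrightarrow> f v = 0)"
proof
  assume v: "vec.span {v} \<in> zariski closure_of S"
  show "\<forall>d. \<forall>f\<in>homog d. S \<subseteq> zero_locus {f} \<longrightarrow> f v = 0"
  proof (intro allI ballI impI)
    fix d f assume f: "f \<in> homog d" "S \<subseteq> zero_locus {f}"
    have "zariski closure_of S \<subseteq> zero_locus {f}"
      by (rule closure_of_minimal[OF f(2) closedin_zero_locus[OF f(1)]])
    then show "f v = 0" using v span_in_zero_locus_iff[OF f(1) assms(2)] by blast
  qed
next
  assume *: "\<forall>d. \<forall>f\<in>homog d. S \<subseteq> zero_locus {f} \<longrightarrow> f v = 0"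
  show "vec.span {v} \<in> zariski closure_of S"
  proof (rule closedin_zariski_point[OF closedin_closure_of assms(2)])
    fix d f assume f: "f \<in> homog d" "zariski closure_of S \<subseteq> zero_locus {f}"
    have "S \<subseteq> zariski closure_of S" by (rule closure_of_subset) (simp add: topspace_zariski assms(1))
    with f(2) have "S \<subseteq> zero_locus {f}" by blast
    with * f(1) show "f v = 0" by blast
  qed
qed

section \<open>Sets parametrized by polynomials: closure, irreducibility, dimension\<close>

definition pts :: "('x \<Rightarrow> 'a::field ^ 'k) \<Rightarrow> ('a ^ 'k) set set" where
  "pts \<psi> = range (\<lambda>t. vec.span {\<psi> t})"

lemma pts_subset_proj: "(\<And>t. \<psi> t \<noteq> 0) \<Longrightarrow> pts \<psi> \<subseteq> proj UNIV"
  by (auto simp: pts_def span_singleton_in_proj)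

lemma pts_subset_zero_locus_iff:
  assumes "f \<in> homog d" "\<And>t. \<psi> t \<noteq> 0"
  shows "pts \<psi> \<subseteq> zero_locus {f} \<longleftrightarrow> (\<forall>t. f (\<psi> t) = 0)"
  unfolding pts_def image_subset_iff using span_in_zero_locus_iff[OF assms(1) assms(2)] by simp

lemma closure_pts_iff:
  assumes "\<And>t. \<psi> t \<noteq> 0" "v \<noteq> 0"
  shows "vec.span {v} \<in> zariski closure_of (pts \<psi>) \<longleftrightarrow>
    (\<forall>d. \<forall>f\<in>homog d. (\<forall>t. f (\<psi> t) = 0) \<longrightarrow> f v = 0)"
  using closure_point_iff[OF pts_subset_proj assms(2), of \<psi>, OF assms(1)]
    pts_subset_zero_locus_iff[of _ _ \<psi>, OF _ assms(1)] by blast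

lemma closure_ptsD:
  assumes "vec.span {v} \<in> zariski closure_of (pts \<psi>)" "v \<noteq> 0" "\<And>t. \<psi> t \<noteq> 0"
    and "f \<in> homog d" "\<And>t. f (\<psi> t) = 0"
  shows "f v = 0"
  using closure_pts_iff[of \<psi> v, OF assms(3,2)] assms(1,4,5) by blast

lemma pts_subset_closure: "(\<And>t. \<psi> t \<noteq> 0) \<Longrightarrow> pts \<psi> \<subseteq> zariski closure_of (pts \<psi>)"
  by (rule closure_of_subset) (simp add: topspace_zariski pts_subset_proj)

lemma closure_subset_proj: "zariski closure_of S \<subseteq> proj UNIV"
  using closure_of_subset_topspace[of zariski S] by (simp add: topspace_zariski)

lemma polys_compose:
  assumes "f \<in> polys" "\<And>i. (\<lambda>t. \<psi> t $ i) \<in> poly_funs C"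
  shows "(\<lambda>t. f (\<psi> t)) \<in> poly_funs C"
  using assms(1) unfolding polys_def
  by induction (auto intro: poly_funs.intros assms(2))

lemma tpoly_path:
  fixes f :: "(nat \<Rightarrow> 'a::field) \<Rightarrow> 'a"
  assumes "f \<in> tpoly r"
  shows "polyf (\<lambda>s. f (\<lambda>i. t i + s * (t' i - t i)))"
proof -
  have "\<exists>p. \<forall>s. poly p s = f (\<lambda>i. t i + s * (t' i - t i))"
    using assms unfolding tpoly_def
  proof (rule poly_funs_path)
    fix c :: "(nat \<Rightarrow> 'a) \<Rightarrow> 'a" assume "c \<in> {\<lambda>t. t i | i. i < r}"
    then obtain i where "c = (\<lambda>t. t i)" by blast
    then show "\<exists>p. \<forall>s. poly p s = c (\<lambda>i. t i + s * (t' i - t i))"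
      by (intro exI[of _ "[:t i, t' i - t i:]"]) simp
  qed
  then show ?thesis unfolding polyf_def .
qed

lemma polyf_nonzero_both:
  fixes f g :: "'a::field_char_0 \<Rightarrow> 'a"
  assumes "polyf f" "polyf g" "f a \<noteq> 0" "g b \<noteq> 0"
  shows "\<exists>s. f s * g s \<noteq> 0"
proof -
  obtain p q where pq: "\<And>s. poly p s = f s" "\<And>s. poly q s = g s" using assms(1,2) unfolding polyf_def by blast
  have "p * q \<noteq> 0" using pq(1)[of a] pq(2)[of b] assms(3,4) by auto
  then obtain s where "poly (p * q) s \<noteq> 0" using poly_all_0_iff_0 by blast
  then show ?thesis using pq by auto
qed

text \<open>Join a parameter where \<open>f\<close> does not vanish to one where \<open>g\<close>
  does not; on this line both are non-zero polynomials of one variable.\<close>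

lemma tpoly_mult_eq_0:
  fixes f g :: "(nat \<Rightarrow> 'a::field_char_0) \<Rightarrow> 'a"
  assumes "f \<in> tpoly r" "g \<in> tpoly r" "\<And>t. f t * g t = 0"
  shows "(\<forall>t. f t = 0) \<or> (\<forall>t. g t = 0)"
proof (rule ccontr)
  assume "\<not> ?thesis"
  then obtain t t' where t: "f t \<noteq> 0" "g t' \<noteq> 0" by blast
  have "\<exists>s. f (\<lambda>i. t i + s * (t' i - t i)) * g (\<lambda>i. t i + s * (t' i - t i)) \<noteq> 0"
    by (rule polyf_nonzero_both[OF tpoly_path[OF assms(1)] tpoly_path[OF assms(2)], where a = 0 and b = 1])
      (use t in simp_all)
  then show False using assms(3) by blast
qed

definition tparam :: "nat \<Rightarrow> ((nat \<Rightarrow> 'a::field) \<Rightarrow> 'a ^ 'k) \<Rightarrow> bool" where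
  "tparam r \<psi> \<longleftrightarrow> (\<forall>i. (\<lambda>t. \<psi> t $ i) \<in> tpoly r) \<and> (\<forall>t. \<psi> t \<noteq> 0)"

lemma tparam_poly: "tparam r \<psi> \<Longrightarrow> f \<in> polys \<Longrightarrow> (\<lambda>t. f (\<psi> t)) \<in> tpoly r"
  unfolding tparam_def tpoly_def by (rule polys_compose) auto

text \<open>If neither of two closed sets covering the closure contained all parametrized points,
  forms separating points from them would pull back to non-zero polynomials with product
  zero.\<close>

lemma irreducible_param:
  fixes \<psi> :: "(nat \<Rightarrow> 'a::field_char_0) \<Rightarrow> 'a ^ 'k"
  assumes p: "tparam r \<psi>"
  shows "irreducible_in zariski (zariski closure_of (pts \<psi>))"
proof -
  have nz: "\<psi> t \<noteq> 0" for t using p by (simp add: tparam_def)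
  have sub: "pts \<psi> \<subseteq> zariski closure_of (pts \<psi>)" by (rule pts_subset_closure[OF nz])
  show ?thesis
    unfolding irreducible_in_def
  proof (intro conjI allI impI)
    show "zariski closure_of (pts \<psi>) \<subseteq> topspace zariski" by (rule closure_of_subset_topspace)
    show "zariski closure_of (pts \<psi>) \<noteq> {}" using sub by (auto simp: pts_def)
    fix A B assume AB: "closedin zariski A \<and> closedin zariski B \<and> zariski closure_of (pts \<psi>) \<subseteq> A \<union> B"
    have "pts \<psi> \<subseteq> A \<or> pts \<psi> \<subseteq> B"
    proof (rule ccontr)
      assume "\<not> ?thesis"
      then obtain t t' where t: "vec.span {\<psi> t} \<notin> A" "vec.span {\<psi> t'} \<notin> B" by (auto simp: pts_def)
      obtain d f where f: "f \<in> homog d" "A \<subseteq> zero_locus {f}" "f (\<psi> t) \<noteq> 0"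
        using closedin_zariski_point[of A, OF _ nz] AB t(1) by blast
      obtain d' g where g: "g \<in> homog d'" "B \<subseteq> zero_locus {g}" "g (\<psi> t') \<noteq> 0"
        using closedin_zariski_point[of B, OF _ nz] AB t(2) by blast
      have "f (\<psi> s) * g (\<psi> s) = 0" for s
      proof -
        have "vec.span {\<psi> s} \<in> A \<union> B" using sub AB by (auto simp: pts_def)
        then show ?thesis
          using f(2) g(2) span_in_zero_locus_iff[OF f(1) nz] span_in_zero_locus_iff[OF g(1) nz] by auto
      qed
      from tpoly_mult_eq_0[OF tparam_poly[OF p homogD(1)[OF f(1)]] tparam_poly[OF p homogD(1)[OF g(1)]] this]
      show False using f(3) g(3) by blast
    qed
    then show "zariski closure_of (pts \<psi>) \<subseteq> A \<or> zariski closure_of (pts \<psi>) \<subseteq> B"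
      using AB closure_of_minimal by blast
  qed
qed

lemma irreducible_in_subtopology:
  assumes "irreducible_in (subtopology T Q) Z"
  shows "irreducible_in T Z"
proof -
  have Z: "Z \<subseteq> topspace T \<inter> Q" "Z \<noteq> {}" using assms by (auto simp: irreducible_in_def)
  show ?thesis
    unfolding irreducible_in_def
  proof (intro conjI allI impI)
    fix A B assume AB: "closedin T A \<and> closedin T B \<and> Z \<subseteq> A \<union> B"
    then have "closedin (subtopology T Q) (A \<inter> Q)" "closedin (subtopology T Q) (B \<inter> Q)"
      by (auto simp: closedin_subtopology)
    moreover have "Z \<subseteq> (A \<inter> Q) \<union> (B \<inter> Q)" using AB Z by auto
    ultimately show "Z \<subseteq> A \<or> Z \<subseteq> B" using assms unfolding irreducible_in_def by blast
  qed (use Z in auto)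
qed

lemma irreducible_in_subtopologyI:
  assumes "irreducible_in T Z" "closedin T Q" "Z \<subseteq> Q"
  shows "irreducible_in (subtopology T Q) Z"
  using assms unfolding irreducible_in_def by (auto simp: closedin_closed_subtopology)

lemma homog_monomial_sum:
  fixes \<phi> :: "nat \<Rightarrow> 'a::field ^ 'k \<Rightarrow> 'a"
  assumes "\<And>j. j < l \<Longrightarrow> \<phi> j \<in> homog E"
  shows "(\<lambda>v. \<Sum>\<alpha>\<in>exponents l d. c \<alpha> * (\<Prod>j<l. \<phi> j v ^ \<alpha> j)) \<in> homog (d * E)"
proof (intro homog_sum homog_scale)
  fix \<alpha> assume "\<alpha> \<in> exponents l d"
  then have "(\<Sum>j<l. \<alpha> j * E) = d * E" by (simp add: exponents_def sum_distrib_right[symmetric])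
  moreover have "(\<lambda>v. \<Prod>j<l. \<phi> j v ^ \<alpha> j) \<in> homog (\<Sum>j<l. \<alpha> j * E)"
    by (intro homog_prod homog_power assms) simp
  ultimately show "(\<lambda>v. \<Prod>j<l. \<phi> j v ^ \<alpha> j) \<in> homog (d * E)" by simp
qed

text \<open>Each step of the chain yields a form vanishing on the smaller set but not on the larger
  one. Brought to equal degree, these forms admit no homogeneous relation on \<open>Z l\<close> by
  \<open>homog_indep_chain\<close>, where irreducibility provides the cancellation; pulled back to
  the parameters, they are bounded in number by \<open>homog_indep_le\<close>.\<close>

lemma chain_length_le:
  fixes \<psi> :: "(nat \<Rightarrow> 'a::field_char_0) \<Rightarrow> 'a ^ 'k"
  assumes p: "tparam r \<psi>"
    and Z: "\<And>i. i \<le> l \<Longrightarrow> closedin zariski (Z i) \<and> irreducible_in zariski (Z i)"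
    and sub: "\<And>i. i < l \<Longrightarrow> Z i \<subset> Z (Suc i)" and top: "Z l \<subseteq> zariski closure_of (pts \<psi>)"
  shows "l \<le> r"
proof -
  have nz: "\<psi> t \<noteq> 0" for t using p by (simp add: tparam_def)
  \<comment> \<open>The empty set in front provides a form for \<open>Z 0\<close> as well, hence
    \<open>l + 1\<close> forms for a chain of length \<open>l\<close>.\<close>
  define Z' where "Z' i = (case i of 0 \<Rightarrow> {} | Suc j \<Rightarrow> Z j)" for i
  have Z'_sub: "Z' i \<subset> Z' (Suc i)" if "i \<le> l" for i
    using Z[of 0] sub that by (cases i) (auto simp: Z'_def irreducible_in_def)
  have Z'_closed: "closedin zariski (Z' i)" if "i \<le> Suc l" for i
    using Z that by (cases i) (auto simp: Z'_def)
  have "\<forall>i\<in>{..l}. \<exists>f d v. f \<in> homog (Suc d) \<and> Z' i \<subseteq> zero_locus {f} \<and> v \<noteq> 0 \<and> vec.span {v} \<in> Z i \<and> f v \<noteq> 0"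
  proof
    fix i assume "i \<in> {..l}"
    then have i: "i \<le> l" by simp
    obtain x where x: "x \<in> Z i" "x \<notin> Z' i" using Z'_sub[OF i] by (auto simp: Z'_def)
    have "x \<in> proj UNIV" using Z[OF i] x(1) by (auto simp: irreducible_in_def topspace_zariski)
    then obtain v where v: "v \<noteq> 0" "x = vec.span {v}" by (rule projE)
    obtain d f where f: "f \<in> homog d" "Z' i \<subseteq> zero_locus {f}" "f v \<noteq> 0"
      using closedin_zariski_point[OF Z'_closed v(1), of i] i x(2) v(2) by auto
    obtain k where k: "v $ k \<noteq> 0" using v(1) by (auto simp: vec_eq_iff)
    \<comment> \<open>The extra coordinate makes the degree positive, so that a common degree can be
      formed and the forms vanish at the origin.\<close>
    have "(\<lambda>v. f v * v $ k) \<in> homog (d + 1)" by (intro homog_mult f coord_homog)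
    moreover have "Z' i \<subseteq> zero_locus {\<lambda>v. f v * v $ k}" using f(2) by (auto simp: zero_locus_def)
    ultimately show "\<exists>f d v. f \<in> homog (Suc d) \<and> Z' i \<subseteq> zero_locus {f} \<and> v \<noteq> 0 \<and> vec.span {v} \<in> Z i \<and> f v \<noteq> 0"
      using v x(1) f(3) k by (intro exI[of _ "\<lambda>v. f v * v $ k"] exI[of _ d] exI[of _ v]) simp
  qed
  from bchoice[OF this] obtain F where "\<forall>i\<in>{..l}. \<exists>d v. F i \<in> homog (Suc d) \<and> Z' i \<subseteq> zero_locus {F i} \<and>
    v \<noteq> 0 \<and> vec.span {v} \<in> Z i \<and> F i v \<noteq> 0" by blast
  from bchoice[OF this] obtain dg where "\<forall>i\<in>{..l}. \<exists>v. F i \<in> homog (Suc (dg i)) \<and> Z' i \<subseteq> zero_locus {F i} \<and>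
    v \<noteq> 0 \<and> vec.span {v} \<in> Z i \<and> F i v \<noteq> 0" by blast
  from bchoice[OF this] obtain w where F: "\<And>i. i \<le> l \<Longrightarrow> F i \<in> homog (Suc (dg i))"
    "\<And>i. i \<le> l \<Longrightarrow> Z' i \<subseteq> zero_locus {F i}"
    and w: "\<And>i. i \<le> l \<Longrightarrow> w i \<noteq> 0" "\<And>i. i \<le> l \<Longrightarrow> vec.span {w i} \<in> Z i" "\<And>i. i \<le> l \<Longrightarrow> F i (w i) \<noteq> 0"
    by auto
  \<comment> \<open>A common multiple of all degrees; suitable powers of the forms then have degree
    \<open>E\<close>.\<close>
  define E where "E = (\<Prod>i\<le>l. Suc (dg i))"
  define \<phi> where "\<phi> i v = F i v ^ (E div Suc (dg i))" for i v
  have E0: "E > 0" by (simp add: E_def)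
  have dvdE: "Suc (dg i) dvd E" if "i \<le> l" for i
    unfolding E_def using that by (intro dvd_prodI) auto
  have hom: "\<phi> i \<in> homog E" if "i \<le> l" for i
    using homog_power[OF F(1)[OF that], of "E div Suc (dg i)"]
    unfolding dvd_div_mult_self[OF dvdE[OF that]] \<phi>_def[abs_def] .
  have pos: "E div Suc (dg i) > 0" if "i \<le> l" for i
    using dvd_imp_le[OF dvdE[OF that] E0] by (simp add: div_greater_zero_iff)
  have zero: "\<phi> i v = 0" if "i \<le> l" "vec.span {v} \<in> Z' i" "v \<noteq> 0" for i v
    using F(2)[OF that(1)] that span_in_zero_locus_iff[OF F(1) that(3), OF that(1)] pos[OF that(1)]
    by (auto simp: \<phi>_def)
  have nonzero: "\<phi> i (w i) \<noteq> 0" if "i \<le> l" for i using w(3)[OF that] by (simp add: \<phi>_def)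
  \<comment> \<open>Affine cones; adding the origin keeps the cone over the empty set
    non-empty.\<close>
  define C where "C i = insert 0 {v. v \<noteq> 0 \<and> vec.span {v} \<in> Z' i}" for i
  have cancel: "P x = 0" if i: "i \<le> l" and P: "P \<in> homog m" and x: "x \<in> C (Suc i)"
      and eq: "\<And>x. x \<in> C (Suc i) \<Longrightarrow> \<phi> i x * P x = 0" for i P m x
  proof -
    have "Z i \<subseteq> zero_locus {\<phi> i} \<union> zero_locus {P}"
    proof
      fix y assume y: "y \<in> Z i"
      then have "y \<in> proj UNIV" using Z[OF i] by (auto simp: irreducible_in_def topspace_zariski)
      then obtain v where v: "v \<noteq> 0" "y = vec.span {v}" by (rule projE)
      then have "\<phi> i v * P v = 0" using y by (intro eq) (auto simp: C_def Z'_def)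
      then show "y \<in> zero_locus {\<phi> i} \<union> zero_locus {P}"
        using v span_in_zero_locus_iff[OF hom[OF i] v(1)] span_in_zero_locus_iff[OF P v(1)] by auto
    qed
    then have "Z i \<subseteq> zero_locus {\<phi> i} \<or> Z i \<subseteq> zero_locus {P}"
      using Z[OF i] closedin_zero_locus[OF hom[OF i]] closedin_zero_locus[OF P]
      unfolding irreducible_in_def by blast
    moreover have "\<not> Z i \<subseteq> zero_locus {\<phi> i}"
      using w(1,2)[OF i] nonzero[OF i] span_in_zero_locus_iff[OF hom[OF i] w(1)[OF i]] by blast
    ultimately have ZP: "Z i \<subseteq> zero_locus {P}" by blast
    have nzP: "P v = 0" if "v \<noteq> 0" "vec.span {v} \<in> Z i" for v
      using ZP that span_in_zero_locus_iff[OF P that(1)] by blast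
    show ?thesis
    proof (cases "x = 0")
      case True
      have "P 0 = 0 ^ m * P (w i)" using homogD(2)[OF P, of 0 "w i"] by simp
      then show ?thesis using nzP[OF w(1,2)[OF i]] True by simp
    next
      case False
      then show ?thesis using x nzP by (auto simp: C_def Z'_def)
    qed
  qed
  have "homog_indep (Suc l) \<phi> (C (Suc l))"
  proof (rule homog_indep_chain[where L = "Suc l"])
    show "C i \<subseteq> C (Suc i)" if "i < Suc l" for i using Z'_sub[of i] that by (auto simp: C_def)
    show "C 0 \<noteq> {}" by (simp add: C_def)
    show "\<phi> i x = 0" if "i < Suc l" "x \<in> C i" for i x
    proof (cases "x = 0")
      case True
      have "\<phi> i 0 = 0 ^ E * \<phi> i 0" using homogD(2)[OF hom, of i 0 0] that by simp
      then show ?thesis using E0 True by (simp add: power_0_left split: if_splits)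
    next
      case False
      then show ?thesis using zero[of i x] that by (auto simp: C_def)
    qed
    show "(\<Sum>\<alpha>\<in>exponents (Suc i) d. c \<alpha> * (\<Prod>j<Suc i. \<phi> j x ^ \<alpha> j)) = 0"
      if "i < Suc l" "\<And>x. x \<in> C (Suc i) \<Longrightarrow> \<phi> i x * (\<Sum>\<alpha>\<in>exponents (Suc i) d. c \<alpha> * (\<Prod>j<Suc i. \<phi> j x ^ \<alpha> j)) = 0"
        "x \<in> C (Suc i)" for i d c x
    proof (rule cancel[where P = "\<lambda>x. \<Sum>\<alpha>\<in>exponents (Suc i) d. c \<alpha> * (\<Prod>j<Suc i. \<phi> j x ^ \<alpha> j)" and m = "d * E"])
      show "(\<lambda>x. \<Sum>\<alpha>\<in>exponents (Suc i) d. c \<alpha> * (\<Prod>j<Suc i. \<phi> j x ^ \<alpha> j)) \<in> homog (d * E)"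
        by (rule homog_monomial_sum) (use hom that(1) in auto)
    qed (use that in auto)
  qed simp
  then have "homog_indep (Suc l) (\<lambda>j t. \<phi> j (\<psi> t)) UNIV"
    unfolding homog_indep_def
  proof (intro allI impI)
    fix d :: nat and c :: "(nat \<Rightarrow> nat) \<Rightarrow> 'a"
    assume ind: "\<forall>d c. (\<forall>x\<in>C (Suc l). (\<Sum>\<alpha>\<in>exponents (Suc l) d. c \<alpha> * (\<Prod>j<Suc l. \<phi> j x ^ \<alpha> j)) = 0) \<longrightarrow>
      (\<forall>\<alpha>\<in>exponents (Suc l) d. c \<alpha> = 0)"
      and 0: "\<forall>t\<in>UNIV. (\<Sum>\<alpha>\<in>exponents (Suc l) d. c \<alpha> * (\<Prod>j<Suc l. \<phi> j (\<psi> t) ^ \<alpha> j)) = 0"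
    define P where "P = (\<lambda>v. \<Sum>\<alpha>\<in>exponents (Suc l) d. c \<alpha> * (\<Prod>j<Suc l. \<phi> j v ^ \<alpha> j))"
    have P: "P \<in> homog (d * E)" unfolding P_def by (rule homog_monomial_sum) (use hom in auto)
    have nzP: "P v = 0" if "v \<noteq> 0" "vec.span {v} \<in> zariski closure_of (pts \<psi>)" for v
      by (rule closure_ptsD[OF that(2,1) nz P]) (use 0 in \<open>simp add: P_def\<close>)
    have "P x = 0" if "x \<in> C (Suc l)" for x
    proof (cases "x = 0")
      case True
      have "P 0 = 0 ^ (d * E) * P (w l)" using homogD(2)[OF P, of 0 "w l"] by simp
      then show ?thesis using nzP[OF w(1)[of l]] w(2)[of l] top True by auto
    next
      case False
      then show ?thesis using nzP that top by (auto simp: C_def Z'_def)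
    qed
    then show "\<forall>\<alpha>\<in>exponents (Suc l) d. c \<alpha> = 0" using ind unfolding P_def by blast
  qed
  then show ?thesis
    by (rule homog_indep_le) (use tparam_poly[OF p homogD(1)[OF hom]] in auto)
qed

lemma tpoly_cut:
  fixes f :: "(nat \<Rightarrow> 'a::field) \<Rightarrow> 'a"
  assumes "f \<in> tpoly r"
  shows "(\<lambda>t. f (\<lambda>j. if j < i then t j else 0)) \<in> tpoly r"
  using assms unfolding tpoly_def
proof induction
  case (coord c)
  then obtain j where j: "j < r" "c = (\<lambda>t. t j)" by blast
  show ?case
    using j by (cases "j < i") (auto intro: poly_funs.coord poly_funs.const)
qed (auto intro: poly_funs.intros)

text \<open>The upper bound is \<open>chain_length_le\<close>. For the lower bound more and more
  parameters are set to zero; the forms \<open>y\<close> of degree one keep the resulting closures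
  distinct.\<close>

theorem dim_param:
  fixes \<psi> :: "(nat \<Rightarrow> 'a::field_char_0) \<Rightarrow> 'a ^ 'k"
  assumes p: "tparam r \<psi>" and y: "\<And>j. j < r \<Longrightarrow> y j \<in> homog 1" "\<And>j t. j < r \<Longrightarrow> y j (\<psi> t) = t j"
  shows "dim_of (zariski closure_of (pts \<psi>)) = enat r"
proof -
  have nz: "\<psi> t \<noteq> 0" for t using p by (simp add: tparam_def)
  let ?Q = "zariski closure_of (pts \<psi>)"
  have Q: "closedin zariski ?Q" by simp
  have ub: "dim_of ?Q \<le> enat r"
    unfolding dim_of_def krull_dim_def
  proof (rule Sup_least)
    fix x assume "x \<in> {enat l | l. \<exists>Z. (\<forall>i\<le>l. closedin (subtopology zariski ?Q) (Z i) \<and>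
      irreducible_in (subtopology zariski ?Q) (Z i)) \<and> (\<forall>i<l. Z i \<subset> Z (Suc i))}"
    then obtain l Z where x: "x = enat l"
      and Z: "\<And>i. i \<le> l \<Longrightarrow> closedin (subtopology zariski ?Q) (Z i)"
        "\<And>i. i \<le> l \<Longrightarrow> irreducible_in (subtopology zariski ?Q) (Z i)" "\<And>i. i < l \<Longrightarrow> Z i \<subset> Z (Suc i)"
      by blast
    have "l \<le> r"
    proof (rule chain_length_le[OF p])
      show "closedin zariski (Z i) \<and> irreducible_in zariski (Z i)" if "i \<le> l" for i
        using Z(1,2)[OF that] irreducible_in_subtopology by (auto simp: closedin_closed_subtopology[OF Q])
      show "Z l \<subseteq> ?Q" using Z(1)[of l] by (auto simp: closedin_closed_subtopology[OF Q])
    qed (rule Z(3))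
    then show "x \<le> enat r" using x by simp
  qed
  define cut where "cut i t = (\<lambda>j. if j < i then t j else 0)" for i :: nat and t :: "nat \<Rightarrow> 'a"
  define Z where "Z i = zariski closure_of (pts (\<lambda>t. \<psi> (cut i t)))" for i
  have par: "tparam r (\<lambda>t. \<psi> (cut i t))" for i
    unfolding tparam_def
  proof (intro conjI allI)
    fix k
    show "(\<lambda>t. \<psi> (cut i t) $ k) \<in> tpoly r"
      using tpoly_cut[of "\<lambda>t. \<psi> t $ k"] p unfolding cut_def tparam_def by blast
  qed (rule nz)
  have cutr: "cut i (cut j t) = cut (min i j) t" for i j t by (auto simp: cut_def)
  have mono: "pts (\<lambda>t. \<psi> (cut i t)) \<subseteq> pts (\<lambda>t. \<psi> (cut j t))" if "i \<le> j" for i j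
  proof
    fix x assume "x \<in> pts (\<lambda>t. \<psi> (cut i t))"
    then obtain t where t: "x = vec.span {\<psi> (cut i t)}" by (auto simp: pts_def)
    have "cut j (cut i t) = cut i t" using that by (simp add: cutr min_def)
    then show "x \<in> pts (\<lambda>t. \<psi> (cut j t))" unfolding pts_def t by (intro image_eqI[where x = "cut i t"]) simp_all
  qed
  have "pts (\<lambda>t. \<psi> (cut r t)) \<subseteq> pts \<psi>" by (auto simp: pts_def)
  then have top: "Z r \<subseteq> ?Q" unfolding Z_def by (rule closure_of_mono)
  have ZQ: "Z i \<subseteq> ?Q" if "i \<le> r" for i
    using closure_of_mono[OF mono[OF that]] top unfolding Z_def by blast
  have lb: "enat r \<le> dim_of ?Q"
    unfolding dim_of_def krull_dim_def
  proof (rule Sup_upper, rule CollectI, intro exI conjI allI impI)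
    show "enat r = enat r" ..
    show "closedin (subtopology zariski ?Q) (Z i)" if "i \<le> r" for i
      using ZQ[OF that] by (simp add: closedin_closed_subtopology[OF Q] Z_def)
    show "irreducible_in (subtopology zariski ?Q) (Z i)" if "i \<le> r" for i
      using irreducible_param[OF par] ZQ[OF that] Q unfolding Z_def by (intro irreducible_in_subtopologyI)
    show "Z i \<subset> Z (Suc i)" if i: "i < r" for i
    proof
      show "Z i \<subseteq> Z (Suc i)" unfolding Z_def by (intro closure_of_mono mono) simp
      \<comment> \<open>The unit parameter of index \<open>i\<close>: \<open>y i\<close> takes the
        value one there but vanishes on \<open>Z i\<close>.\<close>
      define t where "t j = (if j = i then 1 else 0 :: 'a)" for j
      have "cut (Suc i) t = t" by (auto simp: cut_def t_def)
      then have "vec.span {\<psi> t} \<in> pts (\<lambda>t. \<psi> (cut (Suc i) t))" unfolding pts_def by (intro image_eqI[where x = t]) simp_all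
      then have "vec.span {\<psi> t} \<in> Z (Suc i)" unfolding Z_def using pts_subset_closure[OF nz] by blast
      moreover have "vec.span {\<psi> t} \<notin> Z i"
      proof
        assume "vec.span {\<psi> t} \<in> Z i"
        moreover have "\<forall>s. y i (\<psi> (cut i s)) = 0" using y(2)[OF i] by (simp add: cut_def)
        ultimately have "y i (\<psi> t) = 0"
          unfolding Z_def closure_pts_iff[of "\<lambda>t. \<psi> (cut i t)", OF nz nz] using y(1)[OF i] by blast
        then show False using y(2)[OF i] by (simp add: t_def)
      qed
      ultimately show "Z i \<noteq> Z (Suc i)" by blast
    qed
  qed
  from ub lb show ?thesis by simp
qed

text \<open>The coordinates \<open>y i\<close> are constant in direction \<open>u\<close>, so by
  \<open>van\<close> a relation between their pullbacks holds on the whole space, where they are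
  independent. With \<open>u = 0\<close> this handles an orbit dense in projective space; with
  \<open>u\<close> off a quadric it handles the projection of the quadric from
  \<open>u\<close>.\<close>

lemma coords_bound:
  fixes \<psi> :: "(nat \<Rightarrow> 'a::field_char_0) \<Rightarrow> 'a ^ 'k"
  assumes p: "tparam r \<psi>"
    and yw: "\<And>i j. i \<le> m \<Longrightarrow> j \<le> m \<Longrightarrow> lf (y i) (w j) = (if i = j then 1 else 0)"
    and ye: "\<And>i. i \<le> m \<Longrightarrow> lf (y i) u = 0"
    and van: "\<And>d f. f \<in> homog d \<Longrightarrow> (\<And>v c. f (v + c *s u) = f v) \<Longrightarrow> (\<And>t. f (\<psi> t) = 0) \<Longrightarrow> (\<And>v. f v = 0)"
  shows "m \<le> r"
proof -
  define C where "C i = vec.span (w ` {..<i})" for i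
  have van0: "lf (y i) v = 0" if "i \<le> m" "v \<in> C i" for i v
    using that(2) unfolding C_def
  proof (induction rule: vec.span_induct_alt)
    case base
    show ?case by (simp add: lf_zero)
  next
    case (step c x z)
    then obtain j where "j < i" "x = w j" by auto
    then show ?case using step yw[of i j] that(1) by (simp add: lf_add lf_scale)
  qed
  have hom: "(\<lambda>v. \<Sum>\<alpha>\<in>exponents n d. c \<alpha> * (\<Prod>j<n. lf (y j) v ^ \<alpha> j)) \<in> homog (d * 1)" for n d c
    by (rule homog_monomial_sum) (rule lf_homog)
  have "homog_indep (Suc m) (\<lambda>i. lf (y i)) (C (Suc m))"
  proof (rule homog_indep_chain[where L = "Suc m"])
    show "C i \<subseteq> C (Suc i)" for i unfolding C_def by (intro vec.span_mono) auto
    show "C 0 \<noteq> {}" by (simp add: C_def)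
    show "lf (y i) x = 0" if "i < Suc m" "x \<in> C i" for i x using van0 that by simp
    show "(\<Sum>\<alpha>\<in>exponents (Suc i) d. c \<alpha> * (\<Prod>j<Suc i. lf (y j) x ^ \<alpha> j)) = 0"
      if i: "i < Suc m" and eq: "\<And>x. x \<in> C (Suc i) \<Longrightarrow> lf (y i) x * (\<Sum>\<alpha>\<in>exponents (Suc i) d. c \<alpha> * (\<Prod>j<Suc i. lf (y j) x ^ \<alpha> j)) = 0"
        and x: "x \<in> C (Suc i)" for i d c x
    proof -
      define P where "P = (\<lambda>v. \<Sum>\<alpha>\<in>exponents (Suc i) d. c \<alpha> * (\<Prod>j<Suc i. lf (y j) v ^ \<alpha> j))"
      have "P \<in> polys" using homogD(1)[OF hom[where n = "Suc i"]] unfolding P_def .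
      from polys_line_poly[OF this, of x "w i"] have pf: "polyf (\<lambda>s. P (x + s *s w i))" by (simp add: polyf_def)
      have wi: "w i \<in> C (Suc i)" unfolding C_def by (intro vec.span_base) auto
      \<comment> \<open>Along the direction \<open>w i\<close> the factor \<open>lf (y i)\<close>
        has a single zero, so it can be cancelled on that line and the value at \<open>s = 0\<close>
        recovered.\<close>
      have "P (x + s *s w i) = 0" if "s \<notin> {- lf (y i) x}" for s
      proof -
        have "x + s *s w i \<in> C (Suc i)" using x wi unfolding C_def by (intro vec.span_add vec.span_scale)
        from eq[OF this] have "(lf (y i) x + s) * P (x + s *s w i) = 0"
          using yw[of i i] i by (simp add: P_def lf_add lf_scale)
        then show ?thesis using that by (auto simp: add_eq_0_iff)
      qed
      from polyf_eq_cofinite[OF pf polyf_const, of "{- lf (y i) x}" 0 0] this have "P x = 0" by simp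
      then show ?thesis by (simp add: P_def)
    qed
  qed simp
  then have "homog_indep (Suc m) (\<lambda>j t. lf (y j) (\<psi> t)) UNIV"
    unfolding homog_indep_def
  proof (intro allI impI)
    fix d :: nat and c :: "(nat \<Rightarrow> nat) \<Rightarrow> 'a"
    assume ind: "\<forall>d c. (\<forall>x\<in>C (Suc m). (\<Sum>\<alpha>\<in>exponents (Suc m) d. c \<alpha> * (\<Prod>j<Suc m. lf (y j) x ^ \<alpha> j)) = 0) \<longrightarrow>
      (\<forall>\<alpha>\<in>exponents (Suc m) d. c \<alpha> = 0)"
      and 0: "\<forall>t\<in>UNIV. (\<Sum>\<alpha>\<in>exponents (Suc m) d. c \<alpha> * (\<Prod>j<Suc m. lf (y j) (\<psi> t) ^ \<alpha> j)) = 0"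
    define P where "P = (\<lambda>v. \<Sum>\<alpha>\<in>exponents (Suc m) d. c \<alpha> * (\<Prod>j<Suc m. lf (y j) v ^ \<alpha> j))"
    have "P v = 0" for v
    proof (rule van)
      show "P \<in> homog (d * 1)" unfolding P_def by (rule hom)
      show "P (v + c *s u) = P v" for v c
        unfolding P_def by (intro sum.cong refl arg_cong2[where f = "(*)"] prod.cong) (simp add: lf_add lf_scale ye)
      show "P (\<psi> t) = 0" for t using 0 by (simp add: P_def)
    qed
    then show "\<forall>\<alpha>\<in>exponents (Suc m) d. c \<alpha> = 0" using ind unfolding P_def by blast
  qed
  then show ?thesis
    by (rule homog_indep_le) (use tparam_poly[OF p homogD(1)[OF lf_homog]] in auto)
qed

section \<open>Quadratic forms\<close>

lemma polys_intros:
  "(\<lambda>v. v $ i) \<in> polys" "(\<lambda>_. c) \<in> polys"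
  "f \<in> polys \<Longrightarrow> g \<in> polys \<Longrightarrow> (\<lambda>v. f v + g v) \<in> polys"
  "f \<in> polys \<Longrightarrow> g \<in> polys \<Longrightarrow> (\<lambda>v. f v * g v) \<in> polys"
  by (auto simp: polys_def intro: poly_funs.intros)

lemma polys_diff: "f \<in> polys \<Longrightarrow> g \<in> polys \<Longrightarrow> (\<lambda>v. f v - g v) \<in> polys"
  using polys_intros(3)[of f "\<lambda>v. (-1) * g v"] polys_intros(4)[OF polys_intros(2)[of "-1"], of g] by simp

lemma polys_cmult: "f \<in> polys \<Longrightarrow> (\<lambda>v. c * f v) \<in> polys"
  by (rule polys_intros(4)[OF polys_intros(2)])

lemma polys_line:
  fixes f :: "'a::field ^ 'k \<Rightarrow> 'a"
  shows "f \<in> polys \<Longrightarrow> polyf (\<lambda>t. f (v + t *s w))"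
  using polys_line_poly[of f v w] by (simp add: polyf_def)

lemma lf_polys: "lf a \<in> polys"
  by (rule homogD(1)[OF lf_homog])

text \<open>\<open>a\<close> is the gradient of \<open>f\<close> at \<open>v\<close>; one vector
  serves all directions, which makes the derivative linear in \<open>w\<close>.\<close>

lemma polys_first_order:
  fixes f :: "'a::field ^ 'k \<Rightarrow> 'a"
  assumes "f \<in> polys"
  shows "\<exists>a. \<forall>w. \<exists>p. (\<forall>t. poly p t = f (v + t *s w)) \<and> coeff p 0 = f v \<and> coeff p 1 = lf a w"
  using assms unfolding polys_def
proof induction
  case (coord c)
  then obtain i where c: "c = (\<lambda>v. v $ i)" by auto
  have "\<exists>p. (\<forall>t. poly p t = c (v + t *s w)) \<and> coeff p 0 = c v \<and> coeff p 1 = lf (axis i 1) w" for w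
    by (rule exI[of _ "[:v $ i, w $ i:]"]) (simp add: c lf_axis)
  then show ?case by blast
next
  case (const a)
  have "\<exists>p. (\<forall>t. poly p t = a) \<and> coeff p 0 = a \<and> coeff p 1 = lf 0 w" for w
    by (rule exI[of _ "[:a:]"]) (simp add: lf_def)
  then show ?case by blast
next
  case (add f g)
  then obtain a b where a: "\<And>w. \<exists>p. (\<forall>t. poly p t = f (v + t *s w)) \<and> coeff p 0 = f v \<and> coeff p 1 = lf a w"
    and b: "\<And>w. \<exists>p. (\<forall>t. poly p t = g (v + t *s w)) \<and> coeff p 0 = g v \<and> coeff p 1 = lf b w" by blast
  have "\<exists>p. (\<forall>t. poly p t = f (v + t *s w) + g (v + t *s w)) \<and> coeff p 0 = f v + g v \<and> coeff p 1 = lf (a + b) w" for w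
  proof -
    obtain p q where "\<forall>t. poly p t = f (v + t *s w)" "coeff p 0 = f v" "coeff p 1 = lf a w"
      "\<forall>t. poly q t = g (v + t *s w)" "coeff q 0 = g v" "coeff q 1 = lf b w" using a[of w] b[of w] by blast
    then show ?thesis by (intro exI[of _ "p + q"]) (simp add: lf_def algebra_simps sum.distrib)
  qed
  then show ?case by blast
next
  case (mult f g)
  then obtain a b where a: "\<And>w. \<exists>p. (\<forall>t. poly p t = f (v + t *s w)) \<and> coeff p 0 = f v \<and> coeff p 1 = lf a w"
    and b: "\<And>w. \<exists>p. (\<forall>t. poly p t = g (v + t *s w)) \<and> coeff p 0 = g v \<and> coeff p 1 = lf b w" by blast
  have "\<exists>p. (\<forall>t. poly p t = f (v + t *s w) * g (v + t *s w)) \<and> coeff p 0 = f v * g v \<and>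
    coeff p 1 = lf (f v *s b + g v *s a) w" for w
  proof -
    obtain p q where "\<forall>t. poly p t = f (v + t *s w)" "coeff p 0 = f v" "coeff p 1 = lf a w"
      "\<forall>t. poly q t = g (v + t *s w)" "coeff q 0 = g v" "coeff q 1 = lf b w" using a[of w] b[of w] by blast
    then show ?thesis
      by (intro exI[of _ "p * q"])
        (simp add: lf_def coeff_mult algebra_simps sum.distrib sum_distrib_left)
  qed
  then show ?case by blast
qed

lemma dderiv_linear:
  fixes f :: "'a::field_char_0 ^ 'k \<Rightarrow> 'a"
  assumes "f \<in> polys"
  shows "\<exists>a. \<forall>w. dderiv f v w = lf a w"
proof -
  obtain a where a: "\<And>w. \<exists>p. (\<forall>t. poly p t = f (v + t *s w)) \<and> coeff p 0 = f v \<and> coeff p 1 = lf a w"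
    using polys_first_order[OF assms] by blast
  have "dderiv f v w = lf a w" for w
  proof -
    obtain p where "\<forall>t. poly p t = f (v + t *s w)" "coeff p 1 = lf a w" using a by blast
    then show ?thesis using dderiv_eqI[of p f v w] by simp
  qed
  then show ?thesis by blast
qed

text \<open>The associated bilinear form of a quadratic form without the factor one half, so its
  diagonal is twice \<open>q\<close>.\<close>

definition polar :: "('a::field ^ 'k \<Rightarrow> 'a) \<Rightarrow> 'a ^ 'k \<Rightarrow> 'a ^ 'k \<Rightarrow> 'a" where
  "polar q v w = q (v + w) - q v - q w"

lemma polar_sym: "polar q v w = polar q w v"
  by (simp add: polar_def add.commute)

text \<open>By reversal \<open>q (v + t *s w)\<close> has degree at most two in \<open>t\<close>,
  with top coefficient \<open>q w\<close>; evaluation at \<open>t = 1\<close> leaves the polar form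
  as linear coefficient.\<close>

lemma dderiv_eq_polar:
  fixes q :: "'a::field_char_0 ^ 'k \<Rightarrow> 'a"
  assumes q: "q \<in> homog 2"
  shows "dderiv q v w = polar q v w"
proof -
  obtain p where p: "\<And>t. poly p t = q (v + t *s w)" using polys_line_poly[OF homogD(1)[OF q]] by blast
  obtain p' where p': "\<And>t. poly p' t = q (w + t *s v)" using polys_line_poly[OF homogD(1)[OF q]] by blast
  have "poly p' r = r ^ 2 * poly p (1 / r)" if "r \<noteq> 0" for r
  proof -
    have "w + r *s v = r *s (v + (1 / r) *s w)" using that by (simp add: vector_add_ldistrib)
    then show ?thesis unfolding p p' by (simp only: homogD(2)[OF q])
  qed
  note rev = poly_reversal[OF this]
  have "p = [:coeff p 0, coeff p 1, coeff p 2:]"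
  proof (rule poly_eqI)
    fix n :: nat
    consider "n = 0" | "n = 1" | "n = 2" | "n > 2" by linarith
    then show "coeff p n = coeff [:coeff p 0, coeff p 1, coeff p 2:] n"
      by cases (use rev(1) in \<open>auto simp: coeff_pCons coeff_eq_0 numeral_2_eq_2 split: nat.splits\<close>)
  qed
  then have "poly p 1 = coeff p 0 + coeff p 1 + coeff p 2"
    by (metis (no_types, lifting) add.assoc mult_1 poly_0 poly_pCons mult_zero_right add_0_right)
  moreover have "coeff p 2 = q w" using rev(2) p'[of 0] by simp
  moreover have "coeff p 0 = q v" using p[of 0] by (simp add: poly_0_coeff_0)
  moreover have "dderiv q v w = coeff p 1" by (rule dderiv_eqI[OF p])
  ultimately show ?thesis using p[of 1] by (simp add: polar_def)
qed

lemma polar_lf: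
  fixes q :: "'a::field_char_0 ^ 'k \<Rightarrow> 'a"
  assumes "q \<in> homog 2"
  shows "\<exists>a. \<forall>w. polar q v w = lf a w"
  using dderiv_linear[OF homogD(1)[OF assms], of v] dderiv_eq_polar[OF assms] by simp

context
  fixes q :: "'a::field_char_0 ^ 'k \<Rightarrow> 'a"
  assumes q: "q \<in> homog 2"
begin

lemma polar_add: "polar q v (w + w') = polar q v w + polar q v w'" "polar q (w + w') v = polar q w v + polar q w' v"
  and polar_scale: "polar q v (c *s w) = c * polar q v w" "polar q (c *s w) v = c * polar q w v"
  and polar_zero: "polar q v 0 = 0" "polar q 0 v = 0"
  using polar_lf[OF q, of v] polar_sym[of q _ v] by (auto simp: lf_add lf_scale lf_zero)

lemma polar_diff: "polar q v (w - w') = polar q v w - polar q v w'" "polar q (w - w') v = polar q w v - polar q w' v"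
  using polar_lf[OF q, of v] polar_sym[of q _ v] by (auto simp: lf_diff)

lemma polar_minus: "polar q v (- w) = - polar q v w" "polar q (- w) v = - polar q w v"
  using polar_scale[where c = "-1" and v = v and w = w] by (simp_all only: vector_sneg_minus1[symmetric] mult_minus1)

lemma polar_sum: "polar q v (\<Sum>i\<in>I. f i) = (\<Sum>i\<in>I. polar q v (f i))"
  by (induction I rule: infinite_finite_induct) (simp_all add: polar_zero polar_add)

lemma quad_zero: "q 0 = 0"
  using homogD(2)[OF q, of 0 0] by simp

lemma quad_add: "q (v + w) = q v + q w + polar q v w"
  by (simp add: polar_def)

lemma quad_scale: "q (c *s v) = c\<^sup>2 * q v"
  using homogD(2)[OF q] by blast

lemma polar_self: "polar q v v = 2 * q v"
proof -
  have "v + v = 2 *s v" by (simp add: vec_eq_iff)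
  then have "q (v + v) = 4 * q v" using quad_scale[of 2 v] by simp
  then show ?thesis by (simp add: polar_def)
qed

lemma polar_polys: "(\<lambda>v. polar q v w) \<in> polys"
proof -
  obtain a where "\<And>v. polar q w v = lf a v" using polar_lf[OF q] by blast
  then have "(\<lambda>v. polar q v w) = lf a" using polar_sym[of q _ w] by auto
  then show ?thesis using lf_polys by simp
qed

text \<open>The discriminant of \<open>q (x + t *s e)\<close> as a quadratic polynomial in
  \<open>t\<close>; it decides whether the line through \<open>x\<close> in direction
  \<open>e\<close> meets the quadric in two distinct points.\<close>

definition disc :: "'a ^ 'k \<Rightarrow> 'a ^ 'k \<Rightarrow> 'a" where
  "disc e x = (polar q x e)\<^sup>2 - 4 * q x * q e"

lemma disc_polys: "disc e \<in> polys"
proof -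
  have "(\<lambda>x. polar q x e * polar q x e - (4 * q e) * q x) \<in> polys"
    by (intro polys_diff polys_intros(4) polys_cmult polar_polys homogD(1)[OF q])
  then show ?thesis by (simp add: disc_def[abs_def] power2_eq_square algebra_simps)
qed

text \<open>If the discriminant vanished on all of \<open>W\<close>, then
  \<open>4 * q e * q v\<close> would be the square of the linear form \<open>polar q v e\<close>,
  and by reducedness \<open>q\<close> would divide that form. On the line of \<open>e\<close> this
  reads \<open>2 = t * g (t *s e)\<close> for \<open>t \<noteq> 0\<close>, which fails at
  \<open>t = 0\<close>.\<close>

lemma reduced_imp_disc:
  assumes W: "vec.subspace W" and e: "e \<in> W" "q e \<noteq> 0" and red: "reduced_on W q"
  shows "\<exists>x\<in>W. disc e x \<noteq> 0"
proof (rule ccontr)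
  assume "\<not> ?thesis"
  then have sq: "(polar q x e)\<^sup>2 = q x * (4 * q e)" if "x \<in> W" for x using that by (auto simp: disc_def algebra_simps)
  have "\<exists>g\<in>polys. \<forall>v\<in>W. polar q v e ^ 2 = q v * g v"
    by (rule bexI[of _ "\<lambda>_. 4 * q e"], intro ballI, rule sq, assumption, rule polys_intros(2))
  then have "\<exists>g\<in>polys. \<forall>v\<in>W. polar q v e = q v * g v"
    using red[unfolded reduced_on_def, rule_format, OF polar_polys] by blast
  then obtain g where g: "g \<in> polys" "\<And>v. v \<in> W \<Longrightarrow> polar q v e = q v * g v" by blast
  have "2 = t * g (0 + t *s e)" if "t \<noteq> 0" for t
  proof -
    have "t *s e \<in> W" using W e(1) by (rule vec.subspace_scale)
    from g(2)[OF this] have "t * (2 * q e) = t * q e * (t * g (t *s e))"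
      by (simp add: polar_scale polar_self quad_scale power2_eq_square algebra_simps)
    then show ?thesis using that e(2) by simp
  qed
  note eq = this
  have "2 = 0 * g (0 + 0 *s e)"
  proof (rule polyf_eq_cofinite[where S = "{0}" and f = "\<lambda>_. 2" and g = "\<lambda>t. t * g (0 + t *s e)"])
    show "polyf (\<lambda>t. t * g (0 + t *s e))" by (rule polyf_mult[OF polyf_id polys_line[OF g(1)]])
  qed (use eq in \<open>simp_all add: polyf_const\<close>)
  then show False by simp
qed

text \<open>If the quadric lay in the hyperplane of \<open>a\<close>, then \<open>q\<close> would
  have no zero on the lines \<open>v + t *s u\<close> with \<open>lf a u = 0\<close>, hence be
  constant on them. So \<open>q\<close> would be a multiple of the square of \<open>lf a\<close>,
  and its discriminant in direction \<open>v\<close> would vanish. The premise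
  \<open>no_root\<close> supplies algebraic closedness in a context that only assumes characteristic
  zero.\<close>

lemma disc_imp_span:
  assumes e: "q e \<noteq> 0" and disc: "\<And>e. q e \<noteq> 0 \<Longrightarrow> \<exists>x. disc e x \<noteq> 0"
    and no_root: "\<And>p :: 'a poly. (\<And>x. poly p x \<noteq> 0) \<Longrightarrow> \<exists>c. p = [:c:]"
    and a: "\<And>v. q v = 0 \<Longrightarrow> lf a v = 0"
  shows "lf a v = 0"
proof (rule ccontr)
  assume v: "lf a v \<noteq> 0"
  then have qv: "q v \<noteq> 0" using a by blast
  have van: "q u = 0 \<and> polar q v u = 0" if u: "lf a u = 0" for u
  proof -
    have "poly [:q v, polar q v u, q u:] t \<noteq> 0" for t
    proof -
      have "lf a (v + t *s u) \<noteq> 0" using v u by (simp add: lf_add lf_scale)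
      then have "q (v + t *s u) \<noteq> 0" using a by blast
      then show ?thesis by (simp add: quad_add quad_scale polar_scale power2_eq_square algebra_simps)
    qed
    from no_root[OF this] show ?thesis by auto
  qed
  have "disc v x = 0" for x
  proof -
    define s where "s = lf a x / lf a v"
    define u where "u = x - s *s v"
    have "lf a u = 0" using v by (simp add: u_def s_def lf_diff lf_scale)
    from van[OF this] have u0: "q u = 0" "polar q v u = 0" by auto
    have x: "x = u + s *s v" by (simp add: u_def)
    show ?thesis
      unfolding disc_def x using u0
      by (simp add: quad_add quad_scale polar_add polar_scale polar_self polar_sym[of q u v] power2_eq_square)
  qed
  then show False using disc[OF qv] by blast
qed

text \<open>Division with remainder by \<open>q\<close>, read as a polynomial of degree two in the
  variable \<open>lf a\<close> with leading coefficient \<open>q e\<close>. Invariance along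
  \<open>e\<close> expresses that \<open>r1\<close> and \<open>r0\<close> do not involve this
  variable.\<close>

lemma quad_division:
  assumes e: "q e \<noteq> 0" and l: "lf a e = 1" and f: "f \<in> polys"
  shows "\<exists>g\<in>polys. \<exists>r1\<in>polys. \<exists>r0\<in>polys. (\<forall>v c. r1 (v + c *s e) = r1 v \<and> r0 (v + c *s e) = r0 v) \<and>
    (\<forall>v. f v = q v * g v + r1 v * lf a v + r0 v)"
  using f unfolding polys_def
proof induction
  case (coord c)
  then obtain i where c: "c = (\<lambda>v. v $ i)" by auto
  show ?case
    unfolding polys_def[symmetric]
  proof (intro bexI conjI allI)
    show "c v = q v * (\<lambda>_. 0) v + (\<lambda>_. e $ i) v * lf a v + (\<lambda>v. v $ i - e $ i * lf a v) v" for v by (simp add: c)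
    show "(\<lambda>v. v $ i - e $ i * lf a v) \<in> polys"
      by (intro polys_diff polys_intros(1) polys_cmult lf_polys)
  qed (auto simp: lf_add lf_scale l algebra_simps intro: polys_intros(2))
next
  case (const a')
  show ?case
    unfolding polys_def[symmetric]
  proof (intro bexI conjI allI)
    show "a' = q v * (\<lambda>_. 0) v + (\<lambda>_. 0) v * lf a v + (\<lambda>v. a') v" for v by simp
  qed (auto intro: polys_intros(2))
next
  case (add f f')
  from add.IH(1) obtain g r1 r0 where 1: "g \<in> polys" "r1 \<in> polys" "r0 \<in> polys"
    "\<forall>v c. r1 (v + c *s e) = r1 v \<and> r0 (v + c *s e) = r0 v" "\<forall>v. f v = q v * g v + r1 v * lf a v + r0 v"
    unfolding polys_def[symmetric] by (elim bexE conjE)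
  from add.IH(2) obtain g' r1' r0' where 2: "g' \<in> polys" "r1' \<in> polys" "r0' \<in> polys"
    "\<forall>v c. r1' (v + c *s e) = r1' v \<and> r0' (v + c *s e) = r0' v" "\<forall>v. f' v = q v * g' v + r1' v * lf a v + r0' v"
    unfolding polys_def[symmetric] by (elim bexE conjE)
  note g = 1(1-3) 2(1-3) and inv = 1(4)[rule_format, THEN conjunct1] 1(4)[rule_format, THEN conjunct2]
      2(4)[rule_format, THEN conjunct1] 2(4)[rule_format, THEN conjunct2]
    and f = 1(5)[rule_format] 2(5)[rule_format]
  show ?case
    unfolding polys_def[symmetric]
  proof (intro bexI conjI allI)
    show "f v + f' v = q v * (\<lambda>v. g v + g' v) v + (\<lambda>v. r1 v + r1' v) v * lf a v + (\<lambda>v. r0 v + r0' v) v" for v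
      by (simp add: f algebra_simps)
  qed (auto simp: inv intro!: polys_intros(3) g)
next
  case (mult f f')
  from mult.IH(1) obtain g r1 r0 where 1: "g \<in> polys" "r1 \<in> polys" "r0 \<in> polys"
    "\<forall>v c. r1 (v + c *s e) = r1 v \<and> r0 (v + c *s e) = r0 v" "\<forall>v. f v = q v * g v + r1 v * lf a v + r0 v"
    unfolding polys_def[symmetric] by (elim bexE conjE)
  from mult.IH(2) obtain g' r1' r0' where 2: "g' \<in> polys" "r1' \<in> polys" "r0' \<in> polys"
    "\<forall>v c. r1' (v + c *s e) = r1' v \<and> r0' (v + c *s e) = r0' v" "\<forall>v. f' v = q v * g' v + r1' v * lf a v + r0' v"
    unfolding polys_def[symmetric] by (elim bexE conjE)
  note g = 1(1-3) 2(1-3) and inv = 1(4)[rule_format, THEN conjunct1] 1(4)[rule_format, THEN conjunct2]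
      2(4)[rule_format, THEN conjunct1] 2(4)[rule_format, THEN conjunct2]
    and f = 1(5)[rule_format] 2(5)[rule_format]
  \<comment> \<open>\<open>q\<close> equals \<open>q e\<close> times the square of
    \<open>lf a\<close>, plus \<open>B\<close> times \<open>lf a\<close>, plus \<open>N\<close>,
    with \<open>B\<close> and \<open>N\<close> constant along \<open>e\<close>. This reduces the
    square of \<open>lf a\<close> that arises in a product.\<close>
  define B where "B v = polar q v e - 2 * q e * lf a v" for v
  define N where "N v = q v - lf a v * polar q v e + q e * (lf a v * lf a v)" for v
  have B: "B \<in> polys" "B (v + c *s e) = B v" for v c
    unfolding B_def[abs_def]
    by (intro polys_diff polar_polys polys_cmult lf_polys)
      (simp add: polar_add polar_scale polar_self lf_add lf_scale l algebra_simps)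
  have N: "N \<in> polys" "N (v + c *s e) = N v" for v c
    unfolding N_def[abs_def]
    by (intro polys_diff polys_intros(3,4) polar_polys polys_cmult lf_polys homogD(1)[OF q])
      (simp add: quad_add quad_scale polar_add polar_scale polar_self lf_add lf_scale l algebra_simps power2_eq_square)
  have sq: "lf a v * lf a v = (1 / q e) * q v - (1 / q e) * B v * lf a v - (1 / q e) * N v" for v
    using e by (simp add: B_def N_def field_simps)
  define G where "G v = q v * (g v * g' v) + (g v * (r1' v * lf a v + r0' v) + g' v * (r1 v * lf a v + r0 v)) + (1 / q e) * (r1 v * r1' v)" for v
  define R1 where "R1 v = (r1 v * r0' v + r0 v * r1' v) - (1 / q e) * (r1 v * r1' v * B v)" for v
  define R0 where "R0 v = r0 v * r0' v - (1 / q e) * (r1 v * r1' v * N v)" for v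
  show ?case
    unfolding polys_def[symmetric]
  proof (intro bexI conjI allI)
    show "f v * f' v = q v * G v + R1 v * lf a v + R0 v" for v
    proof -
      have "f v * f' v = q v * (q v * (g v * g' v) + (g v * (r1' v * lf a v + r0' v) + g' v * (r1 v * lf a v + r0 v)))
          + (r1 v * r0' v + r0 v * r1' v) * lf a v + r0 v * r0' v + r1 v * r1' v * (lf a v * lf a v)"
        unfolding f by (simp add: algebra_simps)
      also have "\<dots> = q v * G v + R1 v * lf a v + R0 v"
        unfolding sq G_def R1_def R0_def by (simp add: algebra_simps)
      finally show ?thesis .
    qed
    show "G \<in> polys" unfolding G_def[abs_def] by (intro polys_intros(3,4) polys_cmult g lf_polys homogD(1)[OF q])
    show "R1 \<in> polys" unfolding R1_def[abs_def] by (intro polys_diff polys_intros(3,4) polys_cmult g B)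
    show "R0 \<in> polys" unfolding R0_def[abs_def] by (intro polys_diff polys_intros(3,4) polys_cmult g N)
    show "R1 (v + c *s e) = R1 v" "R0 (v + c *s e) = R0 v" for v c
      by (simp_all add: R1_def R0_def inv B N)
  qed
qed

end

lemma quad_roots:
  fixes q :: "'a::{alg_closed_field, field_char_0} ^ 'k \<Rightarrow> 'a"
  assumes q: "q \<in> homog 2" and e: "q e \<noteq> 0"
  shows "\<exists>y1 y2. q (x + y1 *s e) = 0 \<and> q (x + y2 *s e) = 0 \<and> (disc q e x \<noteq> 0 \<longrightarrow> y1 \<noteq> y2)"
proof -
  have "degree [:- disc q e x, 0, 1:] = 2" by simp
  then obtain s where "poly [:- disc q e x, 0, 1:] s = 0"
    using alg_closed_imp_poly_has_root[of "[:- disc q e x, 0, 1:]"] by auto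
  then have s: "s * s = disc q e x" by simp
  have root: "q (x + ((- polar q x e + s) / (2 * q e)) *s e) = 0" if s: "s * s = disc q e x" for s
  proof -
    define y where "y = (- polar q x e + s) / (2 * q e)"
    have y: "2 * q e * y = s - polar q x e" using e by (simp add: y_def)
    have "4 * q e * q (x + y *s e) = 4 * q e * q x + (2 * q e * y) * (2 * q e * y) + 2 * polar q x e * (2 * q e * y)"
      by (simp add: quad_add[OF q] quad_scale[OF q] polar_scale[OF q] algebra_simps power2_eq_square)
    also have "\<dots> = s * s - disc q e x"
      unfolding y disc_def[OF q] by (simp add: algebra_simps power2_eq_square)
    finally show ?thesis using e s by (simp add: y_def)
  qed
  have "(- polar q x e + s) / (2 * q e) \<noteq> (- polar q x e + - s) / (2 * q e)" if "disc q e x \<noteq> 0"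
  proof
    assume "(- polar q x e + s) / (2 * q e) = (- polar q x e + - s) / (2 * q e)"
    then have "s = 0" using e by (simp add: field_simps)
    then show False using s that by simp
  qed
  moreover have "(- s) * (- s) = disc q e x" using s by simp
  note root[OF s] root[OF this]
  ultimately show ?thesis by blast
qed

text \<open>Divide \<open>f\<close> by \<open>q\<close>. A line in direction \<open>e\<close> with
  non-zero discriminant carries two distinct zeros of \<open>q\<close>, at which the remainder, of
  degree one in \<open>lf a\<close>, must vanish. So its coefficients vanish on a dense part of
  \<open>W\<close>, hence on \<open>W\<close>.\<close>

lemma quad_nullstellensatz:
  fixes q :: "'a::{alg_closed_field, field_char_0} ^ 'k \<Rightarrow> 'a"
  assumes q: "q \<in> homog 2" and W: "vec.subspace W" and e: "e \<in> W" "q e \<noteq> 0"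
    and disc: "x0 \<in> W" "disc q e x0 \<noteq> 0"
    and f: "f \<in> polys" "\<And>v. v \<in> W \<Longrightarrow> q v = 0 \<Longrightarrow> f v = 0"
  shows "\<exists>g\<in>polys. \<forall>v\<in>W. f v = q v * g v"
proof -
  have "e \<noteq> 0" using e(2) quad_zero[OF q] by auto
  then obtain i where i: "e $ i \<noteq> 0" by (auto simp: vec_eq_iff)
  define a where "a = (1 / e $ i) *s axis i 1"
  have "lf a v = (1 / e $ i) * lf (axis i 1) v" for v
    by (simp add: lf_def a_def sum_distrib_left algebra_simps)
  then have l: "lf a e = 1" using i by (simp add: lf_axis)
  obtain g r1 r0 where g: "g \<in> polys" "r1 \<in> polys" "r0 \<in> polys"
    and inv: "\<And>v c. r1 (v + c *s e) = r1 v" "\<And>v c. r0 (v + c *s e) = r0 v"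
    and fv: "\<And>v. f v = q v * g v + r1 v * lf a v + r0 v"
    using quad_division[OF q e(2) l f(1)] by blast
  have generic: "r1 x = 0 \<and> r0 x = 0" if x: "x \<in> W" "disc q e x \<noteq> 0" for x
  proof -
    obtain y1 y2 where y: "q (x + y1 *s e) = 0" "q (x + y2 *s e) = 0" "y1 \<noteq> y2" using quad_roots[OF q e(2)] x(2) by blast
    have "x + y *s e \<in> W" for y using W x(1) e(1) by (intro vec.subspace_add vec.subspace_scale)
    then have "r1 x * (lf a x + y1) + r0 x = 0" "r1 x * (lf a x + y2) + r0 x = 0"
      using f(2)[of "x + y1 *s e"] f(2)[of "x + y2 *s e"] y fv[of "x + y1 *s e"] fv[of "x + y2 *s e"]
      by (simp_all add: inv lf_add lf_scale l)
    note z = this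
    have "r1 x * (y1 - y2) = (r1 x * (lf a x + y1) + r0 x) - (r1 x * (lf a x + y2) + r0 x)"
      by (simp add: algebra_simps)
    then have "r1 x = 0" using y(3) unfolding z by simp
    then show ?thesis using z(1) by simp
  qed
  have zero: "r x = 0" if r: "r \<in> polys" "\<And>x. x \<in> W \<Longrightarrow> disc q e x \<noteq> 0 \<Longrightarrow> r x = 0" and x: "x \<in> W" for r x
  proof (rule ccontr)
    assume rx: "r x \<noteq> 0"
    have "\<exists>s. r (x + s *s (x0 - x)) * disc q e (x + s *s (x0 - x)) \<noteq> 0"
      by (rule polyf_nonzero_both[OF polys_line[OF r(1)] polys_line[OF disc_polys[OF q]], where a = 0 and b = 1])
        (use rx disc(2) in simp_all)
    then obtain s where "r (x + s *s (x0 - x)) \<noteq> 0" "disc q e (x + s *s (x0 - x)) \<noteq> 0" by auto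
    moreover have "x + s *s (x0 - x) \<in> W" using W x disc(1) by (intro vec.subspace_add vec.subspace_scale vec.subspace_diff)
    ultimately show False using r(2) by blast
  qed
  have "f v = q v * g v" if v: "v \<in> W" for v
    using fv[of v] zero[OF g(2) _ v] zero[OF g(3) _ v] generic by simp
  then show ?thesis using g(1) by blast
qed

lemma disc_imp_reduced:
  fixes q :: "'a::{alg_closed_field, field_char_0} ^ 'k \<Rightarrow> 'a"
  assumes q: "q \<in> homog 2" and W: "vec.subspace W" and e: "e \<in> W" "q e \<noteq> 0"
    and disc: "x0 \<in> W" "disc q e x0 \<noteq> 0"
  shows "reduced_on W q"
  unfolding reduced_on_def
proof (intro ballI allI impI)
  fix f r assume f: "f \<in> polys" and "\<exists>g\<in>polys. \<forall>v\<in>W. f v ^ r = q v * g v"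
  then obtain g where g: "\<And>v. v \<in> W \<Longrightarrow> f v ^ r = q v * g v" by blast
  show "\<exists>g\<in>polys. \<forall>v\<in>W. f v = q v * g v"
  proof (rule quad_nullstellensatz[OF q W e disc f])
    fix v assume "v \<in> W" "q v = 0"
    then have "f v ^ r = 0" using g by simp
    then show "f v = 0" by (metis power_not_zero)
  qed
qed

text \<open>By \<open>quad_nullstellensatz\<close>, \<open>q'\<close> is \<open>q\<close> times some
  \<open>g\<close>. Equality of degrees makes \<open>g\<close> constant along lines through the
  origin, hence equal to \<open>g 0\<close> wherever \<open>q\<close> is non-zero.\<close>

lemma quad_proportional:
  fixes q :: "'a::{alg_closed_field, field_char_0} ^ 'k \<Rightarrow> 'a"
  assumes q: "q \<in> homog 2" and q': "q' \<in> homog 2" and e: "q e \<noteq> 0" and disc: "disc q e x0 \<noteq> 0"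
    and van: "\<And>v. q v = 0 \<Longrightarrow> q' v = 0"
  shows "\<exists>c. \<forall>v. q' v = c * q v"
proof -
  obtain g where g: "g \<in> polys" "\<And>v. q' v = q v * g v"
    using quad_nullstellensatz[OF q vec.subspace_UNIV UNIV_I e UNIV_I disc homogD(1)[OF q'] van] by blast
  have "q' v = g 0 * q v" for v
  proof (cases "q v = 0")
    case False
    have "g (0 + s *s v) = g v" if "s \<notin> {0}" for s
    proof -
      have "s\<^sup>2 * (q v * g v) = s\<^sup>2 * q v * g (s *s v)"
        using g(2)[of "s *s v"] g(2)[of v] quad_scale[OF q, of s v] quad_scale[OF q', of s v] by simp
      then show ?thesis using False that by simp
    qed
    from polyf_eq_cofinite[OF polys_line[OF g(1)] polyf_const, of "{0}" 0 v "g v" 0] this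
    have "g 0 = g v" by simp
    then show ?thesis using g(2)[of v] by simp
  qed (simp add: van)
  then show ?thesis by blast
qed

text \<open>If \<open>v\<close> is in the radical of the polar form, the cone contains every
  \<open>v + t *s w\<close> with \<open>q w = 0\<close>. Derivatives at \<open>v\<close> of forms
  vanishing on the quadric are then zero on the zeros of \<open>q\<close>, hence everywhere by
  \<open>sp\<close>, and the tangent space has dimension \<open>n + 2\<close>. Otherwise the
  derivative of \<open>q\<close> itself cuts it down to at most \<open>n + 1\<close>.\<close>

lemma Sing_quadric:
  fixes q :: "'a::{alg_closed_field, field_char_0} ^ 'k \<Rightarrow> 'a"
  assumes q: "q \<in> homog 2" and dim: "dim_of (zero_locus {q}) = enat n" "n + 2 = CARD('k)"
    and sp: "\<And>a v. (\<And>v. q v = 0 \<Longrightarrow> lf a v = 0) \<Longrightarrow> lf a v = 0"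
  shows "Sing (zero_locus {q}) = proj {v. \<forall>w. polar q v w = 0}"
proof -
  let ?X = "zero_locus {q}"
  have main: "vec.span {v} \<in> Sing ?X \<longleftrightarrow> (\<forall>w. polar q v w = 0)" if v: "v \<noteq> 0" for v
  proof
    assume *: "\<forall>w. polar q v w = 0"
    then have qv: "q v = 0" using polar_self[OF q, of v] by simp
    then have vX: "vec.span {v} \<in> ?X" using span_in_zero_locus_iff[OF q v] by simp
    have "dderiv f u w = 0" if f: "f \<in> homog d" "?X \<subseteq> zero_locus {f}" and u: "u \<in> vec.span {v}" for f d u w
    proof -
      have fz: "f z = 0" if qz: "q z = 0" for z
      proof (cases "z = 0")
        case True
        have "f v = 0" using subsetD[OF f(2) vX] span_in_zero_locus_iff[OF f(1) v] by simp
        then show ?thesis using homogD(2)[OF f(1), of 0 v] True by simp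
      next
        case False
        then have "vec.span {z} \<in> ?X" using span_in_zero_locus_iff[OF q False] qz by simp
        then have "vec.span {z} \<in> zero_locus {f}" using f(2) by (rule subsetD[rotated])
        then show ?thesis using span_in_zero_locus_iff[OF f(1) False] by simp
      qed
      obtain c where c: "u = c *s v" using u by (auto simp: in_span_singleton_iff)
      obtain a where a: "\<And>w. dderiv f u w = lf a w" using dderiv_linear[OF homogD(1)[OF f(1)]] by blast
      have "lf a w = 0"
      proof (rule sp)
        fix w assume w: "q w = 0"
        have "q (u + t *s w) = 0" for t
          using w qv * by (simp add: c quad_add[OF q] quad_scale[OF q] polar_scale[OF q])
        then have "poly 0 t = f (u + t *s w)" for t using fz by simp
        from dderiv_eqI[OF this] show "lf a w = 0" using a by simp
      qed
      then show ?thesis using a by simp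
    qed
    note tangent = this
    have "w \<in> cone_tangent ?X (vec.span {v})" for w
      unfolding cone_tangent_def
    proof (rule CollectI, intro ballI impI)
      fix f u assume f: "f \<in> (\<Union>d. homog d)" "?X \<subseteq> zero_locus {f}" and u: "u \<in> vec.span {v} - {0}"
      then obtain d where "f \<in> homog d" by blast
      then show "dderiv f u w = 0" using f(2) u by (intro tangent) auto
    qed
    then have "cone_tangent ?X (vec.span {v}) = UNIV" by auto
    then have dimT: "vec.dim (cone_tangent ?X (vec.span {v})) = n + 2"
      by (simp only: vec_dim_card dim(2))
    show "vec.span {v} \<in> Sing ?X"
      unfolding Sing_def using vX by (simp add: dimT dim(1) one_enat_def)
  next
    assume S: "vec.span {v} \<in> Sing ?X"
    show "\<forall>w. polar q v w = 0"
    proof (rule ccontr)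
      assume "\<not> ?thesis"
      then obtain w0 where w0: "polar q v w0 \<noteq> 0" by blast
      obtain a where a: "\<And>w. polar q v w = lf a w" using polar_lf[OF q] by blast
      have "cone_tangent ?X (vec.span {v}) \<subseteq> {w. lf a w = 0}"
      proof
        fix w assume "w \<in> cone_tangent ?X (vec.span {v})"
        then have "dderiv q v w = 0"
          unfolding cone_tangent_def using q v by (auto simp: vec.span_base)
        then show "w \<in> {w. lf a w = 0}" using a dderiv_eq_polar[OF q] by simp
      qed
      then have "vec.dim (cone_tangent ?X (vec.span {v})) \<le> vec.dim {w. lf a w = 0}" by (rule vec.dim_subset)
      also have "vec.dim {w. lf a w = 0} < vec.dim (UNIV :: ('a ^ 'k) set)"
      proof (rule vec.dim_psubset)
        have "vec.subspace {w. lf a w = 0}"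
          unfolding vec.subspace_def by (simp add: lf_zero lf_add lf_scale)
        then have H: "vec.span {w. lf a w = 0} = {w. lf a w = 0}" by (simp add: vec.span_eq_iff)
        have "w0 \<notin> {w. lf a w = 0}" using w0 a by simp
        then show "vec.span {w. lf a w = 0} \<subset> vec.span UNIV" unfolding H vec.span_UNIV by blast
      qed
      also have "\<dots> = n + 2" by (simp only: vec_dim_card dim(2))
      finally show False using S dim(1) by (simp add: Sing_def one_enat_def)
    qed
  qed
  show ?thesis
  proof (intro equalityI subsetI)
    fix x assume x: "x \<in> Sing ?X"
    then have "x \<in> proj UNIV" by (auto simp: Sing_def zero_locus_def)
    then obtain v where "v \<noteq> 0" "x = vec.span {v}" by (rule projE)
    then show "x \<in> proj {v. \<forall>w. polar q v w = 0}" using main x by (auto simp: proj_def)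
  next
    fix x assume "x \<in> proj {v. \<forall>w. polar q v w = 0}"
    then show "x \<in> Sing ?X" using main by (auto simp: proj_def)
  qed
qed

section \<open>Exponentials in finite-dimensional commutative algebras\<close>

locale calg =
  fixes e :: "'a::field_char_0 ^ 'k" and mul :: "'a ^ 'k \<Rightarrow> 'a ^ 'k \<Rightarrow> 'a ^ 'k" (infixl "\<odot>" 70)
  assumes mul_assoc: "(u \<odot> v) \<odot> w = u \<odot> (v \<odot> w)"
    and mul_comm: "u \<odot> v = v \<odot> u"
    and mul_unit [simp]: "e \<odot> v = v"
    and mul_add: "(u + v) \<odot> w = u \<odot> w + v \<odot> w"
    and mul_scale: "(c *s v) \<odot> w = c *s (v \<odot> w)"
begin

lemma mul_lcomm: "u \<odot> (v \<odot> w) = v \<odot> (u \<odot> w)"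
  by (metis mul_assoc mul_comm)

lemma mul_add_right: "w \<odot> (u + v) = w \<odot> u + w \<odot> v"
  by (metis mul_add mul_comm)

lemma mul_scale_right: "w \<odot> (c *s v) = c *s (w \<odot> v)"
  by (metis mul_scale mul_comm)

lemma mul_unit_right [simp]: "v \<odot> e = v"
  by (metis mul_unit mul_comm)

lemma mul_zero [simp]: "0 \<odot> v = 0" "v \<odot> 0 = 0"
  using mul_scale[of 0 0 v] mul_scale_right[of v 0 0] by simp_all

lemma mul_minus: "(- u) \<odot> v = - (u \<odot> v)" "u \<odot> (- v) = - (u \<odot> v)"
  using mul_scale[of "-1" u v] mul_scale_right[of u "-1" v] by (simp_all only: vector_sneg_minus1[symmetric])

lemma mul_diff: "(u - v) \<odot> w = u \<odot> w - v \<odot> w" "w \<odot> (u - v) = w \<odot> u - w \<odot> v"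
  using mul_add[of u "- v" w] mul_add_right[of w u "- v"] by (simp_all add: mul_minus)

lemma mul_sum: "(\<Sum>i\<in>I. f i) \<odot> v = (\<Sum>i\<in>I. f i \<odot> v)" "v \<odot> (\<Sum>i\<in>I. f i) = (\<Sum>i\<in>I. v \<odot> f i)"
  by (induction I rule: infinite_finite_induct) (simp_all add: mul_add mul_add_right)

lemmas mul_ac = mul_assoc mul_comm mul_lcomm

lemmas mul_bilin = mul_add mul_add_right mul_diff mul_minus mul_scale mul_scale_right

definition pw :: "'a ^ 'k \<Rightarrow> nat \<Rightarrow> 'a ^ 'k" where
  "pw x n = (((\<odot>) x) ^^ n) e"

lemma pw_simps [simp]: "pw x 0 = e" "pw x (Suc n) = x \<odot> pw x n"
  by (simp_all add: pw_def)

lemma pw_add: "pw x (m + n) = pw x m \<odot> pw x n"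
  by (induction m) (simp_all add: mul_assoc)

lemma pw_scale: "pw (c *s x) n = c ^ n *s pw x n"
  by (induction n) (simp_all add: mul_scale mul_scale_right)

lemma pw_mul: "pw (x \<odot> y) n = pw x n \<odot> pw y n"
  by (induction n) (simp_all add: mul_ac)

lemma pw_zero_mono: "pw x n = 0 \<Longrightarrow> n \<le> m \<Longrightarrow> pw x m = 0"
  using pw_add[of x n "m - n"] by simp

definition nil :: "'a ^ 'k \<Rightarrow> bool" where
  "nil x \<longleftrightarrow> (\<exists>n. pw x n = 0)"

lemma nil_zero: "nil 0"
  unfolding nil_def by (rule exI[of _ 1]) simp

lemma nil_scale: "nil x \<Longrightarrow> nil (c *s x)"
  by (auto simp: nil_def pw_scale)

lemma nil_mul: "nil x \<Longrightarrow> nil (x \<odot> y)"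
  unfolding nil_def pw_mul by (metis mul_zero(1))

lemma nil_minus: "nil x \<Longrightarrow> nil (- x)"
  using nil_scale[of x "-1"] by (simp only: vector_sneg_minus1[symmetric])

text \<open>Divided powers: with the factorials built in, the binomial theorem has no
  coefficients.\<close>

definition dp :: "'a ^ 'k \<Rightarrow> nat \<Rightarrow> 'a ^ 'k" where
  "dp x n = (1 / fact n) *s pw x n"

lemma dp_0 [simp]: "dp x 0 = e"
  by (simp add: dp_def)

lemma dp_Suc: "of_nat (Suc n) *s dp x (Suc n) = x \<odot> dp x n"
proof -
  have "of_nat (Suc n) *s dp x (Suc n) = (of_nat (Suc n) * (1 / fact (Suc n))) *s (x \<odot> pw x n)"
    by (simp add: dp_def)
  also have "of_nat (Suc n) * (1 / fact (Suc n)) = (1 / fact n :: 'a)"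
    by (simp only: fact_Suc) (simp add: field_simps del: of_nat_Suc)
  finally show ?thesis by (simp add: dp_def mul_scale_right)
qed

text \<open>Multiplied by \<open>of_nat (Suc n)\<close>, split as \<open>i\<close> plus
  \<open>Suc n - i\<close>, the sum satisfies the same recursion \<open>dp_Suc\<close> as the
  left-hand side.\<close>

lemma dp_add: "dp (x + y) n = (\<Sum>i\<le>n. dp x i \<odot> dp y (n - i))"
proof (induction n)
  case (Suc n)
  let ?f = "\<lambda>i. dp x i \<odot> dp y (Suc n - i)"
  have 1: "(\<Sum>i\<le>Suc n. of_nat i *s ?f i) = x \<odot> (\<Sum>i\<le>n. dp x i \<odot> dp y (n - i))"
  proof -
    have "(\<Sum>i\<le>Suc n. of_nat i *s ?f i) = (\<Sum>i\<le>n. of_nat (Suc i) *s ?f (Suc i))"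
      by (subst sum.atMost_Suc_shift) simp
    also have "\<dots> = (\<Sum>i\<le>n. x \<odot> (dp x i \<odot> dp y (n - i)))"
      by (intro sum.cong refl) (simp add: mul_scale[symmetric] dp_Suc[symmetric] mul_assoc[symmetric] del: of_nat_Suc)
    finally show ?thesis by (simp add: mul_sum)
  qed
  have 2: "(\<Sum>i\<le>Suc n. of_nat (Suc n - i) *s ?f i) = y \<odot> (\<Sum>i\<le>n. dp x i \<odot> dp y (n - i))"
  proof -
    have "(\<Sum>i\<le>Suc n. of_nat (Suc n - i) *s ?f i) = (\<Sum>i\<le>n. of_nat (Suc n - i) *s ?f i)"
      by simp
    also have "\<dots> = (\<Sum>i\<le>n. y \<odot> (dp x i \<odot> dp y (n - i)))"
    proof (intro sum.cong refl)
      fix i assume "i \<in> {..n}"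
      then have i: "Suc n - i = Suc (n - i)" by (simp add: Suc_diff_le)
      show "of_nat (Suc n - i) *s ?f i = y \<odot> (dp x i \<odot> dp y (n - i))"
        unfolding i mul_lcomm[of y] dp_Suc[symmetric] mul_scale_right ..
    qed
    finally show ?thesis by (simp add: mul_sum)
  qed
  have "of_nat (Suc n) *s (\<Sum>i\<le>Suc n. ?f i) = (\<Sum>i\<le>Suc n. of_nat i *s ?f i + of_nat (Suc n - i) *s ?f i)"
    unfolding vec.scale_sum_right
  proof (intro sum.cong refl)
    fix i assume "i \<in> {..Suc n}"
    then have "of_nat (Suc n) = (of_nat i + of_nat (Suc n - i) :: 'a)" by (simp flip: of_nat_add)
    then show "of_nat (Suc n) *s ?f i = of_nat i *s ?f i + of_nat (Suc n - i) *s ?f i"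
      by (simp only: vec.scale_left_distrib)
  qed
  also have "\<dots> = (x + y) \<odot> dp (x + y) n"
    unfolding sum.distrib 1 2 Suc by (simp add: mul_add)
  also have "\<dots> = of_nat (Suc n) *s dp (x + y) (Suc n)" by (rule dp_Suc[symmetric])
  finally have "of_nat (Suc n) *s (\<Sum>i\<le>Suc n. ?f i) = of_nat (Suc n) *s dp (x + y) (Suc n)" .
  from vec.scale_left_imp_eq[OF of_nat_neq_0 this] show ?case by simp
qed simp

text \<open>Every summand of \<open>dp (x + y) (m + n)\<close> contains a vanishing power of
  \<open>x\<close> or of \<open>y\<close>.\<close>

lemma nil_add:
  assumes "nil x" "nil y"
  shows "nil (x + y)"
proof -
  obtain m n where mn: "pw x m = 0" "pw y n = 0" using assms by (auto simp: nil_def)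
  have "dp x i \<odot> dp y (m + n - i) = 0" if "i \<le> m + n" for i
  proof (cases "m \<le> i")
    case True
    then show ?thesis using pw_zero_mono[OF mn(1)] by (simp add: dp_def)
  next
    case False
    then show ?thesis using pw_zero_mono[OF mn(2), of "m + n - i"] by (simp add: dp_def)
  qed
  then have "dp (x + y) (m + n) = 0" unfolding dp_add by simp
  then have "pw (x + y) (m + n) = 0" by (simp add: dp_def)
  then show ?thesis unfolding nil_def ..
qed

text \<open>The exponential series, summed over its non-zero powers so that no nilpotency bound
  enters the definition. If \<open>x\<close> is not nilpotent, the index set is infinite and the
  value is the default \<open>0\<close>.\<close>

definition E :: "'a ^ 'k \<Rightarrow> 'a ^ 'k" where
  "E x = (\<Sum>n\<in>{n. pw x n \<noteq> 0}. dp x n)"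

lemma E_eq:
  assumes "pw x D = 0"
  shows "E x = (\<Sum>n<D. dp x n)"
  unfolding E_def
proof (rule sum.mono_neutral_left)
  show "{n. pw x n \<noteq> 0} \<subseteq> {..<D}" using pw_zero_mono[OF assms] by (auto simp: not_le[symmetric])
  show "\<forall>i\<in>{..<D} - {n. pw x n \<noteq> 0}. dp x i = 0" by (auto simp: dp_def)
qed simp

lemma E_zero [simp]: "E 0 = e"
  using E_eq[of 0 1] by simp

lemma E_add:
  assumes "nil x" "nil y"
  shows "E (x + y) = E x \<odot> E y"
proof -
  obtain m n where mn: "pw x m = 0" "pw y n = 0" using assms by (auto simp: nil_def)
  obtain k where k: "pw (x + y) k = 0" using nil_add[OF assms] by (auto simp: nil_def)
  \<comment> \<open>A common bound: all pairs below \<open>D\<close> lie in the triangle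
    \<open>i + j < 2 * D\<close>, and the other terms of the triangle vanish.\<close>
  define D where "D = m + n + k"
  have D: "pw x D = 0" "pw y D = 0" "pw (x + y) (2 * D) = 0"
    using pw_zero_mono[OF mn(1)] pw_zero_mono[OF mn(2)] pw_zero_mono[OF k] by (auto simp: D_def)
  have zero: "dp x i = 0" "dp y i = 0" if "D \<le> i" for i
    using pw_zero_mono[OF D(1) that] pw_zero_mono[OF D(2) that] by (auto simp: dp_def)
  have "E (x + y) = (\<Sum>n<2 * D. \<Sum>i\<le>n. dp x i \<odot> dp y (n - i))"
    unfolding E_eq[OF D(3)] dp_add ..
  also have "\<dots> = (\<Sum>(i, j)\<in>{(i, j). i + j < 2 * D}. dp x i \<odot> dp y j)"
    by (rule sum.triangle_reindex[symmetric])
  also have "\<dots> = (\<Sum>(i, j)\<in>{..<D} \<times> {..<D}. dp x i \<odot> dp y j)"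
  proof (rule sum.mono_neutral_right)
    have "{(i, j). i + j < 2 * D} \<subseteq> {..<2 * D} \<times> {..<2 * D}" by auto
    then show "finite {(i, j). i + j < 2 * D}" by (rule finite_subset) simp
    show "\<forall>p\<in>{(i, j). i + j < 2 * D} - {..<D} \<times> {..<D}. (case p of (i, j) \<Rightarrow> dp x i \<odot> dp y j) = 0"
    proof
      fix p assume p: "p \<in> {(i, j). i + j < 2 * D} - {..<D} \<times> {..<D}"
      obtain i j where ij: "p = (i, j)" by force
      then have "D \<le> i \<or> D \<le> j" using p by auto
      then show "(case p of (i, j) \<Rightarrow> dp x i \<odot> dp y j) = 0" using zero ij by auto
    qed
  qed auto
  also have "\<dots> = E x \<odot> E y"
    unfolding E_eq[OF D(1)] E_eq[OF D(2)] by (simp add: mul_sum sum.cartesian_product[symmetric]) (rule sum.swap)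
  finally show ?thesis .
qed

lemma E_minus: "nil x \<Longrightarrow> E x \<odot> E (- x) = e"
  using E_add[of x "- x"] nil_minus by simp

lemma E_expand:
  assumes "nil z"
  shows "\<exists>w. E z = e + z + (z \<odot> z) \<odot> w"
proof -
  obtain D where "pw z D = 0" using assms by (auto simp: nil_def)
  then have "pw z (Suc (Suc D)) = 0" by simp
  from E_eq[OF this] have "E z = (\<Sum>n<Suc (Suc D). dp z n)" .
  also have "\<dots> = dp z 0 + dp z 1 + (\<Sum>n<D. dp z (Suc (Suc n)))"
    by (simp only: sum.lessThan_Suc_shift) simp
  also have "(\<Sum>n<D. dp z (Suc (Suc n))) = (z \<odot> z) \<odot> (\<Sum>n<D. (1 / fact (Suc (Suc n))) *s pw z n)"
    by (simp add: dp_def mul_sum mul_scale_right mul_assoc del: fact_Suc)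
  finally show ?thesis by (intro exI) (simp add: dp_def)
qed

lemma nil_fixpoint:
  assumes "nil y" "z = y \<odot> z"
  shows "z = 0"
proof -
  have "z = pw y n \<odot> z" for n
  proof (induction n)
    case (Suc n)
    have "pw y (Suc n) \<odot> z = pw y n \<odot> (y \<odot> z)" by (simp add: mul_ac)
    then show ?case using Suc assms(2) by simp
  qed simp
  then show ?thesis using assms(1) by (metis nil_def mul_zero(1))
qed

text \<open>For the difference \<open>z\<close> of \<open>x\<close> and \<open>y\<close>,
  \<open>E z = e\<close> and \<open>E_expand\<close> make \<open>z\<close> a nilpotent multiple of
  itself, so \<open>nil_fixpoint\<close> applies.\<close>

lemma E_inj:
  assumes "nil x" "nil y" "E x = E y"
  shows "x = y"
proof -
  have n: "nil (x + - y)" using assms nil_add nil_minus by blast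
  have "E (x + - y) = E x \<odot> E (- y)" using assms nil_minus by (intro E_add)
  also have "\<dots> = e" using assms(2,3) E_minus by simp
  finally have "E (x + - y) = e" .
  moreover obtain w where w: "E (x + - y) = e + (x + - y) + ((x + - y) \<odot> (x + - y)) \<odot> w" using E_expand[OF n] by blast
  ultimately have "(x + - y) + ((x + - y) \<odot> (x + - y)) \<odot> w = 0" by (simp add: add.assoc)
  then have "x + - y = - (((x + - y) \<odot> (x + - y)) \<odot> w)" by (rule add_implies_diff[where a = 0, simplified, of "(x + - y)", unfolded diff_0])
  also have "\<dots> = ((x + - y) \<odot> (- w)) \<odot> (x + - y)" by (simp only: mul_minus mul_ac)
  finally have "x + - y = 0" by (intro nil_fixpoint[OF nil_mul[OF n]])
  then show ?thesis by simp
qed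

text \<open>The exponential is unipotent. If \<open>x\<close> did not kill \<open>v\<close>, the
  highest power of \<open>x\<close> not killing \<open>v\<close> would give \<open>c = 1\<close>,
  and the power just below it would then give a contradiction.\<close>

lemma E_eigen:
  assumes "nil x" "E x \<odot> v = c *s v"
  shows "x \<odot> v = 0"
proof (rule ccontr)
  assume xv: "x \<odot> v \<noteq> 0"
  obtain w where w: "E x = e + x + (x \<odot> x) \<odot> w" using E_expand[OF assms(1)] by blast
  obtain D where D: "pw x D = 0" using assms(1) by (auto simp: nil_def)
  define k where "k = (LEAST k. pw x k \<odot> v = 0)"
  have k0: "pw x k \<odot> v = 0" unfolding k_def by (rule LeastI[of _ D]) (simp add: D)
  have kmin: "pw x j \<odot> v \<noteq> 0" if "j < k" for j using not_less_Least that unfolding k_def by blast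
  have "v \<noteq> 0" using xv by auto
  then have "k \<noteq> 0" using k0 by (cases k) simp_all
  moreover have "k \<noteq> 1"
  proof
    assume "k = 1"
    then show False using k0 xv by simp
  qed
  ultimately have j: "k = Suc (Suc (k - 2))" by linarith
  define j where "j = k - 2"
  note j = j[folded j_def]
  have "c *s (pw x (Suc j) \<odot> v) = pw x (Suc j) \<odot> (E x \<odot> v)" unfolding assms(2) mul_scale_right ..
  also have "\<dots> = pw x (Suc j) \<odot> v + pw x (Suc (Suc j)) \<odot> v + (pw x (Suc (Suc j)) \<odot> v) \<odot> (x \<odot> w)"
    unfolding w by (simp add: mul_bilin mul_ac)
  also have "\<dots> = pw x (Suc j) \<odot> v" using k0 unfolding j by simp
  finally have "(c - 1) *s (pw x (Suc j) \<odot> v) = 0"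
    unfolding vec.scale_left_diff_distrib vec.scale_one by (simp only: diff_self)
  moreover have "pw x (Suc j) \<odot> v \<noteq> 0" by (rule kmin) (use j in linarith)
  ultimately have c: "c = 1" unfolding vec.scale_eq_0_iff by simp
  have "c *s (pw x j \<odot> v) = pw x j \<odot> (E x \<odot> v)" unfolding assms(2) mul_scale_right ..
  also have "\<dots> = pw x j \<odot> v + pw x (Suc j) \<odot> v + (pw x (Suc (Suc j)) \<odot> v) \<odot> w"
    unfolding w by (simp add: mul_bilin mul_ac)
  also have "\<dots> = pw x j \<odot> v + pw x (Suc j) \<odot> v" using k0 unfolding j by simp
  finally have "pw x (Suc j) \<odot> v = 0" unfolding c by simp
  moreover have "pw x (Suc j) \<odot> v \<noteq> 0" by (rule kmin) (use j in linarith)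
  ultimately show False by blast
qed

lemma E_annihilate:
  assumes "nil x" "x \<odot> v = 0"
  shows "E x \<odot> v = v"
proof -
  obtain w where w: "E x = e + x + (x \<odot> x) \<odot> w" using E_expand[OF assms(1)] by blast
  have "((x \<odot> x) \<odot> w) \<odot> v = (x \<odot> w) \<odot> (x \<odot> v)" by (simp add: mul_ac)
  then show ?thesis unfolding w using assms(2) by (simp add: mul_add)
qed

lemma pw_Suc_closed:
  assumes "\<And>x y. x \<in> T \<Longrightarrow> y \<in> T \<Longrightarrow> x \<odot> y \<in> T" "x \<in> T"
  shows "pw x (Suc n) \<in> T"
proof (induction n)
  case (Suc n)
  then show ?case using assms(1)[OF assms(2)] by (simp only: pw_simps(2))
qed (simp add: assms(2))

lemma E_minus_unit_closed:
  assumes T: "vec.subspace T" and mult: "\<And>x y. x \<in> T \<Longrightarrow> y \<in> T \<Longrightarrow> x \<odot> y \<in> T" and x: "nil x" "x \<in> T"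
  shows "E x - e \<in> T"
proof -
  obtain D where "pw x D = 0" using x(1) by (auto simp: nil_def)
  then have "pw x (Suc D) = 0" by simp
  from E_eq[OF this] have "E x - e = (\<Sum>n<D. dp x (Suc n))"
    by (simp only: sum.lessThan_Suc_shift) simp
  moreover have "dp x (Suc n) \<in> T" for n
    unfolding dp_def by (rule vec.subspace_scale[OF T pw_Suc_closed]) (use mult x in auto)
  ultimately show ?thesis using vec.subspace_sum[OF T] by metis
qed

text \<open>Newton iteration: an approximate logarithm with error \<open>z\<close> is improved by adding \<open>z\<close>.\<close>

lemma E_surj:
  assumes T: "vec.subspace T" and mult: "\<And>x y. x \<in> T \<Longrightarrow> y \<in> T \<Longrightarrow> x \<odot> y \<in> T"
    and nil: "\<And>x. x \<in> T \<Longrightarrow> nil x" and a: "a \<in> T"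
  shows "\<exists>x\<in>T. E x = e + a"
proof -
  have step: "\<exists>x\<in>T. \<exists>z\<in>T. (\<exists>y. z = pw a (Suc k) \<odot> y) \<and> E x \<odot> (e + z) = e + a" for k
  proof (induction k)
    case 0
    show ?case
      by (intro bexI[of _ 0] bexI[of _ a] conjI exI[of _ e]) (use a vec.subspace_0[OF T] in simp_all)
  next
    case (Suc k)
    then obtain x z y where x: "x \<in> T" and z: "z \<in> T" "z = pw a (Suc k) \<odot> y" and eq: "E x \<odot> (e + z) = e + a" by blast
    have mz: "- z \<in> T" using vec.subspace_neg[OF T z(1)] .
    define s where "s = E (- z) - e"
    have s: "s \<in> T" unfolding s_def by (rule E_minus_unit_closed[OF T mult nil[OF mz] mz])
    define z' where "z' = s + z + s \<odot> z"
    have z'T: "z' \<in> T" unfolding z'_def using T s z(1) mult by (intro vec.subspace_add)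
    have Es: "E (- z) = e + s" by (simp add: s_def)
    have ez': "E (- z) \<odot> (e + z) = e + z'" unfolding Es z'_def by (simp add: mul_bilin algebra_simps)
    obtain w where w: "E (- z) = e + - z + (- z \<odot> - z) \<odot> w" using E_expand[OF nil[OF mz]] by blast
    have sw: "s = - z + (z \<odot> z) \<odot> w" unfolding s_def w by (simp add: mul_minus)
    have "z' = (z \<odot> z) \<odot> (w + w \<odot> z - e)"
      unfolding z'_def sw by (simp add: mul_bilin mul_ac algebra_simps)
    also have "\<dots> = pw a (Suc (Suc k)) \<odot> (pw a k \<odot> y \<odot> y \<odot> (w + w \<odot> z - e))"
      unfolding z(2) by (simp add: mul_ac)
    finally have "\<exists>y. z' = pw a (Suc (Suc k)) \<odot> y" by blast
    moreover have "E (x + z) \<odot> (e + z') = e + a"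
    proof -
      have "E (x + z) \<odot> (e + z') = E x \<odot> E z \<odot> (E (- z) \<odot> (e + z))"
        unfolding ez' E_add[OF nil[OF x] nil[OF z(1)]] ..
      also have "\<dots> = E x \<odot> ((E z \<odot> E (- z)) \<odot> (e + z))" by (simp only: mul_assoc)
      also have "\<dots> = e + a" unfolding E_minus[OF nil[OF z(1)]] using eq by simp
      finally show ?thesis .
    qed
    moreover have "x + z \<in> T" using T x z(1) by (rule vec.subspace_add)
    ultimately show ?case using z'T by blast
  qed
  obtain D where "pw a D = 0" using nil[OF a] by (auto simp: nil_def)
  then have "pw a (Suc D) = 0" by simp
  with step[of D] show ?thesis by auto
qed

end

section \<open>Local algebras and the residue map\<close>

locale local_calg = calg e mul
  for e :: "'a::field_char_0 ^ 'k" and mul (infixl "\<odot>" 70) +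
  assumes e_nonzero: "e \<noteq> 0" and local: "\<exists>c. nil (v - c *s e)"
begin

lemma nil_multiple_e: "nil (c *s e) \<Longrightarrow> c = 0"
proof -
  have "pw e n = e" for n by (induction n) simp_all
  then show "nil (c *s e) \<Longrightarrow> c = 0" using e_nonzero by (auto simp: nil_def pw_scale)
qed

text \<open>The residue map onto the ground field. Its non-vanishing will cut the open orbits out of
  their closures.\<close>

definition h :: "'a ^ 'k \<Rightarrow> 'a" where
  "h v = (SOME c. nil (v - c *s e))"

lemma nil_h: "nil (v - h v *s e)"
  unfolding h_def by (rule someI_ex[OF local])

lemma h_eqI: "nil (v - c *s e) \<Longrightarrow> h v = c"
proof -
  assume "nil (v - c *s e)"
  then have "nil (- (v - c *s e) + (v - h v *s e))" by (intro nil_add nil_minus nil_h)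
  moreover have "- (v - c *s e) + (v - h v *s e) = (c - h v) *s e" by (simp add: vec_eq_iff algebra_simps)
  ultimately show "h v = c" using nil_multiple_e[of "c - h v"] by simp
qed

lemma h_add: "h (v + w) = h v + h w"
proof (rule h_eqI)
  have eq: "v + w - (h v + h w) *s e = (v - h v *s e) + (w - h w *s e)" by (simp add: vec_eq_iff algebra_simps)
  show "nil (v + w - (h v + h w) *s e)" unfolding eq by (intro nil_add nil_h)
qed

lemma h_scale: "h (c *s v) = c * h v"
proof (rule h_eqI)
  have eq: "c *s v - (c * h v) *s e = c *s (v - h v *s e)" by (simp add: vec_eq_iff algebra_simps)
  show "nil (c *s v - (c * h v) *s e)" unfolding eq by (intro nil_scale nil_h)
qed

lemma h_e [simp]: "h e = 1"
  by (rule h_eqI) (simp add: nil_zero)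

lemma nil_iff_h: "nil x \<longleftrightarrow> h x = 0"
  using nil_h[of x] h_eqI[of x 0] by auto

lemma h_zero [simp]: "h 0 = 0"
  using nil_iff_h nil_zero by blast

lemma nil_subspace: "vec.subspace {x. nil x}"
  unfolding vec.subspace_def by (simp add: nil_zero nil_add nil_scale)

lemma h_lf: "h v = lf (\<chi> i. h (axis i 1)) v"
  by (rule linear_functional_lf[OF h_add h_scale])

lemma h_E: "nil x \<Longrightarrow> h (E x) = 1"
proof (rule h_eqI)
  assume x: "nil x"
  have "E x - e \<in> {x. nil x}" by (rule E_minus_unit_closed[OF nil_subspace]) (use x nil_mul in auto)
  then show "nil (E x - 1 *s e)" by simp
qed

lemma decompose: "\<exists>x. nil x \<and> v = h v *s e + x"
  using nil_h[of v] by (intro exI[of _ "v - h v *s e"]) simp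

end

section \<open>The algebra of a cyclic representation\<close>

locale cyclic_rep =
  fixes \<rho> :: "'a::field_char_0 ^ 'n \<Rightarrow> 'a ^ 'k ^ 'k" and e :: "'a ^ 'k"
  assumes rho_add: "\<rho> (g + g') = \<rho> g ** \<rho> g'" and rho_0: "\<rho> 0 = mat 1"
    and rho_poly: "polyf_mat (\<lambda>t. \<rho> (t *s g))"
    and cyclic: "vec.span (range (\<lambda>g. \<rho> g *v e)) = UNIV"
begin

text \<open>The commutant of the representation; evaluation at \<open>e\<close> will carry its
  algebra structure over to the vector space.\<close>

definition cm :: "'a ^ 'k ^ 'k \<Rightarrow> bool" where
  "cm T \<longleftrightarrow> (\<forall>g. T ** \<rho> g = \<rho> g ** T)"

lemma cyclic_induct:
  assumes "vec.subspace S" "\<And>g. \<rho> g *v e \<in> S"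
  shows "v \<in> S"
proof -
  have "vec.span (range (\<lambda>g. \<rho> g *v e)) \<subseteq> S" by (rule vec.span_minimal) (use assms in auto)
  then show ?thesis using cyclic by blast
qed

lemma cm_uniq:
  assumes "cm T" "cm T'" "T *v e = T' *v e"
  shows "T = T'"
proof -
  have "v \<in> {v. T *v v = T' *v v}" for v
  proof (rule cyclic_induct)
    show "vec.subspace {v. T *v v = T' *v v}"
      unfolding vec.subspace_def by (simp add: vec.add vec.scale)
    show "\<rho> g *v e \<in> {v. T *v v = T' *v v}" for g
      using assms unfolding cm_def by (simp add: matrix_vector_mul_assoc) (simp add: matrix_vector_mul_assoc[symmetric])
  qed
  then show ?thesis by (simp add: matrix_eq)
qed

lemma cm_rho: "cm (\<rho> g)"
  unfolding cm_def by (metis rho_add add.commute)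

lemma cm_add: "cm T \<Longrightarrow> cm T' \<Longrightarrow> cm (T + T')"
  unfolding cm_def by (simp add: matrix_add_ldistrib vec_eq_iff matrix_matrix_mult_def algebra_simps sum.distrib)

lemma cm_smat: "cm T \<Longrightarrow> cm (smat c T)"
  unfolding cm_def using smat_mult[of c T 1] smat_mult[of 1 _ c T] by simp

lemma cm_mult: "cm T \<Longrightarrow> cm T' \<Longrightarrow> cm (T ** T')"
  unfolding cm_def by (metis matrix_mul_assoc)

text \<open>The orbit of \<open>e\<close> is reached because the group is commutative, so that each
  \<open>\<rho> g\<close> lies in the commutant; linearity and cyclicity do the rest.\<close>

lemma cm_exists: "\<exists>T. cm T \<and> T *v e = v"
proof -
  have "v \<in> {v. \<exists>T. cm T \<and> T *v e = v}"
  proof (rule cyclic_induct)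
    show "vec.subspace {v. \<exists>T. cm T \<and> T *v e = v}"
      unfolding vec.subspace_def
    proof (intro conjI ballI allI)
      have "cm 0" by (simp add: cm_def vec_eq_iff matrix_matrix_mult_def)
      then show "0 \<in> {v. \<exists>T. cm T \<and> T *v e = v}" by (intro CollectI exI[of _ 0]) simp
      fix v w assume "v \<in> {v. \<exists>T. cm T \<and> T *v e = v}" "w \<in> {v. \<exists>T. cm T \<and> T *v e = v}"
      then obtain T T' where "cm T" "T *v e = v" "cm T'" "T' *v e = w" by blast
      then show "v + w \<in> {v. \<exists>T. cm T \<and> T *v e = v}"
        by (intro CollectI exI[of _ "T + T'"]) (simp add: cm_add matrix_vector_mult_add_rdistrib)
    next
      fix c v assume "v \<in> {v. \<exists>T. cm T \<and> T *v e = v}"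
      then obtain T where "cm T" "T *v e = v" by blast
      then show "c *s v \<in> {v. \<exists>T. cm T \<and> T *v e = v}"
        by (intro CollectI exI[of _ "smat c T"]) (simp add: cm_smat smat_mult_vec)
    qed
  qed (use cm_rho in blast)
  then show ?thesis by simp
qed

definition M :: "'a ^ 'k \<Rightarrow> 'a ^ 'k ^ 'k" where
  "M v = (SOME T. cm T \<and> T *v e = v)"

lemma cm_M: "cm (M v)" and M_e: "M v *v e = v"
  using someI_ex[OF cm_exists, of v] unfolding M_def by auto

lemma M_eqI: "cm T \<Longrightarrow> T *v e = v \<Longrightarrow> M v = T"
  by (rule cm_uniq[OF cm_M]) (simp_all add: M_e)

lemma M_add: "M (v + w) = M v + M w"
  by (rule M_eqI) (simp_all add: cm_add cm_M M_e matrix_vector_mult_add_rdistrib)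

lemma M_scale: "M (c *s v) = smat c (M v)"
  by (rule M_eqI) (simp_all add: cm_smat cm_M M_e smat_mult_vec)

lemma M_rho: "M (\<rho> g *v e) = \<rho> g"
  by (rule M_eqI) (simp_all add: cm_rho)

definition mul :: "'a ^ 'k \<Rightarrow> 'a ^ 'k \<Rightarrow> 'a ^ 'k" where
  "mul v w = M v *v w"

text \<open>Both sides are linear in \<open>w\<close> and agree on the orbit of \<open>e\<close>,
  because \<open>M v\<close> commutes with every \<open>\<rho> g\<close>.\<close>

lemma mul_commute: "mul v w = mul w v"
proof -
  have "w \<in> {w. mul v w = mul w v}"
  proof (rule cyclic_induct)
    show "vec.subspace {w. mul v w = mul w v}"
      unfolding vec.subspace_def mul_def using M_scale[of 0 0]
      by (simp add: M_add M_scale vec.add vec.scale matrix_vector_mult_add_rdistrib smat_mult_vec)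
    have "mul v (\<rho> g *v e) = mul (\<rho> g *v e) v" for g
      unfolding mul_def M_rho using cm_M[of v] M_e[of v] unfolding cm_def
      by (simp add: matrix_vector_mul_assoc) (simp add: matrix_vector_mul_assoc[symmetric])
    then show "\<rho> g *v e \<in> {w. mul v w = mul w v}" for g by simp
  qed
  then show ?thesis by simp
qed

lemma M_mul: "M (mul v w) = M v ** M w"
  by (rule M_eqI) (simp_all add: cm_mult cm_M mul_def M_e matrix_vector_mul_assoc[symmetric])

lemma rho_mul: "\<rho> g *v v = mul (\<rho> g *v e) v"
  by (simp add: mul_def M_rho)

sublocale calg e mul
proof
  show "mul (mul u v) w = mul u (mul v w)" for u v w
    by (simp add: mul_def[of "mul u v"] M_mul) (simp add: mul_def matrix_vector_mul_assoc)
  have "cm (mat 1)" by (simp add: cm_def)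
  then have "M e = mat 1" by (intro M_eqI) simp_all
  then show "mul e v = v" for v by (simp add: mul_def)
  show "mul u v = mul v u" for u v by (rule mul_commute)
  show "mul (u + v) w = mul u w + mul v w" for u v w
    by (simp only: mul_def M_add matrix_vector_mult_add_rdistrib)
  show "mul (c *s v) w = c *s mul v w" for c v w
    by (simp only: mul_def M_scale smat_mult_vec)
qed

definition r :: "'a ^ 'n \<Rightarrow> 'a ^ 'k" where
  "r g = \<rho> g *v e"

lemma r_add: "r (g + g') = mul (r g) (r g')"
  by (simp add: r_def rho_add mul_def M_rho matrix_vector_mul_assoc)

lemma r_0: "r 0 = e"
  by (simp add: r_def rho_0)

lemma r_polyf: "polyf (\<lambda>t. r (t *s g) $ i)"
  unfolding r_def matrix_vector_mult_def using rho_poly[of g] unfolding polyf_mat_def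
  by (simp) (intro polyf_sum polyf_mult polyf_const, blast)

text \<open>Comparing the coefficients of \<open>s\<close> in \<open>r ((s + t) g) = r (s g) r (t g)\<close> yields the recursion of the
  exponential series.\<close>

lemma r_exponential: "\<exists>x. nil x \<and> (\<forall>t. r (t *s g) = E (t *s x))"
proof -
  have "\<forall>i. \<exists>p. \<forall>t. poly p t = r (t *s g) $ i" using r_polyf unfolding polyf_def by blast
  from choice[OF this] obtain p where p: "\<And>i t. poly (p i) t = r (t *s g) $ i" by blast
  \<comment> \<open>The two additional units ensure \<open>1 < D\<close>, so that the coefficient of
    index one can be extracted from the sums.\<close>
  define D where "D = Suc (Suc (Max (range (\<lambda>i. degree (p i)))))"
  have deg: "degree (p i) < D" for i
  proof -
    have "degree (p i) \<le> Max (range (\<lambda>i. degree (p i)))" by (intro Max_ge) auto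
    then show ?thesis unfolding D_def by linarith
  qed
  define c where "c j = (\<chi> i. coeff (p i) j)" for j
  have cD: "c j = 0" if "D \<le> j" for j
  proof -
    have "degree (p i) < j" for i using deg[of i] that by linarith
    then show ?thesis by (simp add: c_def vec_eq_iff coeff_eq_0)
  qed
  have rt: "r (t *s g) = (\<Sum>j<D. t ^ j *s c j)" for t
  proof -
    have "r (t *s g) $ i = (\<Sum>j<D. t ^ j *s c j) $ i" for i
    proof -
      have "(\<Sum>j\<le>degree (p i). coeff (p i) j * t ^ j) = (\<Sum>j<D. coeff (p i) j * t ^ j)"
        by (rule sum.mono_neutral_left) (use deg[of i] in \<open>auto simp: coeff_eq_0 not_le\<close>)
      then have "poly (p i) t = (\<Sum>j<D. coeff (p i) j * t ^ j)" by (simp only: poly_altdef)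
      then show ?thesis unfolding p by (simp add: c_def mult.commute)
    qed
    then show ?thesis by (simp add: vec_eq_iff)
  qed
  have c0: "c 0 = e"
  proof -
    have "c 0 $ i = r (0 *s g) $ i" for i unfolding p[symmetric] by (simp add: c_def poly_0_coeff_0)
    then have "c 0 = r (0 *s g)" unfolding vec_eq_iff by blast
    then show ?thesis by (simp add: r_0)
  qed
  have rec: "of_nat (Suc j) *s c (Suc j) = mul (c 1) (c j)" for j
  proof -
    have "of_nat (Suc j) * coeff (p i) (Suc j) = mul (c 1) (c j) $ i" for i
    proof -
      have d: "poly (pderiv (p i)) t = poly (\<Sum>b<D. monom (mul (c 1) (c b) $ i) b) t" for t
      proof -
        define P where "P = (\<Sum>a<D. monom (\<Sum>b<D. t ^ b * mul (c a) (c b) $ i) a)"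
        have "poly (pcompose (p i) [:t, 1:]) s = poly P s" for s
        proof -
          have "r ((s + t) *s g) = mul (r (s *s g)) (r (t *s g))" by (simp add: vector_sadd_rdistrib r_add)
          also have "\<dots> = (\<Sum>a<D. s ^ a *s (\<Sum>b<D. t ^ b *s mul (c a) (c b)))"
            unfolding rt
            by (simp add: mul_sum mul_scale mul_scale_right vec.scale_sum_right mult.commute) (rule sum.swap)
          finally have "r ((s + t) *s g) $ i = (\<Sum>a<D. s ^ a * (\<Sum>b<D. t ^ b * mul (c a) (c b) $ i))" by simp
          then have "poly (p i) (s + t) = (\<Sum>a<D. s ^ a * (\<Sum>b<D. t ^ b * mul (c a) (c b) $ i))" unfolding p .
          then show ?thesis
            by (simp add: poly_pcompose P_def poly_sum poly_monom mult.commute add.commute)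
        qed
        then have "pcompose (p i) [:t, 1:] = P" using poly_eq_poly_eq_iff by blast
        then have "coeff (pcompose (p i) [:t, 1:]) 1 = coeff P 1" by simp
        moreover have "coeff P 1 = (\<Sum>b<D. t ^ b * mul (c 1) (c b) $ i)"
          by (simp add: P_def coeff_sum D_def del: sum.lessThan_Suc)
        moreover have "coeff (pcompose (p i) [:t, 1:]) 1 = poly (pderiv (p i)) t"
        proof -
          have "coeff (pcompose (p i) [:t, 1:]) 1 = poly (pderiv (pcompose (p i) [:t, 1:])) 0"
            by (simp add: poly_0_coeff_0 coeff_pderiv)
          then show ?thesis by (simp add: pderiv_pcompose poly_pcompose pderiv_pCons)
        qed
        ultimately show ?thesis by (simp add: poly_sum poly_monom mult.commute)
      qed
      have "pderiv (p i) = (\<Sum>b<D. monom (mul (c 1) (c b) $ i) b)"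
        using d poly_eq_poly_eq_iff by blast
      then have "coeff (pderiv (p i)) j = coeff (\<Sum>b<D. monom (mul (c 1) (c b) $ i) b) j" by simp
      then have "of_nat (Suc j) * coeff (p i) (Suc j) = (if j < D then mul (c 1) (c j) $ i else 0)"
        by (simp add: coeff_pderiv coeff_sum)
      then show ?thesis using cD[of j] by (auto simp: not_less)
    qed
    then show ?thesis unfolding vec_eq_iff vector_smult_component c_def vec_lambda_beta by blast
  qed
  have cdp: "c j = dp (c 1) j" for j
  proof (induction j)
    case (Suc j)
    have "of_nat (Suc j) *s c (Suc j) = of_nat (Suc j) *s dp (c 1) (Suc j)"
      unfolding rec dp_Suc Suc ..
    from vec.scale_left_imp_eq[OF of_nat_neq_0 this] show ?case .
  qed (simp add: c0)
  have pwD: "pw (c 1) D = 0" using cdp[of D] cD[of D] by (simp add: dp_def)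
  have "r (t *s g) = E (t *s c 1)" for t
  proof -
    have "pw (t *s c 1) D = 0" unfolding pw_scale pwD by simp
    from E_eq[OF this] have "E (t *s c 1) = (\<Sum>j<D. dp (t *s c 1) j)" .
    also have "\<dots> = (\<Sum>j<D. t ^ j *s c j)"
    proof (intro sum.cong refl)
      fix j
      have "dp (t *s x) j = t ^ j *s dp x j" for x by (simp add: dp_def pw_scale mult.commute)
      then show "dp (t *s c 1) j = t ^ j *s c j" unfolding cdp[of j] by blast
    qed
    finally have "E (t *s c 1) = (\<Sum>j<D. t ^ j *s c j)" .
    then show ?thesis by (simp add: rt)
  qed
  moreover have "nil (c 1)" using pwD by (auto simp: nil_def)
  ultimately show ?thesis by blast
qed

text \<open>The logarithm of the orbit map, unique by \<open>E_inj\<close> and hence linear in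
  \<open>g\<close>.\<close>

definition \<nu> :: "'a ^ 'n \<Rightarrow> 'a ^ 'k" where
  "\<nu> g = (SOME x. nil x \<and> r g = E x)"

lemma nu_ex: "\<exists>x. nil x \<and> r g = E x"
  using r_exponential[of g] by (metis vector_smult_lid)

lemma nil_nu: "nil (\<nu> g)" and r_eq_E: "r g = E (\<nu> g)"
  using someI_ex[OF nu_ex, of g] unfolding \<nu>_def by auto

lemma nu_eqI: "nil x \<Longrightarrow> r g = E x \<Longrightarrow> \<nu> g = x"
  by (rule E_inj[OF nil_nu]) (simp_all add: r_eq_E[symmetric])

lemma nu_add: "\<nu> (g + g') = \<nu> g + \<nu> g'"
  by (rule nu_eqI) (simp_all add: nil_add nil_nu E_add r_add r_eq_E[symmetric])

lemma nu_scale: "\<nu> (c *s g) = c *s \<nu> g"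
proof -
  obtain x where x: "nil x" "\<And>t. r (t *s g) = E (t *s x)" using r_exponential by blast
  have "\<nu> g = x" using x(2)[of 1] by (intro nu_eqI x) simp
  then show ?thesis by (intro nu_eqI) (simp_all add: x nil_scale)
qed

lemma rho_E: "\<rho> g *v v = mul (E (\<nu> g)) v"
  using rho_mul[of g v] r_eq_E[of g] by (simp add: r_def)

text \<open>Orbit vectors are exponentials, hence of the form \<open>e\<close> plus a nilpotent, and
  they span.\<close>

lemma local_cyclic: "\<exists>c. nil (v - c *s e)"
proof -
  have "v \<in> {v. \<exists>c. nil (v - c *s e)}"
  proof (rule cyclic_induct)
    show "vec.subspace {v. \<exists>c. nil (v - c *s e)}"
      unfolding vec.subspace_def
    proof (intro conjI ballI allI)
      show "0 \<in> {v. \<exists>c. nil (v - c *s e)}" by (intro CollectI exI[of _ 0]) (simp add: nil_zero)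
      fix v w assume "v \<in> {v. \<exists>c. nil (v - c *s e)}" "w \<in> {v. \<exists>c. nil (v - c *s e)}"
      then obtain c d where "nil (v - c *s e)" "nil (w - d *s e)" by blast
      then have "nil ((v - c *s e) + (w - d *s e))" by (rule nil_add)
      moreover have "(v - c *s e) + (w - d *s e) = v + w - (c + d) *s e" by (simp add: vec_eq_iff algebra_simps)
      ultimately show "v + w \<in> {v. \<exists>c. nil (v - c *s e)}" by (intro CollectI exI[of _ "c + d"]) simp
    next
      fix a v assume "v \<in> {v. \<exists>c. nil (v - c *s e)}"
      then obtain c where "nil (v - c *s e)" by blast
      then have "nil (a *s (v - c *s e))" by (rule nil_scale)
      moreover have "a *s (v - c *s e) = a *s v - (a * c) *s e" by (simp add: vec_eq_iff algebra_simps)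
      ultimately show "a *s v \<in> {v. \<exists>c. nil (v - c *s e)}" by (intro CollectI exI[of _ "a * c"]) simp
    qed
    have "nil (r g - 1 *s e)" for g
    proof -
      obtain w where w: "E (\<nu> g) = e + \<nu> g + mul (mul (\<nu> g) (\<nu> g)) w" using E_expand[OF nil_nu] by blast
      have "r g - 1 *s e = \<nu> g + mul (mul (\<nu> g) (\<nu> g)) w" unfolding r_eq_E w by simp
      then show ?thesis using nil_nu by (simp add: nil_add nil_mul)
    qed
    then show "\<rho> g *v e \<in> {v. \<exists>c. nil (v - c *s e)}" for g unfolding r_def by blast
  qed
  then show ?thesis by simp
qed

end

section \<open>Graphs over affine subspaces\<close>

lemma dual_functional:
  fixes B :: "('a::field ^ 'k) set"
  assumes "vec.independent B" "b \<in> B"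
  shows "\<exists>a. lf a b = 1 \<and> (\<forall>x\<in>B - {b}. lf a x = 0)"
proof -
  \<comment> \<open>The functional is obtained as one coordinate of a linear self-map, hence the
    value \<open>axis undefined 1\<close>.\<close>
  define f :: "'a ^ 'k \<Rightarrow> 'a ^ 'k" where "f x = (if x = b then axis undefined 1 else 0)" for x
  obtain g where g: "Vector_Spaces.linear (*s) (*s) g" "\<forall>x\<in>B. g x = f x"
    using vec.linear_independent_extend[OF assms(1), of f] by blast
  have lin: "g (v + w) $ undefined = g v $ undefined + g w $ undefined"
    "g (c *s v) $ undefined = c * g v $ undefined" for v w c
    using vec.linear_add[OF g(1)] vec.linear_scale[OF g(1)] by simp_all
  have eq: "g v $ undefined = lf (\<chi> i. g (axis i 1) $ undefined) v" for v
    by (rule linear_functional_lf[of "\<lambda>v. g v $ undefined", OF lin])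
  show ?thesis
  proof (intro exI[of _ "\<chi> i. g (axis i 1) $ undefined"] conjI ballI)
    show "lf (\<chi> i. g (axis i 1) $ undefined) b = 1"
      unfolding eq[symmetric] using g(2) assms(2) by (simp add: f_def)
    show "lf (\<chi> i. g (axis i 1) $ undefined) x = 0" if "x \<in> B - {b}" for x
      unfolding eq[symmetric] using g(2) that by (simp add: f_def)
  qed
qed

lemma lf_zero_on_span:
  assumes "\<And>x. x \<in> B \<Longrightarrow> lf a x = 0" "v \<in> vec.span B"
  shows "lf a v = 0"
proof -
  have "vec.subspace {v. lf a v = 0}" by (simp add: vec.subspace_def lf_zero lf_add lf_scale)
  then have "vec.span B \<subseteq> {v. lf a v = 0}" by (intro vec.span_minimal) (use assms(1) in auto)
  then show ?thesis using assms(2) by blast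
qed

lemma separating_functional:
  fixes W :: "('a::field ^ 'k) set"
  assumes "vec.subspace W" "v \<notin> W"
  shows "\<exists>a. (\<forall>w\<in>W. lf a w = 0) \<and> lf a v \<noteq> 0"
proof -
  obtain B where B: "B \<subseteq> W" "vec.independent B" "W \<subseteq> vec.span B" by (rule vec.basis_exists[of W])
  have "vec.span B \<subseteq> W" by (rule vec.span_minimal[OF B(1) assms(1)])
  then have "v \<notin> vec.span B" using assms(2) by blast
  then have "vec.independent (insert v B)" using B(2) by (rule vec.independent_insertI)
  then obtain a where a: "lf a v = 1" "\<forall>x\<in>insert v B - {v}. lf a x = 0" using dual_functional by blast
  have "v \<notin> B" using B(1) assms(2) by blast
  then have "\<forall>x\<in>B. lf a x = 0" using a(2) by blast
  then have "\<forall>w\<in>W. lf a w = 0" using B(3) lf_zero_on_span by blast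
  then show ?thesis using a(1) by (intro exI[of _ a]) simp
qed

text \<open>The alternative for \<open>p\<close> covers affine subspaces, with \<open>p = 0\<close>,
  and graphs in a new direction \<open>p\<close>. Since the coordinates vanish on \<open>e\<close>
  and \<open>p\<close>, they read off the base point of a graph over \<open>S\<close>.\<close>

lemma subspace_coords:
  fixes S :: "('a::field ^ 'k) set"
  assumes S: "vec.subspace S" and p: "p = 0 \<or> p \<notin> S" and e: "e \<notin> vec.span (insert p S)"
  shows "\<exists>b y. (\<forall>i<vec.dim S. b i \<in> S \<and> lf (y i) e = 0 \<and> lf (y i) p = 0 \<and>
      (\<forall>j<vec.dim S. lf (y i) (b j) = (if i = j then 1 else 0))) \<and>
    (\<forall>v\<in>S. \<exists>t. v = (\<Sum>i<vec.dim S. t i *s b i))"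
proof -
  obtain B where B: "B \<subseteq> S" "vec.independent B" "S \<subseteq> vec.span B" "card B = vec.dim S"
    by (rule vec.basis_exists[of S])
  have fin: "finite B" using B(2) by (rule vec.finiteI_independent)
  have spB: "vec.span B \<subseteq> S" by (rule vec.span_minimal[OF B(1) S])
  obtain b where b: "bij_betw b {..<vec.dim S} B"
    using ex_bij_betw_nat_finite[OF fin] B(4) by (auto simp: atLeast0LessThan)
  define P where "P = (if p = 0 then {} else {p})"
  have indP: "vec.independent (P \<union> B)"
    using B(2) vec.independent_insertI[of p B] p spB by (auto simp: P_def)
  have spP: "vec.span (P \<union> B) \<subseteq> vec.span (insert p S)"
    by (rule vec.span_mono) (use B(1) in \<open>auto simp: P_def\<close>)
  have ind: "vec.independent (insert e (P \<union> B))"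
    by (rule vec.independent_insertI[OF _ indP]) (use spP e in blast)
  have bB: "b i \<in> B" if "i < vec.dim S" for i using b that by (auto simp: bij_betw_def)
  have eB: "e \<notin> P \<union> B" using spP e vec.span_superset by blast
  have pB: "p \<notin> B" if "p \<noteq> 0" using p that B(1) by blast
  have "\<exists>a. lf a e = 0 \<and> lf a p = 0 \<and> (\<forall>j<vec.dim S. lf a (b j) = (if i = j then 1 else 0))" if i: "i < vec.dim S" for i
  proof -
    obtain a where a: "lf a (b i) = 1" "\<forall>x\<in>insert e (P \<union> B) - {b i}. lf a x = 0"
      using dual_functional[OF ind, of "b i"] bB[OF i] by blast
    have "lf a e = 0" using a(2) eB bB[OF i] by auto
    moreover have "lf a p = 0"
    proof (cases "p = 0")
      case False
      then have "p \<in> insert e (P \<union> B) - {b i}" using pB bB[OF i] by (auto simp: P_def)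
      then show ?thesis using a(2) by blast
    qed (simp add: lf_zero)
    moreover have "lf a (b j) = (if i = j then 1 else 0)" if j: "j < vec.dim S" for j
    proof (cases "i = j")
      case False
      then have "b j \<noteq> b i" using b i j by (auto simp: bij_betw_def inj_on_def)
      then show ?thesis using a(2) bB[OF j] False by auto
    qed (use a(1) in simp)
    ultimately show ?thesis by blast
  qed
  then have "\<forall>i\<in>{..<vec.dim S}. \<exists>a. lf a e = 0 \<and> lf a p = 0 \<and> (\<forall>j<vec.dim S. lf a (b j) = (if i = j then 1 else 0))" by blast
  from bchoice[OF this] obtain y where y: "\<forall>i\<in>{..<vec.dim S}. lf (y i) e = 0 \<and> lf (y i) p = 0 \<and>
    (\<forall>j<vec.dim S. lf (y i) (b j) = (if i = j then 1 else 0))" by blast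
  have "\<exists>t. v = (\<Sum>i<vec.dim S. t i *s b i)" if v: "v \<in> S" for v
  proof -
    have "v \<in> vec.span B" using v B(3) by blast
    then obtain u where u: "v = (\<Sum>x\<in>B. u x *s x)" using vec.span_finite[OF fin] by auto
    have "(\<Sum>i<vec.dim S. u (b i) *s b i) = (\<Sum>x\<in>B. u x *s x)"
      by (rule sum.reindex_bij_betw[OF b])
    then show ?thesis using u by (intro exI[of _ "\<lambda>i. u (b i)"]) simp
  qed
  then show ?thesis using y bB B(1) by (intro exI[of _ b] exI[of _ y] conjI allI impI ballI) auto
qed

lemma tpoly_add: "f \<in> tpoly r \<Longrightarrow> g \<in> tpoly r \<Longrightarrow> (\<lambda>t. f t + g t) \<in> tpoly r"
  and tpoly_mult: "f \<in> tpoly r \<Longrightarrow> g \<in> tpoly r \<Longrightarrow> (\<lambda>t. f t * g t) \<in> tpoly r"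
  and tpoly_const: "(\<lambda>t. c) \<in> tpoly r"
  unfolding tpoly_def by (auto intro: poly_funs.intros)

lemma tpoly_coord: "i < r \<Longrightarrow> (\<lambda>t. t i) \<in> tpoly r"
  unfolding tpoly_def by (auto intro: poly_funs.coord)

lemma tpoly_sum: "(\<And>i. i \<in> I \<Longrightarrow> f i \<in> tpoly r) \<Longrightarrow> (\<lambda>t. \<Sum>i\<in>I. f i t) \<in> tpoly r"
  by (induction I rule: infinite_finite_induct) (simp_all add: tpoly_const tpoly_add)

text \<open>The functionals of \<open>subspace_coords\<close> recover the parameters from a point of
  the graph, as \<open>dim_param\<close> requires.\<close>

lemma graph_param:
  fixes S :: "('a::field_char_0 ^ 'k) set"
  assumes S: "vec.subspace S" and p: "p = 0 \<or> p \<notin> S" and e: "e \<notin> vec.span (insert p S)"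
    and \<kappa>: "\<kappa> \<in> polys"
  shows "\<exists>\<psi>. tparam (vec.dim S) \<psi> \<and> range \<psi> = (\<lambda>u. e + u + \<kappa> u *s p) ` S \<and>
    dim_of (zariski closure_of (pts \<psi>)) = enat (vec.dim S)"
proof -
  obtain b y where bb: "\<forall>i<vec.dim S. b i \<in> S \<and> lf (y i) e = 0 \<and> lf (y i) p = 0 \<and>
      (\<forall>j<vec.dim S. lf (y i) (b j) = (if i = j then 1 else 0))"
    and coords: "\<forall>v\<in>S. \<exists>t. v = (\<Sum>i<vec.dim S. t i *s b i)"
    using subspace_coords[OF S p e] by blast
  define u where "u t = (\<Sum>i<vec.dim S. t i *s b i)" for t :: "nat \<Rightarrow> 'a"
  define \<psi> where "\<psi> t = e + u t + \<kappa> (u t) *s p" for t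
  have uS: "u t \<in> S" for t unfolding u_def using bb by (intro vec.subspace_sum[OF S] vec.subspace_scale[OF S]) auto
  have ut: "(\<lambda>t. u t $ i) \<in> tpoly (vec.dim S)" for i
    unfolding u_def by (simp add: sum_component) (intro tpoly_sum tpoly_mult tpoly_coord tpoly_const; simp)
  have "range u = S" using uS coords by (auto simp: u_def)
  then have ran: "range \<psi> = (\<lambda>u. e + u + \<kappa> u *s p) ` S" unfolding \<psi>_def by auto
  have nz: "\<psi> t \<noteq> 0" for t
  proof
    assume "\<psi> t = 0"
    then have "e = - (u t + \<kappa> (u t) *s p)" unfolding \<psi>_def add.assoc by (simp only: eq_neg_iff_add_eq_0)
    moreover have "- (u t + \<kappa> (u t) *s p) \<in> vec.span (insert p S)"
      by (intro vec.span_neg vec.span_add vec.span_scale vec.span_base) (use uS in auto)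
    ultimately show False using e by simp
  qed
  have par: "tparam (vec.dim S) \<psi>"
    unfolding tparam_def
  proof (intro conjI allI)
    fix i
    have "(\<lambda>t. \<kappa> (u t)) \<in> tpoly (vec.dim S)"
      using polys_compose[OF \<kappa>, of u] ut unfolding tpoly_def by blast
    then show "(\<lambda>t. \<psi> t $ i) \<in> tpoly (vec.dim S)"
      unfolding \<psi>_def by (simp) (intro tpoly_add tpoly_mult tpoly_const ut)
  qed (rule nz)
  have "lf (y j) (\<psi> t) = t j" if j: "j < vec.dim S" for j t
  proof -
    have "lf (y j) (\<psi> t) = (\<Sum>i<vec.dim S. t i * lf (y j) (b i))"
      using bb j unfolding \<psi>_def u_def by (simp add: lf_add lf_scale lf_sum)
    also have "\<dots> = (\<Sum>i<vec.dim S. if j = i then t i else 0)" using bb j by (intro sum.cong) auto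
    also have "\<dots> = t j" using j by (simp add: sum.delta)
    finally show ?thesis .
  qed
  from dim_param[OF par lf_homog this] par ran show ?thesis by blast
qed

lemma polys_path_polyf:
  fixes f :: "'a::field ^ 'k \<Rightarrow> 'a"
  assumes "f \<in> polys" "\<And>i. polyf (\<lambda>s. \<gamma> s $ i)"
  shows "polyf (\<lambda>s. f (\<gamma> s))"
  unfolding polyf_def
proof (rule poly_funs_path[where \<gamma> = \<gamma>])
  show "f \<in> poly_funs (range (\<lambda>i v. v $ i))" using assms(1) by (simp add: polys_def)
  show "\<exists>p. \<forall>t. poly p t = c (\<gamma> t)" if "c \<in> range (\<lambda>i v. v $ i)" for c
    using that assms(2) unfolding polyf_def by auto
qed

lemma closure_pts_in_subspace:
  assumes W: "vec.subspace W" and r: "\<And>t. \<psi> t \<in> W" "\<And>t. \<psi> t \<noteq> 0"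
  shows "zariski closure_of (pts \<psi>) \<subseteq> proj W"
proof
  fix x assume x: "x \<in> zariski closure_of (pts \<psi>)"
  then obtain v where v: "v \<noteq> 0" "x = vec.span {v}" using closure_subset_proj projE by blast
  have "v \<in> W"
  proof (rule ccontr)
    assume "v \<notin> W"
    then obtain a where a: "\<forall>w\<in>W. lf a w = 0" "lf a v \<noteq> 0" using separating_functional[OF W] by blast
    have "lf a v = 0" by (rule closure_ptsD[OF _ v(1) r(2) lf_homog]) (use x v a(1) r(1) in auto)
    with a(2) show False by simp
  qed
  then show "x \<in> proj W" using v by (auto simp: proj_def)
qed

lemma proj_mono: "V \<subseteq> W \<Longrightarrow> proj V \<subseteq> proj W"
  by (auto simp: proj_def)

lemma span_in_proj_iff:
  assumes "vec.subspace W" "v \<noteq> 0"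
  shows "vec.span {v} \<in> proj W \<longleftrightarrow> v \<in> W"
proof
  assume "vec.span {v} \<in> proj W"
  then obtain w where "w \<in> W" "vec.span {v} = vec.span {w}" by (auto simp: proj_def)
  moreover have "v \<in> vec.span {v}" by (simp add: vec.span_base)
  ultimately show "v \<in> W" using assms(1) by (auto simp: in_span_singleton_iff vec.subspace_scale)
qed (use assms in \<open>auto simp: proj_def\<close>)

lemma subspace_sum_line:
  assumes "vec.subspace S"
  shows "vec.subspace {c *s e + x | c x. x \<in> S}"
  unfolding vec.subspace_def
proof (intro conjI ballI allI)
  show "0 \<in> {c *s e + x | c x. x \<in> S}" using vec.subspace_0[OF assms] by (intro CollectI exI[of _ 0]) simp
  fix v w assume "v \<in> {c *s e + x | c x. x \<in> S}" "w \<in> {c *s e + x | c x. x \<in> S}"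
  then obtain c x d y where "v = c *s e + x" "x \<in> S" "w = d *s e + y" "y \<in> S" by blast
  then show "v + w \<in> {c *s e + x | c x. x \<in> S}"
    by (intro CollectI exI[of _ "c + d"] exI[of _ "x + y"])
      (simp add: vec.subspace_add[OF assms] vec.scale_left_distrib)
next
  fix a v assume "v \<in> {c *s e + x | c x. x \<in> S}"
  then obtain c x where "v = c *s e + x" "x \<in> S" by blast
  then show "a *s v \<in> {c *s e + x | c x. x \<in> S}"
    by (intro CollectI exI[of _ "a * c"] exI[of _ "a *s x"])
      (simp add: vec.subspace_scale[OF assms] vector_add_ldistrib)
qed

context local_calg
begin

definition unital :: "('a ^ 'k) set \<Rightarrow> ('a ^ 'k) set" where
  "unital T = {c *s e + x | c x. x \<in> T}"

lemma unital_subspace: "vec.subspace T \<Longrightarrow> vec.subspace (unital T)"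
  unfolding unital_def by (rule subspace_sum_line)

lemma h_unital: "(\<And>x. x \<in> T \<Longrightarrow> nil x) \<Longrightarrow> x \<in> T \<Longrightarrow> h (c *s e + x) = c"
  using nil_iff_h[of x] by (simp add: h_add h_scale)

lemma unital_mem_iff:
  assumes "\<And>x. x \<in> T \<Longrightarrow> nil x"
  shows "v \<in> unital T \<longleftrightarrow> v - h v *s e \<in> T"
proof
  assume "v \<in> unital T"
  then obtain c x where v: "v = c *s e + x" "x \<in> T" by (auto simp: unital_def)
  have "h v = c" unfolding v(1) by (rule h_unital[of T, OF assms v(2)])
  with v show "v - h v *s e \<in> T" by simp
next
  assume "v - h v *s e \<in> T"
  moreover have "v = h v *s e + (v - h v *s e)" by simp
  ultimately show "v \<in> unital T" unfolding unital_def by blast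
qed

lemma unital_mult_closed:
  assumes T: "vec.subspace T" and "\<And>x y. x \<in> T \<Longrightarrow> y \<in> T \<Longrightarrow> x \<odot> y \<in> T" "v \<in> unital T" "w \<in> unital T"
  shows "v \<odot> w \<in> unital T"
proof -
  obtain c x d y where v: "v = c *s e + x" "x \<in> T" and w: "w = d *s e + y" "y \<in> T"
    using assms(3,4) by (auto simp: unital_def)
  have eq: "v \<odot> w = (c * d) *s e + (c *s y + d *s x + x \<odot> y)"
    unfolding v(1) w(1) by (simp add: mul_bilin vector_add_ldistrib algebra_simps)
  have "c *s y + d *s x + x \<odot> y \<in> T"
    using T v(2) w(2) assms(2) by (intro vec.subspace_add vec.subspace_scale)
  then show ?thesis unfolding eq unital_def by blast
qed

lemma E_in_unital:
  assumes "vec.subspace T" "\<And>x y. x \<in> T \<Longrightarrow> y \<in> T \<Longrightarrow> x \<odot> y \<in> T" "nil x" "x \<in> T"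
  shows "E x \<in> unital T"
proof -
  have "E x = 1 *s e + (E x - e)" by simp
  then show ?thesis unfolding unital_def using E_minus_unit_closed[OF assms] by blast
qed

lemma e_in_unital: "vec.subspace T \<Longrightarrow> e \<in> unital T"
  unfolding unital_def using vec.subspace_0 by (intro CollectI exI[of _ 1] exI[of _ 0]) auto

text \<open>The data about \<open>exp S\<close> from which the additive action on its closure is read off.\<close>

definition orbit_data :: "('a ^ 'k) set \<Rightarrow> ('a ^ 'k) set \<Rightarrow> bool" where
  "orbit_data S W \<longleftrightarrow> vec.subspace W \<and> vec.span (E ` S) = W \<and>
     (\<forall>s\<in>S. \<forall>w\<in>W. E s \<odot> w \<in> W) \<and>
     (\<exists>\<psi>. tparam (vec.dim S) \<psi> \<and> range \<psi> = E ` S \<and>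
        dim_of (zariski closure_of (pts \<psi>)) = enat (vec.dim S) \<and>
        (\<forall>v. v \<noteq> 0 \<longrightarrow> vec.span {v} \<in> zariski closure_of (pts \<psi>) \<longrightarrow> h v \<noteq> 0 \<longrightarrow>
           (\<exists>s\<in>S. \<exists>c. v = c *s E s)))"

text \<open>For a nilpotent subalgebra the exponentials fill all of \<open>e + S\<close>, by
  \<open>E_minus_unit_closed\<close> and \<open>E_surj\<close>, so the orbit is an affine chart of a
  projective space.\<close>

lemma subalgebra_orbit:
  assumes S: "vec.subspace S" and nilS: "\<And>x. x \<in> S \<Longrightarrow> nil x"
    and mult: "\<And>x y. x \<in> S \<Longrightarrow> y \<in> S \<Longrightarrow> x \<odot> y \<in> S"
  shows "orbit_data S (unital S)"
    and "range \<psi> = E ` S \<Longrightarrow> zariski closure_of (pts \<psi>) = proj (unital S)"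
proof -
  let ?W = "unital S"
  have W: "vec.subspace ?W" by (rule unital_subspace[OF S])
  have ES: "E ` S = (\<lambda>u. e + u) ` S"
  proof (intro equalityI subsetI)
    fix v assume "v \<in> E ` S"
    then obtain s where s: "s \<in> S" "v = E s" by blast
    have "E s - e \<in> S" by (rule E_minus_unit_closed[OF S mult nilS[OF s(1)] s(1)])
    then show "v \<in> (\<lambda>u. e + u) ` S" using s(2) by (intro image_eqI[where x = "E s - e"]) simp_all
  next
    fix v assume "v \<in> (\<lambda>u. e + u) ` S"
    then show "v \<in> E ` S" using E_surj[OF S mult nilS] by (auto simp: image_iff) metis
  qed
  have e: "e \<notin> vec.span (insert 0 S)"
  proof
    assume "e \<in> vec.span (insert 0 S)"
    then have "e \<in> S" using vec.span_minimal[of "insert 0 S" S] S vec.subspace_0[OF S] by blast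
    from nilS[OF this] show False using nil_multiple_e[of 1] by simp
  qed
  have span: "vec.span (E ` S) = ?W"
  proof (rule antisym)
    show "vec.span (E ` S) \<subseteq> ?W"
      by (rule vec.span_minimal[OF _ W]) (use E_in_unital[OF S mult] nilS in auto)
    have eS: "e \<in> vec.span (E ` S)" unfolding ES by (intro vec.span_base image_eqI[where x = 0]) (use vec.subspace_0[OF S] in simp_all)
    show "?W \<subseteq> vec.span (E ` S)"
    proof
      fix v assume "v \<in> ?W"
      then obtain c x where v: "v = c *s e + x" "x \<in> S" by (auto simp: unital_def)
      have "e + x \<in> vec.span (E ` S)" unfolding ES using v(2) by (intro vec.span_base) simp
      then have "(e + x) - e \<in> vec.span (E ` S)" using eS by (rule vec.span_diff)
      then show "v \<in> vec.span (E ` S)" unfolding v(1) using eS by (intro vec.span_add vec.span_scale) simp_all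
    qed
  qed
  have hv: "\<exists>s\<in>S. \<exists>c. v = c *s E s" if v: "v \<in> ?W" "h v \<noteq> 0" for v
  proof -
    have "(1 / h v) *s (v - h v *s e) \<in> S" using v(1) unital_mem_iff[OF nilS] vec.subspace_scale[OF S] by blast
    then have "e + (1 / h v) *s (v - h v *s e) \<in> E ` S" unfolding ES by blast
    then obtain s where s: "s \<in> S" "E s = e + (1 / h v) *s (v - h v *s e)" by auto
    have "v = h v *s E s" unfolding s(2) using v(2) by (simp add: vec_eq_iff field_simps)
    with s(1) show ?thesis by blast
  qed
  obtain \<psi> where \<psi>: "tparam (vec.dim S) \<psi>" "range \<psi> = (\<lambda>u. e + u + (\<lambda>_. 0) u *s 0) ` S"
    "dim_of (zariski closure_of (pts \<psi>)) = enat (vec.dim S)"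
    using graph_param[OF S _ e polys_intros(2)[of 0]] by blast
  have r\<psi>: "range \<psi> = E ` S" unfolding \<psi>(2) ES by simp
  have sub: "zariski closure_of (pts \<psi>) \<subseteq> proj ?W" if "range \<psi> = E ` S" for \<psi> :: "'x \<Rightarrow> 'a ^ 'k"
  proof (rule closure_pts_in_subspace[OF W])
    fix t
    have "\<psi> t \<in> E ` S" using that by blast
    then obtain s where s: "s \<in> S" "\<psi> t = E s" by blast
    show "\<psi> t \<in> ?W" unfolding s(2) by (rule E_in_unital[OF S mult nilS[OF s(1)] s(1)])
    show "\<psi> t \<noteq> 0" using h_E[OF nilS[OF s(1)]] s(2) by auto
  qed
  show "orbit_data S ?W"
    unfolding orbit_data_def
  proof (intro conjI exI[of _ \<psi>] ballI allI impI)
    show "E s \<odot> w \<in> ?W" if "s \<in> S" "w \<in> ?W" for s w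
      by (rule unital_mult_closed[OF S mult E_in_unital[OF S mult nilS[OF that(1)] that(1)] that(2)])
    show "\<exists>s\<in>S. \<exists>c. v = c *s E s" if "v \<noteq> 0" "vec.span {v} \<in> zariski closure_of (pts \<psi>)" "h v \<noteq> 0" for v
      using hv[OF _ that(3)] sub[OF r\<psi>] that(2) span_in_proj_iff[OF W that(1)] by blast
  qed (use W span \<psi> r\<psi> in auto)
  show "zariski closure_of (pts \<psi>) = proj ?W" if ran: "range \<psi> = E ` S" for \<psi> :: "'x \<Rightarrow> 'a ^ 'k"
  proof (rule antisym[OF sub[OF ran]], rule subsetI)
    fix x assume "x \<in> proj ?W"
    then obtain v where v: "v \<in> ?W" "v \<noteq> 0" "x = vec.span {v}" by (auto simp: proj_def)
    have nz: "\<psi> t \<noteq> 0" for t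
    proof -
      have "\<psi> t \<in> E ` S" using ran by blast
      then show ?thesis using h_E nilS by fastforce
    qed
    have "f v = 0" if f: "f \<in> homog d" "\<forall>t. f (\<psi> t) = 0" for d f
    proof -
      have gen: "f w = 0" if w: "w \<in> ?W" "h w \<noteq> 0" for w
      proof -
        obtain s c where "s \<in> S" "w = c *s E s" using hv[OF w] by blast
        moreover have "E s \<in> range \<psi>" using ran \<open>s \<in> S\<close> by blast
        ultimately show ?thesis using f(2) homogD(2)[OF f(1)] by auto
      qed
      show ?thesis
      proof (cases "h v = 0")
        case True
        \<comment> \<open>A point at infinity is approached in direction \<open>e\<close>, where
          \<open>h\<close> is non-zero for \<open>s \<noteq> 0\<close>.\<close>
        have "f (v + s *s e) = 0" if "s \<notin> {0}" for s
        proof (rule gen)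
          show "v + s *s e \<in> ?W" using W v(1) e_in_unital[OF S] by (intro vec.subspace_add vec.subspace_scale)
          show "h (v + s *s e) \<noteq> 0" using that True by (simp add: h_add h_scale)
        qed
        from polyf_eq_cofinite[OF polys_line[OF homogD(1)[OF f(1)]] polyf_const, of "{0}" v e 0 0] this
        show ?thesis by simp
      qed (use gen v(1) in blast)
    qed
    then show "x \<in> zariski closure_of (pts \<psi>)" unfolding v(3) closure_pts_iff[of \<psi>, OF nz v(2)] by blast
  qed
qed

end

section \<open>Invariant quadrics\<close>

text \<open>\<open>codim\<close> only bounds the codimension of \<open>U\<close> among the
  nilpotents by one; that \<open>U\<close> is proper comes out of \<open>phi_U\<close> and
  \<open>phi_nonzero\<close>.\<close>

locale quad_calg = local_calg e mul
  for e :: "'a::{alg_closed_field, field_char_0} ^ 'k" and mul (infixl "\<odot>" 70) +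
  fixes q :: "'a ^ 'k \<Rightarrow> 'a" and U :: "('a ^ 'k) set"
  assumes q: "q \<in> homog 2" and U: "vec.subspace U" and nilU: "u \<in> U \<Longrightarrow> nil u"
    and inv: "u \<in> U \<Longrightarrow> q (E u \<odot> v) = q v" and qe: "q e = 0" and qnz: "\<exists>v. q v \<noteq> 0"
    and cyc: "vec.span (E ` U) = UNIV"
    and codim: "\<exists>p0. \<forall>x. nil x \<longrightarrow> (\<exists>u\<in>U. \<exists>c. x = u + c *s p0)"
begin

abbreviation B where "B \<equiv> polar q"

lemmas B_add = polar_add[OF q] and B_scale = polar_scale[OF q] and B_zero = polar_zero[OF q]
  and B_sum = polar_sum[OF q] and B_minus = polar_minus[OF q] and B_diff = polar_diff[OF q]

lemma B_sum_left: "B (\<Sum>i\<in>I. f i) v = (\<Sum>i\<in>I. B (f i) v)"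
  using B_sum[of v f I] by (simp add: polar_sym[of q _ v])

text \<open>\<open>E u\<close> is an isometry of \<open>q\<close> with inverse
  \<open>E (- u)\<close>.\<close>

lemma adjoint_E:
  assumes "u \<in> U"
  shows "B (E u \<odot> v) w = B v (E (- u) \<odot> w)"
proof -
  have "E u \<odot> (E (- u) \<odot> w) = w" using E_minus[OF nilU[OF assms]] by (simp add: mul_assoc[symmetric])
  then have "B (E u \<odot> v) w = B (E u \<odot> v) (E u \<odot> (E (- u) \<odot> w))" by simp
  also have "\<dots> = B v (E (- u) \<odot> w)"
    unfolding polar_def mul_add_right[symmetric] inv[OF assms] ..
  finally show ?thesis .
qed

lemma E_scale_sum:
  assumes "pw u D = 0"
  shows "E (t *s u) = (\<Sum>n<D. t ^ n *s dp u n)"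
proof -
  have "pw (t *s u) D = 0" unfolding pw_scale assms by simp
  from E_eq[OF this] show ?thesis by (simp add: dp_def pw_scale mult.commute)
qed

text \<open>Multiplication by an element of the Lie algebra \<open>U\<close> is skew: compare the coefficients of \<open>t\<close> in
  \<open>B (exp (t u) v) w = B v (exp (- t u) w)\<close>.\<close>

lemma skew:
  assumes u: "u \<in> U"
  shows "B (u \<odot> v) w = - B v (u \<odot> w)"
proof -
  obtain D0 where "pw u D0 = 0" using nilU[OF u] by (auto simp: nil_def)
  then have D: "pw u (Suc (Suc D0)) = 0" by simp
  define D where "D = Suc (Suc D0)"
  note D = D[folded D_def]
  define P where "P = (\<Sum>n<D. monom (B (dp u n \<odot> v) w) n)"
  define Q where "Q = (\<Sum>n<D. monom ((-1) ^ n * B v (dp u n \<odot> w)) n)"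
  have "poly P t = poly Q t" for t
  proof -
    have "t *s u \<in> U" by (rule vec.subspace_scale[OF U u])
    from adjoint_E[OF this, of v w] have "B (E (t *s u) \<odot> v) w = B v (E ((- t) *s u) \<odot> w)" by simp
    then have "(\<Sum>n<D. t ^ n * B (dp u n \<odot> v) w) = (\<Sum>n<D. (- t) ^ n * B v (dp u n \<odot> w))"
      unfolding E_scale_sum[OF D] by (simp add: mul_sum mul_scale B_sum B_sum_left B_scale)
    moreover have "(- t) ^ n = (-1) ^ n * t ^ n" for n by (metis mult_minus1 power_mult_distrib)
    ultimately show ?thesis by (simp add: P_def Q_def poly_sum poly_monom ac_simps)
  qed
  then have "P = Q" using poly_eq_poly_eq_iff by blast
  then have "coeff P 1 = coeff Q 1" by simp
  moreover have "coeff P 1 = B (dp u 1 \<odot> v) w" "coeff Q 1 = (-1) ^ 1 * B v (dp u 1 \<odot> w)"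
    by (simp_all add: P_def Q_def coeff_sum D_def del: sum.lessThan_Suc)
  moreover have "dp u 1 = u" by (simp add: dp_def)
  ultimately show ?thesis by simp
qed

lemma phi_U: "u \<in> U \<Longrightarrow> B e u = 0"
  using skew[of u e e] polar_sym[of q u e] by (simp add: eq_neg_iff_add_eq_0)

lemma phi_e: "B e e = 0"
  using polar_self[OF q, of e] qe by simp

lemma B_prod: "u \<in> U \<Longrightarrow> B u w = - B e (u \<odot> w)"
  using skew[of u e w] by simp

text \<open>Skewness applied twice turns \<open>B (u1 \<odot> u2) u3\<close> into the value in
  question, while applied once to the equal number \<open>B u3 (u1 \<odot> u2)\<close> it gives the
  negative of that value.\<close>

lemma triple:
  assumes "u1 \<in> U" "u2 \<in> U" "u3 \<in> U"
  shows "B e (u1 \<odot> (u2 \<odot> u3)) = 0"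
proof -
  have "B (u1 \<odot> u2) u3 = B e (u2 \<odot> (u1 \<odot> u3))"
    using skew[OF assms(1), of u2 u3] B_prod[OF assms(2), of "u1 \<odot> u3"] by simp
  moreover have "B u3 (u1 \<odot> u2) = - B e (u3 \<odot> (u1 \<odot> u2))" by (rule B_prod[OF assms(3)])
  moreover have "u2 \<odot> (u1 \<odot> u3) = u1 \<odot> (u2 \<odot> u3)" "u3 \<odot> (u1 \<odot> u2) = u1 \<odot> (u2 \<odot> u3)"
    by (simp_all only: mul_ac)
  ultimately show ?thesis using polar_sym[of q "u1 \<odot> u2" u3] by (simp add: eq_neg_iff_add_eq_0)
qed

text \<open>If \<open>B e\<close> were zero on nilpotents, it would be zero; by
  \<open>adjoint_E\<close> so would \<open>B v\<close> for every \<open>v\<close> in the orbit,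
  which spans, and then \<open>q\<close> itself.\<close>

lemma phi_nonzero: "\<exists>x. nil x \<and> B e x \<noteq> 0"
proof (rule ccontr)
  assume "\<not> ?thesis"
  then have n: "B e x = 0" if "nil x" for x using that by blast
  have phi: "B e v = 0" for v
  proof -
    obtain x where "nil x" "v = h v *s e + x" using decompose by blast
    then have "B e v = h v * B e e + B e x" using B_add(1) B_scale(1) by metis
    then show ?thesis using n \<open>nil x\<close> phi_e by simp
  qed
  have "B v w = 0" for v w
  proof -
    have "vec.subspace {v. B v w = 0}" by (simp add: vec.subspace_def B_zero B_add B_scale)
    moreover have "E ` U \<subseteq> {v. B v w = 0}"
    proof (rule image_subsetI)
      fix u assume "u \<in> U"
      from adjoint_E[OF this, of e w] phi show "E u \<in> {v. B v w = 0}" by simp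
    qed
    ultimately have "vec.span (E ` U) \<subseteq> {v. B v w = 0}" by (intro vec.span_minimal)
    then show ?thesis using cyc by blast
  qed
  then have "q v = 0" for v using polar_self[OF q, of v] by simp
  then show False using qnz by blast
qed

text \<open>\<open>B e\<close> vanishes on \<open>U\<close> but not on all nilpotents, so it is
  non-zero on the complementary direction \<open>p0\<close>.\<close>

lemma kernel_phi:
  assumes "nil x" "B e x = 0"
  shows "x \<in> U"
proof -
  obtain p0 where p0: "\<And>x. nil x \<Longrightarrow> \<exists>u\<in>U. \<exists>c. x = u + c *s p0" using codim by blast
  obtain x0 where x0: "nil x0" "B e x0 \<noteq> 0" using phi_nonzero by blast
  obtain u0 c0 where 0: "u0 \<in> U" "x0 = u0 + c0 *s p0" using p0[OF x0(1)] by blast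
  obtain u c where 1: "u \<in> U" "x = u + c *s p0" using p0[OF assms(1)] by blast
  have "B e p0 \<noteq> 0" using x0(2) 0 phi_U by (auto simp: B_add B_scale)
  then have "c = 0" using assms(2) 1 phi_U[OF 1(1)] by (simp add: B_add B_scale)
  then show ?thesis using 1 by simp
qed

lemma adjoint_pw:
  assumes "\<And>v w. B (p \<odot> v) w = B v (p \<odot> w)"
  shows "B (pw p n \<odot> v) w = B v (pw p n \<odot> w)"
proof (induction n arbitrary: v w)
  case (Suc n)
  have "B (pw p (Suc n) \<odot> v) w = B (p \<odot> (pw p n \<odot> v)) w" by (simp only: pw_simps mul_assoc)
  also have "\<dots> = B v (pw p n \<odot> (p \<odot> w))" by (simp only: assms Suc)
  also have "pw p n \<odot> (p \<odot> w) = pw p (Suc n) \<odot> w" by (simp only: pw_simps mul_ac)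
  finally show ?case .
qed simp

section \<open>Ideals whose intersection with \<open>U\<close> is not closed under
  multiplication\<close>

context
  fixes J S :: "('a ^ 'k) set" and s1 s2 :: "'a ^ 'k"
  assumes J: "vec.subspace J" and nilJ: "\<And>x. x \<in> J \<Longrightarrow> nil x"
    and ideal: "\<And>x y. x \<in> J \<Longrightarrow> x \<odot> y \<in> J"
    and S: "S = J \<inter> U" and s: "s1 \<in> S" "s2 \<in> S" and not_closed: "s1 \<odot> s2 \<notin> S"
begin

definition "p = s1 \<odot> s2"
definition "\<theta> = B e p"

lemma sU: "s1 \<in> U" "s2 \<in> U" and sJ: "s1 \<in> J" "s2 \<in> J"
  using s S by auto

lemma S_subspace: "vec.subspace S"
  unfolding S by (rule vec.subspace_inter[OF J U])

lemma p_in_J: "p \<in> J"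
  unfolding p_def by (rule ideal[OF sJ(1)])

text \<open>\<open>p\<close> lies in the ideal \<open>J\<close>; if \<open>B e p\<close> were zero,
  \<open>kernel_phi\<close> would put it into \<open>U\<close> and thus into
  \<open>S\<close>.\<close>

lemma theta_nonzero: "\<theta> \<noteq> 0"
  using kernel_phi[OF nilJ[OF p_in_J]] not_closed p_in_J S unfolding \<theta>_def p_def by blast

lemma p_notin_S: "p \<notin> S"
  using not_closed by (simp add: p_def)

text \<open>A product of two commuting skew operators is self-adjoint.\<close>

lemma adjoint_p: "B (p \<odot> v) w = B v (p \<odot> w)"
proof -
  have "B (p \<odot> v) w = B (s1 \<odot> (s2 \<odot> v)) w" by (simp only: p_def mul_assoc)
  also have "\<dots> = B v (s2 \<odot> (s1 \<odot> w))" by (simp add: skew[OF sU(1)] skew[OF sU(2)])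
  also have "s2 \<odot> (s1 \<odot> w) = p \<odot> w" by (simp only: p_def mul_ac)
  finally show ?thesis .
qed

lemma B_U_p: "u \<in> U \<Longrightarrow> B u p = 0"
  unfolding B_prod p_def using triple[OF _ sU] by simp

text \<open>Since \<open>p\<close> is nilpotent, the geometric sequence \<open>B e (p\<^sup>k)\<close> vanishes from \<open>k = 2\<close> on.\<close>

lemma phi_pw: "B e (pw p (Suc (Suc n))) = 0"
proof -
  \<comment> \<open>Chosen so that \<open>p \<odot> p - \<alpha> *s p\<close> is killed by
    \<open>B e\<close> and hence lies in \<open>U\<close>.\<close>
  define \<alpha> where "\<alpha> = B e (p \<odot> p) / \<theta>"
  define u where "u = p \<odot> p - \<alpha> *s p"
  have "u \<in> J" unfolding u_def using J ideal[OF p_in_J] p_in_J by (intro vec.subspace_diff vec.subspace_scale)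
  then have "nil u" by (rule nilJ)
  moreover have "B e u = 0" unfolding u_def \<alpha>_def using theta_nonzero by (simp add: B_diff B_scale \<theta>_def)
  ultimately have uU: "u \<in> U" by (rule kernel_phi)
  have pp: "p \<odot> p = u + \<alpha> *s p" by (simp add: u_def)
  \<comment> \<open>Powers of \<open>p\<close> are self-adjoint while \<open>u\<close> is skew, so
    this value is its own negative.\<close>
  have pu: "B e (pw p n \<odot> u) = 0" for n
  proof -
    have "B e (pw p n \<odot> u) = B (pw p n) u" using adjoint_pw[OF adjoint_p, of n e u] by simp
    also have "\<dots> = B u (pw p n)" by (rule polar_sym)
    also have "\<dots> = - B e (pw p n \<odot> u)" using B_prod[OF uU, of "pw p n"] by (simp only: mul_comm)
    finally show ?thesis by (simp add: eq_neg_iff_add_eq_0)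
  qed
  have step: "B e (pw p (Suc (Suc n))) = \<alpha> * B e (pw p (Suc n))" for n
  proof -
    have "pw p (Suc (Suc n)) = pw p n \<odot> (p \<odot> p)" by (simp only: pw_simps mul_ac)
    also have "\<dots> = pw p n \<odot> u + \<alpha> *s pw p (Suc n)" unfolding pp by (simp add: mul_bilin mul_comm)
    finally show ?thesis using pu[of n] by (simp only: B_add B_scale) simp
  qed
  have geo: "B e (pw p (Suc n)) = \<alpha> ^ n * \<theta>" for n
  proof (induction n)
    case 0
    show ?case by (simp add: \<theta>_def)
  next
    case (Suc n)
    show ?case unfolding step Suc by simp
  qed
  obtain D where "pw p D = 0" using nilJ[OF p_in_J] by (auto simp: nil_def)
  then have "pw p (Suc D) = 0" by simp
  then have "\<alpha> ^ D * \<theta> = 0" using geo[of D] B_zero by simp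
  then have "\<alpha> = 0" using theta_nonzero by simp
  then show ?thesis unfolding step by simp
qed

lemma q_p: "q p = 0"
proof -
  have "B p p = B e (p \<odot> p)" using adjoint_p[of e p] by simp
  also have "\<dots> = 0" using phi_pw[of 0] by simp
  finally show ?thesis using polar_self[OF q, of p] by simp
qed

lemma q_formula:
  assumes "u \<in> U"
  shows "q (a *s e + u + c *s p) = q u + a * c * \<theta>"
proof -
  have "B (a *s e + u) (c *s p) = a * c * \<theta>"
    using B_U_p[OF assms] by (simp add: B_add B_scale \<theta>_def)
  moreover have "q (a *s e + u) = q u"
    using phi_U[OF assms] qe by (simp add: quad_add[OF q] quad_scale[OF q] B_scale)
  ultimately show ?thesis by (simp add: quad_add[OF q, of "a *s e + u"] quad_scale[OF q] q_p)
qed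

lemma J_decompose:
  assumes "x \<in> J"
  shows "\<exists>u\<in>S. \<exists>c. x = u + c *s p"
proof -
  define c where "c = B e x / \<theta>"
  define u where "u = x - c *s p"
  have uJ: "u \<in> J" unfolding u_def using J assms p_in_J by (intro vec.subspace_diff vec.subspace_scale)
  have "B e u = 0" unfolding u_def c_def using theta_nonzero by (simp add: B_diff B_scale \<theta>_def)
  with kernel_phi[OF nilJ[OF uJ]] have "u \<in> S" using uJ S by blast
  moreover have "x = u + c *s p" by (simp add: u_def)
  ultimately show ?thesis by blast
qed

text \<open>Self-adjointness of \<open>p\<close> gives
  \<open>2 * q (E (c *s p)) = B e (E ((2 * c) *s p))\<close>, and only the linear term of that
  series survives under \<open>B e\<close>.\<close>

lemma q_E_p: "q (E (c *s p)) = c * \<theta>"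
proof -
  have np: "nil (c *s p)" by (rule nil_scale[OF nilJ[OF p_in_J]])
  obtain D0 where "pw p D0 = 0" using nilJ[OF p_in_J] by (auto simp: nil_def)
  then have D: "pw p (Suc (Suc D0)) = 0" by simp
  have adj: "B (E (c *s p) \<odot> v) w = B v (E (c *s p) \<odot> w)" for v w
    unfolding E_scale_sum[OF D]
    by (simp only: mul_sum mul_scale B_sum B_sum_left B_scale dp_def adjoint_pw[OF adjoint_p])
  have "2 * q (E (c *s p)) = B (E (c *s p) \<odot> e) (E (c *s p))" using polar_self[OF q, of "E (c *s p)"] by simp
  also have "\<dots> = B e (E (c *s p + c *s p))" unfolding adj E_add[OF np np] ..
  also have "c *s p + c *s p = (2 * c) *s p" by (simp add: vec_eq_iff)
  also have "B e (E ((2 * c) *s p)) = (\<Sum>n<Suc (Suc D0). (2 * c) ^ n * B e (dp p n))"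
    unfolding E_scale_sum[OF D] by (simp only: B_sum B_scale)
  also have "\<dots> = B e (dp p 0) + 2 * c * B e (dp p 1) + (\<Sum>n<D0. (2 * c) ^ Suc (Suc n) * B e (dp p (Suc (Suc n))))"
    by (simp only: sum.lessThan_Suc_shift) simp
  also have "(\<Sum>n<D0. (2 * c) ^ Suc (Suc n) * B e (dp p (Suc (Suc n)))) = 0"
    by (intro sum.neutral ballI) (simp only: dp_def B_scale phi_pw mult_zero_right)
  also have "dp p 1 = p" by (simp add: dp_def)
  finally show ?thesis by (simp add: phi_e \<theta>_def)
qed

text \<open>Solved from \<open>q_formula\<close> so that \<open>e + u + \<kappa> u *s p\<close> lies
  on the quadric.\<close>

definition \<kappa> :: "'a ^ 'k \<Rightarrow> 'a" where "\<kappa> u = (- 1 / \<theta>) * q u"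

lemma kappa_polys: "\<kappa> \<in> polys"
  unfolding \<kappa>_def[abs_def] by (rule polys_cmult[OF homogD(1)[OF q]])

text \<open>From left to right, vanishing of \<open>q\<close> on the orbit fixes the coefficient of
  \<open>p\<close>. From right to left, the logarithm of a point of the quadric is taken in
  \<open>J\<close> and written as \<open>w + c *s p\<close>; invariance under \<open>E w\<close> and
  \<open>q_E_p\<close> then give \<open>c = 0\<close>.\<close>

lemma E_S_eq: "E ` S = (\<lambda>u. e + u + \<kappa> u *s p) ` S"
proof (intro equalityI subsetI)
  fix v assume "v \<in> E ` S"
  then obtain s where s: "s \<in> S" "v = E s" by blast
  have sJ: "s \<in> J" "s \<in> U" using s S by auto
  have "E s - e \<in> J" by (rule E_minus_unit_closed[OF J ideal nilJ[OF sJ(1)] sJ(1)])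
  from J_decompose[OF this] obtain u c where u: "u \<in> S" "E s - e = u + c *s p" by blast
  have Es: "E s = 1 *s e + u + c *s p" using u(2) by (simp add: algebra_simps)
  have "q (E s) = 0" using inv[OF sJ(2), of e] qe by simp
  then have "q u + 1 * c * \<theta> = 0" unfolding Es using q_formula[of u 1 c] u(1) S by simp
  then have "c = \<kappa> u" using theta_nonzero by (simp add: \<kappa>_def field_simps eq_neg_iff_add_eq_0)
  then show "v \<in> (\<lambda>u. e + u + \<kappa> u *s p) ` S" using u(1) Es s(2) by (intro image_eqI[where x = u]) simp_all
next
  fix v assume "v \<in> (\<lambda>u. e + u + \<kappa> u *s p) ` S"
  then obtain u where u: "u \<in> S" "v = e + u + \<kappa> u *s p" by blast
  have uU: "u \<in> U" and uJ: "u \<in> J" using u(1) S by auto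
  have qv: "q v = 0" using q_formula[OF uU, of 1 "\<kappa> u"] theta_nonzero u(2) by (simp add: \<kappa>_def)
  have "u + \<kappa> u *s p \<in> J" using J uJ p_in_J by (intro vec.subspace_add vec.subspace_scale)
  from E_surj[OF J ideal nilJ this] obtain x where x: "x \<in> J" "E x = v" unfolding u(2) by (auto simp: add.assoc)
  from J_decompose[OF x(1)] obtain w c where w: "w \<in> S" "x = w + c *s p" by blast
  have wU: "w \<in> U" using w(1) S by auto
  have "E x = E w \<odot> E (c *s p)" unfolding w(2) by (rule E_add[OF nilU[OF wU] nil_scale[OF nilJ[OF p_in_J]]])
  then have "q v = q (E (c *s p))" unfolding x(2) inv[OF wU] by (simp only: inv[OF wU])
  then have "c = 0" using qv q_E_p theta_nonzero by simp
  then have "x = w" using w(2) by simp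
  then show "v \<in> E ` S" using x(2) w(1) by blast
qed

lemma unital_J_decompose:
  assumes "v \<in> unital J"
  shows "\<exists>u\<in>S. \<exists>c. v = h v *s e + u + c *s p"
proof -
  have "v - h v *s e \<in> J" using assms unital_mem_iff[of J, OF nilJ] by blast
  from J_decompose[OF this] obtain u c where u: "u \<in> S" "v - h v *s e = u + c *s p" by blast
  have "v = h v *s e + u + c *s p" using u(2) by (simp add: diff_eq_eq ac_simps)
  with u(1) show ?thesis by blast
qed

lemma quadric_chart:
  assumes v: "v \<in> unital J" "q v = 0" "h v \<noteq> 0"
  shows "\<exists>s\<in>S. \<exists>c. v = c *s E s"
proof -
  obtain u c where u: "u \<in> S" "v = h v *s e + u + c *s p" using unital_J_decompose[OF v(1)] by blast
  have uU: "u \<in> U" using u(1) S by auto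
  have "q u + h v * c * \<theta> = 0"
    using q_formula[OF uU, of "h v" c] v(2) unfolding u(2)[symmetric] by simp
  then have c: "c = h v * \<kappa> ((1 / h v) *s u)"
    using theta_nonzero v(3) by (simp add: \<kappa>_def quad_scale[OF q] field_simps power2_eq_square eq_neg_iff_add_eq_0)
  have "(1 / h v) *s u \<in> S" by (rule vec.subspace_scale[OF S_subspace u(1)])
  then have "e + (1 / h v) *s u + \<kappa> ((1 / h v) *s u) *s p \<in> E ` S" unfolding E_S_eq by (rule imageI)
  then obtain s where s: "s \<in> S" "E s = e + (1 / h v) *s u + \<kappa> ((1 / h v) *s u) *s p" by auto
  have "h v *s E s = h v *s e + u + c *s p"
    unfolding s(2) c using v(3) by (simp add: vec_eq_iff algebra_simps)
  then have "v = h v *s E s" using u(2) by simp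
  with s(1) show ?thesis by blast
qed

text \<open>The polar form of \<open>s1\<close> and \<open>s2\<close> is \<open>- \<theta>\<close>,
  so \<open>q\<close> cannot vanish on all of \<open>S\<close>.\<close>

lemma anisotropic: "\<exists>w\<in>S. q w \<noteq> 0"
proof (rule ccontr)
  assume "\<not> ?thesis"
  then have z: "q w = 0" if "w \<in> S" for w using that by blast
  have "s1 + s2 \<in> S" by (rule vec.subspace_add[OF S_subspace s])
  then have "B s1 s2 = 0" using z s quad_add[OF q, of s1 s2] by simp
  moreover have "B s1 s2 = - \<theta>" using B_prod[OF sU(1), of s2] by (simp add: \<theta>_def p_def)
  ultimately show False using theta_nonzero by simp
qed

lemma S_in_unital: "u \<in> S \<Longrightarrow> a *s e + u + c *s p \<in> unital J"
  unfolding unital_def using vec.subspace_add[OF J _ vec.subspace_scale[OF J p_in_J]] S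
  by (intro CollectI exI[of _ a] exI[of _ "u + c *s p"]) (simp add: add.assoc)

text \<open>A point of the quadric at infinity is a limit of points \<open>s(\<epsilon>) e + u + \<epsilon> w + c p\<close> of the chart,
  where \<open>q w \<noteq> 0\<close>.\<close>

lemma quadric_dense:
  assumes f: "f \<in> homog d" and van: "\<And>s. s \<in> S \<Longrightarrow> f (E s) = 0"
    and v: "v \<in> unital J" "q v = 0"
  shows "f v = 0"
proof -
  have gen: "f w = 0" if "w \<in> unital J" "q w = 0" "h w \<noteq> 0" for w
    using quadric_chart[OF that] van homogD(2)[OF f] by auto
  have hs: "h (a *s e + u + c *s p) = a" if "u \<in> S" for a u c
  proof -
    have "nil u" "nil (c *s p)" using that S nilU nilJ[OF p_in_J] nil_scale by auto
    then show ?thesis by (simp add: h_add h_scale nil_iff_h)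
  qed
  obtain u c where u: "u \<in> S" "v = h v *s e + u + c *s p" using unital_J_decompose[OF v(1)] by blast
  have uU: "u \<in> U" using u(1) S by auto
  show ?thesis
  proof (cases "h v = 0")
    case False
    then show ?thesis using gen v by blast
  next
    case True
    then have vu: "v = u + c *s p" using u(2) by simp
    have qu: "q u = 0" using q_formula[OF uU, of 0 c] v(2) vu by simp
    show ?thesis
    proof (cases "c = 0")
      case True
      have "f (u + t *s e) = 0" if "t \<notin> {0}" for t
      proof (rule gen)
        have eq: "u + t *s e = t *s e + u + 0 *s p" by simp
        show "u + t *s e \<in> unital J" unfolding eq by (rule S_in_unital[OF u(1)])
        show "q (u + t *s e) = 0" unfolding eq q_formula[OF uU] using qu by simp
        show "h (u + t *s e) \<noteq> 0" unfolding eq hs[OF u(1)] using that by simp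
      qed
      from polyf_eq_cofinite[OF polys_line[OF homogD(1)[OF f]] polyf_const, of "{0}" u e 0 0] this
      show ?thesis using vu True by simp
    next
      case False
      obtain w where w: "w \<in> S" "q w \<noteq> 0" using anisotropic by blast
      \<comment> \<open>The coefficient of \<open>e\<close> that \<open>q_formula\<close> forces on
        a point of the quadric with components \<open>u + t *s w\<close> and
        \<open>c *s p\<close>.\<close>
      define \<sigma> where "\<sigma> t = (- 1 / (c * \<theta>)) * (t * B u w + t\<^sup>2 * q w)" for t
      define \<gamma> where "\<gamma> t = \<sigma> t *s e + (u + t *s w) + c *s p" for t
      have uw: "u + t *s w \<in> S" for t
        by (intro vec.subspace_add[OF S_subspace] vec.subspace_scale[OF S_subspace] u w)
      have uwU: "u + t *s w \<in> U" for t using uw[of t] S by auto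
      have "q (\<gamma> t) = 0" for t
      proof -
        have "q (u + t *s w) = t * B u w + t\<^sup>2 * q w" using qu by (simp add: quad_add[OF q] quad_scale[OF q] B_scale)
        then show ?thesis unfolding \<gamma>_def q_formula[OF uwU] \<sigma>_def using False theta_nonzero by simp
      qed
      then have prod: "f (\<gamma> t) * \<sigma> t = 0" for t
        using gen[OF S_in_unital[OF uw], of "\<sigma> t" t c] hs[OF uw, of "\<sigma> t" t c] unfolding \<gamma>_def by auto
      have \<sigma>: "polyf \<sigma>" unfolding \<sigma>_def[abs_def] by (intro polyf_intros)
      have "polyf (\<lambda>t. \<gamma> t $ i)" for i
        unfolding \<gamma>_def by (simp) (intro polyf_add polyf_mult[OF \<sigma>] polyf_mult[OF polyf_id] polyf_const)
      then have fg: "polyf (\<lambda>t. f (\<gamma> t))" by (rule polys_path_polyf[OF homogD(1)[OF f]])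
      have "\<exists>t. \<sigma> t \<noteq> 0"
      proof (rule ccontr)
        assume "\<not> ?thesis"
        \<comment> \<open>Adding the conditions at these two values isolates
          \<open>q w\<close>.\<close>
        then have "\<sigma> 1 = 0" "\<sigma> (- 1) = 0" by blast+
        then have "B u w + q w = 0" "- B u w + q w = 0"
          using False theta_nonzero by (simp_all add: \<sigma>_def)
        then have "(B u w + q w) + (- B u w + q w) = 0" by simp
        then show False using w(2) by simp
      qed
      then obtain t1 where t1: "\<sigma> t1 \<noteq> 0" by blast
      have "f (\<gamma> 0) = 0"
      proof (rule ccontr)
        assume "f (\<gamma> 0) \<noteq> 0"
        from polyf_nonzero_both[OF fg \<sigma> this t1] prod show False by blast
      qed
      moreover have "\<gamma> 0 = v" unfolding vu by (simp add: \<gamma>_def \<sigma>_def)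
      ultimately show ?thesis by simp
    qed
  qed
qed

lemma quadric_orbit:
  shows "orbit_data S (unital J)"
    and "range \<psi> = E ` S \<Longrightarrow> hyperquadric (unital J) (zariski closure_of (pts \<psi>))"
proof -
  let ?W = "unital J"
  have W: "vec.subspace ?W" by (rule unital_subspace[OF J])
  have e: "e \<notin> vec.span (insert p S)"
  proof
    assume "e \<in> vec.span (insert p S)"
    moreover have "vec.span (insert p S) \<subseteq> J" by (rule vec.span_minimal[OF _ J]) (use p_in_J S in auto)
    ultimately have "nil e" using nilJ by blast
    then show False using nil_multiple_e[of 1] by simp
  qed
  have EsW: "E s \<in> ?W" if "s \<in> S" for s
    by (rule E_in_unital[OF J ideal]) (use that S nilJ in auto)
  have span: "vec.span (E ` S) = ?W"
  proof (rule antisym)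
    show "vec.span (E ` S) \<subseteq> ?W" by (rule vec.span_minimal[OF _ W]) (use EsW in auto)
    have g: "e + u + \<kappa> u *s p \<in> vec.span (E ` S)" if "u \<in> S" for u
      by (rule vec.span_base) (use that in \<open>simp add: E_S_eq\<close>)
    have e: "e \<in> vec.span (E ` S)" using g[OF vec.subspace_0[OF S_subspace]] by (simp add: \<kappa>_def quad_zero[OF q])
    have uS: "u \<in> vec.span (E ` S)" if u: "u \<in> S" for u
    proof -
      \<comment> \<open>\<open>\<kappa>\<close> is even, so the difference of the points over
        \<open>u\<close> and \<open>- u\<close> is \<open>u + u\<close>.\<close>
      have "(e + u + \<kappa> u *s p) - (e + - u + \<kappa> (- u) *s p) \<in> vec.span (E ` S)"
        by (intro vec.span_diff g u vec.subspace_neg[OF S_subspace u])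
      moreover have "\<kappa> (- u) = \<kappa> u"
        using quad_scale[OF q, of "-1" u] by (simp add: \<kappa>_def vector_sneg_minus1[symmetric])
      ultimately have "u + u \<in> vec.span (E ` S)" by simp
      then have "(1 / 2) *s (u + u) \<in> vec.span (E ` S)" by (rule vec.span_scale)
      moreover have "(1 / 2) *s (u + u) = u" by (simp add: vec_eq_iff)
      ultimately show ?thesis by simp
    qed
    \<comment> \<open>With \<open>e\<close> and \<open>S\<close> already in the span, a point with
      \<open>\<kappa> w \<noteq> 0\<close> contributes the direction \<open>p\<close>.\<close>
    obtain w where w: "w \<in> S" "q w \<noteq> 0" using anisotropic by blast
    have "(e + w + \<kappa> w *s p) - e - w \<in> vec.span (E ` S)" by (intro vec.span_diff g w(1) e uS)
    then have "\<kappa> w *s p \<in> vec.span (E ` S)" by (simp add: algebra_simps)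
    then have "(1 / \<kappa> w) *s (\<kappa> w *s p) \<in> vec.span (E ` S)" by (rule vec.span_scale)
    moreover have "\<kappa> w \<noteq> 0" using w(2) theta_nonzero by (simp add: \<kappa>_def)
    ultimately have pS: "p \<in> vec.span (E ` S)" by simp
    show "?W \<subseteq> vec.span (E ` S)"
    proof
      fix v assume "v \<in> ?W"
      then obtain u c where u: "u \<in> S" "v = h v *s e + u + c *s p" using unital_J_decompose by blast
      have "h v *s e + u + c *s p \<in> vec.span (E ` S)" by (intro vec.span_add vec.span_scale e pS uS u(1))
      then show "v \<in> vec.span (E ` S)" using u(2) by simp
    qed
  qed
  obtain \<psi>0 where \<psi>0: "tparam (vec.dim S) \<psi>0" "range \<psi>0 = (\<lambda>u. e + u + \<kappa> u *s p) ` S"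
    "dim_of (zariski closure_of (pts \<psi>0)) = enat (vec.dim S)"
    using graph_param[OF S_subspace _ e kappa_polys] p_notin_S by blast
  have r0: "range \<psi>0 = E ` S" unfolding \<psi>0(2) E_S_eq ..
  have closure: "zariski closure_of (pts \<psi>) = proj ?W \<inter> zero_locus {q}" if ran: "range \<psi> = E ` S"
    for \<psi> :: "'x \<Rightarrow> 'a ^ 'k"
  proof -
    have ex: "\<exists>s\<in>S. \<psi> t = E s" for t using ran by blast
    have nz: "\<psi> t \<noteq> 0" for t
    proof -
      obtain s where "s \<in> S" "\<psi> t = E s" using ex by blast
      then show ?thesis using h_E[of s] nilU[of s] S by auto
    qed
    show ?thesis
    proof (intro equalityI subsetI IntI)
      fix x assume x: "x \<in> zariski closure_of (pts \<psi>)"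
      have "\<psi> t \<in> ?W" for t
      proof -
        obtain s where "s \<in> S" "\<psi> t = E s" using ex by blast
        then show ?thesis using EsW by simp
      qed
      then have "zariski closure_of (pts \<psi>) \<subseteq> proj ?W" by (rule closure_pts_in_subspace[OF W _ nz])
      then show "x \<in> proj ?W" using x by blast
      obtain v where v: "v \<noteq> 0" "x = vec.span {v}" using x closure_subset_proj projE by blast
      have "q (\<psi> t) = 0" for t
      proof -
        obtain s where s: "s \<in> S" "\<psi> t = E s" using ex by blast
        have "s \<in> U" using s(1) S by blast
        from inv[OF this, of e] show ?thesis unfolding s(2) using qe by simp
      qed
      then have "q v = 0" by (intro closure_ptsD[OF _ v(1) nz q]) (use x v(2) in auto)
      then show "x \<in> zero_locus {q}" using v span_in_zero_locus_iff[OF q v(1)] by simp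
    next
      fix x assume x: "x \<in> proj ?W \<inter> zero_locus {q}"
      then obtain v where v: "v \<in> ?W" "v \<noteq> 0" "x = vec.span {v}" by (auto simp: proj_def)
      have qv: "q v = 0" using x v(3) span_in_zero_locus_iff[OF q v(2)] by blast
      have "f v = 0" if f: "f \<in> homog d" "\<forall>t. f (\<psi> t) = 0" for d f
      proof (rule quadric_dense[OF f(1) _ v(1) qv])
        fix s assume "s \<in> S"
        then have "E s \<in> range \<psi>" using ran by blast
        then show "f (E s) = 0" using f(2) by auto
      qed
      then show "x \<in> zariski closure_of (pts \<psi>)" unfolding v(3) closure_pts_iff[of \<psi>, OF nz v(2)] by blast
    qed
  qed
  show "orbit_data S ?W"
    unfolding orbit_data_def
  proof (intro conjI exI[of _ \<psi>0] ballI allI impI)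
    show "E s \<odot> w \<in> ?W" if "s \<in> S" "w \<in> ?W" for s w
      by (rule unital_mult_closed[OF J ideal EsW[OF that(1)] that(2)])
    show "\<exists>s\<in>S. \<exists>c. v = c *s E s" if v: "v \<noteq> 0" "vec.span {v} \<in> zariski closure_of (pts \<psi>0)" "h v \<noteq> 0" for v
    proof (rule quadric_chart[OF _ _ v(3)])
      show "v \<in> ?W" using v(2) span_in_proj_iff[OF W v(1)] unfolding closure[OF r0] by blast
      show "q v = 0" using v(2) span_in_zero_locus_iff[OF q v(1)] unfolding closure[OF r0] by blast
    qed
  qed (use W span \<psi>0(1,3) r0 in auto)
  show "hyperquadric ?W (zariski closure_of (pts \<psi>))" if ran: "range \<psi> = E ` S" for \<psi> :: "'x \<Rightarrow> 'a ^ 'k"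
    unfolding hyperquadric_def
  proof (intro bexI[OF _ q] conjI)
    obtain w where w: "w \<in> S" "q w \<noteq> 0" using anisotropic by blast
    have wU: "w \<in> U" using w(1) S by blast
    have wW: "w \<in> ?W" using S_in_unital[OF w(1), of 0 0] by simp
    then show "\<exists>v\<in>?W. q v \<noteq> 0" using w(2) by blast
    show "zariski closure_of (pts \<psi>) = proj ?W \<inter> zero_locus {q}" by (rule closure[OF ran])
    have "pts \<psi> = (\<lambda>v. vec.span {v}) ` range \<psi>" "pts \<psi>0 = (\<lambda>v. vec.span {v}) ` range \<psi>0"
      unfolding pts_def by (rule image_image[symmetric])+
    then have "pts \<psi> = pts \<psi>0" unfolding ran r0 by simp
    then show "irreducible_in zariski (zariski closure_of (pts \<psi>))" using irreducible_param[OF \<psi>0(1)] by simp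
    show "reduced_on ?W q"
    proof (rule disc_imp_reduced[OF q W wW w(2)])
      \<comment> \<open>\<open>e + p\<close> is orthogonal to \<open>w\<close>, so its discriminant
        in direction \<open>w\<close> is \<open>- 4 * \<theta> * q w\<close>.\<close>
      show "1 *s e + 0 + 1 *s p \<in> ?W" by (rule S_in_unital[OF vec.subspace_0[OF S_subspace]])
      have "B (1 *s e + 0 + 1 *s p) w = 0"
        using phi_U[OF wU] B_U_p[OF wU] polar_sym[of q p w] by (simp add: B_add B_scale B_zero)
      moreover have "q (1 *s e + 0 + 1 *s p) = \<theta>"
        using q_formula[OF vec.subspace_0[OF U], of 1 1] quad_zero[OF q] by simp
      ultimately show "disc q w (1 *s e + 0 + 1 *s p) \<noteq> 0"
        unfolding disc_def[OF q] using theta_nonzero w(2) by simp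
    qed
  qed
qed

end

end

section \<open>The induced additive action\<close>

lemma tpoly_polyf:
  fixes f :: "'a::field \<Rightarrow> 'a"
  assumes "polyf f" "i < n"
  shows "(\<lambda>t. f (t i)) \<in> tpoly n"
proof -
  obtain p where p: "\<And>x. poly p x = f x" using assms(1) unfolding polyf_def by blast
  have "(\<lambda>t. poly p (t i)) \<in> tpoly n"
    by (induction p) (simp_all add: tpoly_const tpoly_add tpoly_mult tpoly_coord[OF assms(2)])
  then show ?thesis by (simp add: p)
qed

lemma span_Union_lines: "vec.span (\<Union>v\<in>A. vec.span {v}) = vec.span A"
proof (rule antisym)
  show "vec.span (\<Union>v\<in>A. vec.span {v}) \<subseteq> vec.span A"
    by (rule vec.span_minimal) (auto intro: subsetD[OF vec.span_mono])
  show "vec.span A \<subseteq> vec.span (\<Union>v\<in>A. vec.span {v})"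
    by (rule vec.span_mono) (auto intro: vec.span_base)
qed

lemma homog_matrix_compose:
  fixes f :: "'a::field ^ 'k \<Rightarrow> 'a" and A :: "'a ^ 'k ^ 'k"
  assumes "f \<in> homog d"
  shows "(\<lambda>v. f (A *v v)) \<in> homog d"
proof -
  have "(\<lambda>v. (A *v v) $ i) \<in> poly_funs (range (\<lambda>i v. v $ i))" for i
  proof -
    have "(\<lambda>v. (A *v v) $ i) = lf (A $ i)" by (simp add: fun_eq_iff matrix_vector_mult_def lf_def)
    then show ?thesis using lf_polys[of "A $ i"] by (simp add: polys_def)
  qed
  from polys_compose[OF homogD(1)[OF assms] this] have "(\<lambda>v. f (A *v v)) \<in> polys" by (simp only: polys_def)
  then show ?thesis unfolding homog_def by (simp add: vec.scale homogD(2)[OF assms])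
qed

locale act_rep = cyclic_rep \<rho> e
  for \<rho> :: "'a::{alg_closed_field, field_char_0} ^ 'n \<Rightarrow> 'a ^ 'k ^ 'k" and e :: "'a ^ 'k" +
  fixes act :: "'a ^ 'n \<Rightarrow> ('a ^ 'k) set \<Rightarrow> ('a ^ 'k) set"
  assumes rep: "rep act (\<rho> g) g" and act: "is_action UNIV UNIV act" and mor: "is_morphism UNIV UNIV act"
    and eff: "effective UNIV UNIV act" and e_nz: "e \<noteq> 0"
begin

sublocale local_calg e mul
  by unfold_locales (rule e_nz, rule local_cyclic)

lemma act_pt: "v \<noteq> 0 \<Longrightarrow> act g (vec.span {v}) = vec.span {mul (E (\<nu> g)) v}"
  and E_mul_nz: "v \<noteq> 0 \<Longrightarrow> mul (E (\<nu> g)) v \<noteq> 0"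
  using repD[OF rep, of v g] unfolding rho_E by auto

text \<open>By \<open>E_eigen\<close> a unipotent operator preserves a line only if its logarithm
  kills the line.\<close>

lemma stab_iff:
  assumes "v \<noteq> 0"
  shows "act g (vec.span {v}) = vec.span {v} \<longleftrightarrow> mul (\<nu> g) v = 0"
proof
  assume "act g (vec.span {v}) = vec.span {v}"
  then have "vec.span {v} = vec.span {mul (E (\<nu> g)) v}" using act_pt[OF assms] by simp
  then obtain c where "mul (E (\<nu> g)) v = c *s v" using span_singleton_eqD by blast
  then show "mul (\<nu> g) v = 0" by (rule E_eigen[OF nil_nu])
next
  assume "mul (\<nu> g) v = 0"
  from E_annihilate[OF nil_nu this] show "act g (vec.span {v}) = vec.span {v}" using act_pt[OF assms] by simp
qed

lemma nu_linear: "Vector_Spaces.linear (*s) (*s) \<nu>"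
  by unfold_locales (simp_all add: nu_add nu_scale)

text \<open>An element with logarithm zero fixes every point, so effectiveness makes it
  trivial.\<close>

lemma nu_inj: "inj \<nu>"
proof (rule injI)
  fix g g' assume eq: "\<nu> g = \<nu> g'"
  have "\<nu> (g - g') = 0"
    using nu_add[of "g - g'" g'] eq by simp
  then have "mul (\<nu> (g - g')) v = 0" for v by simp
  then have fixed: "act (g - g') (vec.span {v}) = vec.span {v}" if "v \<noteq> 0" for v using stab_iff[OF that] by simp
  have "\<forall>x\<in>proj UNIV. act (g - g') x = x"
  proof
    fix x :: "('a ^ 'k) set" assume "x \<in> proj UNIV"
    then obtain v where "v \<noteq> 0" "x = vec.span {v}" using projE by blast
    then show "act (g - g') x = x" using fixed by simp
  qed
  then have "g - g' = 0" using eff[unfolded effective_def, rule_format, of "g - g'"] by simp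
  then show "g = g'" by simp
qed

lemma nu_0: "\<nu> 0 = 0"
  using nu_scale[of 0 0] by simp

lemma nu_zero: "\<nu> g = 0 \<Longrightarrow> g = 0"
  using injD[OF nu_inj, of g 0] nu_0 by simp

lemma dim_nu: "vec.dim (\<nu> ` A) = vec.dim A"
  by (rule vec.dim_image_eq[OF nu_linear]) (rule inj_on_subset[OF nu_inj], simp)

lemma range_nu_subspace: "vec.subspace A \<Longrightarrow> vec.subspace (\<nu> ` A)"
  by (rule vec.linear_subspace_image[OF nu_linear])

lemma dim_nil: "vec.dim {x. nil x} + 1 = CARD('k)"
proof -
  have e: "e \<notin> {x. nil x}" using nil_iff_h[of e] by simp
  have H: "vec.span {x. nil x} = {x. nil x}" using nil_subspace by (simp only: vec.span_eq_iff)
  have "vec.dim (insert e {x. nil x}) = vec.dim {x. nil x} + 1"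
    unfolding vec.dim_insert H using e by simp
  moreover have "vec.span (insert e {x. nil x}) = UNIV"
  proof -
    have "v \<in> vec.span (insert e {x. nil x})" for v
    proof -
      obtain x where x: "nil x" "v = h v *s e + x" using decompose by blast
      have "h v *s e + x \<in> vec.span (insert e {x. nil x})"
        by (intro vec.span_add vec.span_scale vec.span_base) (use x in auto)
      then show ?thesis using x(2) by simp
    qed
    then show ?thesis by blast
  qed
  then have "vec.dim (insert e {x. nil x}) = CARD('k)" by (metis vec.dim_span vec_dim_card)
  ultimately show ?thesis by simp
qed

text \<open>\<open>\<rho>\<close> is known to be polynomial only along one-parameter groups; writing
  a group element as a sum of multiples of coordinate vectors turns \<open>\<rho>\<close> into a
  product of such families.\<close>

lemma r_param: "\<exists>\<psi>. tparam CARD('n) \<psi> \<and> range \<psi> = range r"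
proof -
  obtain a :: "nat \<Rightarrow> 'n" where a: "bij_betw a {..<CARD('n)} UNIV"
    using ex_bij_betw_nat_finite[of "UNIV :: 'n set"] by (auto simp: atLeast0LessThan)
  define g where "g m t = (\<Sum>i<m. t i *s axis (a i) 1)" for m and t :: "nat \<Rightarrow> 'a"
  have entries: "(\<lambda>t. \<rho> (g m t) $ i $ j) \<in> tpoly CARD('n)" if "m \<le> CARD('n)" for m i j
    using that
  proof (induction m arbitrary: i j)
    case 0
    show ?case by (simp add: g_def rho_0 tpoly_const)
  next
    case (Suc m)
    have "\<rho> (g (Suc m) t) = \<rho> (g m t) ** \<rho> (t m *s axis (a m) 1)" for t
      by (simp add: g_def rho_add)
    then have eq: "(\<lambda>t. \<rho> (g (Suc m) t) $ i $ j) =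
        (\<lambda>t. \<Sum>k\<in>UNIV. \<rho> (g m t) $ i $ k * \<rho> (t m *s axis (a m) 1) $ k $ j)"
      by (simp add: matrix_matrix_mult_def)
    have "(\<lambda>t. \<rho> (t m *s axis (a m) 1) $ k $ j) \<in> tpoly CARD('n)" for k
      by (rule tpoly_polyf[of "\<lambda>x. \<rho> (x *s axis (a m) 1) $ k $ j"])
        (use rho_poly[of "axis (a m) 1"] Suc.prems in \<open>auto simp: polyf_mat_def\<close>)
    then show ?case unfolding eq using Suc by (intro tpoly_sum tpoly_mult) auto
  qed
  have "(\<lambda>t. r (g CARD('n) t) $ i) \<in> tpoly CARD('n)" for i
    unfolding r_def matrix_vector_mult_def
    by (simp) (intro tpoly_sum tpoly_mult tpoly_const entries order_refl)
  moreover have "r x \<noteq> 0" for x using repD(1)[OF rep e_nz] by (simp add: r_def)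
  ultimately have "tparam CARD('n) (\<lambda>t. r (g CARD('n) t))" by (simp add: tparam_def)
  moreover have "range (\<lambda>t. r (g CARD('n) t)) = range r"
  proof -
    have "\<exists>t. x = g CARD('n) t" for x
    proof -
      have "(\<Sum>i<CARD('n). x $ a i *s axis (a i) 1) = (\<Sum>i\<in>UNIV. x $ i *s axis i 1)"
        by (rule sum.reindex_bij_betw[OF a])
      then show ?thesis unfolding g_def by (intro exI[of _ "\<lambda>i. x $ a i"]) (simp add: basis_expansion)
    qed
    then show ?thesis by (auto simp: image_iff) metis
  qed
  ultimately show ?thesis by blast
qed

lemma assemble:
  fixes G1 :: "('a ^ 'n) set"
  defines "O1 \<equiv> (\<lambda>g. act g (vec.span {e})) ` G1"
  assumes G1: "vec.subspace G1" and data: "orbit_data (\<nu> ` G1) W"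
  shows "span_space O1 = W" "\<forall>g\<in>G1. act g ` proj W = proj W"
    "additive_action G1 W (zariski closure_of O1) act O1" "nondegenerate W (zariski closure_of O1)"
    "\<exists>\<psi> :: (nat \<Rightarrow> 'a) \<Rightarrow> 'a ^ 'k. range \<psi> = E ` \<nu> ` G1 \<and> O1 = pts \<psi>"
proof -
  let ?S = "\<nu> ` G1"
  obtain \<psi> where W: "vec.subspace W" and span: "vec.span (E ` ?S) = W"
    and inv: "\<forall>s\<in>?S. \<forall>w\<in>W. mul (E s) w \<in> W"
    and par: "tparam (vec.dim ?S) \<psi>" and ran: "range \<psi> = E ` ?S"
    and dim: "dim_of (zariski closure_of (pts \<psi>)) = enat (vec.dim ?S)"
    and chart: "\<forall>v. v \<noteq> 0 \<longrightarrow> vec.span {v} \<in> zariski closure_of (pts \<psi>) \<longrightarrow> h v \<noteq> 0 \<longrightarrow>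
        (\<exists>s\<in>?S. \<exists>c. v = c *s E s)"
    using data unfolding orbit_data_def by (elim conjE exE) (rule that, assumption+)
  have O1: "O1 = (\<lambda>v. vec.span {v}) ` E ` ?S"
    unfolding O1_def image_image using act_pt[OF e_nz] by simp
  also have "\<dots> = pts \<psi>" unfolding ran[symmetric] pts_def by (rule image_image)
  finally have O1\<psi>: "O1 = pts \<psi>" .
  have nz: "\<psi> t \<noteq> 0" for t using par by (simp add: tparam_def)
  have EsW: "E s \<in> W" if "s \<in> ?S" for s unfolding span[symmetric] using that by (intro vec.span_base) blast
  have Es0: "E s \<noteq> 0" if "s \<in> ?S" for s using h_E[of s] nil_nu that by auto
  show sp: "span_space O1 = W" unfolding span_space_def O1 span_Union_lines span ..
  have neg: "- g \<in> G1" if "g \<in> G1" for g using vec.subspace_neg[OF G1 that] .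
  have inv_image: "act g ` A = A" if g: "g \<in> G1" and A: "A \<subseteq> proj UNIV" and *: "\<And>g x. g \<in> G1 \<Longrightarrow> x \<in> A \<Longrightarrow> act g x \<in> A" for g A
  proof (intro equalityI subsetI)
    fix x assume x: "x \<in> A"
    have "act (g + - g) x = act g (act (- g) x)" "act 0 x = x"
      using act subsetD[OF A x] by (simp_all only: is_action_def UNIV_I)
    then have "x = act g (act (- g) x)" by simp
    then show "x \<in> act g ` A" using *[OF neg[OF g] x] by blast
  qed (use * g in auto)
  have invW: "act g x \<in> proj W" if gx: "g \<in> G1" "x \<in> proj W" for g x
  proof -
    obtain w where w: "w \<in> W" "w \<noteq> 0" "x = vec.span {w}" using gx(2) by (auto simp: proj_def)
    have "mul (E (\<nu> g)) w \<in> W" using inv w(1) gx(1) by blast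
    then show ?thesis using E_mul_nz[OF w(2)] act_pt[OF w(2)] w(3) by (auto simp: proj_def)
  qed
  show projW: "\<forall>g\<in>G1. act g ` proj W = proj W"
    by (intro ballI inv_image[OF _ proj_mono[OF subset_UNIV]] invW)
  let ?Q = "zariski closure_of O1"
  have invQ: "act g x \<in> ?Q" if g: "g \<in> G1" and x: "x \<in> ?Q" for g x
  proof -
    obtain v where v: "v \<noteq> 0" "x = vec.span {v}" using x closure_subset_proj projE by blast
    \<comment> \<open>Forms vanishing on the orbit are pulled back along \<open>\<rho> g\<close>,
      which permutes the orbit.\<close>
    have "f (\<rho> g *v v) = 0" if f: "f \<in> homog d" "\<forall>t. f (\<psi> t) = 0" for d f
    proof (rule closure_ptsD[where \<psi> = \<psi> and f = "\<lambda>v. f (\<rho> g *v v)", OF _ v(1) nz homog_matrix_compose[OF f(1)]])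
      show "vec.span {v} \<in> zariski closure_of (pts \<psi>)" using x v(2) O1\<psi> by simp
      fix t
      obtain g' where g': "g' \<in> G1" "\<psi> t = E (\<nu> g')" using ran by (metis imageE rangeI)
      have "\<rho> g *v \<psi> t = E (\<nu> (g + g'))"
        unfolding rho_E g'(2) nu_add by (rule E_add[OF nil_nu nil_nu, symmetric])
      moreover have "E (\<nu> (g + g')) \<in> range \<psi>" unfolding ran using vec.subspace_add[OF G1 g g'(1)] by blast
      ultimately show "f (\<rho> g *v \<psi> t) = 0" using f(2) by auto
    qed
    then have "vec.span {\<rho> g *v v} \<in> zariski closure_of (pts \<psi>)"
      using closure_pts_iff[of \<psi> "\<rho> g *v v", OF nz repD(1)[OF rep v(1)]] by blast
    then show ?thesis using repD(2)[OF rep v(1)] v(2) O1\<psi> by simp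
  qed
  have QW: "?Q \<subseteq> proj W"
    unfolding O1\<psi>
  proof (rule closure_pts_in_subspace[OF W _ nz])
    fix t
    have "\<psi> t \<in> E ` ?S" using ran by blast
    then show "\<psi> t \<in> W" using EsW by auto
  qed
  have O1Q: "O1 \<subseteq> ?Q" unfolding O1\<psi> by (rule pts_subset_closure[OF nz])
  have hh: "h \<in> homog 1"
  proof -
    have "h = lf (\<chi> i. h (axis i 1))" using h_lf by blast
    then show ?thesis using lf_homog by metis
  qed
  \<comment> \<open>The residue map \<open>h\<close> is a linear form; by the last clause of
    \<open>orbit_data\<close> the orbit is the part of its closure where \<open>h\<close> does not
    vanish.\<close>
  have open_O1: "openin (subtopology zariski ?Q) O1"
    unfolding openin_subtopology
  proof (intro exI conjI)
    show "openin zariski (proj UNIV - zero_locus {h})"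
      using openin_diff[OF openin_topspace closedin_zero_locus[OF hh]] unfolding topspace_zariski .
    show "O1 = (proj UNIV - zero_locus {h}) \<inter> ?Q"
    proof (intro equalityI subsetI)
      fix x assume x: "x \<in> O1"
      then obtain s where s: "s \<in> ?S" "x = vec.span {E s}" unfolding O1 by blast
      have "h (E s) \<noteq> 0" using h_E[of s] nil_nu s(1) by auto
      then have "x \<notin> zero_locus {h}" using s span_in_zero_locus_iff[OF hh Es0[OF s(1)]] by simp
      moreover have "x \<in> proj UNIV" using s span_singleton_in_proj[OF Es0[OF s(1)]] by simp
      ultimately show "x \<in> (proj UNIV - zero_locus {h}) \<inter> ?Q" using x O1Q by blast
    next
      fix x assume x: "x \<in> (proj UNIV - zero_locus {h}) \<inter> ?Q"
      then obtain v where v: "v \<noteq> 0" "x = vec.span {v}" using projE by blast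
      have "h v \<noteq> 0" using x v span_in_zero_locus_iff[OF hh v(1)] by blast
      moreover have "vec.span {v} \<in> zariski closure_of (pts \<psi>)" using x v(2) O1\<psi> by simp
      ultimately obtain s c where s: "s \<in> ?S" "v = c *s E s" using chart v(1) by blast
      have "c \<noteq> 0" using s(2) v(1) by auto
      then have "x = vec.span {E s}" using v(2) s(2) span_singleton_scale by metis
      then show "x \<in> O1" unfolding O1 using s(1) by blast
    qed
  qed
  have mor1: "is_morphism G1 W act"
    unfolding is_morphism_def
  proof (intro ballI)
    fix g\<^sub>0 v\<^sub>0 assume "g\<^sub>0 \<in> G1" "v\<^sub>0 \<in> W - {0}"
    then have "v\<^sub>0 \<noteq> 0" by simp
    from morphism_chart[OF mor this, of g\<^sub>0] obtain c F d k where ch: "is_chart act g\<^sub>0 v\<^sub>0 c F d k"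
      by (elim exE)
    show "\<exists>h\<in>polys2. \<exists>F d e. (\<forall>i. (\<lambda>p. F p $ i) \<in> polys2) \<and>
       (\<forall>g v c. h (g, c *s v) = c ^ d * h (g, v)) \<and> (\<forall>g v c. F (g, c *s v) = c ^ e *s F (g, v)) \<and>
       h (g\<^sub>0, v\<^sub>0) \<noteq> 0 \<and> (\<forall>g\<in>G1. \<forall>v\<in>W - {0}. h (g, v) \<noteq> 0 \<longrightarrow>
          F (g, v) \<noteq> 0 \<and> act g (vec.span {v}) = vec.span {F (g, v)})"
      by (rule bexI[OF _ is_chartD(2)[OF ch]], rule exI[of _ F], rule exI[of _ d], rule exI[of _ k],
          intro conjI allI ballI impI)
        (simp_all add: is_chartD[OF ch])
  qed
  have eff1: "effective G1 W act"
    unfolding effective_def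
  proof (intro ballI impI)
    fix g assume "g \<in> G1" "\<forall>x\<in>proj W. act g x = x"
    \<comment> \<open>The point of \<open>e\<close> alone already has trivial stabilizer, so it
      suffices that it belongs to \<open>proj W\<close>.\<close>
    moreover have "e \<in> W"
    proof -
      have "0 \<in> ?S" using vec.subspace_0[OF G1] nu_0 by (intro image_eqI[where x = 0]) simp_all
      from EsW[OF this] show ?thesis by simp
    qed
    ultimately have "act g (vec.span {e}) = vec.span {e}" using span_in_proj_iff[OF W e_nz] by blast
    then have "\<nu> g = 0" using stab_iff[OF e_nz] by simp
    then show "g = 0" by (rule nu_zero)
  qed
  have act1: "is_action G1 W act"
    unfolding is_action_def
  proof (intro conjI ballI)
    show "act g x \<in> proj W" if "g \<in> G1" "x \<in> proj W" for g x by (rule invW[OF that])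
    show "act 0 x = x" if "x \<in> proj W" for x
      using act subsetD[OF proj_mono[OF subset_UNIV] that] by (simp add: is_action_def)
    show "act (g + h) x = act g (act h x)" if "x \<in> proj W" for g h x
      using act subsetD[OF proj_mono[OF subset_UNIV] that] by (simp add: is_action_def)
  qed
  have "\<exists>x\<in>?Q. O1 = (\<lambda>g. act g x) ` G1"
  proof
    show "vec.span {e} \<in> ?Q"
    proof -
      have "act 0 (vec.span {e}) = vec.span {e}" using act span_singleton_in_proj[OF e_nz] by (simp add: is_action_def)
      then have "vec.span {e} \<in> O1" unfolding O1_def using vec.subspace_0[OF G1] by force
      then show ?thesis using O1Q by blast
    qed
  qed (simp add: O1_def)
  moreover have "irreducible_in zariski ?Q" unfolding O1\<psi> by (rule irreducible_param[OF par])
  moreover have "dim_of ?Q = enat (vec.dim G1)" unfolding O1\<psi> dim dim_nu ..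
  moreover have "\<forall>g\<in>G1. act g ` ?Q = ?Q" by (intro ballI inv_image[OF _ closure_subset_proj] invQ)
  ultimately show "additive_action G1 W ?Q act O1"
    unfolding additive_action_def closed_subvariety_def
    using G1 W QW act1 mor1 eff1 open_O1 by (intro conjI closedin_closure_of) assumption+
  show "nondegenerate W ?Q"
    unfolding nondegenerate_def
  proof
    assume "\<exists>H. vec.subspace H \<and> H \<subseteq> W \<and> vec.dim H + 1 = vec.dim W \<and> ?Q \<subseteq> proj H"
    then obtain H where H: "vec.subspace H" "vec.dim H + 1 = vec.dim W" "?Q \<subseteq> proj H" by blast
    have "E ` ?S \<subseteq> H"
    proof
      fix v assume "v \<in> E ` ?S"
      then obtain s where s: "s \<in> ?S" "v = E s" by blast
      then have "vec.span {E s} \<in> O1" unfolding O1 by blast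
      then have "vec.span {E s} \<in> proj H" using O1Q H(3) by blast
      then show "v \<in> H" using span_in_proj_iff[OF H(1) Es0[OF s(1)]] s(2) by blast
    qed
    then have "W \<subseteq> H" unfolding span[symmetric] by (rule vec.span_minimal[OF _ H(1)])
    then have "vec.dim W \<le> vec.dim H" by (rule vec.dim_subset)
    with H(2) show False by simp
  qed
  show "\<exists>\<psi> :: (nat \<Rightarrow> 'a) \<Rightarrow> 'a ^ 'k. range \<psi> = E ` \<nu> ` G1 \<and> O1 = pts \<psi>" using ran O1\<psi> by blast
qed

end

context act_rep
begin

text \<open>Restricted to nilpotents so that exponentials of its elements are available.\<close>

definition annih :: "('a ^ 'k) set \<Rightarrow> ('a ^ 'k) set" where
  "annih R = {x. nil x \<and> (\<forall>v\<in>R. mul x v = 0)}"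

lemma annih_subspace: "vec.subspace (annih R)"
  using nil_subspace unfolding vec.subspace_def annih_def by (simp add: mul_add mul_scale)

lemma annih_ideal: "x \<in> annih R \<Longrightarrow> mul x y \<in> annih R"
  unfolding annih_def using nil_mul[of x y] by (auto simp: mul_assoc mul_lcomm[of x y])

lemma stabilizers:
  "(\<Inter>x\<in>proj R. stabilizer act x) = {g. \<forall>v\<in>R. mul (\<nu> g) v = 0}"
proof -
  have "(\<forall>x\<in>proj R. act g x = x) \<longleftrightarrow> (\<forall>v\<in>R. mul (\<nu> g) v = 0)" for g
  proof
    assume *: "\<forall>x\<in>proj R. act g x = x"
    show "\<forall>v\<in>R. mul (\<nu> g) v = 0"
    proof
      fix v assume v: "v \<in> R"
      show "mul (\<nu> g) v = 0"
      proof (cases "v = 0")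
        case False
        then have "vec.span {v} \<in> proj R" using v by (auto simp: proj_def)
        with * stab_iff[OF False, of g] show ?thesis by simp
      qed simp
    qed
  next
    assume *: "\<forall>v\<in>R. mul (\<nu> g) v = 0"
    show "\<forall>x\<in>proj R. act g x = x"
    proof
      fix x assume "x \<in> proj R"
      then obtain v where "v \<in> R" "v \<noteq> 0" "x = vec.span {v}" by (auto simp: proj_def)
      with * stab_iff[of v g] show "act g x = x" by simp
    qed
  qed
  then show ?thesis by (simp add: stabilizer_def set_eq_iff)
qed

text \<open>The first alternative of \<open>alt\<close> serves the projective space, the second the
  quadric, where \<open>S\<close> may nevertheless be closed under multiplication; in that case too
  the orbit closure is a projective space. For properness, a group element moving a point of
  \<open>proj R\<close> has its logarithm outside \<open>J\<close>, and being nilpotent this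
  logarithm is not in \<open>unital J\<close> either.\<close>

lemma stabilizer_orbit:
  fixes R :: "('a ^ 'k) set"
  defines "G1 \<equiv> \<Inter>x\<in>proj R. stabilizer act x"
  defines "O1 \<equiv> (\<lambda>g. act g (vec.span {e})) ` G1"
  assumes RX: "proj R \<subseteq> X" and notfix: "\<not> proj R \<subseteq> Fix act X"
    and alt: "(\<forall>x\<in>annih R \<inter> range \<nu>. \<forall>y\<in>annih R \<inter> range \<nu>. mul x y \<in> range \<nu>) \<or>
      (\<exists>q. quad_calg e mul q (range \<nu>))"
  shows "proj (span_space O1) \<subset> proj UNIV \<and>
    (\<forall>g\<in>G1. act g ` proj (span_space O1) = proj (span_space O1)) \<and>
    additive_action G1 (span_space O1) (zariski closure_of O1) act O1 \<and>
    (hyperquadric (span_space O1) (zariski closure_of O1) \<and>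
       nondegenerate (span_space O1) (zariski closure_of O1) \<or>
     zariski closure_of O1 = proj (span_space O1))"
proof -
  define J where "J = annih R"
  define S where "S = J \<inter> range \<nu>"
  have J: "vec.subspace J" unfolding J_def by (rule annih_subspace)
  have nilJ: "nil x" if "x \<in> J" for x using that by (simp add: J_def annih_def)
  have ideal: "mul x y \<in> J" if "x \<in> J" for x y using that unfolding J_def by (rule annih_ideal)
  have S: "vec.subspace S"
    unfolding S_def by (intro vec.subspace_inter J range_nu_subspace vec.subspace_UNIV)
  have nilS: "nil x" if "x \<in> S" for x using that nilJ by (simp add: S_def)
  have G1: "G1 = {g. \<forall>v\<in>R. mul (\<nu> g) v = 0}" unfolding G1_def by (rule stabilizers)
  have subG1: "vec.subspace G1"
    unfolding G1 vec.subspace_def by (simp add: nu_0 nu_add nu_scale mul_add mul_scale)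
  have \<nu>G1: "\<nu> ` G1 = S" unfolding S_def J_def annih_def G1 using nil_nu by auto
  obtain W where data: "orbit_data S W" and WJ: "W \<subseteq> unital J"
    and Q: "\<And>\<psi> :: (nat \<Rightarrow> 'a) \<Rightarrow> 'a ^ 'k. range \<psi> = E ` S \<Longrightarrow>
      hyperquadric W (zariski closure_of (pts \<psi>)) \<or> zariski closure_of (pts \<psi>) = proj W"
  proof (cases "\<forall>x\<in>S. \<forall>y\<in>S. mul x y \<in> S")
    case True
    then have mult: "mul x y \<in> S" if "x \<in> S" "y \<in> S" for x y using that by blast
    show ?thesis
    proof (rule that[of "unital S"])
      show "orbit_data S (unital S)" by (rule subalgebra_orbit(1)[OF S nilS mult]; assumption)
      show "unital S \<subseteq> unital J" by (auto simp: unital_def S_def)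
      show "hyperquadric (unital S) (zariski closure_of (pts \<psi>)) \<or> zariski closure_of (pts \<psi>) = proj (unital S)"
        if "range \<psi> = E ` S" for \<psi> :: "(nat \<Rightarrow> 'a) \<Rightarrow> 'a ^ 'k"
        by (rule disjI2, rule subalgebra_orbit(2)[OF S nilS mult that]; assumption)
    qed
  next
    case False
    then obtain s1 s2 where s: "s1 \<in> S" "s2 \<in> S" "mul s1 s2 \<notin> S" by blast
    then have "mul s1 s2 \<notin> range \<nu>" using ideal[of s1 s2] by (simp add: S_def)
    then obtain q where "quad_calg e mul q (range \<nu>)" using alt s(1,2) unfolding S_def J_def by blast
    then interpret Q: quad_calg e mul q "range \<nu>" .
    show ?thesis
    proof (rule that[of "unital J"])
      show "orbit_data S (unital J)" by (rule Q.quadric_orbit(1)[OF J nilJ ideal S_def s]; assumption)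
      show "hyperquadric (unital J) (zariski closure_of (pts \<psi>)) \<or> zariski closure_of (pts \<psi>) = proj (unital J)"
        if "range \<psi> = E ` S" for \<psi> :: "(nat \<Rightarrow> 'a) \<Rightarrow> 'a ^ 'k"
        by (rule disjI1, rule Q.quadric_orbit(2)[OF J nilJ ideal S_def s that]; assumption)
    qed simp
  qed
  note a = assemble[OF subG1, of W, unfolded \<nu>G1, OF data, folded O1_def]
  obtain x where x: "x \<in> proj R" "x \<notin> Fix act X" using notfix by blast
  then obtain g where "act g x \<noteq> x" using RX by (auto simp: Fix_def)
  moreover obtain v where v: "v \<in> R" "v \<noteq> 0" "x = vec.span {v}" using x(1) by (auto simp: proj_def)
  ultimately have nz: "mul (\<nu> g) v \<noteq> 0" using stab_iff[OF v(2)] by simp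
  then have "\<nu> g \<notin> J" using v(1) by (auto simp: J_def annih_def)
  moreover have "h (\<nu> g) = 0" using nil_nu nil_iff_h by blast
  moreover have "v \<in> unital J \<longleftrightarrow> v - h v *s e \<in> J" for v by (rule unital_mem_iff[OF nilJ])
  ultimately have "\<nu> g \<notin> unital J" by simp
  then have "\<nu> g \<notin> W" using WJ by blast
  moreover have "\<nu> g \<noteq> 0" using nz by auto
  moreover have W: "vec.subspace W" using data by (simp add: orbit_data_def)
  ultimately have "vec.span {\<nu> g} \<notin> proj W" "vec.span {\<nu> g} \<in> proj UNIV"
    using span_in_proj_iff[OF W] span_singleton_in_proj by auto
  then have "proj W \<subset> proj UNIV" using proj_mono[of W UNIV] by blast
  moreover obtain \<psi> :: "(nat \<Rightarrow> 'a) \<Rightarrow> 'a ^ 'k" where \<psi>: "range \<psi> = E ` S" "O1 = pts \<psi>"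
    using a(5) by blast
  ultimately show ?thesis
    unfolding a(1) using a(2-4) Q[OF \<psi>(1)] unfolding \<psi>(2) by blast
qed

end

section \<open>The two cases\<close>

text \<open>\<open>\<rho> 0\<close> is an invertible idempotent, hence the identity.\<close>

lemma linearization_unital:
  fixes act :: "'a::{alg_closed_field, field_char_0} ^ 'n \<Rightarrow> ('a ^ 'k) set \<Rightarrow> ('a ^ 'k) set"
  assumes act: "is_action UNIV UNIV act" and mor: "is_morphism UNIV UNIV act"
  obtains \<rho> where "\<And>g. rep act (\<rho> g) g" "\<And>g h. \<rho> (g + h) = \<rho> g ** \<rho> h" "\<rho> 0 = mat 1"
    "\<And>g. polyf_mat (\<lambda>t. \<rho> (t *s g))"
proof -
  obtain \<rho> where \<rho>: "\<forall>g. rep act (\<rho> g) g" "\<forall>g h. \<rho> (g + h) = \<rho> g ** \<rho> h"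
    "\<forall>g. polyf_mat (\<lambda>t. \<rho> (t *s g))" using linearization[OF act mor] by blast
  have "invertible (\<rho> 0)" using rep_det \<rho>(1) invertible_det_nz by blast
  then obtain B where B: "B ** \<rho> 0 = mat 1" by (auto simp: invertible_def)
  have "\<rho> 0 = (B ** \<rho> 0) ** \<rho> 0" by (simp add: B)
  also have "\<dots> = B ** \<rho> (0 + 0)" by (simp only: matrix_mul_assoc \<rho>(2)[rule_format, of 0 0])
  finally have "\<rho> 0 = mat 1" by (simp add: B)
  with \<rho> show ?thesis by (intro that) blast+
qed

lemma open_subset_dense:
  assumes irr: "irreducible_in zariski X" and op: "openin (subtopology zariski X) Om" and ne: "Om \<noteq> {}"
    and f: "f \<in> homog d" "Om \<subseteq> zero_locus {f}"
  shows "X \<subseteq> zero_locus {f}"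
proof -
  obtain T where T: "openin zariski T" "Om = T \<inter> X" using op by (auto simp: openin_subtopology)
  have "X \<subseteq> topspace zariski" using irr by (simp add: irreducible_in_def)
  then have "X \<subseteq> zero_locus {f} \<union> (topspace zariski - T)" using T(2) f(2) by blast
  moreover have "closedin zariski (topspace zariski - T)" using T(1) by blast
  ultimately have "X \<subseteq> zero_locus {f} \<or> X \<subseteq> topspace zariski - T"
    using irr closedin_zero_locus[OF f(1)] by (simp add: irreducible_in_def)
  then show ?thesis using ne T(2) by blast
qed

lemma hyperquadricE:
  fixes X :: "('a::{alg_closed_field, field_char_0} ^ 'k) set set"
  assumes "hyperquadric UNIV X"
  obtains q e' where "q \<in> homog 2" "X = zero_locus {q}" "q e' \<noteq> 0"
    "\<forall>e. q e \<noteq> 0 \<longrightarrow> (\<exists>x. disc q e x \<noteq> 0)"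
    "\<forall>a. (\<forall>v. q v = 0 \<longrightarrow> lf a v = 0) \<longrightarrow> (\<forall>v. lf a v = 0)"
proof -
  obtain q e' where q: "q \<in> homog 2" "q e' \<noteq> 0" "X = proj UNIV \<inter> zero_locus {q}" "reduced_on UNIV q"
    using assms unfolding hyperquadric_def by blast
  have disc: "\<exists>x. disc q e x \<noteq> 0" if "q e \<noteq> 0" for e
    using reduced_imp_disc[OF q(1) vec.subspace_UNIV UNIV_I that q(4)] by blast
  have no_root: "\<exists>c. p = [:c:]" if "\<And>x. poly p x \<noteq> 0" for p :: "'a poly"
    using no_root_imp_const[OF that] by blast
  show ?thesis
  proof (rule that[OF q(1) _ q(2)])
    show "\<forall>e. q e \<noteq> 0 \<longrightarrow> (\<exists>x. disc q e x \<noteq> 0)" using disc by blast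
    show "X = zero_locus {q}" using q(3) by (auto simp: zero_locus_def)
    show "\<forall>a. (\<forall>v. q v = 0 \<longrightarrow> lf a v = 0) \<longrightarrow> (\<forall>v. lf a v = 0)"
    proof (intro allI impI)
      fix a v assume a: "\<forall>v. q v = 0 \<longrightarrow> lf a v = 0"
      show "lf a v = 0" by (rule disc_imp_span[OF q(1,2) disc no_root]) (simp_all add: a)
    qed
  qed
qed

locale open_orbit = act_rep \<rho> e act
  for \<rho> :: "'a::{alg_closed_field, field_char_0} ^ 'n \<Rightarrow> 'a ^ 'k ^ 'k" and e act +
  fixes X Om :: "('a ^ 'k) set set"
  assumes additive: "additive_action UNIV UNIV X act Om"
    and orbit: "Om = range (\<lambda>g. act g (vec.span {e}))"
begin

lemma orbit_r: "Om = range (\<lambda>g. vec.span {r g})"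
  unfolding orbit using repD(2)[OF rep e_nz] by (simp add: r_def)

lemma r_nonzero: "r g \<noteq> 0"
  using repD(1)[OF rep e_nz] by (simp add: r_def)

lemma orbit_subset: "Om \<subseteq> X"
  using additive openin_subset unfolding additive_action_def by fastforce

lemma range_r: "range r = E ` range \<nu>"
  by (simp add: image_image r_eq_E)

lemma vanish_on_X:
  assumes f: "f \<in> homog d" and van: "\<And>g. f (r g) = 0"
  shows "X \<subseteq> zero_locus {f}"
proof (rule open_subset_dense[OF _ _ _ f])
  show "irreducible_in zariski X" "openin (subtopology zariski X) Om"
    using additive by (simp_all add: additive_action_def closed_subvariety_def)
  show "Om \<noteq> {}" by (simp add: orbit)
  show "Om \<subseteq> zero_locus {f}"
    unfolding orbit_r image_subset_iff using span_in_zero_locus_iff[OF f r_nonzero] van by simp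
qed

lemma vanish_zero:
  assumes f: "f \<in> homog d" and van: "\<And>g. f (r g) = 0"
  shows "f 0 = 0"
  using homogD(2)[OF f, of 0 "r 0"] van by simp

lemma dim_range_nu: "vec.dim (range \<nu>) = CARD('n)"
  using dim_nu[of UNIV] by (simp only: vec_dim_card)

lemma range_nu_nil: "range \<nu> \<subseteq> {x. nil x}"
  using nil_nu by blast

text \<open>When all nilpotents are logarithms of group elements, every \<open>e + x\<close> with
  \<open>x\<close> nilpotent is an orbit vector by \<open>E_surj\<close>.\<close>

lemma orbit_affine:
  assumes all: "range \<nu> = {x. nil x}" and v: "v \<noteq> 0"
  shows "vec.span {v} \<in> Om \<longleftrightarrow> h v \<noteq> 0"
proof
  assume "vec.span {v} \<in> Om"
  then obtain g where "vec.span {r g} = vec.span {v}" unfolding orbit_r by auto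
  then obtain c where "v = c *s r g" using span_singleton_eqD by blast
  then have "v = c *s E (\<nu> g)" by (simp add: r_eq_E)
  with v show "h v \<noteq> 0" using h_E[OF nil_nu] by (auto simp: h_scale)
next
  assume hv: "h v \<noteq> 0"
  obtain x where x: "nil x" "v = h v *s e + x" using decompose by blast
  have "\<exists>y\<in>{x. nil x}. E y = e + (1 / h v) *s x"
    by (rule E_surj[OF nil_subspace]) (use x nil_mul nil_scale in auto)
  then obtain g where g: "E (\<nu> g) = e + (1 / h v) *s x" unfolding all[symmetric] by blast
  have "h v *s r g = h v *s e + x" unfolding r_eq_E g using hv by (simp add: vec_eq_iff field_simps)
  then have "v = h v *s r g" using x(2) by simp
  then have "vec.span {v} = vec.span {r g}" using span_singleton_scale[OF hv] by metis
  then show "vec.span {v} \<in> Om" unfolding orbit_r by blast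
qed

lemma coords_le:
  assumes yw: "\<And>i j. i \<le> m \<Longrightarrow> j \<le> m \<Longrightarrow> lf (y i) (w j) = (if i = j then 1 else 0)"
    and ye: "\<And>i. i \<le> m \<Longrightarrow> lf (y i) u = 0"
    and van: "\<And>d f. f \<in> homog d \<Longrightarrow> (\<And>v c. f (v + c *s u) = f v) \<Longrightarrow> (\<And>g. f (r g) = 0) \<Longrightarrow> (\<And>v. f v = 0)"
  shows "m \<le> CARD('n)"
proof -
  obtain \<psi> where \<psi>: "tparam CARD('n) \<psi>" "range \<psi> = range r" using r_param by blast
  show ?thesis
  proof (rule coords_bound[OF \<psi>(1) yw ye])
    fix f v d assume f: "f \<in> homog d" "\<And>v c. f (v + c *s u) = f v" "\<And>t. f (\<psi> t) = 0"
    have "f (r g) = 0" for g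
    proof -
      have "r g \<in> range \<psi>" using \<psi>(2) by blast
      with f(3) show ?thesis by auto
    qed
    from van[OF f(1,2) this] show "f v = 0" .
  qed
qed

text \<open>Only the zero form vanishes on the dense orbit, so the \<open>CARD('k)\<close>
  coordinates have no relation on it, and \<open>coords_le\<close> forces the subspace
  \<open>range \<nu>\<close> to have the dimension of the space of nilpotents.\<close>

lemma projective_space_nil:
  assumes X: "X = proj UNIV"
  shows "range \<nu> = {x. nil x}"
proof -
  obtain c :: "nat \<Rightarrow> 'k" where c: "bij_betw c {..<CARD('k)} UNIV"
    using ex_bij_betw_nat_finite[of "UNIV :: 'k set"] by (auto simp: atLeast0LessThan)
  have less: "i < CARD('k)" if "i \<le> CARD('k) - 1" for i
    using that zero_less_card_finite[where 'a = 'k] by linarith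
  have "CARD('k) - 1 \<le> CARD('n)"
  proof (rule coords_le[where y = "\<lambda>i. axis (c i) 1" and w = "\<lambda>i. axis (c i) 1" and u = 0])
    fix i j assume "i \<le> CARD('k) - 1" "j \<le> CARD('k) - 1"
    then show "lf (axis (c i) 1) (axis (c j) 1) = (if i = j then 1 else 0)"
      using inj_onD[OF bij_betw_imp_inj_on[OF c], of i j] less unfolding lf_axis by (auto simp: axis_def)
  next
    fix d f and v :: "'a ^ 'k" assume f: "f \<in> homog d" "\<And>g. f (r g) = 0"
    show "f v = 0"
    proof (cases "v = 0")
      case True
      then show ?thesis using vanish_zero[OF f] by simp
    next
      case False
      then show ?thesis
        using vanish_on_X[OF f] span_singleton_in_proj[OF False] span_in_zero_locus_iff[OF f(1) False]
        unfolding X by blast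
    qed
  qed (simp add: lf_zero)
  then have "vec.dim {x. nil x} \<le> vec.dim (range \<nu>)" unfolding dim_range_nu using dim_nil by simp
  then show ?thesis
    by (intro vec.subspace_dim_equal range_nu_subspace vec.subspace_UNIV nil_subspace range_nu_nil)
qed

lemma boundary_projective_space:
  assumes X: "X = proj UNIV"
  shows "X - Om = proj {x. nil x}"
proof (rule set_eqI)
  fix x
  show "x \<in> X - Om \<longleftrightarrow> x \<in> proj {x. nil x}"
  proof (cases "x \<in> proj UNIV")
    case True
    then obtain v where v: "v \<noteq> 0" "x = vec.span {v}" using projE by blast
    show ?thesis
      unfolding v(2) span_in_proj_iff[OF nil_subspace v(1)] X
      using orbit_affine[OF projective_space_nil[OF X] v(1)] span_singleton_in_proj[OF v(1)] nil_iff_h by simp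
  next
    case False
    then show ?thesis using proj_mono[of "{x. nil x}" UNIV] X by blast
  qed
qed

context
  fixes q :: "'a ^ 'k \<Rightarrow> 'a" and e' :: "'a ^ 'k"
  assumes q: "q \<in> homog 2" and X: "X = zero_locus {q}" and qe': "q e' \<noteq> 0"
    and disc: "\<forall>e. q e \<noteq> 0 \<longrightarrow> (\<exists>x. disc q e x \<noteq> 0)"
begin

lemma in_X_iff: "v \<noteq> 0 \<Longrightarrow> vec.span {v} \<in> X \<longleftrightarrow> q v = 0"
  unfolding X by (rule span_in_zero_locus_iff[OF q])

text \<open>Otherwise the orbit would be the whole chart \<open>h \<noteq> 0\<close>, on which
  \<open>q\<close> would vanish, and then \<open>q\<close> would be zero.\<close>

lemma quadric_nil: "range \<nu> \<noteq> {x. nil x}"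
proof
  assume all: "range \<nu> = {x. nil x}"
  have van: "q v = 0" if "h v \<noteq> 0" for v
  proof -
    have "v \<noteq> 0" using that by auto
    then show ?thesis using orbit_affine[OF all, of v] that orbit_subset in_X_iff[of v] by blast
  qed
  have "q (e' + 0 *s e) = 0"
  proof (rule polyf_eq_cofinite[where f = "\<lambda>t. q (e' + t *s e)" and g = "\<lambda>t. 0" and S = "{- h e'}"])
    show "polyf (\<lambda>t. q (e' + t *s e))" by (rule polys_line[OF homogD(1)[OF q]])
    show "q (e' + t *s e) = 0" if "t \<notin> {- h e'}" for t
      by (rule van) (use that in \<open>simp add: h_add h_scale add_eq_0_iff\<close>)
  qed (simp_all add: polyf_const)
  then show False using qe' by simp
qed

text \<open>The lower bound for \<open>CARD('k)\<close> comes from \<open>quadric_nil\<close>. For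
  the upper bound the quadric is projected from the point of \<open>e'\<close>, which is not on it:
  every line in direction \<open>e'\<close> meets the zeros of \<open>q\<close>, so a form that is
  constant along \<open>e'\<close> and vanishes on the orbit is zero.\<close>

lemma quadric_card: "CARD('n) + 2 = CARD('k)"
proof -
  have "vec.dim (range \<nu>) < vec.dim {x. nil x}"
  proof (rule ccontr)
    assume "\<not> ?thesis"
    then have "range \<nu> = {x. nil x}"
      by (intro vec.subspace_dim_equal range_nu_subspace vec.subspace_UNIV nil_subspace range_nu_nil) simp
    with quadric_nil show False ..
  qed
  then have lower: "CARD('n) + 2 \<le> CARD('k)" unfolding dim_range_nu using dim_nil by simp
  have "e' \<noteq> 0" using qe' quad_zero[OF q] by auto
  then obtain a where a: "lf a e' \<noteq> 0" using separating_functional[of "{0}" e'] by auto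
  define H where "H = {v. lf a v = 0}"
  have H: "vec.subspace H" unfolding H_def vec.subspace_def by (simp add: lf_zero lf_add lf_scale)
  have spanH: "vec.span H = H" using H by (simp only: vec.span_eq_iff)
  have e'H: "e' \<notin> H" using a by (simp add: H_def)
  have "vec.dim (insert e' H) = vec.dim H + 1" unfolding vec.dim_insert spanH using e'H by simp
  moreover have "vec.span (insert e' H) = UNIV"
  proof -
    have "v \<in> vec.span (insert e' H)" for v
      unfolding vec.span_breakdown_eq spanH
      by (rule exI[of _ "lf a v / lf a e'"]) (use a in \<open>simp add: H_def lf_diff lf_scale\<close>)
    then show ?thesis by blast
  qed
  ultimately have dimH: "vec.dim H + 1 = CARD('k)" by (metis vec.dim_span vec_dim_card)
  have "e' \<notin> vec.span (insert 0 H)" unfolding vec.span_insert_0 spanH by (rule e'H)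
  from subspace_coords[OF H _ this] obtain b y where
    bys: "\<forall>i<vec.dim H. b i \<in> H \<and> lf (y i) e' = 0 \<and> lf (y i) 0 = 0 \<and>
      (\<forall>j<vec.dim H. lf (y i) (b j) = (if i = j then 1 else 0))" by blast
  have less: "i < vec.dim H" if "i \<le> vec.dim H - 1" for i using that dimH lower by linarith
  have "vec.dim H - 1 \<le> CARD('n)"
  proof (rule coords_le[where y = y and w = b and u = e'])
    fix d f and v :: "'a ^ 'k"
    assume f: "f \<in> homog d" "\<And>v c. f (v + c *s e') = f v" "\<And>g. f (r g) = 0"
    obtain c where c: "q (v + c *s e') = 0" using quad_roots[OF q qe'] by blast
    have "f (v + c *s e') = 0"
    proof (cases "v + c *s e' = 0")
      case True
      then show ?thesis using vanish_zero[OF f(1,3)] by simp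
    next
      case False
      then show ?thesis
        using vanish_on_X[OF f(1,3)] c in_X_iff[OF False] span_in_zero_locus_iff[OF f(1) False] by blast
    qed
    then show "f v = 0" by (simp add: f(2))
  qed (use bys less in auto)
  with lower dimH show ?thesis by linarith
qed

text \<open>Each \<open>\<rho> g\<close> preserves the zeros of \<open>q\<close>, hence multiplies
  \<open>q\<close> by a factor \<open>c g\<close>. Along one-parameter groups this factor is a
  polynomial without zeros, so it is constant and equal to its value one at the identity.\<close>

lemma quadric_invariant: "q (\<rho> g *v v) = q v"
proof -
  have prp: "\<exists>c. \<forall>v. q (\<rho> g *v v) = c * q v" for g
  proof -
    obtain x where x: "disc q e' x \<noteq> 0" using disc qe' by blast
    show ?thesis
    proof (rule quad_proportional[OF q homog_matrix_compose[OF q] qe' x])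
      fix v assume v: "q v = 0"
      show "q (\<rho> g *v v) = 0"
      proof (cases "v = 0")
        case False
        have "vec.span {v} \<in> X" using in_X_iff[OF False] v by simp
        then have "act g (vec.span {v}) \<in> X" using additive unfolding additive_action_def by blast
        then show ?thesis using repD[OF rep False, of g] in_X_iff by simp
      qed (simp add: quad_zero[OF q])
    qed
  qed
  obtain c where c: "\<And>g v. q (\<rho> g *v v) = c g * q v" using choice[of "\<lambda>g c. \<forall>v. q (\<rho> g *v v) = c * q v"] prp by blast
  have "(\<lambda>t. (\<rho> (t *s g) *v e') $ i) = (\<lambda>t. \<Sum>j\<in>UNIV. \<rho> (t *s g) $ i $ j * e' $ j)" for i
    by (simp add: matrix_vector_mult_def)
  moreover have "polyf (\<lambda>t. \<Sum>j\<in>UNIV. \<rho> (t *s g) $ i $ j * e' $ j)" for i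
    by (intro polyf_sum polyf_mult polyf_const) (use rho_poly[of g] in \<open>simp add: polyf_mat_def\<close>)
  ultimately have "polyf (\<lambda>t. q (\<rho> (t *s g) *v e'))"
    by (intro polys_path_polyf[OF homogD(1)[OF q]]) simp
  then obtain p where p: "\<And>t. poly p t = c (t *s g) * q e'" unfolding polyf_def c by blast
  have "c g * c (- g) = 1" for g
  proof -
    have "q (\<rho> (g + - g) *v e') = c g * (c (- g) * q e')"
      unfolding rho_add c[symmetric] by (simp add: matrix_vector_mul_assoc)
    then have "1 * q e' = (c g * c (- g)) * q e'" by (simp add: rho_0)
    then show ?thesis using qe' by simp
  qed
  then have "c g \<noteq> 0" for g by (metis mult_zero_left zero_neq_one)
  then have "poly p t \<noteq> 0" for t using qe' by (simp add: p)
  then obtain k where "p = [:k:]" using no_root_imp_const by blast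
  then have "c (1 *s g) * q e' = c (0 *s g) * q e'" using p[of 1] p[of 0] by simp
  moreover have "c 0 = 1" using c[of 0 e'] qe' by (simp add: rho_0)
  ultimately have "c g = 1" using qe' by simp
  then show ?thesis by (simp add: c)
qed

lemma quadric_calg: "quad_calg e mul q (range \<nu>)"
proof unfold_locales
  show "q \<in> homog 2" by (rule q)
  show "vec.subspace (range \<nu>)" by (rule range_nu_subspace[OF vec.subspace_UNIV])
  show "nil u" if "u \<in> range \<nu>" for u using that nil_nu by blast
  show "q (mul (E u) v) = q v" if u: "u \<in> range \<nu>" for u v
  proof -
    obtain g where "u = \<nu> g" using u by blast
    then show ?thesis using quadric_invariant[of g v] by (simp add: rho_E)
  qed
  show "q e = 0"
  proof -
    have "vec.span {r 0} \<in> Om" unfolding orbit_r by blast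
    then show ?thesis using orbit_subset in_X_iff[OF r_nonzero, of 0] by (auto simp: r_0)
  qed
  show "\<exists>v. q v \<noteq> 0" using qe' by blast
  show "vec.span (E ` range \<nu>) = UNIV" using cyclic unfolding range_r[symmetric] by (simp add: r_def[abs_def])
  show "\<exists>p0. \<forall>x. nil x \<longrightarrow> (\<exists>u\<in>range \<nu>. \<exists>c. x = u + c *s p0)"
  proof -
    \<comment> \<open>By \<open>quadric_card\<close> any nilpotent outside
      \<open>range \<nu>\<close> spans a complement.\<close>
    obtain p0 where p0: "nil p0" "p0 \<notin> range \<nu>" using quadric_nil range_nu_nil by blast
    have U: "vec.subspace (range \<nu>)" by (rule range_nu_subspace[OF vec.subspace_UNIV])
    have spanU: "vec.span (range \<nu>) = range \<nu>" using U by (simp only: vec.span_eq_iff)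
    have "vec.dim (insert p0 (range \<nu>)) = vec.dim (range \<nu>) + 1"
      unfolding vec.dim_insert spanU using p0(2) by simp
    then have dim: "vec.dim {x. nil x} \<le> vec.dim (vec.span (insert p0 (range \<nu>)))"
      using dim_nil quadric_card dim_range_nu by simp
    have sub: "vec.span (insert p0 (range \<nu>)) \<subseteq> {x. nil x}"
      by (rule vec.span_minimal[OF _ nil_subspace]) (use p0(1) range_nu_nil in auto)
    have span: "vec.span (insert p0 (range \<nu>)) = {x. nil x}"
      by (rule vec.subspace_dim_equal[OF vec.subspace_span nil_subspace sub dim])
    have "\<exists>u\<in>range \<nu>. \<exists>c. x = u + c *s p0" if "nil x" for x
    proof -
      have "x \<in> vec.span (insert p0 (range \<nu>))" unfolding span using that by simp
      then obtain c where "x - c *s p0 \<in> range \<nu>" unfolding vec.span_breakdown_eq spanU by blast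
      then show ?thesis by (intro bexI[of _ "x - c *s p0"] exI[of _ c]) simp_all
    qed
    then show ?thesis by blast
  qed
qed

end

end

theorem theorem1p6:
  fixes act :: "'a::{alg_closed_field, field_char_0} ^ 'n \<Rightarrow> ('a ^ 'k) set \<Rightarrow> ('a ^ 'k) set"
    and X Om :: "('a ^ 'k) set set"
    and x\<^sub>0 :: "('a ^ 'k) set"
  defines "K \<equiv> K_locus X Om"
  defines "G1 \<equiv> \<Inter>x\<in>K. stabilizer act x"
  defines "O1 \<equiv> (\<lambda>g. act g x\<^sub>0) ` G1"
  defines "W1 \<equiv> span_space O1"
  defines "L1 \<equiv> proj W1"
  defines "Q1 \<equiv> zariski closure_of O1"
  assumes "hyperquadric UNIV X \<or> X = proj UNIV"
    and "additive_action UNIV UNIV X act Om"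
    and "\<not> K \<subseteq> Fix act X"
    and "x\<^sub>0 \<in> Om"
  shows "L1 \<subset> proj UNIV
    \<and> (\<forall>g\<in>G1. act g ` L1 = L1)
    \<and> additive_action G1 W1 Q1 act O1
    \<and> (hyperquadric W1 Q1 \<and> nondegenerate W1 Q1 \<or> Q1 = L1)"
proof -
  have additive: "additive_action UNIV UNIV X act Om" and x\<^sub>0: "x\<^sub>0 \<in> Om"
    and X: "hyperquadric UNIV X \<or> X = proj UNIV" and notfix: "\<not> K \<subseteq> Fix act X" by fact+
  have act: "is_action UNIV UNIV act" and mor: "is_morphism UNIV UNIV act" and eff: "effective UNIV UNIV act"
    and XP: "X \<subseteq> proj UNIV" and irr: "irreducible_in zariski X"
    and Om: "openin (subtopology zariski X) Om" and dimX: "dim_of X = enat (vec.dim (UNIV :: ('a ^ 'n) set))"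
    using additive by (simp_all add: additive_action_def closed_subvariety_def)
  have OmX: "Om \<subseteq> X" using openin_subset[OF Om] by simp
  obtain e where e: "e \<noteq> 0" "x\<^sub>0 = vec.span {e}" using projE[of x\<^sub>0] x\<^sub>0 OmX XP by blast
  obtain x where x: "x \<in> X" "Om = range (\<lambda>g. act g x)" using additive unfolding additive_action_def by blast
  \<comment> \<open>The orbit is rebased at the chosen point, so that the unit \<open>e\<close> of
    the algebra lies over \<open>x\<^sub>0\<close>.\<close>
  have orbit: "Om = range (\<lambda>g. act g (vec.span {e}))"
  proof -
    obtain g0 where g0: "x\<^sub>0 = act g0 x" using x\<^sub>0 x(2) by blast
    have *: "act (g + g0) x = act g x\<^sub>0" for g
      using act subsetD[OF XP x(1)] unfolding g0 by (simp add: is_action_def)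
    have "act g x \<in> range (\<lambda>g. act g x\<^sub>0)" for g
      using *[of "g - g0"] by (intro image_eqI[where x = "g - g0"]) simp_all
    moreover have "act g x\<^sub>0 \<in> range (\<lambda>g. act g x)" for g
      using *[of g] by (intro image_eqI[where x = "g + g0"]) simp_all
    ultimately show ?thesis unfolding x(2) e(2)[symmetric] by blast
  qed
  obtain \<rho> where \<rho>: "\<And>g. rep act (\<rho> g) g" "\<And>g h. \<rho> (g + h) = \<rho> g ** \<rho> h" "\<rho> 0 = mat 1"
    "\<And>g. polyf_mat (\<lambda>t. \<rho> (t *s g))" using linearization_unital[OF act mor] by blast
  \<comment> \<open>A hyperplane containing the orbit would contain \<open>X\<close>, but neither a
    reduced quadric nor the whole space lies in a hyperplane.\<close>
  have cyclic: "vec.span (range (\<lambda>g. \<rho> g *v e)) = UNIV"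
  proof (rule ccontr)
    assume "\<not> ?thesis"
    then obtain v where "v \<notin> vec.span (range (\<lambda>g. \<rho> g *v e))" by blast
    from separating_functional[OF vec.subspace_span this] obtain a
      where a: "\<forall>w\<in>vec.span (range (\<lambda>g. \<rho> g *v e)). lf a w = 0" "lf a v \<noteq> 0" by blast
    have "Om \<subseteq> zero_locus {lf a}"
      unfolding orbit image_subset_iff
    proof
      fix g
      have "lf a (\<rho> g *v e) = 0" using a(1) by (simp add: vec.span_base)
      then show "act g (vec.span {e}) \<in> zero_locus {lf a}"
        unfolding repD(2)[OF \<rho>(1) e(1)] using span_in_zero_locus_iff[OF lf_homog repD(1)[OF \<rho>(1) e(1)]] by simp
    qed
    then have sub: "X \<subseteq> zero_locus {lf a}"
      using open_subset_dense[OF irr Om _ lf_homog] x\<^sub>0 by blast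
    from X show False
    proof
      assume "hyperquadric UNIV X"
      then obtain q e' where q: "q \<in> homog 2" "X = zero_locus {q}" "q e' \<noteq> 0"
        "\<forall>e. q e \<noteq> 0 \<longrightarrow> (\<exists>x. disc q e x \<noteq> 0)"
        and span: "\<forall>a. (\<forall>v. q v = 0 \<longrightarrow> lf a v = 0) \<longrightarrow> (\<forall>v. lf a v = 0)" by (rule hyperquadricE)
      have "lf a w = 0" if "q w = 0" for w
      proof (cases "w = 0")
        case False
        then show ?thesis
          using sub that span_in_zero_locus_iff[OF q(1) False] span_in_zero_locus_iff[OF lf_homog False]
          unfolding q(2) by blast
      qed (simp add: lf_zero)
      with span a(2) show False by blast
    next
      assume "X = proj UNIV"
      moreover have "v \<noteq> 0" using a(2) by (auto simp: lf_zero)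
      ultimately show False
        using sub a(2) span_singleton_in_proj span_in_zero_locus_iff[OF lf_homog] by blast
    qed
  qed
  interpret open_orbit \<rho> e act X Om
    by unfold_locales (fact \<rho> cyclic act mor eff e additive orbit)+
  \<comment> \<open>In both cases \<open>K\<close> is linear: it comes from the radical of the polar
    form or from the space of nilpotents.\<close>
  have "\<exists>R. K = proj R \<and> K \<subseteq> X \<and>
    ((\<forall>x\<in>annih R \<inter> range \<nu>. \<forall>y\<in>annih R \<inter> range \<nu>. mul x y \<in> range \<nu>) \<or>
     (\<exists>q. quad_calg e mul q (range \<nu>)))"
  proof (cases "hyperquadric UNIV X")
    case True
    then have K: "K = Sing X" by (simp add: K_def K_locus_def)
    from True obtain q e' where q: "q \<in> homog 2" "X = zero_locus {q}" "q e' \<noteq> 0"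
      "\<forall>e. q e \<noteq> 0 \<longrightarrow> (\<exists>x. disc q e x \<noteq> 0)"
      and span: "\<forall>a. (\<forall>v. q v = 0 \<longrightarrow> lf a v = 0) \<longrightarrow> (\<forall>v. lf a v = 0)" by (rule hyperquadricE)
    have "dim_of (zero_locus {q}) = enat CARD('n)" using dimX unfolding q(2) by (simp only: vec_dim_card)
    from Sing_quadric[OF q(1) this quadric_card[OF q]] span
    have "K = proj {v. \<forall>w. polar q v w = 0}" unfolding K q(2) by blast
    moreover have "K \<subseteq> X" unfolding K Sing_def by blast
    moreover have "quad_calg e mul q (range \<nu>)" by (rule quadric_calg[OF q])
    ultimately show ?thesis by blast
  next
    case False
    then have K: "K = X - Om" by (simp add: K_def K_locus_def)
    have XU: "X = proj UNIV" using X False by blast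
    \<comment> \<open>Here \<open>range \<nu>\<close> consists of all nilpotents, and these form an
      ideal.\<close>
    have "mul x y \<in> range \<nu>" if "x \<in> range \<nu>" for x y
      using that nil_mul unfolding projective_space_nil[OF XU] by blast
    then show ?thesis using K boundary_projective_space[OF XU] by blast
  qed
  then obtain R where R: "K = proj R" "K \<subseteq> X"
    and alt: "(\<forall>x\<in>annih R \<inter> range \<nu>. \<forall>y\<in>annih R \<inter> range \<nu>. mul x y \<in> range \<nu>) \<or>
     (\<exists>q. quad_calg e mul q (range \<nu>))" by blast
  show ?thesis
    using stabilizer_orbit[OF R(2)[unfolded R(1)] notfix[unfolded R(1)] alt]
    unfolding L1_def W1_def Q1_def O1_def G1_def R(1) e(2) .
qed

end
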